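(* Let $X\colon \Sigma \to \mathbf{R}^4$ be a nonflat complete minimal surface of genus $0$ of finite total curvature and let $g=(g_{1}, g_{2})\colon \Sigma \to \overline{\mathbf{C}}\times \overline{\mathbf{C}}$ be its Gauss map. If both $g_{1}$ and $g_{2}$ are nonconstant, then at least one of $g_{1}$, $g_{2}$ omits at most $2$ values in $\overline{\mathbf{C}}$.
   Context: $\overline{\mathbf{C}}=\mathbf{C}\cup\{\infty\}$ is the Riemann sphere and $\mathrm{i}=\sqrt{-1}$. A minimal surface $X=(x^1,x^2,x^3,x^4)\colon\Sigma\to\mathbf{R}^4$ is a conformal minimal immersion of a connected oriented surface $\Sigma$, regarded as a Riemann surface whose conformal metric is the induced metric $ds^2$. In a local complex coordinate $z=u+\mathrm{i}v$, put $\phi_i=\partial x^i\,dz$ with $\partial=\frac12(\partial/\partial u-\mathrm{i}\,\partial/\partial v)$; these are holomorphic differentials on $\Sigma$. Put $$g_1=\frac{\phi_3+\mathrm{i}\phi_4}{\phi_1-\mathrm{i}\phi_2},\qquad g_2=\frac{-\phi_3+\mathrm{i}\phi_4}{\phi_1-\mathrm{i}\phi_2},\qquad h\,dz=\phi_1-\mathrm{i}\phi_2 .$$ The holomorphic map $g=(g_1,g_2)\colon\Sigma\to\overline{\mathbf{C}}\times\overline{\mathbf{C}}$ is the Gauss map of $X$. The induced metric is $ds^2=|h|^2(1+|g_1|^2)(1+|g_2|^2)|dz|^2$. The surface is complete if all divergent paths have infinite length with respect to $ds^2$. The total curvature is $\int_\Sigma K\,dA$, with $K$ the Gauss curvature and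 $dA$ the area element of $ds^2$. The surface is nonflat if $K\not\equiv0$. By the Huber–Osserman theorem, if a complete minimal surface has finite total curvature, then $\Sigma$ is conformally equivalent to $\overline{\Sigma}_G\setminus\{p_1,\dots,p_k\}$ with $\overline{\Sigma}_G$ a closed Riemann surface of genus $G$, and $g_1,g_2,h\,dz$ extend meromorphically to $\overline{\Sigma}_G$; $G$ is called the genus of the surface. A value $\alpha\in\overline{\mathbf{C}}$ is omitted by $g_i$ if $g_i$ never attains $\alpha$ on $\Sigma$. *)

theory Defs
  imports "HOL-Complex_Analysis.Complex_Analysis"
begin

section \<open>Riemann surfaces\<close>

text \<open>A chart is a pair \<open>(U, z)\<close> of an open set and a coordinate function, meaningful on \<open>U\<close> only.\<close>

record 'a csurface =
  surf_top :: "'a topology"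
  charts :: "('a set \<times> ('a \<Rightarrow> complex)) set"

definition riemann_surface :: "'a csurface \<Rightarrow> bool" where
  "riemann_surface S \<longleftrightarrow>
     Hausdorff_space (surf_top S) \<and> second_countable (surf_top S) \<and>
     connected_space (surf_top S) \<and> topspace (surf_top S) \<noteq> {} \<and>
     topspace (surf_top S) = (\<Union>(U, z)\<in>charts S. U) \<and>
     (\<forall>(U, z)\<in>charts S. openin (surf_top S) U \<and> open (z ` U) \<and>
        homeomorphic_map (subtopology (surf_top S) U) (top_of_set (z ` U)) z) \<and>
     (\<forall>(U, z)\<in>charts S. \<forall>(V, w)\<in>charts S.
        (\<lambda>\<zeta>. w (inv_into U z \<zeta>)) holomorphic_on z ` (U \<inter> V))"

definition remove_points :: "'a csurface \<Rightarrow> 'a set \<Rightarrow> 'a csurface" where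
  "remove_points S P =
     \<lparr> surf_top = subtopology (surf_top S) (topspace (surf_top S) - P),
       charts = (\<lambda>(U, z). (U - P, z)) ` charts S \<rparr>"

definition conformally_equivalent :: "'a csurface \<Rightarrow> 'b csurface \<Rightarrow> bool" where
  "conformally_equivalent S T \<longleftrightarrow>
     (\<exists>f. homeomorphic_map (surf_top S) (surf_top T) f \<and>
        (\<forall>(U, z)\<in>charts S. \<forall>(V, w)\<in>charts T.
           (\<lambda>\<zeta>. w (f (inv_into U z \<zeta>))) holomorphic_on z ` (U \<inter> f -` V)))"

text \<open>Genus is topological: the closed oriented surface of genus \<open>0\<close> is the 2-sphere. The complex
  structure is arbitrary.\<close>

definition closed_riemann_surface_genus_0 :: "'a csurface \<Rightarrow> bool" where
  "closed_riemann_surface_genus_0 M \<longleftrightarrow>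
     riemann_surface M \<and> compact_space (surf_top M) \<and>
     surf_top M homeomorphic_space top_of_set (sphere (0 :: real^3) 1)"

text \<open>A definition cannot quantify over the type of the points of \<open>M\<close>. Taking them in \<open>real^3\<close> loses
  nothing: a surface homeomorphic to the 2-sphere can be transported to it along the homeomorphism.\<close>

definition genus_0 :: "'a csurface \<Rightarrow> bool" where
  "genus_0 S \<longleftrightarrow>
     (\<exists>(M :: (real^3) csurface) P. closed_riemann_surface_genus_0 M \<and>
        P \<subseteq> topspace (surf_top M) \<and> finite P \<and> conformally_equivalent S (remove_points M P))"

section \<open>Calculus in a coordinate \<open>u + \<i> v\<close>\<close>

definition Du :: "(complex \<Rightarrow> 'b::real_normed_vector) \<Rightarrow> complex \<Rightarrow> 'b" where
  "Du f \<zeta> = vector_derivative (\<lambda>t. f (\<zeta> + of_real t)) (at 0)"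

definition Dv :: "(complex \<Rightarrow> 'b::real_normed_vector) \<Rightarrow> complex \<Rightarrow> 'b" where
  "Dv f \<zeta> = vector_derivative (\<lambda>t. f (\<zeta> + \<i> * of_real t)) (at 0)"

primrec Ck_on :: "nat \<Rightarrow> (complex \<Rightarrow> 'b::real_normed_vector) \<Rightarrow> complex set \<Rightarrow> bool" where
  "Ck_on 0 f W \<longleftrightarrow> continuous_on W f"
| "Ck_on (Suc k) f W \<longleftrightarrow> f differentiable_on W \<and> Ck_on k (Du f) W \<and> Ck_on k (Dv f) W"

definition smooth_on :: "(complex \<Rightarrow> 'b::real_normed_vector) \<Rightarrow> complex set \<Rightarrow> bool" where
  "smooth_on f W \<longleftrightarrow> (\<forall>k. Ck_on k f W)"

section \<open>Surfaces in \<open>\<real>\<^sup>4\<close>, in a coordinate\<close>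

text \<open>Coefficients of the first fundamental form \<open>E du\<^sup>2 + 2 F du dv + G dv\<^sup>2\<close>.\<close>

definition fff_E :: "(complex \<Rightarrow> real^4) \<Rightarrow> complex \<Rightarrow> real" where
  "fff_E Y \<zeta> = Du Y \<zeta> \<bullet> Du Y \<zeta>"

definition fff_F :: "(complex \<Rightarrow> real^4) \<Rightarrow> complex \<Rightarrow> real" where
  "fff_F Y \<zeta> = Du Y \<zeta> \<bullet> Dv Y \<zeta>"

definition fff_G :: "(complex \<Rightarrow> real^4) \<Rightarrow> complex \<Rightarrow> real" where
  "fff_G Y \<zeta> = Dv Y \<zeta> \<bullet> Dv Y \<zeta>"

definition fff_det :: "(complex \<Rightarrow> real^4) \<Rightarrow> complex \<Rightarrow> real" where
  "fff_det Y \<zeta> = fff_E Y \<zeta> * fff_G Y \<zeta> - (fff_F Y \<zeta>)\<^sup>2"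

definition normal_part :: "(complex \<Rightarrow> real^4) \<Rightarrow> complex \<Rightarrow> real^4 \<Rightarrow> real^4" where
  "normal_part Y \<zeta> x =
     (THE n. orthogonal n (Du Y \<zeta>) \<and> orthogonal n (Dv Y \<zeta>) \<and> x - n \<in> span {Du Y \<zeta>, Dv Y \<zeta>})"

text \<open>Half the trace, with respect to the induced metric, of the second fundamental form.\<close>

definition mean_curvature_vector :: "(complex \<Rightarrow> real^4) \<Rightarrow> complex \<Rightarrow> real^4" where
  "mean_curvature_vector Y \<zeta> =
     (1 / (2 * fff_det Y \<zeta>)) *\<^sub>R
       (fff_G Y \<zeta> *\<^sub>R normal_part Y \<zeta> (Du (Du Y) \<zeta>)
        - (2 * fff_F Y \<zeta>) *\<^sub>R normal_part Y \<zeta> (Du (Dv Y) \<zeta>)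
        + fff_E Y \<zeta> *\<^sub>R normal_part Y \<zeta> (Dv (Dv Y) \<zeta>))"

definition conformal_minimal_immersion_on :: "(complex \<Rightarrow> real^4) \<Rightarrow> complex set \<Rightarrow> bool" where
  "conformal_minimal_immersion_on Y W \<longleftrightarrow>
     smooth_on Y W \<and>
     (\<forall>\<zeta>\<in>W. fff_det Y \<zeta> \<noteq> 0 \<and>
            fff_E Y \<zeta> = fff_G Y \<zeta> \<and> fff_F Y \<zeta> = 0 \<and>
            mean_curvature_vector Y \<zeta> = 0)"

text \<open>Curvature \<open>- \<Delta> log \<lambda> / \<lambda>\<^sup>2\<close> of the conformal metric \<open>\<lambda>\<^sup>2 |dz|\<^sup>2\<close>, where \<open>\<lambda>\<^sup>2 = E\<close>.\<close>

definition coord_gauss_curvature :: "(complex \<Rightarrow> real^4) \<Rightarrow> complex \<Rightarrow> real" where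
  "coord_gauss_curvature Y \<zeta> =
     (let lam = (\<lambda>\<xi>. sqrt (fff_E Y \<xi>)); L = (\<lambda>\<xi>. ln (lam \<xi>))
      in - (Du (Du L) \<zeta> + Dv (Dv L) \<zeta>) / (lam \<zeta>)\<^sup>2)"

text \<open>The coefficient of \<open>dz\<close> in \<open>\<phi>\<^sub>i = \<partial>x\<^sup>i dz\<close>, with \<open>\<partial> = (\<partial>/\<partial>u - \<i> \<partial>/\<partial>v) / 2\<close>.\<close>

definition phi :: "(complex \<Rightarrow> real^4) \<Rightarrow> 4 \<Rightarrow> complex \<Rightarrow> complex" where
  "phi Y i \<zeta> = (of_real (Du (\<lambda>\<xi>. Y \<xi> $ i) \<zeta>) - \<i> * of_real (Dv (\<lambda>\<xi>. Y \<xi> $ i) \<zeta>)) / 2"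

section \<open>Minimal surfaces in \<open>\<real>\<^sup>4\<close>\<close>

definition local_rep :: "('a \<Rightarrow> 'b) \<Rightarrow> 'a set \<times> ('a \<Rightarrow> complex) \<Rightarrow> complex \<Rightarrow> 'b" where
  "local_rep X c = (\<lambda>\<zeta>. X (inv_into (fst c) (snd c) \<zeta>))"

definition minimal_surface :: "'a csurface \<Rightarrow> ('a \<Rightarrow> real^4) \<Rightarrow> bool" where
  "minimal_surface S X \<longleftrightarrow>
     riemann_surface S \<and>
     (\<forall>(U, z)\<in>charts S. conformal_minimal_immersion_on (local_rep X (U, z)) (z ` U))"

text \<open>Curvature and the Gauss map do not depend on the coordinate, so any chart around the point
  may be used.\<close>

definition chart_at :: "'a csurface \<Rightarrow> 'a \<Rightarrow> 'a set \<times> ('a \<Rightarrow> complex)" where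
  "chart_at S p = (SOME c. c \<in> charts S \<and> p \<in> fst c)"

definition gauss_curvature :: "'a csurface \<Rightarrow> ('a \<Rightarrow> real^4) \<Rightarrow> 'a \<Rightarrow> real" where
  "gauss_curvature S X p =
     (let c = chart_at S p in coord_gauss_curvature (local_rep X c) (snd c p))"

definition nonflat :: "'a csurface \<Rightarrow> ('a \<Rightarrow> real^4) \<Rightarrow> bool" where
  "nonflat S X \<longleftrightarrow> (\<exists>p\<in>topspace (surf_top S). gauss_curvature S X p \<noteq> 0)"

text \<open>The Borel measure \<open>dA\<close> on the surface, which in each chart is \<open>sqrt (E G - F\<^sup>2) du dv\<close>;
  by second countability there is exactly one.\<close>

definition is_area_measure :: "'a csurface \<Rightarrow> ('a \<Rightarrow> real^4) \<Rightarrow> 'a measure \<Rightarrow> bool" where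
  "is_area_measure S X \<mu> \<longleftrightarrow>
     sets \<mu> = sets (sigma (topspace (surf_top S)) {U. openin (surf_top S) U}) \<and>
     (\<forall>(U, z)\<in>charts S. \<forall>B\<in>sets \<mu>. B \<subseteq> U \<longrightarrow>
        emeasure \<mu> B =
          (\<integral>\<^sup>+\<zeta>\<in>z ` B. ennreal (sqrt (fff_det (local_rep X (U, z)) \<zeta>)) \<partial>lborel))"

definition finite_total_curvature :: "'a csurface \<Rightarrow> ('a \<Rightarrow> real^4) \<Rightarrow> bool" where
  "finite_total_curvature S X \<longleftrightarrow>
     (\<exists>dA. is_area_measure S X dA \<and> integrable dA (gauss_curvature S X))"

text \<open>Paths are parametrized by \<open>[0, 1)\<close>. As \<open>X\<close> is an immersion, a continuous path \<open>\<gamma>\<close> in the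
  surface is piecewise \<open>C\<^sup>1\<close> iff \<open>X \<circ> \<gamma>\<close> is; its speed in the induced metric is \<open>|(X \<circ> \<gamma>)'|\<close>.\<close>

definition divergent_path :: "'a csurface \<Rightarrow> ('a \<Rightarrow> real^4) \<Rightarrow> (real \<Rightarrow> 'a) \<Rightarrow> bool" where
  "divergent_path S X \<gamma> \<longleftrightarrow>
     continuous_map (top_of_set {0..<1}) (surf_top S) \<gamma> \<and>
     (\<forall>b. 0 < b \<and> b < 1 \<longrightarrow> (X \<circ> \<gamma>) piecewise_C1_differentiable_on {0..b}) \<and>
     (\<forall>C. compactin (surf_top S) C \<longrightarrow> (\<exists>t0<1. \<forall>t. t0 < t \<and> 0 \<le> t \<and> t < 1 \<longrightarrow> \<gamma> t \<notin> C))"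

definition path_length_ds :: "('a \<Rightarrow> real^4) \<Rightarrow> (real \<Rightarrow> 'a) \<Rightarrow> ennreal" where
  "path_length_ds X \<gamma> =
     (\<integral>\<^sup>+t\<in>{0..<1}. ennreal (norm (vector_derivative (X \<circ> \<gamma>) (at t))) \<partial>lborel)"

definition complete_surface :: "'a csurface \<Rightarrow> ('a \<Rightarrow> real^4) \<Rightarrow> bool" where
  "complete_surface S X \<longleftrightarrow> (\<forall>\<gamma>. divergent_path S X \<gamma> \<longrightarrow> path_length_ds X \<gamma> = \<infinity>)"

section \<open>The Gauss map\<close>

text \<open>The Riemann sphere, with \<open>None\<close> as the point at infinity.\<close>

type_synonym csphere = "complex option"

text \<open>Value at \<open>\<zeta>\<close> of the meromorphic function \<open>a / b\<close>. The limit is needed where \<open>a\<close> and \<open>b\<close>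
  vanish simultaneously: \<open>\<phi>\<^sub>1 - \<i> \<phi>\<^sub>2\<close> and \<open>\<phi>\<^sub>3 + \<i> \<phi>\<^sub>4\<close> do so at a pole of \<open>g\<^sub>2\<close> at which \<open>g\<^sub>1\<close>
  is finite. If \<open>b\<close> vanishes identically (where the quotient has no meaning) the value is \<open>0\<close>,
  so that \<open>g\<^sub>1\<close> and \<open>g\<^sub>2\<close> are then constant.\<close>

definition quotient_value :: "(complex \<Rightarrow> complex) \<Rightarrow> (complex \<Rightarrow> complex) \<Rightarrow> complex \<Rightarrow> csphere" where
  "quotient_value a b \<zeta> =
     (let q = (\<lambda>\<xi>. a \<xi> / b \<xi>) in if is_pole q \<zeta> then None else Some (Lim (at \<zeta>) q))"

definition gauss_map_1 :: "'a csurface \<Rightarrow> ('a \<Rightarrow> real^4) \<Rightarrow> 'a \<Rightarrow> csphere" where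
  "gauss_map_1 S X p =
     (let c = chart_at S p; Y = local_rep X c
      in quotient_value (\<lambda>\<zeta>. phi Y 3 \<zeta> + \<i> * phi Y 4 \<zeta>) (\<lambda>\<zeta>. phi Y 1 \<zeta> - \<i> * phi Y 2 \<zeta>) (snd c p))"

definition gauss_map_2 :: "'a csurface \<Rightarrow> ('a \<Rightarrow> real^4) \<Rightarrow> 'a \<Rightarrow> csphere" where
  "gauss_map_2 S X p =
     (let c = chart_at S p; Y = local_rep X c
      in quotient_value (\<lambda>\<zeta>. - phi Y 3 \<zeta> + \<i> * phi Y 4 \<zeta>) (\<lambda>\<zeta>. phi Y 1 \<zeta> - \<i> * phi Y 2 \<zeta>) (snd c p))"

definition omitted_values :: "'a csurface \<Rightarrow> ('a \<Rightarrow> csphere) \<Rightarrow> csphere set" where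
  "omitted_values S g = {\<alpha>. \<forall>p\<in>topspace (surf_top S). g p \<noteq> \<alpha>}"

end

theory Submission
  imports Defs
begin

text \<open>
  Suppose that both components of the Gauss map omit three values. On the closed surface
  \<open>M\<close> of genus \<open>0\<close> that contains the given surface as the complement of a
  finite set \<open>P\<close>, three forms with isolated singularities are compared. The first is
  the form \<open>B dz = \<phi>\<^sub>1 - \<i> \<phi>\<^sub>2\<close>. The other two belong to the
  two components: if \<open>g = a / b\<close> with \<open>a\<close> and \<open>b\<close> without
  common zeros and \<open>v\<^sub>1, v\<^sub>2, v\<^sub>3\<close> are values omitted by
  \<open>g\<close>, then \<open>(a' b - a b') b / (l\<^sub>1 l\<^sub>2 l\<^sub>3) dz\<close>, where
  \<open>l\<^sub>j\<close> is the linear form in \<open>a, b\<close> that vanishes where \<open>g =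
  v\<^sub>j\<close>, is homogeneous of degree \<open>0\<close> in \<open>(a, b)\<close>, so that it
  is a well-defined form on \<open>M\<close>; Picard's great theorem extends \<open>a\<close> and
  \<open>b\<close> over the punctures. Each of the three forms has total order \<open>-2\<close>,
  the degree of the canonical bundle of the sphere (\<open>degree_of_form\<close>).

  Let \<open>p\<^sub>1\<close> and \<open>p\<^sub>2\<close> be the pole orders of
  \<open>g\<^sub>1\<close> and \<open>g\<^sub>2\<close> at a point. Off the punctures the linear
  forms \<open>l\<^sub>j\<close> have no zeros, so the form of \<open>g\<^sub>i\<close> has order at
  least \<open>p\<^sub>i\<close>; at a puncture one of them may vanish, to an order at most one more
  than that of the Wronskian, and the order is at least \<open>p\<^sub>i - 1\<close>
  (\<open>omega_order\<close>). The induced metric is \<open>|B|\<^sup>2 (1 + |g\<^sub>1|\<^sup>2)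
  (1 + |g\<^sub>2|\<^sup>2) |dz|\<^sup>2\<close>. As \<open>X\<close> is an immersion,
  \<open>B\<close> has order at most \<open>p\<^sub>1 + p\<^sub>2\<close> at a point of the surface
  (\<open>order_at_regular_point\<close>), and as the metric is complete, at most \<open>p\<^sub>1 +
  p\<^sub>2 - 2\<close> at a puncture (\<open>order_at_puncture\<close>). At every point of
  \<open>M\<close> the order of \<open>B dz\<close> is therefore at most the sum of the orders of
  the other two forms (\<open>order_inequality\<close>). Summed over \<open>M\<close> this says
  \<open>-2 \<le> -4\<close>.

  Two ingredients carry the analysis. The degree of a form is computed with winding numbers in a
  plane coordinate that is only a homeomorphism, because the complex structure of the sphere is
  arbitrary: integrating the form over a short fixed translation gives a nonvanishing function whose
  winding numbers around the singular points and around infinity are those of the form, with a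
  further \<open>-2\<close> from infinity (\<open>sum_windings\<close>). The bound at a puncture is
  Osserman's: if \<open>B / (b\<^sub>1 b\<^sub>2)\<close> had order greater than \<open>-2\<close>,
  possibly with an essential singularity, a path of finite length would run into the puncture
  (\<open>end_order_le\<close>); a pole of order \<open>1\<close> is excluded by the isotropy of
  real residues (\<open>no_simple_pole\<close>).
\<close>

section \<open>Asymptotic paths of entire immersions\<close>

lemma local_holomorphic_section:
  fixes F :: "complex \<Rightarrow> complex"
  assumes F: "F holomorphic_on UNIV" and d: "deriv F z0 \<noteq> 0"
  obtains N \<sigma> \<delta> where "open N" "z0 \<in> N" "0 < \<delta>" "\<sigma> holomorphic_on ball (F z0) \<delta>" "\<sigma> (F z0) = z0"
    "\<And>w. w \<in> ball (F z0) \<delta> \<Longrightarrow> \<sigma> w \<in> N \<and> F (\<sigma> w) = w" "inj_on F N"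
proof -
  obtain r where r: "r > 0" "open (F ` ball z0 r)" "inj_on F (ball z0 r)"
    using has_complex_derivative_locally_invertible[OF F _ open_UNIV d] by auto
  have Fh: "F holomorphic_on ball z0 r" using F holomorphic_on_subset by blast
  obtain g where g: "g holomorphic_on (F ` ball z0 r)" "\<And>z. z \<in> ball z0 r \<Longrightarrow> g (F z) = z"
    using holomorphic_has_inverse[OF Fh open_ball r(3)] by metis
  have "F z0 \<in> F ` ball z0 r" using r(1) by auto
  then obtain \<delta> where \<delta>: "\<delta> > 0" "ball (F z0) \<delta> \<subseteq> F ` ball z0 r"
    using r(2) open_contains_ball by blast
  show ?thesis
  proof (rule that[of "ball z0 r" \<delta> g])
    show "g holomorphic_on ball (F z0) \<delta>" using g(1) \<delta>(2) holomorphic_on_subset by blast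
    show "\<And>w. w \<in> ball (F z0) \<delta> \<Longrightarrow> g w \<in> ball z0 r \<and> F (g w) = w" using g(2) \<delta>(2) by fastforce
  qed (use r \<delta> g in auto)
qed

text \<open>The radius is part of the predicate because the sections of a fixed germ are glued over growing
  discs.\<close>

definition section_on :: "(complex \<Rightarrow> complex) \<Rightarrow> (complex \<Rightarrow> complex) \<Rightarrow> real \<Rightarrow> bool" where
  "section_on F \<psi> R \<longleftrightarrow> 0 < R \<and> \<psi> holomorphic_on ball 0 R \<and> \<psi> 0 = 0 \<and> (\<forall>w\<in>ball 0 R. F (\<psi> w) = w)"

text \<open>Two sections that meet in a set on which \<open>F\<close> is injective agree near that point,
  hence everywhere by analytic continuation.\<close>

lemma sections_agree:
  fixes F :: "complex \<Rightarrow> complex"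
  assumes U: "open U" "connected U" "w \<in> U"
    and h: "\<psi> holomorphic_on U" "\<psi>' holomorphic_on U"
    and s: "\<And>x. x \<in> U \<Longrightarrow> F (\<psi> x) = F (\<psi>' x)"
    and N: "open N" "inj_on F N" "\<psi> w \<in> N" "\<psi>' w \<in> N"
    and x: "x \<in> U"
  shows "\<psi> x = \<psi>' x"
proof -
  define A where "A = (U \<inter> \<psi> -` N) \<inter> (U \<inter> \<psi>' -` N)"
  have "open A" unfolding A_def
    using h N(1) U(1) holomorphic_on_imp_continuous_on
    by (intro open_Int continuous_open_preimage) auto
  moreover have "w \<in> A" using U N by (auto simp: A_def)
  moreover have "\<psi> y = \<psi>' y" if "y \<in> A" for y
    using that N(2) s unfolding A_def inj_on_def by auto
  ultimately show ?thesis
    using analytic_continuation_open[of A U \<psi> \<psi>' x] U h x unfolding A_def by blast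
qed

lemma section_on_unique:
  assumes F: "F holomorphic_on UNIV" "deriv F 0 \<noteq> 0" 
    and 1: "section_on F \<psi> R" and 2: "section_on F \<psi>' R'" and x: "x \<in> ball 0 R" "x \<in> ball 0 R'"
  shows "\<psi> x = \<psi>' x"
proof -
  obtain N where N: "open N" "0 \<in> N" "inj_on F N" 
    using local_holomorphic_section[OF F] by metis
  show ?thesis
  proof (rule sections_agree[where U = "ball 0 (min R R')" and w = 0 and F = F and N = N and \<psi> = \<psi> and \<psi>' = \<psi>' and x = x])
    show "\<psi> holomorphic_on ball 0 (min R R')" "\<psi>' holomorphic_on ball 0 (min R R')"
      using 1 2 unfolding section_on_def by (auto elim!: holomorphic_on_subset)
  qed (use 1 2 x N in \<open>auto simp: section_on_def\<close>)
qed

text \<open>An automorphism of the plane is proper, hence a polynomial; as its derivative has no zeros, the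
  derivative is constant by the fundamental theorem of algebra.\<close>

lemma biholomorphic_plane_deriv_const:
  fixes F :: "complex \<Rightarrow> complex"
  assumes F: "F holomorphic_on UNIV" and d: "\<And>z. deriv F z \<noteq> 0"
    and \<psi>: "\<psi> holomorphic_on UNIV" and inv: "\<And>z. \<psi> (F z) = z"
  shows "deriv F constant_on UNIV"
proof -
  have "filterlim F at_infinity at_infinity"
    unfolding filterlim_at_infinity[OF order_refl]
  proof safe
    fix r :: real assume "0 < r"
    have "bounded (\<psi> ` cball 0 r)"
      using \<psi> by (intro compact_imp_bounded compact_continuous_image)
        (auto intro: holomorphic_on_imp_continuous_on holomorphic_on_subset)
    then obtain B where B: "\<And>w. w \<in> cball 0 r \<Longrightarrow> norm (\<psi> w) \<le> B" unfolding bounded_iff ball_simps by blast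
    have "r \<le> norm (F z)" if "B + 1 \<le> norm z" for z
    proof (rule ccontr)
      assume "\<not> r \<le> norm (F z)"
      then have "norm (\<psi> (F z)) \<le> B" by (intro B) auto
      then show False using inv that by auto
    qed
    then show "\<forall>\<^sub>F x in at_infinity. r \<le> cmod (F x)" unfolding eventually_at_infinity by blast
  qed
  then have "((inverse \<circ> F) \<longlongrightarrow> 0) at_infinity"
    unfolding o_def by (rule filterlim_compose[OF tendsto_inverse_0])
  then obtain a n where a: "\<And>z. F z = (\<Sum>i\<le>n. a i * z ^ i)" using pole_at_infinity[OF F] by metis
  have dF: "deriv F z = (\<Sum>i\<le>n. (of_nat (Suc i) * (if Suc i \<le> n then a (Suc i) else 0)) * z ^ i)" (is "_ = ?S z") for z
  proof -
    have "(F has_field_derivative (\<Sum>i\<le>n. a i * (of_nat i * z ^ (i - 1)))) (at z)"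
      unfolding a[abs_def] by (auto intro!: derivative_eq_intros simp: ac_simps)
    then have "deriv F z = (\<Sum>i\<le>n. a i * (of_nat i * z ^ (i - 1)))" by (rule DERIV_imp_deriv)
    also have "\<dots> = (\<Sum>i<n. of_nat (Suc i) * a (Suc i) * z ^ i)"
      unfolding sum.atMost_shift by (simp add: ac_simps)
    also have "\<dots> = (\<Sum>i<n. (of_nat (Suc i) * (if Suc i \<le> n then a (Suc i) else 0)) * z ^ i)"
      by (intro sum.cong) auto
    also have "\<dots> = ?S z"
      unfolding lessThan_Suc_atMost[symmetric] by simp
    finally show ?thesis .
  qed
  define b where "b = (\<lambda>i. of_nat (Suc i) * (if Suc i \<le> n then a (Suc i) else 0))"
  have dF': "deriv F z = (\<Sum>i\<le>n. b i * z ^ i)" for z unfolding dF b_def ..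
  have b0: "b i = 0" if "i \<in> {1..n}" for i
    using fundamental_theorem_of_algebra[of b n] that d dF' by metis
  have "deriv F z = b 0" for z
    unfolding dF' using b0 by (subst sum.atMost_shift) (auto intro!: sum.neutral)
  then show ?thesis unfolding constant_on_def by auto
qed

text \<open>The inverse of \<open>F\<close> at \<open>0\<close> extends to a largest disc, whose radius is
  finite as otherwise \<open>F\<close> would be an automorphism of the plane. If the inverse stayed
  on a bounded sequence along every radius of that disc, it would extend across every boundary
  point, because \<open>F\<close> is locally invertible at a limit point; by compactness of the
  circle it would then extend to a larger disc. So along some radius the inverse tends to infinity.\<close>

lemma entire_immersion_asymptotic_path:
  fixes F :: "complex \<Rightarrow> complex"
  assumes F: "F holomorphic_on UNIV" and d: "\<And>z. deriv F z \<noteq> 0" and F0: "F 0 = 0"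
    and nc: "\<not> deriv F constant_on UNIV"
  obtains \<psi> w0 where "\<psi> holomorphic_on ball 0 (norm w0)" "w0 \<noteq> 0"
    "\<And>w. w \<in> ball 0 (norm w0) \<Longrightarrow> F (\<psi> w) = w"
    "filterlim (\<lambda>t. \<psi> (of_real t * w0)) at_infinity (at_left (1::real))"
proof -
  note witness = that
  define \<R> where "\<R> = {R. \<exists>\<psi>. section_on F \<psi> R}"
  define \<Psi> where "\<Psi> = (\<lambda>R. SOME \<psi>. section_on F \<psi> R)"
  have \<Psi>: "section_on F (\<Psi> R) R" if "R \<in> \<R>" for R
    using that unfolding \<R>_def \<Psi>_def mem_Collect_eq by (rule someI_ex)
  define \<psi> where "\<psi> w = \<Psi> (SOME R. R \<in> \<R> \<and> norm w < R) w" for w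
  have \<psi>eq: "\<psi> w = \<Psi> R w" if "R \<in> \<R>" "norm w < R" for w R
  proof -
    have "\<exists>R. R \<in> \<R> \<and> norm w < R" using that by blast
    then have "(SOME R. R \<in> \<R> \<and> norm w < R) \<in> \<R> \<and> norm w < (SOME R. R \<in> \<R> \<and> norm w < R)" (is "?Q \<in> _ \<and> _")
      by (rule someI_ex)
    then show ?thesis unfolding \<psi>_def
      using section_on_unique[OF F d \<Psi>[of ?Q] \<Psi>[of R]] that by simp
  qed
  have \<psi>h: "\<psi> holomorphic_on ball 0 R" if "R \<in> \<R>" for R
  proof (rule holomorphic_transform)
    show "\<Psi> R holomorphic_on ball 0 R" using \<Psi>[OF that] unfolding section_on_def by blast
    show "\<Psi> R w = \<psi> w" if "w \<in> ball 0 R" for w using \<psi>eq[OF \<open>R \<in> \<R>\<close>, of w] that by simp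
  qed
  have \<psi>F: "F (\<psi> w) = w" if "R \<in> \<R>" "norm w < R" for w R
    using \<Psi>[OF that(1)] \<psi>eq[OF that] that(2) unfolding section_on_def by simp
  have \<psi>0: "\<psi> 0 = 0" if "R \<in> \<R>" for R
    using \<Psi>[OF that(1)] \<psi>eq[OF that, of 0] unfolding section_on_def by auto
  obtain N0 \<sigma>0 \<delta>0 where 0: "open N0" "0 \<in> N0" "0 < \<delta>0" "\<sigma>0 holomorphic_on ball 0 \<delta>0" "\<sigma>0 0 = 0"
    "\<And>w. w \<in> ball 0 \<delta>0 \<Longrightarrow> \<sigma>0 w \<in> N0 \<and> F (\<sigma>0 w) = w" "inj_on F N0"
    by (rule local_holomorphic_section[OF F d[of 0], unfolded F0]) (rule that)
  have \<delta>0: "\<delta>0 \<in> \<R>" unfolding \<R>_def section_on_def using 0 by auto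
  have bdd: "bdd_above \<R>"
  proof (rule ccontr)
    assume unb: "\<not> bdd_above \<R>"
    have big: "\<exists>R\<in>\<R>. norm w < R" for w :: complex
      using unb unfolding bdd_above_def by (meson not_le)
    have Uh: "\<psi> holomorphic_on UNIV" 
    proof -
      have "\<psi> field_differentiable at w" for w
        using big[of w] \<psi>h holomorphic_on_imp_differentiable_at[OF _ open_ball] by fastforce
      then show ?thesis by (simp add: holomorphic_on_def)
    qed
    have UF: "F (\<psi> w) = w" for w using big \<psi>F by blast
    have "\<psi> (F z) = z" for z
    proof (rule sections_agree[where U = UNIV and w = 0 and F = F and N = N0 and \<psi> = "\<lambda>z. \<psi> (F z)" and \<psi>' = "\<lambda>z. z" and x = z])
      show "(\<lambda>a. \<psi> (F a)) holomorphic_on UNIV" "(\<lambda>a. a) holomorphic_on UNIV" 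
        using holomorphic_on_compose[of F UNIV \<psi>] F Uh holomorphic_on_subset by (auto simp: o_def)
    qed (use 0 UF \<psi>0[OF \<delta>0] F0 in auto)
    then show False using biholomorphic_plane_deriv_const[OF F d Uh] nc by blast
  qed
  define R0 where "R0 = Sup \<R>"
  have R0: "0 < R0" using cSup_upper[OF \<delta>0 bdd] 0(3) unfolding R0_def by linarith
  have below: "\<exists>R\<in>\<R>. norm w < R" if "norm w < R0" for w :: complex
    using that less_cSup_iff[OF _ bdd] \<delta>0 unfolding R0_def by blast
  have ph: "\<psi> holomorphic_on ball 0 R0"
  proof -
    have "\<psi> field_differentiable at w" if "norm w < R0" for w
      using below[OF that] \<psi>h holomorphic_on_imp_differentiable_at[OF _ open_ball] by fastforce
    then show ?thesis by (auto simp: holomorphic_on_def intro: field_differentiable_at_within)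
  qed
  have pF: "F (\<psi> w) = w" if "norm w < R0" for w using below[OF that] \<psi>F by blast
  have tR: "norm (of_real t * w0) < R0" if "norm w0 = R0" "0 < t" "t < 1" for t and w0 :: complex
    using that R0 by (simp add: norm_mult)
  show ?thesis
  proof (rule ccontr)
    assume notthesis: "\<not> thesis"
    have ext: "\<exists>\<delta> \<sigma>. 0 < \<delta> \<and> \<sigma> holomorphic_on ball w0 \<delta> \<and> (\<forall>w\<in>ball w0 \<delta>. F (\<sigma> w) = w) \<and>
          (\<forall>w\<in>ball w0 \<delta> \<inter> ball 0 R0. \<sigma> w = \<psi> w)" if w0: "norm w0 = R0" for w0
    proof -
      have "\<not> filterlim (\<lambda>t. \<psi> (of_real t * w0)) at_infinity (at_left (1::real))"
        using notthesis witness[of \<psi> w0] w0 ph pF R0 by fastforce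
      then obtain K where K: "\<not> (\<forall>\<^sub>F t in at_left 1. K \<le> norm (\<psi> (of_real t * w0)))" "K > 0"
        unfolding filterlim_at_infinity[OF order_refl] by auto
      have "\<exists>t. 1 - 1 / real (Suc (Suc n)) < t \<and> t < 1 \<and> norm (\<psi> (of_real t * w0)) \<le> K" for n
      proof (rule ccontr)
        assume "\<not> ?thesis"
        then have "\<forall>\<^sub>F t in at_left 1. K \<le> norm (\<psi> (of_real t * w0))"
          unfolding eventually_at_left_field by (intro exI[of _ "1 - 1 / real (Suc (Suc n))"]) auto
        with K show False by blast
      qed
      then obtain t where t: "\<And>n. 1 - 1 / real (Suc (Suc n)) < t n" "\<And>n. t n < 1" "\<And>n. norm (\<psi> (of_real (t n) * w0)) \<le> K"
        by metis
      have tpos: "0 < t n" for n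
      proof -
        have "1 / real (Suc (Suc n)) < 1" by simp
        then show ?thesis using t(1)[of n] by linarith
      qed
      have tlim: "t \<longlonglongrightarrow> 1"
      proof (rule tendsto_sandwich[of "\<lambda>n. 1 - 1 / real (Suc (Suc n))" t _ "\<lambda>_. 1"])
        show "(\<lambda>n. 1 - 1 / real (Suc (Suc n))) \<longlonglongrightarrow> 1"
          using tendsto_diff[OF tendsto_const LIMSEQ_Suc[OF LIMSEQ_inverse_real_of_nat]] by (simp add: inverse_eq_divide)
      qed (use t(1,2) in \<open>auto intro!: always_eventually less_imp_le simp del: of_nat_Suc\<close>)
      have "seq_compact (cball 0 K :: complex set)" by (simp add: compact_imp_seq_compact)
      then obtain z0 q where q: "strict_mono q" "((\<lambda>n. \<psi> (of_real (t n) * w0)) \<circ> q) \<longlonglongrightarrow> z0"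
        unfolding seq_compact_def using t(3) by (metis mem_cball_0)
      have tq: "(\<lambda>n. of_real (t (q n)) * w0) \<longlonglongrightarrow> w0"
        using tendsto_mult[OF tendsto_of_real[OF LIMSEQ_subseq_LIMSEQ[OF tlim q(1)]] tendsto_const[of w0]] by (simp add: o_def)
      have Fc: "isCont F z0" using F holomorphic_on_imp_continuous_on continuous_on_eq_continuous_at open_UNIV by blast
      have "(\<lambda>n. F (\<psi> (of_real (t (q n)) * w0))) \<longlonglongrightarrow> F z0"
        using isCont_tendsto_compose[OF Fc q(2)] by (simp add: o_def)
      moreover have "F (\<psi> (of_real (t n) * w0)) = of_real (t n) * w0" for n
        using pF tR[OF w0 tpos t(2)] by blast
      ultimately have Fz0: "F z0 = w0" using LIMSEQ_unique[OF tq, of "F z0"] by simp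
      obtain N \<sigma> \<delta> where N: "open N" "z0 \<in> N" "0 < \<delta>" "\<sigma> holomorphic_on ball w0 \<delta>"
        "\<And>w. w \<in> ball w0 \<delta> \<Longrightarrow> \<sigma> w \<in> N \<and> F (\<sigma> w) = w" "inj_on F N"
        by (rule local_holomorphic_section[OF F d[of z0], unfolded Fz0]) (rule that)
      have "\<forall>\<^sub>F n in sequentially. \<psi> (of_real (t (q n)) * w0) \<in> N"
        using topological_tendstoD[OF q(2) N(1,2)] by (simp add: o_def)
      moreover have "\<forall>\<^sub>F n in sequentially. of_real (t (q n)) * w0 \<in> ball w0 \<delta>"
        using topological_tendstoD[OF tq open_ball] N(3) by simp
      ultimately have "\<exists>n. \<psi> (of_real (t (q n)) * w0) \<in> N \<and> of_real (t (q n)) * w0 \<in> ball w0 \<delta>"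
        using eventually_conj eventually_happens'[OF sequentially_bot] by blast
      then obtain n where n: "\<psi> (of_real (t (q n)) * w0) \<in> N" "of_real (t (q n)) * w0 \<in> ball w0 \<delta>" by blast
      have "\<sigma> w = \<psi> w" if "w \<in> ball w0 \<delta> \<inter> ball 0 R0" for w
      proof (rule sections_agree[where U = "ball w0 \<delta> \<inter> ball 0 R0" and w = "of_real (t (q n)) * w0" and F = F and N = N and \<psi> = \<sigma> and \<psi>' = \<psi> and x = w])
        show "connected (ball w0 \<delta> \<inter> ball 0 R0)" by (intro convex_connected convex_Int convex_ball)
        show "\<sigma> holomorphic_on ball w0 \<delta> \<inter> ball 0 R0" "\<psi> holomorphic_on ball w0 \<delta> \<inter> ball 0 R0"
          using N(4) ph by (auto elim: holomorphic_on_subset)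
        show "of_real (t (q n)) * w0 \<in> ball w0 \<delta> \<inter> ball 0 R0" using n tR[OF w0 tpos t(2)] by simp
      qed (use that N n pF in auto)
      then show ?thesis using N by blast
    qed
    obtain \<delta> \<sigma> where \<sigma>: "\<And>w0. norm w0 = R0 \<Longrightarrow> 0 < \<delta> w0 \<and> \<sigma> w0 holomorphic_on ball w0 (\<delta> w0) \<and> (\<forall>w\<in>ball w0 (\<delta> w0). F (\<sigma> w0 w) = w) \<and>
          (\<forall>w\<in>ball w0 (\<delta> w0) \<inter> ball 0 R0. \<sigma> w0 w = \<psi> w)" using ext by metis
    have agree: "\<sigma> a x = \<sigma> b x" if ab: "norm a = R0" "norm b = R0" and x: "x \<in> ball a (\<delta> a)" "x \<in> ball b (\<delta> b)" for a b x
    proof (cases "a = b")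
      case False
      have pos: "\<delta> a > 0" "\<delta> b > 0" using \<sigma> ab by auto
      define s where "s = \<delta> a / (\<delta> a + \<delta> b)"
      have s: "0 < s" "s < 1" using pos by (auto simp: s_def)
      have dd: "norm (b - a) < \<delta> a + \<delta> b"
        using x dist_triangle_less_add[of a x "\<delta> a" b "\<delta> b"] by (simp add: dist_commute dist_norm norm_minus_commute)
      define p where "p = (1 - s) *\<^sub>R a + s *\<^sub>R b"
      have "p \<in> open_segment a b" using False s unfolding p_def in_segment by blast
      then have "norm p < R0" using dist_decreases_open_segment[of p a b 0] ab by auto
      moreover have "p \<in> ball a (\<delta> a)"
      proof -
        have "p - a = s *\<^sub>R (b - a)" by (simp add: p_def algebra_simps)
        then have "norm (p - a) = s * norm (b - a)" using s by simp
        also have "\<dots> < s * (\<delta> a + \<delta> b)" using dd s by simp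
        also have "\<dots> = \<delta> a" using pos by (simp add: s_def)
        finally show ?thesis by (simp add: dist_norm norm_minus_commute)
      qed
      moreover have "p \<in> ball b (\<delta> b)"
      proof -
        have "b - p = (1 - s) *\<^sub>R (b - a)" by (simp add: p_def algebra_simps)
        then have "norm (b - p) = (1 - s) * norm (b - a)" using s by simp
        also have "\<dots> < (1 - s) * (\<delta> a + \<delta> b)" using dd s by simp
        also have "\<dots> = \<delta> b" using pos by (simp add: s_def field_simps)
        finally show ?thesis by (simp add: dist_norm)
      qed
      ultimately have p: "p \<in> ball a (\<delta> a) \<inter> ball b (\<delta> b) \<inter> ball 0 R0" by simp
      show ?thesis
      proof (rule analytic_continuation_open[of "ball a (\<delta> a) \<inter> ball b (\<delta> b) \<inter> ball 0 R0" "ball a (\<delta> a) \<inter> ball b (\<delta> b)" "\<sigma> a" "\<sigma> b" x])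
        show "connected (ball a (\<delta> a) \<inter> ball b (\<delta> b))" by (intro convex_connected convex_Int convex_ball)
        show "\<sigma> a holomorphic_on ball a (\<delta> a) \<inter> ball b (\<delta> b)" "\<sigma> b holomorphic_on ball a (\<delta> a) \<inter> ball b (\<delta> b)"
          using \<sigma>[OF ab(1)] \<sigma>[OF ab(2)] by (auto elim: holomorphic_on_subset)
        show "ball a (\<delta> a) \<inter> ball b (\<delta> b) \<inter> ball 0 R0 \<noteq> {}" using p by blast
      qed (use x \<sigma>[OF ab(1)] \<sigma>[OF ab(2)] in auto)
    qed auto
    define W where "W = ball 0 R0 \<union> (\<Union>a\<in>sphere 0 R0. ball a (\<delta> a))"
    define c where "c w = (SOME a. norm a = R0 \<and> w \<in> ball a (\<delta> a))" for w
    define \<psi>' where "\<psi>' w = (if w \<in> ball 0 R0 then \<psi> w else \<sigma> (c w) w)" for w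
    have e1: "\<psi>' w = \<sigma> a w" if "norm a = R0" "w \<in> ball a (\<delta> a)" for a w
    proof (cases "w \<in> ball 0 R0")
      case True then show ?thesis using \<sigma>[OF that(1)] that by (simp add: \<psi>'_def)
    next
      case False
      have "norm (c w) = R0 \<and> w \<in> ball (c w) (\<delta> (c w))" unfolding c_def by (rule someI[of _ a]) (use that in auto)
      then show ?thesis using agree[of "c w" a w] that False by (simp add: \<psi>'_def)
    qed
    have Wh: "\<psi>' field_differentiable at w \<and> F (\<psi>' w) = w" if "w \<in> W" for w
    proof (cases "w \<in> ball 0 R0")
      case True
      have "\<psi>' holomorphic_on ball 0 R0" using ph by (rule holomorphic_transform) (simp add: \<psi>'_def)
      then show ?thesis using True pF holomorphic_on_imp_differentiable_at[OF _ open_ball] by (auto simp: \<psi>'_def)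
    next
      case False
      then obtain a where a: "norm a = R0" "w \<in> ball a (\<delta> a)" using \<open>w \<in> W\<close> unfolding W_def by auto
      have "\<psi>' holomorphic_on ball a (\<delta> a)" 
      proof (rule holomorphic_transform)
        show "\<sigma> a holomorphic_on ball a (\<delta> a)" using \<sigma>[OF a(1)] by blast
      qed (simp add: e1[OF a(1)])
      then show ?thesis using a e1 \<sigma>[OF a(1)] holomorphic_on_imp_differentiable_at[OF _ open_ball] by auto
    qed
    have "open W" unfolding W_def by auto
    moreover have "cball 0 R0 \<subseteq> W"
    proof
      fix x :: complex assume "x \<in> cball 0 R0"
      then consider "norm x < R0" | "norm x = R0" by fastforce
      then show "x \<in> W"
      proof cases
        case 2
        then have "x \<in> ball x (\<delta> x)" using \<sigma>[of x] by auto
        with 2 show ?thesis unfolding W_def by fastforce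
      qed (simp add: W_def)
    qed
    ultimately obtain \<epsilon> where \<epsilon>: "\<epsilon> > 0" "(\<Union>x\<in>cball 0 R0. ball x \<epsilon>) \<subseteq> W"
      using compact_subset_open_imp_ball_epsilon_subset[OF compact_cball] by blast
    have "ball 0 (R0 + \<epsilon>) \<subseteq> W"
    proof
      fix x :: complex assume x: "x \<in> ball 0 (R0 + \<epsilon>)"
      show "x \<in> W"
      proof (cases "norm x \<le> R0")
        case True then show ?thesis using \<epsilon>(1) by (intro subsetD[OF \<epsilon>(2)] UN_I[of x]) auto
      next
        case False
        define y where "y = (R0 / norm x) *\<^sub>R x"
        have nx: "norm x > R0" "norm x > 0" using False R0 by linarith+
        have "norm y = R0" using R0 nx(2) by (simp add: y_def)
        have "x - y = (1 - R0 / norm x) *\<^sub>R x" by (simp add: y_def algebra_simps)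
        then have "norm (x - y) = (1 - R0 / norm x) * norm x" using R0 nx by (simp add: abs_of_nonneg)
        also have "\<dots> = norm x - R0" using R0 nx by (simp add: field_simps)
        finally have "dist y x < \<epsilon>" using x by (simp add: dist_norm norm_minus_commute)
        then show ?thesis using \<open>norm y = R0\<close> by (intro subsetD[OF \<epsilon>(2)] UN_I[of y]) auto
      qed
    qed
    then have sub: "w \<in> W" if "w \<in> ball 0 (R0 + \<epsilon>)" for w using that by blast
    have "\<psi>' holomorphic_on ball 0 (R0 + \<epsilon>)"
      unfolding holomorphic_on_def using Wh sub field_differentiable_at_within by blast
    moreover have "\<psi>' 0 = 0" using R0 \<psi>0[OF \<delta>0] by (simp add: \<psi>'_def)
    ultimately have "section_on F \<psi>' (R0 + \<epsilon>)"
      unfolding section_on_def using Wh sub R0 \<epsilon>(1) by simp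
    then have "R0 + \<epsilon> \<in> \<R>" unfolding \<R>_def by blast
    then show False using cSup_upper[OF _ bdd] \<epsilon>(1) unfolding R0_def by fastforce
  qed
qed

section \<open>The order of a form at an end without short paths\<close>

lemma cauchy_circle_integral_holomorphic:
  fixes f :: "complex \<Rightarrow> complex"
  assumes "0 < \<rho>" "continuous_on (sphere 0 \<rho>) f"
  shows "(\<lambda>z. contour_integral (circlepath 0 \<rho>) (\<lambda>u. f u / (u - z))) holomorphic_on - sphere 0 \<rho>"
proof -
  have "(\<lambda>z. contour_integral (circlepath 0 \<rho>) (\<lambda>u. f u / (u - z))) field_differentiable at w" if "w \<notin> sphere 0 \<rho>" for w
  proof -
    have "((\<lambda>z. contour_integral (circlepath 0 \<rho>) (\<lambda>u. f u / (u - z))) has_field_derivative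
       (of_nat 1 * contour_integral (circlepath 0 \<rho>) (\<lambda>u. f u / (u - w) ^ Suc 1))) (at w)"
    proof (rule Cauchy_next_derivative(2)[where S = UNIV and B = "2 * pi * \<rho>"])
      show "continuous_on (path_image (circlepath 0 \<rho>)) f" using assms by simp
      show "cmod (vector_derivative (circlepath 0 \<rho>) (at t)) \<le> 2 * pi * \<rho>" for t
        using assms(1) by (simp add: vector_derivative_circlepath norm_mult)
      show "((\<lambda>u. f u / (u - x) ^ 1) has_contour_integral contour_integral (circlepath 0 \<rho>) (\<lambda>u. f u / (u - x))) (circlepath 0 \<rho>)"
        if "x \<in> UNIV - path_image (circlepath 0 \<rho>)" for x
      proof -
        have "(\<lambda>u. f u / (u - x)) contour_integrable_on circlepath 0 \<rho>"
          using that assms by (intro contour_integrable_continuous_circlepath continuous_intros) auto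
        then show ?thesis by (simp add: has_contour_integral_integral)
      qed
    qed (use that assms in auto)
    then show ?thesis unfolding field_differentiable_def by blast
  qed
  then show ?thesis by (auto simp: holomorphic_on_def intro: field_differentiable_at_within)
qed

text \<open>Cauchy's theorem for the difference quotient \<open>(f w - f z) / (w - z)\<close>, whose integrals
  over the two circles agree.\<close>

lemma cauchy_formula_annulus:
  fixes f :: "complex \<Rightarrow> complex"
  assumes f: "f holomorphic_on ball 0 r - {0}" and \<rho>: "0 < \<rho>1" "\<rho>2 < r" and z: "\<rho>1 < norm z" "norm z < \<rho>2"
  shows "2 * of_real pi * \<i> * f z = contour_integral (circlepath 0 \<rho>2) (\<lambda>u. f u / (u - z))
           - contour_integral (circlepath 0 \<rho>1) (\<lambda>u. f u / (u - z))"
proof -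
  define k where "k w = (if w = z then deriv f z else (f w - f z) / (w - z))" for w
  have zb: "z \<in> ball 0 r - {0}" using z \<rho> by auto
  have op: "open (ball 0 r - {0::complex})" by auto
  have k: "k holomorphic_on ball 0 r - {0}"
    unfolding k_def by (rule pole_lemma_open[OF f op])
  have keq: "contour_integral (circlepath 0 \<rho>2) k = contour_integral (circlepath 0 \<rho>1) k"
    by (rule contour_integral_circlepath_eq(3)[OF open_ball k]) (use \<rho> z in auto)
  have fc: "continuous_on (sphere 0 \<rho>) f" if "0 < \<rho>" "\<rho> < r" for \<rho>
    using f that by (intro holomorphic_on_imp_continuous_on) (auto elim!: holomorphic_on_subset)
  have split: "contour_integral (circlepath 0 \<rho>) k =
      contour_integral (circlepath 0 \<rho>) (\<lambda>u. f u / (u - z)) - f z * contour_integral (circlepath 0 \<rho>) (\<lambda>u. 1 / (u - z))"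
    if \<rho>: "0 < \<rho>" "\<rho> < r" "norm z \<noteq> \<rho>" for \<rho>
  proof -
    have "contour_integral (circlepath 0 \<rho>) k = contour_integral (circlepath 0 \<rho>) (\<lambda>u. f u / (u - z) - f z * (1 / (u - z)))"
      using \<rho> by (intro contour_integral_cong) (auto simp: k_def diff_divide_distrib)
    also have "\<dots> = contour_integral (circlepath 0 \<rho>) (\<lambda>u. f u / (u - z)) - contour_integral (circlepath 0 \<rho>) (\<lambda>u. f z * (1 / (u - z)))"
      using \<rho> fc by (intro contour_integral_diff contour_integrable_continuous_circlepath continuous_intros) auto
    also have "contour_integral (circlepath 0 \<rho>) (\<lambda>u. f z * (1 / (u - z))) = f z * contour_integral (circlepath 0 \<rho>) (\<lambda>u. 1 / (u - z))"
      using \<rho> by (intro contour_integral_lmul contour_integrable_continuous_circlepath continuous_intros) auto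
    finally show ?thesis .
  qed
  have o: "contour_integral (circlepath 0 \<rho>2) (\<lambda>u. 1 / (u - z)) = 2 * of_real pi * \<i>"
    using z Cauchy_integral_circlepath_simple[of "\<lambda>_. 1" 0 \<rho>2 z] by (auto intro: contour_integral_unique)
  have i: "contour_integral (circlepath 0 \<rho>1) (\<lambda>u. 1 / (u - z)) = 0"
  proof (rule contour_integral_unique, rule Cauchy_theorem_convex_simple)
    show "(\<lambda>u. 1 / (u - z)) holomorphic_on ball 0 (norm z)" by (intro holomorphic_intros) auto
  qed (use z \<rho> in auto)
  show ?thesis using keq split[of \<rho>1] split[of \<rho>2] z \<rho> o i by (simp add: algebra_simps)
qed

text \<open>The two circle integrals in the Cauchy formula of an annulus are the regular and the principal
  part; they glue because the integrals do not depend on the radii.\<close>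

lemma laurent_splitting:
  fixes f :: "complex \<Rightarrow> complex"
  assumes r: "0 < r" and f: "f holomorphic_on ball 0 r - {0}"
  obtains f1 G where "f1 holomorphic_on ball 0 (r/2)" "G holomorphic_on UNIV"
    "\<And>z. z \<in> ball 0 (r/2) - {0} \<Longrightarrow> f z = f1 z + G (1 / z)"
proof -
  define I where "I \<rho> z = contour_integral (circlepath 0 \<rho>) (\<lambda>u. f u / (u - z)) / (2 * of_real pi * \<i>)" for \<rho> z
  have fc: "continuous_on (sphere 0 \<rho>) f" if "0 < \<rho>" "\<rho> < r" for \<rho>
    using f that by (intro holomorphic_on_imp_continuous_on) (auto elim!: holomorphic_on_subset)
  have Ih: "I \<rho> holomorphic_on - sphere 0 \<rho>" if "0 < \<rho>" "\<rho> < r" for \<rho>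
    unfolding I_def using cauchy_circle_integral_holomorphic[OF that(1) fc[OF that]] by (intro holomorphic_intros) auto
  define \<rho> where "\<rho> = r / 2"
  define \<rho>' where "\<rho>' = r / 4"
  have \<rho>: "0 < \<rho>'" "\<rho>' < \<rho>" "\<rho> < r" "0 < \<rho>" "\<rho>' < r" using r by (auto simp: \<rho>_def \<rho>'_def)
  define f2 where "f2 z = (if z \<in> ball 0 \<rho> - {0} then f z - I \<rho> z else - I \<rho>' z)" for z
  have "f2 holomorphic_on (ball 0 \<rho> - {0}) \<union> - cball 0 \<rho>'"
    unfolding f2_def
  proof (rule holomorphic_on_If_Un)
    show "(\<lambda>z. f z - I \<rho> z) holomorphic_on ball 0 \<rho> - {0}"
      using f Ih[OF \<rho>(4,3)] \<rho> by (intro holomorphic_intros) (auto elim!: holomorphic_on_subset)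
    show "(\<lambda>z. - I \<rho>' z) holomorphic_on - cball 0 \<rho>'"
      using Ih[OF \<rho>(1,5)] \<rho> by (intro holomorphic_intros) (auto elim!: holomorphic_on_subset)
    show "f z - I \<rho> z = - I \<rho>' z" if "z \<in> ball 0 \<rho> - {0}" "z \<in> - cball 0 \<rho>'" for z
    proof -
      have "2 * of_real pi * \<i> * f z = 2 * of_real pi * \<i> * (I \<rho> z - I \<rho>' z)"
        using cauchy_formula_annulus[OF f \<rho>(1,3), of z] that unfolding I_def by (simp add: algebra_simps)
      then have "f z = I \<rho> z - I \<rho>' z" by simp
      then show ?thesis by (simp add: algebra_simps)
    qed
  qed auto
  moreover have "(ball 0 \<rho> - {0}) \<union> - cball 0 \<rho>' = - {0::complex}" using \<rho> by auto
  ultimately have f2h: "f2 holomorphic_on - {0}" by simp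
  define g where "g \<zeta> = f2 (1 / \<zeta>)" for \<zeta>
  have gh: "g holomorphic_on UNIV - {0}"
    unfolding g_def
  proof (rule holomorphic_on_compose_gen[of "\<lambda>\<zeta>. 1 / \<zeta>" "UNIV - {0}" f2 "- {0}", unfolded o_def])
    show "(\<lambda>\<zeta>. 1 / \<zeta>) holomorphic_on UNIV - {0::complex}" by (intro holomorphic_intros) auto
  qed (use f2h in auto)
  have "bounded (f ` sphere 0 \<rho>')" using fc[OF \<rho>(1,5)] by (intro compact_imp_bounded compact_continuous_image) auto
  then obtain B where B: "B > 0" "\<And>u. norm u = \<rho>' \<Longrightarrow> norm (f u) \<le> B" unfolding bounded_pos by auto
  have gb: "norm (g \<zeta>) \<le> B" if "\<zeta> \<noteq> 0" "norm \<zeta> < 1 / (2 * \<rho>)" for \<zeta>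
  proof -
    have n: "norm (1 / \<zeta>) > 2 * \<rho>" using that \<rho> by (simp add: norm_divide field_simps)
    then have "g \<zeta> = - I \<rho>' (1 / \<zeta>)" using \<rho> by (auto simp: g_def f2_def)
    moreover have CI: "norm (contour_integral (circlepath 0 \<rho>') (\<lambda>u. f u / (u - 1 / \<zeta>))) \<le> B / \<rho> * (2 * pi * \<rho>')"
    proof (rule has_contour_integral_bound_circlepath)
      show "((\<lambda>u. f u / (u - 1 / \<zeta>)) has_contour_integral contour_integral (circlepath 0 \<rho>') (\<lambda>u. f u / (u - 1 / \<zeta>))) (circlepath 0 \<rho>')"
      proof (rule has_contour_integral_integral[OF contour_integrable_continuous_circlepath])
        show "continuous_on (path_image (circlepath 0 \<rho>')) (\<lambda>u. f u / (u - 1 / \<zeta>))"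
          using fc[OF \<rho>(1,5)] \<rho> n by (intro continuous_intros) auto
      qed
      fix u :: complex assume u: "norm (u - 0) = \<rho>'"
      have "norm (u - 1/\<zeta>) \<ge> norm (1/\<zeta>) - norm u" by (metis norm_minus_commute norm_triangle_ineq2)
      then have "norm (u - 1/\<zeta>) \<ge> \<rho>" using n u \<rho> by simp
      then show "norm (f u / (u - 1 / \<zeta>)) \<le> B / \<rho>" unfolding norm_divide using B u \<rho> by (intro frac_le) auto
    qed (use B \<rho> in auto)
    moreover have "norm (I \<rho>' (1 / \<zeta>)) = norm (contour_integral (circlepath 0 \<rho>') (\<lambda>u. f u / (u - 1 / \<zeta>))) / (2 * pi)"
      unfolding I_def by (simp add: norm_divide norm_mult)
    ultimately have "norm (g \<zeta>) = norm (contour_integral (circlepath 0 \<rho>') (\<lambda>u. f u / (u - 1 / \<zeta>))) / (2 * pi)"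
      by simp
    also have "\<dots> \<le> B / \<rho> * (2 * pi * \<rho>') / (2 * pi)" by (rule divide_right_mono[OF CI]) simp
    also have "\<dots> \<le> B" using B \<rho> by (simp add: field_simps)
    finally show ?thesis .
  qed
  have "\<exists>G. G holomorphic_on UNIV \<and> (\<forall>z\<in>UNIV - {0}. G z = g z)"
  proof (subst holomorphic_on_extend_bounded[OF gh])
    show "\<exists>B. \<forall>\<^sub>F z in at 0. norm (g z) \<le> B"
      unfolding eventually_at using gb \<rho> by (intro exI[of _ B] exI[of _ "1 / (2 * \<rho>)"]) auto
  qed auto
  then obtain G where G: "G holomorphic_on UNIV" "\<And>z. z \<noteq> 0 \<Longrightarrow> G z = g z" by auto
  show ?thesis
  proof (rule that[of "I \<rho>" G])
    show "I \<rho> holomorphic_on ball 0 (r / 2)" using Ih[OF \<rho>(4,3)] by (rule holomorphic_on_subset) (auto simp: \<rho>_def)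
    show "f z = I \<rho> z + G (1 / z)" if "z \<in> ball 0 (r/2) - {0}" for z
      using that G(2)[of "1 / z"] unfolding g_def f2_def \<rho>_def by auto
  qed (use G in auto)
qed

text \<open>Split \<open>f z = f1 z + G (1 / z)\<close> with \<open>G\<close> entire and let \<open>F' = exp
  G\<close>. For \<open>e \<ge> -1\<close> and \<open>w = 1 / z\<close> near infinity,
  \<open>|\<eta> dz| = |z|\<^sup>e\<^sup>+\<^sup>2 |exp (f1 z)| |exp (G w) dw|\<close> is bounded by
  a multiple of \<open>|F' dw|\<close>. Unless \<open>F'\<close> is constant, the inverse of
  \<open>F\<close> along a suitable segment of the plane is a path to infinity whose image under
  \<open>F\<close> has finite length, which contradicts completeness. If \<open>F'\<close> is
  constant then \<open>\<eta>\<close> has no essential singularity: for \<open>e \<ge> 0\<close> a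
  radius has finite length, and \<open>e = -1\<close> is the simple pole of the second alternative.\<close>

lemma end_order_le:
  fixes \<eta> f :: "complex \<Rightarrow> complex" and e :: int
  assumes r: "0 < r" and f: "f holomorphic_on ball 0 r - {0}"
    and \<eta>: "\<And>z. z \<in> ball 0 r - {0} \<Longrightarrow> \<eta> z = z powi e * exp (f z)"
    and complete: "\<And>\<gamma> \<gamma>' K. \<lbrakk>\<And>t. t \<in> {0..<1} \<Longrightarrow> (\<gamma> has_vector_derivative \<gamma>' t) (at t) \<and> \<gamma> t \<in> ball 0 r - {0}
           \<and> norm (\<eta> (\<gamma> t) * \<gamma>' t) \<le> K; continuous_on {0..<1} \<gamma>'; (\<gamma> \<longlongrightarrow> 0) (at_left (1::real))\<rbrakk> \<Longrightarrow> False"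
  shows "e \<le> -2 \<or> (e = -1 \<and> (\<exists>k \<rho>. 0 < \<rho> \<and> \<rho> \<le> r \<and> k holomorphic_on ball 0 \<rho> \<and> k 0 \<noteq> 0 \<and> (\<forall>z\<in>ball 0 \<rho> - {0}. \<eta> z = k z / z)))"
proof (rule ccontr)
  assume neg: "\<not> ?thesis"
  then have e: "e \<ge> -1" by simp
  obtain f1 G where f1: "f1 holomorphic_on ball 0 (r/2)" and G: "G holomorphic_on UNIV"
    and sp: "\<And>z. z \<in> ball 0 (r/2) - {0} \<Longrightarrow> f z = f1 z + G (1 / z)" by (rule laurent_splitting[OF r f]) (rule that)
  define \<rho> where "\<rho> = r / 4"
  have \<rho>: "0 < \<rho>" "\<rho> < r / 2" using r by (auto simp: \<rho>_def)
  have "bounded ((\<lambda>z. exp (f1 z)) ` cball 0 \<rho>)"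
  proof (intro compact_imp_bounded compact_continuous_image continuous_intros)
    show "continuous_on (cball 0 \<rho>) f1"
      using f1 \<rho> by (intro holomorphic_on_imp_continuous_on) (auto elim!: holomorphic_on_subset)
  qed auto
  then obtain M where M: "M > 0" "\<And>z. z \<in> cball 0 \<rho> \<Longrightarrow> norm (exp (f1 z)) \<le> M" unfolding bounded_pos by auto
  obtain F0 where F0: "\<And>z. (F0 has_field_derivative exp (G z)) (at z)"
    using holomorphic_convex_primitive'[of UNIV "\<lambda>z. exp (G z)"] G by (auto intro: holomorphic_intros)
  define F where "F z = F0 z - F0 0" for z
  have dF: "(F has_field_derivative exp (G z)) (at z)" for z
    unfolding F_def using F0[of z] by (auto intro!: derivative_eq_intros)
  then have dF': "deriv F = (\<lambda>z. exp (G z))" by (auto intro: DERIV_imp_deriv)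
  have Fh: "F holomorphic_on UNIV" using dF holomorphic_on_open by blast
  show False
  proof (cases "deriv F constant_on UNIV")
    case True
    then obtain c where c: "\<And>z. exp (G z) = c" unfolding constant_on_def dF' by auto
    have \<eta>c: "\<eta> z = z powi e * (exp (f1 z) * c)" if "z \<in> ball 0 (r/2) - {0}" for z
      using \<eta>[of z] sp[OF that] c that r by (auto simp: exp_add)
    show False
    proof (cases "e = -1")
      case True
      have "\<forall>z\<in>ball 0 (r/2) - {0}. \<eta> z = exp (f1 z) * c / z"
        using \<eta>c True by (auto simp: power_int_minus divide_simps)
      moreover have "(\<lambda>z. exp (f1 z) * c) holomorphic_on ball 0 (r/2)" using f1 by (intro holomorphic_intros)
      moreover have "exp (f1 0) * c \<noteq> 0" using c[of 0] by auto
      moreover have "0 < r/2 \<and> r/2 \<le> r" using r by auto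
      ultimately show False using neg True by meson
    next
      case False
      then have e0: "e \<ge> 0" using e by simp
      define \<gamma> :: "real \<Rightarrow> complex" where "\<gamma> t = of_real (\<rho> * (1 - t))" for t
      define \<gamma>' :: "real \<Rightarrow> complex" where "\<gamma>' t = of_real (- \<rho>)" for t
      have d\<gamma>: "(\<gamma> has_vector_derivative \<gamma>' t) (at t)" for t
        unfolding \<gamma>_def \<gamma>'_def by (auto intro!: derivative_eq_intros has_vector_derivative_of_real simp: has_real_derivative_iff_has_vector_derivative[symmetric])
      have g\<gamma>: "\<gamma> t \<in> cball 0 \<rho> - {0}" if "t \<in> {0..<1}" for t
        using that \<rho> by (auto simp: \<gamma>_def norm_mult abs_mult simp del: of_real_mult of_real_diff intro!: mult_left_le)
      have \<eta>b: "norm (\<eta> z) \<le> \<rho> powi e * (M * norm c)" if "z \<in> cball 0 \<rho> - {0}" for z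
      proof -
        have "\<eta> z = z powi e * (exp (f1 z) * c)" using that \<rho> by (intro \<eta>c) auto
        moreover have "norm (z powi e) \<le> \<rho> powi e" unfolding norm_power_int using that e0 by (intro power_int_mono) auto
        moreover have "norm (exp (f1 z) * c) \<le> M * norm c" unfolding norm_mult using M that by (intro mult_right_mono) auto
        ultimately show ?thesis using \<rho> by (simp add: norm_mult mult_mono)
      qed
      have "(\<gamma> has_vector_derivative \<gamma>' t) (at t) \<and> \<gamma> t \<in> ball 0 r - {0}
           \<and> norm (\<eta> (\<gamma> t) * \<gamma>' t) \<le> \<rho> powi e * (M * norm c) * \<rho>" if "t \<in> {0..<1}" for t
        using d\<gamma>[of t] g\<gamma>[OF that] \<eta>b[OF g\<gamma>[OF that]] \<rho>
        by (auto simp: \<gamma>'_def norm_mult intro!: mult_right_mono)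
      moreover have "continuous_on {0..<1} \<gamma>'" unfolding \<gamma>'_def by (intro continuous_intros)
      moreover have "(\<gamma> \<longlongrightarrow> 0) (at_left 1)" unfolding \<gamma>_def by (auto intro!: tendsto_eq_intros)
      ultimately show False by (rule complete)
    qed
  next
    case False
    have dnz: "deriv F z \<noteq> 0" for z unfolding dF' by simp
    have F00: "F 0 = 0" by (simp add: F_def)
    obtain \<psi> w0 where \<psi>: "\<psi> holomorphic_on ball 0 (norm w0)" "w0 \<noteq> 0"
      and F\<psi>: "\<And>w. w \<in> ball 0 (norm w0) \<Longrightarrow> F (\<psi> w) = w"
      and lim: "filterlim (\<lambda>t. \<psi> (of_real t * w0)) at_infinity (at_left (1::real))"
      using entire_immersion_asymptotic_path[OF Fh dnz F00 False] by metis
    define g where "g t = \<psi> (of_real t * w0)" for t :: real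
    have in_b: "of_real t * w0 \<in> ball 0 (norm w0)" if "0 < t" "t < 1" for t using that \<psi>(2) by (auto simp: norm_mult)
    have dg: "(g has_vector_derivative (w0 * exp (- G (g t)))) (at t)" if t: "0 < t" "t < 1" for t
    proof -
      have h: "(\<psi> has_field_derivative deriv \<psi> (of_real t * w0)) (at (of_real t * w0))"
        using holomorphic_derivI[OF \<psi>(1) open_ball in_b[OF t]] .
      have "((\<lambda>w. F (\<psi> w)) has_field_derivative exp (G (\<psi> (of_real t * w0))) * deriv \<psi> (of_real t * w0)) (at (of_real t * w0))"
        using DERIV_chain2[OF dF h] .
      moreover have "((\<lambda>w. F (\<psi> w)) has_field_derivative 1) (at (of_real t * w0))"
        by (rule has_field_derivative_transform_within_open[OF DERIV_ident open_ball in_b[OF t]]) (simp add: F\<psi>)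
      ultimately have "exp (G (g t)) * deriv \<psi> (of_real t * w0) = 1" unfolding g_def by (rule DERIV_unique)
      then have d: "deriv \<psi> (of_real t * w0) = exp (- G (g t))" by (simp add: exp_minus field_simps)
      have "((\<lambda>t. of_real t * w0) has_vector_derivative w0) (at t)"
        by (auto intro!: derivative_eq_intros)
      from field_vector_diff_chain_at[OF this h] show ?thesis unfolding g_def d[unfolded g_def] o_def by (simp add: mult.commute)
    qed
    \<comment> \<open>The bound \<open>1\<close> gives \<open>|z| \<le> 1\<close> along the path, so that \<open>|z|\<^sup>e\<^sup>+\<^sup>2 \<le> 1\<close>; the bound \<open>1 / \<rho>\<close> keeps the path where \<open>f1\<close> is bounded.\<close>
    define K0 where "K0 = max 1 (1 / \<rho>)"
    have "K0 > 0" by (simp add: K0_def)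
    then have "\<forall>\<^sub>F t in at_left 1. K0 \<le> norm (g t)" using lim unfolding filterlim_at_infinity[OF order_refl] g_def by blast
    then obtain b where b: "b < 1" "\<And>t. b < t \<Longrightarrow> t < 1 \<Longrightarrow> K0 \<le> norm (g t)" unfolding eventually_at_left_field by auto
    define t1 where "t1 = (max b 0 + 1) / 2"
    have t1: "b < t1" "0 < t1" "t1 < 1" using b by (auto simp: t1_def)
    define c where "c = (\<lambda>s. t1 + (1 - t1) * s)"
    have c01: "b < c s" "0 < c s" "c s < 1" if "s \<in> {0..<1}" for s
    proof -
      have "0 \<le> (1 - t1) * s" using that t1 by auto
      moreover have "(1 - t1) * s < 1 - t1" using mult_strict_left_mono[of s 1 "1 - t1"] that t1 by auto
      ultimately show "b < c s" "0 < c s" "c s < 1" using t1 unfolding c_def by linarith+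
    qed
    define \<gamma> where "\<gamma> s = 1 / g (c s)" for s
    define \<gamma>' where "\<gamma>' s = - of_real (1 - t1) * (w0 * exp (- G (g (c s)))) / (g (c s))\<^sup>2" for s
    have gK: "norm (g (c s)) \<ge> K0" if "s \<in> {0..<1}" for s using b(2) c01[OF that] by blast
    have gnz: "g (c s) \<noteq> 0" if "s \<in> {0..<1}" for s using gK[OF that] \<open>K0 > 0\<close> by auto
    have dgc: "((\<lambda>s. g (c s)) has_vector_derivative (of_real (1 - t1) * (w0 * exp (- G (g (c s)))))) (at s)" if "s \<in> {0..<1}" for s
    proof -
      have "(c has_vector_derivative (1 - t1)) (at s)" unfolding c_def
        by (auto intro!: derivative_eq_intros simp: has_real_derivative_iff_has_vector_derivative[symmetric])
      from vector_diff_chain_at[OF this dg[OF c01(2,3)[OF that]]] show ?thesis by (simp add: o_def scaleR_conv_of_real)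
    qed
    have d\<gamma>: "(\<gamma> has_vector_derivative \<gamma>' s) (at s)" if "s \<in> {0..<1}" for s
    proof -
      have "((\<lambda>z. 1 / z) has_field_derivative (- 1 / (g (c s))\<^sup>2)) (at (g (c s)))"
        using gnz[OF that] by (auto intro!: derivative_eq_intros simp: power2_eq_square)
      moreover have "\<gamma>' s = of_real (1 - t1) * (w0 * exp (- G (g (c s)))) * (- 1 / (g (c s))\<^sup>2)"
        by (simp add: \<gamma>'_def del: of_real_diff)
      ultimately show ?thesis
        using field_vector_diff_chain_at[OF dgc[OF that]] unfolding \<gamma>_def o_def by metis
    qed
    have in_\<rho>: "\<gamma> s \<in> cball 0 \<rho> - {0}" if "s \<in> {0..<1}" for s
    proof -
      have "1 / \<rho> \<le> norm (g (c s))" using gK[OF that] by (simp add: K0_def)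
      then have "norm (\<gamma> s) \<le> \<rho>" using \<rho> gnz[OF that] by (simp add: \<gamma>_def norm_divide field_simps)
      then show ?thesis using gnz[OF that] by (simp add: \<gamma>_def)
    qed
    have bd: "norm (\<eta> (\<gamma> s) * \<gamma>' s) \<le> M * norm w0" if "s \<in> {0..<1}" for s
    proof -
      let ?g = "g (c s)"
      have "\<gamma> s \<in> ball 0 (r/2) - {0}" using in_\<rho>[OF that] \<rho> by auto
      then have "\<eta> (\<gamma> s) = (\<gamma> s) powi e * (exp (f1 (\<gamma> s)) * exp (G ?g))"
        using \<eta>[of "\<gamma> s"] sp[of "\<gamma> s"] r by (auto simp: exp_add \<gamma>_def)
      then have "\<eta> (\<gamma> s) * \<gamma>' s = (\<gamma> s) powi e * (\<gamma> s)\<^sup>2 * exp (f1 (\<gamma> s)) * (exp (G ?g) * exp (- G ?g)) * (- of_real (1 - t1) * w0)"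
        unfolding \<gamma>'_def by (simp add: \<gamma>_def power_one_over field_simps)
      also have "exp (G ?g) * exp (- G ?g) = 1" by (simp add: exp_minus)
      also have "(\<gamma> s) powi e * (\<gamma> s)\<^sup>2 = (\<gamma> s) powi (e + 2)" using gnz[OF that] by (simp add: power_int_add \<gamma>_def)
      finally have "norm (\<eta> (\<gamma> s) * \<gamma>' s) = norm ((\<gamma> s) powi (e + 2)) * norm (exp (f1 (\<gamma> s))) * (\<bar>1 - t1\<bar> * norm w0)"
        by (simp add: norm_mult del: of_real_diff)
      also have "\<dots> \<le> 1 * M * (1 * norm w0)"
      proof (intro mult_mono)
        have "norm (\<gamma> s) \<le> 1" using gK[OF that] gnz[OF that] by (simp add: \<gamma>_def K0_def norm_divide)
        then show "norm ((\<gamma> s) powi (e + 2)) \<le> 1" unfolding norm_power_int using e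
          by (simp add: power_int_def power_le_one)
        show "norm (exp (f1 (\<gamma> s))) \<le> M" using M in_\<rho>[OF that] by blast
      qed (use t1 M in auto)
      finally show ?thesis by simp
    qed
    show False
    proof (rule complete[of \<gamma> \<gamma>' "M * norm w0"])
      show "(\<gamma> has_vector_derivative \<gamma>' t) (at t) \<and> \<gamma> t \<in> ball 0 r - {0} \<and> norm (\<eta> (\<gamma> t) * \<gamma>' t) \<le> M * norm w0" if "t \<in> {0..<1}" for t
        using d\<gamma>[OF that] in_\<rho>[OF that] bd[OF that] \<rho> by auto
      have gc: "continuous_on {0..<1} (\<lambda>s. g (c s))"
        using dgc has_vector_derivative_continuous continuous_at_imp_continuous_on by blast
      have "continuous_on UNIV G" using G by (rule holomorphic_on_imp_continuous_on)
      from continuous_on_compose2[OF this gc] have Gc: "continuous_on {0..<1} (\<lambda>s. G (g (c s)))" by simp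
      show "continuous_on {0..<1} \<gamma>'" unfolding \<gamma>'_def
      proof (intro continuous_intros gc Gc)
        show "\<forall>s\<in>{0..<1}. (g (c s))\<^sup>2 \<noteq> 0" using gnz by simp
      qed
      have "filterlim c (at_left 1) (at_left 1)"
      proof (rule tendsto_imp_filterlim_at_left)
        show "(c \<longlongrightarrow> 1) (at_left 1)" unfolding c_def by (auto intro!: tendsto_eq_intros)
        show "\<forall>\<^sub>F x in at_left 1. c x < 1" unfolding eventually_at_left_field using c01(3) by (intro exI[of _ 0]) auto
      qed
      from filterlim_compose[OF lim this] have "filterlim (\<lambda>s. g (c s)) at_infinity (at_left 1)" unfolding g_def .
      from filterlim_compose[OF tendsto_inverse_0 this] show "(\<gamma> \<longlongrightarrow> 0) (at_left 1)" unfolding \<gamma>_def by (simp add: inverse_eq_divide)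
    qed
  qed
qed

section \<open>Winding numbers of nonvanishing functions\<close>

text \<open>The function \<open>u\<close> winds \<open>m\<close> times around \<open>0\<close> whenever
  \<open>\<phi>\<close> winds once: \<open>u / \<phi>\<^sup>m\<close> has a continuous logarithm.
  Winding relative to an arbitrary reference function \<open>\<phi>\<close> makes sense on any
  domain and can be composed, as in \<open>winds_trans\<close>, when the reference is only a
  homeomorphic coordinate.\<close>

definition winds :: "'p::topological_space set \<Rightarrow> ('p \<Rightarrow> complex) \<Rightarrow> ('p \<Rightarrow> complex) \<Rightarrow> int \<Rightarrow> bool" where
  "winds A \<phi> u m \<longleftrightarrow> (\<exists>l. continuous_on A l \<and> (\<forall>x\<in>A. u x = \<phi> x powi m * exp (l x)))"

lemma windsI: "continuous_on A l \<Longrightarrow> (\<And>x. x \<in> A \<Longrightarrow> u x = \<phi> x powi m * exp (l x)) \<Longrightarrow> winds A \<phi> u m"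
  unfolding winds_def by blast

lemma winds_exp: "continuous_on A l \<Longrightarrow> (\<And>x. x \<in> A \<Longrightarrow> u x = exp (l x)) \<Longrightarrow> winds A \<phi> u 0"
  by (rule windsI[of A l]) auto

lemma winds_self: "winds A \<phi> \<phi> 1"
  by (rule windsI[of A "\<lambda>_. 0"]) auto

lemma winds_subset: "winds B \<phi> u m \<Longrightarrow> A \<subseteq> B \<Longrightarrow> winds A \<phi> u m"
  unfolding winds_def by (meson continuous_on_subset subsetD)

lemma winds_cong: "winds A \<phi> u m \<Longrightarrow> (\<And>x. x \<in> A \<Longrightarrow> u x = v x) \<Longrightarrow> (\<And>x. x \<in> A \<Longrightarrow> \<phi> x = \<psi> x) \<Longrightarrow> winds A \<psi> v m"
  unfolding winds_def by auto

lemma winds_mult: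
  assumes "winds A \<phi> u m" "winds A \<phi> v n" "\<And>x. x \<in> A \<Longrightarrow> \<phi> x \<noteq> 0"
  shows "winds A \<phi> (\<lambda>x. u x * v x) (m + n)"
proof -
  obtain l k where "continuous_on A l" "continuous_on A k" "\<And>x. x \<in> A \<Longrightarrow> u x = \<phi> x powi m * exp (l x)"
     "\<And>x. x \<in> A \<Longrightarrow> v x = \<phi> x powi n * exp (k x)" using assms unfolding winds_def by metis
  then show ?thesis using assms(3)
    by (intro windsI[of A "\<lambda>x. l x + k x"] continuous_intros) (auto simp: exp_add power_int_add)
qed

lemma winds_power_int:
  assumes "winds A \<phi> u m"
  shows "winds A \<phi> (\<lambda>x. u x powi k) (m * k)"
proof -
  obtain l where "continuous_on A l" "\<And>x. x \<in> A \<Longrightarrow> u x = \<phi> x powi m * exp (l x)"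
    using assms unfolding winds_def by metis
  then show ?thesis
    by (intro windsI[of A "\<lambda>x. of_int k * l x"] continuous_intros)
      (auto simp: power_int_mult power_int_mult_distrib exp_power_int)
qed

lemma winds_divide:
  assumes "winds A \<phi> u m" "winds A \<phi> v n" "\<And>x. x \<in> A \<Longrightarrow> \<phi> x \<noteq> 0"
  shows "winds A \<phi> (\<lambda>x. u x / v x) (m - n)"
  using winds_mult[OF assms(1) winds_power_int[OF assms(2), of "-1"] assms(3)]
  by (simp add: power_int_minus divide_inverse)

lemma winds_prod:
  assumes "finite Q" "\<And>q. q \<in> Q \<Longrightarrow> winds A \<phi> (u q) (m q)" "\<And>x. x \<in> A \<Longrightarrow> \<phi> x \<noteq> 0"
  shows "winds A \<phi> (\<lambda>x. \<Prod>q\<in>Q. u q x) (\<Sum>q\<in>Q. m q)"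
  using assms(1,2)
proof (induction Q rule: finite_induct)
  case empty
  show ?case by (rule windsI[of A "\<lambda>_. 0"]) auto
next
  case (insert q Q)
  then show ?case using winds_mult[of A \<phi> "u q" "m q", OF _ _ assms(3)] by simp
qed

lemma winds_trans:
  assumes "winds A \<phi> u m" "winds A \<theta> \<phi> s" "\<And>x. x \<in> A \<Longrightarrow> \<theta> x \<noteq> 0"
  shows "winds A \<theta> u (s * m)"
proof -
  obtain l where l: "continuous_on A l" "\<And>x. x \<in> A \<Longrightarrow> u x = \<phi> x powi m * exp (l x)"
    using assms(1) unfolding winds_def by metis
  have "winds A \<theta> (\<lambda>x. exp (l x)) 0" using l by (intro winds_exp) auto
  from winds_mult[OF winds_power_int[OF assms(2), of m] this assms(3)]
  have "winds A \<theta> (\<lambda>x. \<phi> x powi m * exp (l x)) (s * m)" by simp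
  then show ?thesis by (rule winds_cong) (use l in auto)
qed

lemma winds_compose:
  assumes "winds B \<phi> u m" "continuous_on A h" "h ` A \<subseteq> B"
  shows "winds A (\<lambda>x. \<phi> (h x)) (\<lambda>x. u (h x)) m"
proof -
  obtain l where l: "continuous_on B l" "\<And>x. x \<in> B \<Longrightarrow> u x = \<phi> x powi m * exp (l x)"
    using assms(1) unfolding winds_def by metis
  show ?thesis
    by (rule windsI[of A "\<lambda>x. l (h x)"]) (use l assms in \<open>auto intro: continuous_on_compose2\<close>)
qed

lemma winds_contractible:
  fixes u :: "'p::real_normed_vector \<Rightarrow> complex"
  assumes "continuous_on A u" "convex A" "\<And>x. x \<in> A \<Longrightarrow> u x \<noteq> 0"
  shows "winds A \<phi> u 0"
  using continuous_logarithm_on_contractible[OF assms(1) convex_imp_contractible[OF assms(2)] assms(3)]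
  by (metis winds_exp)

lemma winds_near_1:
  assumes "continuous_on A u" "\<And>x. x \<in> A \<Longrightarrow> norm (u x - 1) < 1"
  shows "winds A \<phi> u 0"
proof (rule winds_exp)
  have u: "0 < Re (u x)" if "x \<in> A" for x
  proof -
    have "\<bar>Re (u x - 1)\<bar> \<le> norm (u x - 1)" by (rule abs_Re_le_cmod)
    then show ?thesis using assms(2)[OF that] by simp
  qed
  then have n: "u x \<notin> \<real>\<^sub>\<le>\<^sub>0" if "x \<in> A" for x using that by (force simp: complex_nonpos_Reals_iff)
  show "continuous_on A (\<lambda>x. Ln (u x))" using assms(1) n by (intro continuous_intros) auto
  show "u x = exp (Ln (u x))" if "x \<in> A" for x using u[OF that] by (subst exp_Ln) auto
qed

text \<open>A continuous function with values in the discrete set \<open>2 \<pi> \<i> \<int>\<close>.\<close>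

lemma periods_integral_constant:
  fixes h :: "'p::topological_space \<Rightarrow> complex"
  assumes "connected S" "continuous_on S h" "\<And>x. x \<in> S \<Longrightarrow> exp (h x) = 1"
  obtains k :: int where "\<And>x. x \<in> S \<Longrightarrow> h x = of_int (2 * k) * pi * \<i>"
proof (cases "S = {}")
  case False
  then obtain x0 where x0: "x0 \<in> S" by auto
  have "h constant_on S"
  proof (rule continuous_discrete_range_constant[OF assms(1,2)])
    fix x assume x: "x \<in> S"
    have "2 * pi \<le> norm (h y - h x)" if y: "y \<in> S" "h y \<noteq> h x" for y
    proof (rule ccontr)
      assume a: "\<not> 2 * pi \<le> norm (h y - h x)"
      have "exp (h y) = exp (h x)" using assms(3) x y by simp
      then obtain n where n: "h y = h x + of_int (2 * n) * of_real pi * \<i>" unfolding exp_eq by (auto simp: mult_ac)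
      then have "norm (h y - h x) = \<bar>of_int n\<bar> * (2 * pi)" by (simp add: norm_mult)
      then have "\<bar>of_int n\<bar> < (1::real)" using a by simp
      then have "n = 0" by linarith
      then show False using n y by simp
    qed
    then show "\<exists>e>0. \<forall>y. y \<in> S \<and> h y \<noteq> h x \<longrightarrow> e \<le> norm (h y - h x)" using pi_gt_zero by (intro exI[of _ "2*pi"]) auto
  qed
  then obtain c where c: "\<And>x. x \<in> S \<Longrightarrow> h x = c" unfolding constant_on_def by blast
  have "exp c = 1" using c assms(3) x0 by metis
  then obtain n :: int where "c = of_int (2 * n) * pi * \<i>" unfolding exp_eq_1 by (auto simp: complex_eq_iff)
  then show ?thesis using that c by metis
qed (use that in auto)

text \<open>If \<open>1 = (x - a)\<^sup>k exp (l x)\<close> on the circle, then \<open>l\<close> plus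
  \<open>k\<close> times a logarithm of \<open>x - a\<close> is a constant period; following it once
  around the circle gives \<open>2 \<pi> \<i> k = 0\<close>.\<close>

lemma winds_circle_unique:
  assumes \<rho>: "0 < \<rho>" and "winds (sphere a \<rho>) (\<lambda>x. x - a) u m" "winds (sphere a \<rho>) (\<lambda>x. x - a) u n"
    and nz: "\<And>x. x \<in> sphere a \<rho> \<Longrightarrow> u x \<noteq> 0"
  shows "m = n"
proof -
  have nz': "x - a \<noteq> 0" if "x \<in> sphere a \<rho>" for x using that \<rho> by auto
  have "winds (sphere a \<rho>) (\<lambda>x. x - a) (\<lambda>x. u x / u x) (m - n)"
    using winds_divide[OF assms(2,3) nz'] by blast
  then obtain l where l: "continuous_on (sphere a \<rho>) l" "\<And>x. x \<in> sphere a \<rho> \<Longrightarrow> 1 = (x - a) powi (m - n) * exp (l x)"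
    unfolding winds_def using nz by auto
  define \<gamma> where "\<gamma> t = a + exp (of_real (ln \<rho>) + \<i> * of_real t)" for t :: real
  have \<gamma>: "\<gamma> t \<in> sphere a \<rho>" for t
    using \<rho> by (simp add: \<gamma>_def dist_norm)
  define h where "h t = l (\<gamma> t) + of_int (m - n) * (of_real (ln \<rho>) + \<i> * of_real t)" for t
  have "continuous_on UNIV \<gamma>" unfolding \<gamma>_def by (intro continuous_intros)
  then have "continuous_on UNIV (\<lambda>t. l (\<gamma> t))" using \<gamma> by (intro continuous_on_compose2[OF l(1)]) auto
  then have hc: "continuous_on UNIV h" unfolding h_def by (intro continuous_intros)
  have he: "exp (h t) = 1" for t
  proof -
    have "1 = (\<gamma> t - a) powi (m - n) * exp (l (\<gamma> t))" using l(2) \<gamma> by blast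
    also have "(\<gamma> t - a) powi (m - n) = exp (of_int (m - n) * (of_real (ln \<rho>) + \<i> * of_real t))"
      unfolding \<gamma>_def by (simp only: add_diff_cancel_left' exp_power_int)
    finally show ?thesis unfolding h_def by (simp add: exp_add mult.commute)
  qed
  obtain k :: int where k: "\<And>t. t \<in> UNIV \<Longrightarrow> h t = of_int (2 * k) * pi * \<i>"
    by (rule periods_integral_constant[OF connected_UNIV hc he]) (rule that)
  have "\<gamma> (2 * pi) = \<gamma> 0" unfolding \<gamma>_def by (simp add: exp_add) (metis exp_two_pi_i mult.commute mult.left_commute)
  then have "h (2 * pi) - h 0 = of_int (m - n) * (\<i> * (2 * pi))" unfolding h_def by (simp add: algebra_simps)
  then have "of_int (m - n) * (\<i> * (2 * pi)) = 0" using k by simp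
  then show ?thesis by simp
qed

text \<open>On the contractible cover \<open>A \<times> {Re z < ln r}\<close> the function has a logarithm
  \<open>L\<close>, whose increment over a translation by \<open>2 \<pi> \<i>\<close> is a constant
  period and so determines \<open>m\<close>. The parameter set \<open>A\<close> is there to compare
  nearby base points.\<close>

lemma winds_exists_param:
  fixes u :: "'p::real_normed_vector \<times> complex \<Rightarrow> complex"
  assumes A: "open A" "convex A" and r: "0 < r"
    and u: "continuous_on (A \<times> (ball 0 r - {0})) u" and nz: "\<And>x. x \<in> A \<times> (ball 0 r - {0}) \<Longrightarrow> u x \<noteq> 0"
  obtains m where "winds (A \<times> (ball 0 r - {0})) snd u m"
proof -
  define H where "H = {z. Re z < ln r}"
  have H: "convex H" unfolding H_def by (rule convex_halfspace_Re_lt)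
  have eH: "exp z \<in> ball 0 r - {0}" if "z \<in> H" for z :: complex
    using that r unfolding H_def by (simp add: norm_exp_eq_Re) (metis exp_less_mono exp_ln)
  have LnH: "Ln v \<in> H" if "v \<in> ball 0 r - {0}" for v using that r unfolding H_def by auto
  have cu: "continuous_on (A \<times> H) (\<lambda>x. u (fst x, exp (snd x)))"
    using eH by (intro continuous_on_compose2[OF u] continuous_intros) auto
  have nzc: "u (fst x, exp (snd x)) \<noteq> 0" if "x \<in> A \<times> H" for x
    using nz[of "(fst x, exp (snd x))"] eH[of "snd x"] that by auto
  obtain L where L: "continuous_on (A \<times> H) L" "\<And>x. x \<in> A \<times> H \<Longrightarrow> u (fst x, exp (snd x)) = exp (L x)"
    by (rule continuous_logarithm_on_contractible[OF cu convex_imp_contractible[OF convex_Times[OF A(2) H]] nzc]) (assumption, rule that)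
  define D where "D x = L (fst x, snd x + 2 * pi * \<i>) - L x" for x
  have Dc: "continuous_on (A \<times> H) D" unfolding D_def
    by (intro continuous_intros continuous_on_compose2[OF L(1)]) (auto simp: H_def)
  have De: "exp (D x) = 1" if "x \<in> A \<times> H" for x
  proof -
    have "(fst x, snd x + 2 * pi * \<i>) \<in> A \<times> H" using that by (auto simp: H_def)
    then have "exp (L (fst x, snd x + 2 * pi * \<i>)) = u (fst x, exp (snd x + 2 * pi * \<i>))" using L(2) by fastforce
    also have "exp (snd x + 2 * pi * \<i>) = exp (snd x)" by (simp add: exp_add)
    finally show ?thesis unfolding D_def exp_diff using L(2)[OF that] by simp
  qed
  obtain m :: int where m: "\<And>x. x \<in> A \<times> H \<Longrightarrow> D x = of_int (2 * m) * pi * \<i>"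
    by (rule periods_integral_constant[OF convex_connected[OF convex_Times[OF A(2) H]] Dc De]) (assumption, rule that)
  define l where "l x = L (fst x, Ln (snd x)) - of_int m * Ln (snd x)" for x
  define S where "S = A \<times> (ball 0 r - {0::complex})"
  have l2: "l x = L (fst x, Ln (- snd x) + pi * \<i>) - of_int m * (Ln (- snd x) + pi * \<i>)" if "x \<in> S" for x
  proof -
    have v: "snd x \<in> ball 0 r - {0}" "fst x \<in> A" using that unfolding S_def by auto
    have "Ln (- snd x) + pi * \<i> = Ln (snd x) \<or> Ln (- snd x) + pi * \<i> = Ln (snd x) + 2 * pi * \<i>"
      using Ln_minus[of "snd x"] v by (auto simp: algebra_simps split: if_splits)
    then show ?thesis
    proof
      assume e: "Ln (- snd x) + pi * \<i> = Ln (snd x) + 2 * pi * \<i>"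
      show ?thesis using m[of "(fst x, Ln (snd x))"] LnH v unfolding e D_def l_def by (simp add: algebra_simps)
    qed (simp add: l_def)
  qed
  have "continuous_on (A \<times> (ball 0 r - {0} - \<real>\<^sub>\<le>\<^sub>0)) l"
    unfolding l_def using LnH by (intro continuous_intros continuous_on_compose2[OF L(1)]) auto
  moreover have "continuous_on (A \<times> (ball 0 r - {0} - \<real>\<^sub>\<ge>\<^sub>0)) (\<lambda>x. L (fst x, Ln (- snd x) + pi * \<i>) - of_int m * (Ln (- snd x) + pi * \<i>))"
  proof (intro continuous_intros continuous_on_compose2[OF L(1)])
    show "(\<lambda>x. (fst x, Ln (- snd x) + complex_of_real pi * \<i>)) ` (A \<times> (ball 0 r - {0} - \<real>\<^sub>\<ge>\<^sub>0)) \<subseteq> A \<times> H"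
      using LnH[of "- snd _"] unfolding H_def by (auto simp: H_def)
  qed (auto simp: complex_nonpos_Reals_iff complex_nonneg_Reals_iff)
  then have "continuous_on (A \<times> (ball 0 r - {0} - \<real>\<^sub>\<ge>\<^sub>0)) l"
    by (rule continuous_on_eq) (rule l2[symmetric], auto simp: S_def)
  moreover have "open (A \<times> (ball 0 r - {0::complex} - \<real>\<^sub>\<le>\<^sub>0))" "open (A \<times> (ball 0 r - {0::complex} - \<real>\<^sub>\<ge>\<^sub>0))"
    using A by (auto intro!: open_Times open_Diff)
  ultimately have "continuous_on (A \<times> (ball 0 r - {0} - \<real>\<^sub>\<le>\<^sub>0) \<union> A \<times> (ball 0 r - {0} - \<real>\<^sub>\<ge>\<^sub>0)) l"
    by (intro continuous_on_open_Un)
  moreover have "A \<times> (ball 0 r - {0} - \<real>\<^sub>\<le>\<^sub>0) \<union> A \<times> (ball 0 r - {0} - \<real>\<^sub>\<ge>\<^sub>0) = S"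
    unfolding S_def by (auto simp: complex_nonpos_Reals_iff complex_nonneg_Reals_iff complex_eq_iff)
  ultimately have lc: "continuous_on S l" by simp
  have "winds S snd u m"
  proof (rule windsI[OF lc])
    fix x assume x: "x \<in> S"
    then have v: "snd x \<in> ball 0 r - {0}" "fst x \<in> A" unfolding S_def by auto
    have "u x = exp (L (fst x, Ln (snd x)))" using L(2)[of "(fst x, Ln (snd x))"] v LnH by simp
    also have "\<dots> = exp (of_int m * Ln (snd x)) * exp (l x)" by (simp add: l_def exp_diff)
    also have "exp (of_int m * Ln (snd x)) = snd x powi m"
      using v exp_power_int[of "Ln (snd x)" m] by (simp add: mult.commute)
    finally show "u x = snd x powi m * exp (l x)" .
  qed
  then show ?thesis using that unfolding S_def by blast
qed

lemma winds_exists: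
  assumes r: "0 < r" and u: "continuous_on (ball a r - {a}) u" and nz: "\<And>x. x \<in> ball a r - {a} \<Longrightarrow> u x \<noteq> 0"
  obtains m where "winds (ball a r - {a}) (\<lambda>x. x - a) u m"
proof -
  have "continuous_on (UNIV \<times> (ball 0 r - {0})) (\<lambda>x::real \<times> complex. u (a + snd x))"
    by (intro continuous_on_compose2[OF u] continuous_intros) (auto simp: dist_norm)
  then obtain m where m: "winds (UNIV \<times> (ball 0 r - {0})) snd (\<lambda>x::real \<times> complex. u (a + snd x)) m"
  proof (rule winds_exists_param[OF open_UNIV convex_UNIV r])
    show "u (a + snd x) \<noteq> 0" if "x \<in> UNIV \<times> (ball 0 r - {0})" for x :: "real \<times> complex"
      using that by (intro nz) (auto simp: dist_norm)
  qed
  have "winds (ball a r - {a}) (\<lambda>x. snd (0::real, x - a)) (\<lambda>x. u (a + snd (0::real, x - a))) m"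
    by (rule winds_compose[OF m]) (auto intro!: continuous_intros simp: dist_norm norm_minus_commute)
  then show ?thesis using that by simp
qed

text \<open>Divided by \<open>\<Prod>(x - q)\<^sup>m\<^sup>q\<close>, the function has a logarithm on each
  small annulus. Scaling that logarithm down to \<open>0\<close> across the annulus extends the
  quotient to a nonvanishing function on the whole disc, which does not wind around the boundary
  circle.\<close>

lemma winding_number_additive:
  fixes u :: "complex \<Rightarrow> complex"
  assumes Q: "finite Q" and \<rho>: "0 < \<rho>1" "\<rho>1 < \<rho>2" and R: "0 < R"
    and sub: "\<And>q. q \<in> Q \<Longrightarrow> cball q \<rho>2 \<subseteq> ball 0 R"
    and disj: "\<And>q q'. q \<in> Q \<Longrightarrow> q' \<in> Q \<Longrightarrow> q \<noteq> q' \<Longrightarrow> cball q \<rho>2 \<inter> cball q' \<rho>2 = {}"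
    and u: "continuous_on (cball 0 R - (\<Union>q\<in>Q. ball q \<rho>1)) u"
    and nz: "\<And>x. x \<in> cball 0 R - (\<Union>q\<in>Q. ball q \<rho>1) \<Longrightarrow> u x \<noteq> 0"
    and m: "\<And>q. q \<in> Q \<Longrightarrow> winds (cball q \<rho>2 - ball q \<rho>1) (\<lambda>x. x - q) u (m q)"
    and n: "winds (sphere 0 R) (\<lambda>x. x) u n"
  shows "n = (\<Sum>q\<in>Q. m q)"
proof -
  define k where "k x = u x * (\<Prod>q\<in>Q. (x - q) powi (- m q))" for x
  have ann: "winds (cball q \<rho>2 - ball q \<rho>1) (\<lambda>x. x - q) k 0" if q: "q \<in> Q" for q
  proof -
    have nzq: "x - q \<noteq> 0" if "x \<in> cball q \<rho>2 - ball q \<rho>1" for x using that \<rho> by auto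
    have "winds (cball q \<rho>2 - ball q \<rho>1) (\<lambda>x. x - q) (\<lambda>x. \<Prod>q'\<in>Q. (x - q') powi (- m q')) (\<Sum>q'\<in>Q. (if q' = q then 1 else 0) * (- m q'))"
    proof (intro winds_prod[OF Q] nzq winds_power_int)
      fix q' assume q': "q' \<in> Q"
      show "winds (cball q \<rho>2 - ball q \<rho>1) (\<lambda>x. x - q) (\<lambda>x. x - q') (if q' = q then 1 else 0)"
      proof (cases "q' = q")
        case True then show ?thesis using winds_self by simp
      next
        case False
        have "winds (cball q \<rho>2) (\<lambda>x. x - q) (\<lambda>x. x - q') 0"
          using disj[OF q q'] False \<rho> by (intro winds_contractible continuous_intros) (auto simp: disjoint_iff)
        then show ?thesis using False by (auto intro: winds_subset)
      qed
    qed
    also have "(\<Sum>q'\<in>Q. (if q' = q then 1 else 0) * (- m q')) = - m q" 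
    proof -
      have "(\<Sum>q'\<in>Q. (if q' = q then 1 else 0) * (- m q')) = (\<Sum>q'\<in>Q. if q' = q then - m q' else 0)"
        by (intro sum.cong) auto
      then show ?thesis using Q q by simp
    qed
    finally have "winds (cball q \<rho>2 - ball q \<rho>1) (\<lambda>x. x - q) (\<lambda>x. \<Prod>q'\<in>Q. (x - q') powi (- m q')) (- m q)" .
    from winds_mult[OF m[OF q] this nzq] show ?thesis unfolding k_def by simp
  qed
  then have "\<forall>q\<in>Q. \<exists>l. continuous_on (cball q \<rho>2 - ball q \<rho>1) l \<and> (\<forall>x\<in>cball q \<rho>2 - ball q \<rho>1. k x = exp (l x))"
    unfolding winds_def by simp
  then obtain l where l: "\<And>q. q \<in> Q \<Longrightarrow> continuous_on (cball q \<rho>2 - ball q \<rho>1) (l q)"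
    "\<And>q x. q \<in> Q \<Longrightarrow> x \<in> cball q \<rho>2 - ball q \<rho>1 \<Longrightarrow> k x = exp (l q x)" by metis
  define c where "c q x = max 0 ((dist q x - \<rho>1) / (\<rho>2 - \<rho>1))" for q x :: complex
  define T where "T q x = (if x \<in> cball q \<rho>1 then 1 else exp (of_real (c q x) * l q x))" for q x
  have Tc: "continuous_on (cball q \<rho>2) (T q)" if q: "q \<in> Q" for q
  proof -
    have "continuous_on (cball q \<rho>1 \<union> (cball q \<rho>2 - ball q \<rho>1)) (T q)"
      unfolding T_def
    proof (rule continuous_on_If)
      show "continuous_on (cball q \<rho>2 - ball q \<rho>1) (\<lambda>x. exp (of_real (c q x) * l q x))"
        unfolding c_def using \<rho> by (intro continuous_intros l q) auto
    qed (auto simp: c_def)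
    moreover have "cball q \<rho>1 \<union> (cball q \<rho>2 - ball q \<rho>1) = cball q \<rho>2" using \<rho> by auto
    ultimately show ?thesis by simp
  qed
  \<comment> \<open>The factor \<open>c q\<close> is \<open>0\<close> on the inner and \<open>1\<close> on the outer circle, so \<open>T q\<close> continues \<open>k\<close> inwards to the constant \<open>1\<close>.\<close>
  define K where "K x = (if \<exists>q\<in>Q. x \<in> cball q \<rho>2 then T (SOME q. q \<in> Q \<and> x \<in> cball q \<rho>2) x else k x)" for x
  have KT: "K x = T q x" if "q \<in> Q" "x \<in> cball q \<rho>2" for q x
  proof -
    have s: "(SOME q. q \<in> Q \<and> x \<in> cball q \<rho>2) \<in> Q \<and> x \<in> cball (SOME q. q \<in> Q \<and> x \<in> cball q \<rho>2) \<rho>2"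
      by (rule someI[of _ q]) (use that in auto)
    then have "(SOME q. q \<in> Q \<and> x \<in> cball q \<rho>2) = q" using disj that by blast
    then show ?thesis unfolding K_def using that by auto
  qed
  have Kk: "K x = k x" if "x \<in> cball 0 R - (\<Union>q\<in>Q. ball q \<rho>2)" for x
  proof (cases "\<exists>q\<in>Q. x \<in> cball q \<rho>2")
    case True
    then obtain q where q: "q \<in> Q" "x \<in> cball q \<rho>2" by auto
    then have d: "dist q x = \<rho>2" using that by force
    have "T q x = exp (l q x)" using d \<rho> by (simp add: T_def c_def)
    also have "\<dots> = k x" using l(2)[OF q(1), of x] d \<rho> by simp
    finally show ?thesis using KT[OF q] by simp
  qed (simp add: K_def)
  define B where "B = (\<Union>q\<in>Q. ball q \<rho>1)"
  have kc: "continuous_on (cball 0 R - B) k"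
    unfolding k_def B_def using u \<rho> by (intro continuous_intros) auto
  have knz: "k x \<noteq> 0" if "x \<in> cball 0 R - B" for x
    using nz[of x] that \<rho> Q unfolding k_def B_def by auto
  have Kc: "continuous_on (cball 0 R) K"
  proof -
    have "continuous_on ((cball 0 R - (\<Union>q\<in>Q. ball q \<rho>2)) \<union> (\<Union>q\<in>Q. cball q \<rho>2)) K"
    proof (rule continuous_on_closed_Un)
      show "closed (cball 0 R - (\<Union>q\<in>Q. ball q \<rho>2))" by (intro closed_Diff) auto
      show "closed (\<Union>q\<in>Q. cball q \<rho>2)" using Q by auto
      have "continuous_on (cball 0 R - (\<Union>q\<in>Q. ball q \<rho>2)) k"
        by (rule continuous_on_subset[OF kc]) (use \<rho> in \<open>force simp: B_def\<close>)
      then show "continuous_on (cball 0 R - (\<Union>q\<in>Q. ball q \<rho>2)) K" by (rule continuous_on_eq) (simp add: Kk)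
      show "continuous_on (\<Union>q\<in>Q. cball q \<rho>2) K"
      proof (rule continuous_on_closed_Union[OF Q])
        fix q assume q: "q \<in> Q"
        show "continuous_on (cball q \<rho>2) K" using Tc[OF q] by (rule continuous_on_eq) (rule KT[OF q, symmetric])
      qed auto
    qed
    moreover have "cball 0 R \<subseteq> (cball 0 R - (\<Union>q\<in>Q. ball q \<rho>2)) \<union> (\<Union>q\<in>Q. cball q \<rho>2)"
    proof
      fix x :: complex assume "x \<in> cball 0 R"
      then show "x \<in> (cball 0 R - (\<Union>q\<in>Q. ball q \<rho>2)) \<union> (\<Union>q\<in>Q. cball q \<rho>2)"
        using ball_subset_cball by blast
    qed
    ultimately show ?thesis by (rule continuous_on_subset)
  qed
  have Knz: "K x \<noteq> 0" if x: "x \<in> cball 0 R" for x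
  proof (cases "\<exists>q\<in>Q. x \<in> cball q \<rho>2")
    case True
    then obtain q where "q \<in> Q" "x \<in> cball q \<rho>2" by auto
    from KT[OF this] show ?thesis by (cases "x \<in> cball q \<rho>1") (simp_all add: T_def)
  next
    case False
    have "x \<notin> B"
    proof
      assume "x \<in> B"
      then obtain q where "q \<in> Q" "dist q x < \<rho>1" unfolding B_def by auto
      then have "q \<in> Q" "x \<in> cball q \<rho>2" using \<rho> by auto
      with False show False by blast
    qed
    then show ?thesis using False knz[of x] x unfolding K_def by simp
  qed
  have "winds (cball 0 R) (\<lambda>x. x) K 0" using Kc Knz by (intro winds_contractible) auto
  then have 1: "winds (sphere 0 R) (\<lambda>x. x) K 0" by (rule winds_subset) auto
  have Ksph: "K x = k x" if "x \<in> sphere 0 R" for x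
  proof (rule Kk)
    have "x \<notin> ball q \<rho>2" if q: "q \<in> Q" for q
    proof
      assume "x \<in> ball q \<rho>2"
      then have "x \<in> ball 0 R" using sub[OF q] ball_subset_cball by blast
      then show False using \<open>x \<in> sphere 0 R\<close> by simp
    qed
    then show "x \<in> cball 0 R - (\<Union>q\<in>Q. ball q \<rho>2)" using that by auto
  qed
  have k0: "winds (sphere 0 R) (\<lambda>x. x) k 0" using 1 by (rule winds_cong) (simp_all add: Ksph)
  have nz0: "x \<noteq> 0" if "x \<in> sphere 0 R" for x :: complex using that R by auto
  have fac: "winds (sphere 0 R) (\<lambda>x. x) (\<lambda>x. x - q) 1" if q: "q \<in> Q" for q
  proof -
    have "q \<in> cball q \<rho>2" using \<rho> by simp
    then have "q \<in> ball 0 R" using sub[OF q] by blast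
    then have "norm q < R" by simp
    then have "winds (sphere 0 R) (\<lambda>x. x) (\<lambda>x. 1 - q / x) 0"
      using R nz0 by (intro winds_near_1 continuous_intros) (auto simp: norm_divide)
    from winds_mult[OF winds_self this nz0]
    have "winds (sphere 0 R) (\<lambda>x. x) (\<lambda>x. x * (1 - q / x)) 1" by simp
    then show ?thesis by (rule winds_cong) (use nz0 in \<open>auto simp: field_simps\<close>)
  qed
  have "winds (sphere 0 R) (\<lambda>x. x) (\<lambda>x. \<Prod>q\<in>Q. (x - q) powi (- m q)) (\<Sum>q\<in>Q. 1 * (- m q))"
    using nz0 by (intro winds_prod Q winds_power_int fac) auto
  from winds_mult[OF n this nz0] have 2: "winds (sphere 0 R) (\<lambda>x. x) k (n + (\<Sum>q\<in>Q. 1 * (- m q)))"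
    unfolding k_def .
  have "n + (\<Sum>q\<in>Q. 1 * (- m q)) = 0"
  proof (rule winds_circle_unique[of R 0 k])
    show "k x \<noteq> 0" if "x \<in> sphere 0 R" for x using Ksph[OF that] Knz[of x] that by auto
  qed (use R 2 k0 in simp_all)
  then show ?thesis by (simp add: sum_negf)
qed

section \<open>Forms read in a global plane coordinate\<close>

lemma inj_on_translate_ne: "inj_on H U \<Longrightarrow> x \<in> U \<Longrightarrow> x + v \<in> U \<Longrightarrow> v \<noteq> (0::complex) \<Longrightarrow> H (x + v) \<noteq> H x"
  unfolding inj_on_def by (metis add_cancel_left_right)

text \<open>The difference quotient of an injective holomorphic function has no zeros, the diagonal value
  being the derivative.\<close>

lemma winds_holomorphic_injective:
  assumes T: "T holomorphic_on U" "open U" "inj_on T U" "z \<in> U"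
  obtains r where "r > 0" "ball z r \<subseteq> U" "winds (ball z r - {z}) (\<lambda>\<zeta>. \<zeta> - z) (\<lambda>\<zeta>. T \<zeta> - T z) 1"
proof -
  obtain r where r: "r > 0" "ball z r \<subseteq> U" using T(2,4) open_contains_ball by blast
  define g where "g \<zeta> = (if \<zeta> = z then deriv T z else (T \<zeta> - T z) / (\<zeta> - z))" for \<zeta>
  have "g holomorphic_on U" unfolding g_def by (rule pole_lemma_open[OF T(1,2)])
  then have gc: "continuous_on (ball z r) g" using r(2) by (meson continuous_on_subset holomorphic_on_imp_continuous_on)
  have "deriv T z \<noteq> 0" by (rule holomorphic_injective_imp_regular[OF T])
  then have gnz: "g x \<noteq> 0" if "x \<in> ball z r" for x
    using that r(2) T(3,4) unfolding g_def inj_on_def by auto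
  have "winds (ball z r) (\<lambda>\<zeta>. \<zeta> - z) g 0" using gc gnz by (intro winds_contractible) auto
  then have "winds (ball z r - {z}) (\<lambda>\<zeta>. \<zeta> - z) g 0" by (rule winds_subset) auto
  from winds_mult[OF winds_self this] have "winds (ball z r - {z}) (\<lambda>\<zeta>. \<zeta> - z) (\<lambda>x. (x - z) * g x) 1" by auto
  then have "winds (ball z r - {z}) (\<lambda>\<zeta>. \<zeta> - z) (\<lambda>\<zeta>. T \<zeta> - T z) 1"
    by (rule winds_cong) (auto simp: g_def)
  then show ?thesis using that r by blast
qed

text \<open>For a local homeomorphism \<open>H\<close> of the plane this is the degree, \<open>1\<close> or
  \<open>-1\<close>, at the point \<open>x\<close>.\<close>

definition local_degree :: "(complex \<Rightarrow> complex) \<Rightarrow> complex \<Rightarrow> int \<Rightarrow> bool" where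
  "local_degree H x s \<longleftrightarrow> (\<exists>r>0. winds (ball 0 r - {0}) (\<lambda>v. v) (\<lambda>v. H (x + v) - H x) s)"

lemma winds_punctured_unique:
  assumes "r > 0" "winds (ball 0 r - {0}) (\<lambda>v. v) u m" "r' > 0" "winds (ball 0 r' - {0}) (\<lambda>v. v) u n"
    and nz: "\<And>x. x \<in> ball 0 r - {0} \<Longrightarrow> u x \<noteq> 0"
  shows "m = n"
proof (rule winds_circle_unique[of "min r r' / 2" 0 u])
  show "winds (sphere 0 (min r r' / 2)) (\<lambda>x. x - 0) u m" "winds (sphere 0 (min r r' / 2)) (\<lambda>x. x - 0) u n"
    using assms by (auto elim!: winds_subset)
  show "u x \<noteq> 0" if "x \<in> sphere 0 (min r r' / 2)" for x
    using that assms(1,3) by (intro nz) auto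
qed (use assms in auto)

lemma winds_shift:
  assumes "winds (ball 0 r - {0}) (\<lambda>v. v) (\<lambda>v. H (x + v) - H x) s"
  shows "winds (ball x r - {x}) (\<lambda>y. y - x) (\<lambda>y. H y - H x) s"
proof -
  have "winds (ball x r - {x}) (\<lambda>y. y - x) (\<lambda>y. H (x + (y - x)) - H x) s"
    by (rule winds_compose[OF assms]) (auto simp: dist_norm norm_minus_commute intro!: continuous_intros)
  then show ?thesis by simp
qed

lemma local_degree_mono: 
  assumes "winds (ball 0 r - {0}) (\<lambda>v. v) (\<lambda>v. H (x + v) - H x) s" "r > 0" shows "local_degree H x s"
  using assms unfolding local_degree_def by blast

text \<open>The displacement \<open>H (p + v) - H p\<close> winds equally often in \<open>v\<close> for all
  \<open>p\<close> near \<open>x\<close>; hence the local degree is locally constant.\<close>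

lemma winds_displacement:
  assumes "continuous_on U H" "inj_on H U" "open U" "x \<in> U"
  obtains r s where "r > 0" "ball x (2 * r) \<subseteq> U"
    "winds (ball x r \<times> (ball 0 r - {0})) snd (\<lambda>p. H (fst p + snd p) - H (fst p)) s"
proof -
  obtain r0 where r0: "r0 > 0" "ball x r0 \<subseteq> U" using assms(3,4) open_contains_ball by blast
  define r where "r = r0 / 2"
  have r: "r > 0" "ball x (2 * r) \<subseteq> U" using r0 by (auto simp: r_def)
  have mem: "p \<in> U" "p + v \<in> U" if "p \<in> ball x r" "v \<in> ball 0 r" for p v
  proof -
    have "dist x (p + v) \<le> dist x p + norm v" using norm_triangle_ineq4[of "x - p" v] by (simp add: dist_norm algebra_simps)
    then show "p \<in> U" "p + v \<in> U" using that r by (auto intro!: subsetD[OF r(2)])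
  qed
  have "\<exists>m. winds (ball x r \<times> (ball 0 r - {0})) snd (\<lambda>p. H (fst p + snd p) - H (fst p)) m"
  proof (rule winds_exists_param)
    show "continuous_on (ball x r \<times> (ball 0 r - {0})) (\<lambda>p. H (fst p + snd p) - H (fst p))"
      using mem by (intro continuous_intros continuous_on_compose2[OF assms(1)]) auto
    show "H (fst p + snd p) - H (fst p) \<noteq> 0" if "p \<in> ball x r \<times> (ball 0 r - {0})" for p
      using inj_on_translate_ne[OF assms(2)] mem[of "fst p" "snd p"] that by auto
  qed (use r in auto)
  then show ?thesis using that r by blast
qed

lemma winds_displacement_at:
  assumes "winds (ball x r \<times> (ball 0 r - {0})) snd (\<lambda>p. H (fst p + snd p) - H (fst p)) s" "p \<in> ball x r"
  shows "winds (ball 0 r - {0}) (\<lambda>v. v) (\<lambda>v. H (p + v) - H p) s"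
proof -
  have "winds (ball 0 r - {0}) (\<lambda>v. snd (p, v)) (\<lambda>v. H (fst (p, v) + snd (p, v)) - H (fst (p, v))) s"
    by (rule winds_compose[OF assms(1)]) (use assms(2) in \<open>auto intro!: continuous_intros\<close>)
  then show ?thesis by simp
qed

lemma local_degree_unique:
  assumes "inj_on H U" "open U" "x \<in> U" "local_degree H x s" "local_degree H x s'"
  shows "s = s'"
proof -
  obtain r0 where r0: "r0 > 0" "ball x r0 \<subseteq> U" using assms(2,3) open_contains_ball by blast
  obtain r r' where r: "r > 0" "winds (ball 0 r - {0}) (\<lambda>v. v) (\<lambda>v. H (x + v) - H x) s"
    "r' > 0" "winds (ball 0 r' - {0}) (\<lambda>v. v) (\<lambda>v. H (x + v) - H x) s'"
    using assms(4,5) unfolding local_degree_def by auto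
  show ?thesis
  proof (rule winds_punctured_unique[of "min r r0" _ s r' s'])
    show "winds (ball 0 (min r r0) - {0}) (\<lambda>v. v) (\<lambda>v. H (x + v) - H x) s"
      using r(2) by (rule winds_subset) auto
    show "H (x + v) - H x \<noteq> 0" if "v \<in> ball 0 (min r r0) - {0}" for v
    proof -
      have "x + v \<in> U" using that by (intro subsetD[OF r0(2)]) (auto simp: dist_norm)
      then show ?thesis using inj_on_translate_ne[OF assms(1,3)] that by auto
    qed
  qed (use r r0 in auto)
qed

text \<open>The inverse homeomorphism has some winding number \<open>t\<close>, and the composition, the
  identity, has winding number \<open>s * t\<close>.\<close>

lemma local_degree_nonzero:
  assumes H: "continuous_on U H" "inj_on H U" "open U" "x \<in> U" "local_degree H x s"
  shows "s \<noteq> 0"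
proof -
  obtain r0 where r0: "r0 > 0" "winds (ball 0 r0 - {0}) (\<lambda>v. v) (\<lambda>v. H (x + v) - H x) s"
    using assms(5) unfolding local_degree_def by auto
  have opi: "open (H ` U)" by (rule invariance_of_domain[OF H(1,3,2)])
  obtain K where K: "homeomorphism U (H ` U) H K"
    using invariance_of_domain_homeomorphism[OF H(3,1) _ H(2)] by auto
  have KH: "K (H y) = y" if "y \<in> U" for y using K that by (simp add: homeomorphism_def)
  have Kc: "continuous_on (H ` U) K" using K by (simp add: homeomorphism_def)
  obtain \<rho> where \<rho>: "\<rho> > 0" "ball (H x) \<rho> \<subseteq> H ` U" using opi H(4) open_contains_ball by (metis imageI)
  have "\<exists>t. winds (ball (H x) \<rho> - {H x}) (\<lambda>\<zeta>. \<zeta> - H x) (\<lambda>\<zeta>. K \<zeta> - x) t"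
  proof (rule winds_exists[OF \<rho>(1)])
    show "continuous_on (ball (H x) \<rho> - {H x}) (\<lambda>\<zeta>. K \<zeta> - x)"
      using \<rho>(2) by (intro continuous_intros continuous_on_subset[OF Kc]) auto
    show "K \<zeta> - x \<noteq> 0" if \<zeta>: "\<zeta> \<in> ball (H x) \<rho> - {H x}" for \<zeta>
    proof -
      have "\<zeta> \<in> H ` U" using \<zeta> \<rho>(2) by blast
      then show ?thesis using KH \<zeta> by auto
    qed
  qed blast
  then obtain t where t: "winds (ball (H x) \<rho> - {H x}) (\<lambda>\<zeta>. \<zeta> - H x) (\<lambda>\<zeta>. K \<zeta> - x) t" by blast
  have "open (U \<inter> H -` ball (H x) \<rho>)" using H(1,3) by (intro continuous_open_preimage) auto
  then obtain r1 where r1: "r1 > 0" "ball x r1 \<subseteq> U \<inter> H -` ball (H x) \<rho>"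
    using H(4) \<rho>(1) by (auto elim!: openE[where x = x])
  define r where "r = min r0 r1"
  have r: "r > 0" using r0 r1 by (auto simp: r_def)
  have in1: "x + v \<in> U" "H (x + v) \<in> ball (H x) \<rho>" if "v \<in> ball 0 r" for v
  proof -
    have "x + v \<in> ball x r1" using that by (auto simp: r_def dist_norm)
    then show "x + v \<in> U" "H (x + v) \<in> ball (H x) \<rho>" using r1(2) by auto
  qed
  have ne: "H (x + v) \<noteq> H x" if "v \<in> ball 0 r - {0}" for v
    using inj_on_translate_ne[OF H(2,4)] in1[of v] that by auto
  have "winds (ball 0 r - {0}) (\<lambda>v. H (x + v) - H x) (\<lambda>v. K (H (x + v)) - x) t"
    by (rule winds_compose[OF t]) (use in1 ne in \<open>auto intro!: continuous_intros continuous_on_compose2[OF H(1)]\<close>)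
  then have 1: "winds (ball 0 r - {0}) (\<lambda>v. H (x + v) - H x) (\<lambda>v. v) t"
    by (rule winds_cong) (use in1 KH in auto)
  have 2: "winds (ball 0 r - {0}) (\<lambda>v. v) (\<lambda>v. H (x + v) - H x) s"
    using r0(2) by (rule winds_subset) (auto simp: r_def)
  have 3: "winds (ball 0 r - {0}) (\<lambda>v. v) (\<lambda>v. v) (s * t)" by (rule winds_trans[OF 1 2]) auto
  have "s * t = 1" by (rule winds_punctured_unique[OF r 3 r winds_self]) auto
  then show ?thesis by auto
qed

lemma finite_common_radius:
  assumes "finite Q" "\<And>q. q \<in> Q \<Longrightarrow> \<exists>r>0. P q r" "\<And>q r r'. P q r \<Longrightarrow> 0 < r' \<Longrightarrow> r' \<le> r \<Longrightarrow> P q (r' :: real)"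
  shows "\<exists>r>0. \<forall>q\<in>Q. P q r"
  using assms(1,2)
proof (induction Q rule: finite_induct)
  case empty
  show ?case by (intro exI[of _ 1]) auto
next
  case (insert q Q)
  then obtain r r' where "r > 0" "P q r" "r' > 0" "\<forall>q\<in>Q. P q r'" by (metis insertCI)
  then show ?case using assms(3) by (intro exI[of _ "min r r'"]) auto
qed

text \<open>A form on a sphere, punctured at one point to become a plane. The coordinate \<open>x\<close> of
  the plane is only a homeomorphism: \<open>H i x\<close> is the holomorphic coordinate of the point
  \<open>x\<close> in the chart \<open>i\<close>, defined for \<open>x\<close> in \<open>O'
  i\<close>, the function \<open>\<eta> i\<close> is the coefficient of the form, and \<open>T i
  j\<close> is the change of charts. The chart \<open>c q\<close> measures the winding number
  \<open>n q\<close> at the singular point \<open>q\<close>. The chart \<open>i0\<close> contains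
  the point at infinity; there \<open>K\<close> is the holomorphic coordinate as a function of
  \<open>1 / x\<close>, and \<open>n0\<close> is the winding number of the form.\<close>

locale plane_form =
  fixes Q :: "complex set" and I :: "'i set" and O' :: "'i \<Rightarrow> complex set" and H \<eta> :: "'i \<Rightarrow> complex \<Rightarrow> complex"
    and T :: "'i \<Rightarrow> 'i \<Rightarrow> complex \<Rightarrow> complex" and c :: "complex \<Rightarrow> 'i" and n :: "complex \<Rightarrow> int"
    and i0 :: 'i and R0 :: real and K :: "complex \<Rightarrow> complex" and n0 :: int
  assumes Q: "finite Q"
    and op: "\<And>i. i \<in> I \<Longrightarrow> open (O' i)"
    and Hc: "\<And>i. i \<in> I \<Longrightarrow> continuous_on (O' i) (H i)"
    and Hi: "\<And>i. i \<in> I \<Longrightarrow> inj_on (H i) (O' i)"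
    and cover: "\<And>x. \<exists>i\<in>I. x \<in> O' i"
    and hol: "\<And>i. i \<in> I \<Longrightarrow> \<eta> i holomorphic_on H i ` (O' i - Q)"
    and nz: "\<And>i x. i \<in> I \<Longrightarrow> x \<in> O' i - Q \<Longrightarrow> \<eta> i (H i x) \<noteq> 0"
    and Th: "\<And>i j. i \<in> I \<Longrightarrow> j \<in> I \<Longrightarrow> T i j holomorphic_on H i ` (O' i \<inter> O' j)"
    and TH: "\<And>i j x. i \<in> I \<Longrightarrow> j \<in> I \<Longrightarrow> x \<in> O' i \<inter> O' j \<Longrightarrow> T i j (H i x) = H j x"
    and trans: "\<And>i j x. i \<in> I \<Longrightarrow> j \<in> I \<Longrightarrow> x \<in> O' i \<inter> O' j - Q \<Longrightarrow> \<eta> i (H i x) = \<eta> j (H j x) * deriv (T i j) (H i x)"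
    and cI: "\<And>q. q \<in> Q \<Longrightarrow> c q \<in> I \<and> q \<in> O' (c q)"
    and nq: "\<And>q. q \<in> Q \<Longrightarrow> \<exists>r>0. winds (ball (H (c q) q) r - {H (c q) q}) (\<lambda>\<zeta>. \<zeta> - H (c q) q) (\<eta> (c q)) (n q)"
    and R0: "R0 > 0" and i0: "i0 \<in> I" and inf: "\<And>x. norm x > R0 \<Longrightarrow> x \<in> O' i0 \<and> H i0 x = K (1 / x)"
    and K: "continuous_on (ball 0 (1 / R0)) K" "inj_on K (ball 0 (1 / R0))"
    and n0: "\<exists>r>0. winds (ball (K 0) r - {K 0}) (\<lambda>\<zeta>. \<zeta> - K 0) (\<eta> i0) n0"
begin

lemma local_degree_chart_change:
  assumes ij: "i \<in> I" "j \<in> I" and x: "x \<in> O' i" "x \<in> O' j" and s: "local_degree (H i) x s"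
  shows "local_degree (H j) x s"
proof -
  let ?U = "H i ` (O' i \<inter> O' j)"
  have Ti: "inj_on (T i j) ?U"
    using TH[OF ij] Hi[OF ij(2)] Hi[OF ij(1)] unfolding inj_on_def by auto
  have Uo: "open ?U" using Hc[OF ij(1)] Hi[OF ij(1)] op ij
    by (intro invariance_of_domain) (auto elim: continuous_on_subset inj_on_subset)
  obtain \<rho> where \<rho>: "\<rho> > 0" "ball (H i x) \<rho> \<subseteq> ?U"
     "winds (ball (H i x) \<rho> - {H i x}) (\<lambda>\<zeta>. \<zeta> - H i x) (\<lambda>\<zeta>. T i j \<zeta> - T i j (H i x)) 1"
    using x by (auto intro: winds_holomorphic_injective[OF Th[OF ij] Uo Ti, of "H i x"])
  obtain r0 where r0: "r0 > 0" "winds (ball 0 r0 - {0}) (\<lambda>v. v) (\<lambda>v. H i (x + v) - H i x) s"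
    using s unfolding local_degree_def by auto
  have "open (O' i \<inter> O' j \<inter> H i -` ball (H i x) \<rho>)"
    using op ij Hc[OF ij(1)] by (intro continuous_open_preimage) (auto elim: continuous_on_subset)
  then obtain r1 where r1: "r1 > 0" "ball x r1 \<subseteq> O' i \<inter> O' j \<inter> H i -` ball (H i x) \<rho>"
    using x \<rho>(1) by (auto elim!: openE[where x = x])
  define r where "r = min r0 r1"
  have r: "r > 0" using r0 r1 by (auto simp: r_def)
  have in1: "x + v \<in> O' i" "x + v \<in> O' j" "H i (x + v) \<in> ball (H i x) \<rho>" if "v \<in> ball 0 r" for v
  proof -
    have "x + v \<in> ball x r1" using that by (auto simp: r_def dist_norm)
    then show "x + v \<in> O' i" "x + v \<in> O' j" "H i (x + v) \<in> ball (H i x) \<rho>" using r1(2) by auto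
  qed
  have ne: "H i (x + v) \<noteq> H i x" if "v \<in> ball 0 r - {0}" for v
    using inj_on_translate_ne[OF Hi[OF ij(1)] x(1)] in1[of v] that by auto
  have "winds (ball 0 r - {0}) (\<lambda>v. H i (x + v) - H i x) (\<lambda>v. T i j (H i (x + v)) - T i j (H i x)) 1"
    by (rule winds_compose[OF \<rho>(3)]) (use in1 ne in \<open>auto intro!: continuous_intros continuous_on_compose2[OF Hc[OF ij(1)]]\<close>)
  then have 1: "winds (ball 0 r - {0}) (\<lambda>v. H i (x + v) - H i x) (\<lambda>v. H j (x + v) - H j x) 1"
    by (rule winds_cong) (use in1 TH[OF ij] x in auto)
  have 2: "winds (ball 0 r - {0}) (\<lambda>v. v) (\<lambda>v. H i (x + v) - H i x) s"
    using r0(2) by (rule winds_subset) (auto simp: r_def)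
  have "winds (ball 0 r - {0}) (\<lambda>v. v) (\<lambda>v. H j (x + v) - H j x) (s * 1)" by (rule winds_trans[OF 1 2]) auto
  then show ?thesis using r unfolding local_degree_def by auto
qed

text \<open>All charts have the same local degree, because changes of charts are holomorphic and the plane is
  connected.\<close>

lemma constant_local_degree:
  obtains s where "s \<noteq> 0" "\<And>i x. i \<in> I \<Longrightarrow> x \<in> O' i \<Longrightarrow> local_degree (H i) x s"
proof -
  define g where "g x = (SOME s. \<exists>i\<in>I. x \<in> O' i \<and> local_degree (H i) x s)" for x
  have ex: "\<exists>r>0. \<exists>s. ball x r \<subseteq> O' i \<and> (\<forall>p\<in>ball x r. local_degree (H i) p s)" if "i \<in> I" "x \<in> O' i" for i x
  proof -
    note that' = that
    obtain r s where r: "r > 0" "ball x (2 * r) \<subseteq> O' i"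
      "winds (ball x r \<times> (ball 0 r - {0})) snd (\<lambda>p. H i (fst p + snd p) - H i (fst p)) s"
      by (rule winds_displacement[OF Hc[OF that'(1)] Hi[OF that'(1)] op[OF that'(1)] that'(2)])
    have "ball x r \<subseteq> ball x (2 * r)" using r(1) by (intro subset_ball) simp
    then have "ball x r \<subseteq> O' i" using r(2) by blast
    moreover have "local_degree (H i) p s" if "p \<in> ball x r" for p
      using winds_displacement_at[OF r(3) that] r(1) unfolding local_degree_def by blast
    ultimately show ?thesis using r(1) by blast
  qed
  have g1: "\<exists>i\<in>I. x \<in> O' i \<and> local_degree (H i) x (g x)" for x
  proof -
    obtain i where "i \<in> I" "x \<in> O' i" using cover by blast
    then have "\<exists>s. \<exists>i\<in>I. x \<in> O' i \<and> local_degree (H i) x s" using ex[of i x] centre_in_ball by blast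
    then show ?thesis unfolding g_def by (rule someI_ex)
  qed
  have g: "local_degree (H i) x (g x)" if "i \<in> I" "x \<in> O' i" for i x
    using g1[of x] local_degree_chart_change that by blast
  have "g constant_on UNIV"
  proof (rule locally_constant_imp_constant[OF connected_UNIV])
    fix a :: complex
    obtain i where i: "i \<in> I" "a \<in> O' i" using cover by blast
    then obtain r s where r: "r > 0" "ball a r \<subseteq> O' i" "\<And>p. p \<in> ball a r \<Longrightarrow> local_degree (H i) p s" using ex by blast
    have "g p = s" if "p \<in> ball a r" for p
      using local_degree_unique[OF Hi[OF i(1)] op[OF i(1)]] g[OF i(1), of p] r that by blast
    then show "\<exists>T. openin (top_of_set UNIV) T \<and> a \<in> T \<and> (\<forall>x\<in>T. g x = g a)"
      using r(1) by (intro exI[of _ "ball a r"]) auto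
  qed
  then obtain s where s: "\<And>x. g x = s" unfolding constant_on_def by auto
  obtain i where i: "i \<in> I" "0 \<in> O' i" using cover by blast
  have "s \<noteq> 0" using local_degree_nonzero[OF Hc[OF i(1)] Hi[OF i(1)] op[OF i(1)] i(2)] g[OF i] s by simp
  then show ?thesis using that g s by simp
qed

text \<open>\<open>f\<close> is a primitive of the form near \<open>y\<close>: in the chart \<open>i\<close>
  it is \<open>k\<close>, a primitive of \<open>\<eta> i\<close>. Injectivity of \<open>k\<close> is
  required so that increments of \<open>f\<close> do not vanish.\<close>

definition prim :: "complex \<Rightarrow> real \<Rightarrow> (complex \<Rightarrow> complex) \<Rightarrow> 'i \<Rightarrow> real \<Rightarrow> (complex \<Rightarrow> complex) \<Rightarrow> bool" where
  "prim y \<delta> f i \<rho> k \<longleftrightarrow> \<delta> > 0 \<and> i \<in> I \<and> ball y \<delta> \<subseteq> O' i - Q \<and> H i ` ball y \<delta> \<subseteq> ball (H i y) \<rho> \<and>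
     ball (H i y) \<rho> \<subseteq> H i ` (O' i - Q) \<and> (\<forall>\<zeta>\<in>ball (H i y) \<rho>. (k has_field_derivative \<eta> i \<zeta>) (at \<zeta>)) \<and>
     inj_on k (ball (H i y) \<rho>) \<and> (\<forall>x\<in>ball y \<delta>. f x = k (H i x))"

lemma opimg: "i \<in> I \<Longrightarrow> open (H i ` (O' i - Q))"
  using Hc[of i] Hi[of i] op[of i] Q
  by (intro invariance_of_domain open_Diff finite_imp_closed) (auto elim: continuous_on_subset inj_on_subset)

text \<open>The quarter keeps \<open>\<eta> i\<close> close to a nonzero constant on the disc, so that an
  increment of the primitive is close to the coefficient times the increment of the coordinate.\<close>

lemma prim_exists:
  assumes i: "i \<in> I" and y: "y \<in> O' i - Q"
  shows "\<exists>\<delta> \<rho> k. prim y \<delta> (\<lambda>x. k (H i x)) i \<rho> k \<and> (\<forall>\<zeta>\<in>ball (H i y) \<rho>. norm (\<eta> i \<zeta> - \<eta> i (H i y)) < norm (\<eta> i (H i y)) / 4)"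
proof -
  let ?U = "H i ` (O' i - Q)" and ?z = "H i y"
  have z: "?z \<in> ?U" using y by auto
  obtain \<rho>1 where \<rho>1: "\<rho>1 > 0" "ball ?z \<rho>1 \<subseteq> ?U" using opimg[OF i] z open_contains_ball by blast
  have hb: "\<eta> i holomorphic_on ball ?z \<rho>1" using hol[OF i] \<rho>1(2) holomorphic_on_subset by blast
  obtain k where k: "\<And>\<zeta>. \<zeta> \<in> ball ?z \<rho>1 \<Longrightarrow> (k has_field_derivative \<eta> i \<zeta>) (at \<zeta> within ball ?z \<rho>1)"
    using holomorphic_convex_primitive'[OF convex_ball open_ball hb] by blast
  have k': "(k has_field_derivative \<eta> i \<zeta>) (at \<zeta>)" if "\<zeta> \<in> ball ?z \<rho>1" for \<zeta>
    using k[OF that] at_within_open[OF that open_ball] by simp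
  have kh: "k holomorphic_on ball ?z \<rho>1" using k' holomorphic_on_open[OF open_ball] by blast
  have "deriv k ?z \<noteq> 0" using DERIV_imp_deriv[OF k'[of ?z]] nz[OF i y] \<rho>1(1) by simp
  then obtain \<rho>2 where \<rho>2: "\<rho>2 > 0" "ball ?z \<rho>2 \<subseteq> ball ?z \<rho>1" "inj_on k (ball ?z \<rho>2)"
    using has_complex_derivative_locally_injective[OF kh _ open_ball, of ?z] \<rho>1(1) by auto
  have "isCont (\<eta> i) ?z"
    using hb \<rho>1(1) by (meson centre_in_ball continuous_on_eq_continuous_at holomorphic_on_imp_continuous_on open_ball)
  then obtain \<rho>3 where \<rho>3: "\<rho>3 > 0" "\<And>\<zeta>. dist \<zeta> ?z < \<rho>3 \<Longrightarrow> dist (\<eta> i \<zeta>) (\<eta> i ?z) < norm (\<eta> i ?z) / 4"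
    using nz[OF i y] unfolding continuous_at_eps_delta by (metis divide_pos_pos zero_less_norm_iff zero_less_numeral)
  define \<rho> where "\<rho> = min \<rho>2 \<rho>3"
  have \<rho>: "\<rho> > 0" "ball ?z \<rho> \<subseteq> ball ?z \<rho>1" "inj_on k (ball ?z \<rho>)"
    using \<rho>2 \<rho>3(1) by (auto simp: \<rho>_def intro: inj_on_subset)
  have "open ((O' i - Q) \<inter> H i -` ball ?z \<rho>)"
    using op[OF i] Q Hc[OF i] by (intro continuous_open_preimage open_Diff finite_imp_closed) (auto elim: continuous_on_subset)
  then obtain \<delta> where \<delta>: "\<delta> > 0" "ball y \<delta> \<subseteq> (O' i - Q) \<inter> H i -` ball ?z \<rho>"
    using y \<rho>(1) by (auto elim!: openE[where x = y])
  have "prim y \<delta> (\<lambda>x. k (H i x)) i \<rho> k"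
    unfolding prim_def using \<delta> \<rho> \<rho>1(2) k' i by (auto 0 3)
  moreover have "\<forall>\<zeta>\<in>ball ?z \<rho>. norm (\<eta> i \<zeta> - \<eta> i ?z) < norm (\<eta> i ?z) / 4"
    using \<rho>3(2) unfolding \<rho>_def by (auto simp: dist_norm norm_minus_commute)
  ultimately show ?thesis by blast
qed

lemma primitives_agree_up_to_constant:
  assumes p: "prim y \<delta> f i \<rho> k" and p': "prim y' \<delta>' f' j \<rho>' k'"
    and x: "x \<in> ball y \<delta> \<inter> ball y' \<delta>'" "x' \<in> ball y \<delta> \<inter> ball y' \<delta>'"
  shows "f x - f x' = f' x - f' x'"
proof -
  let ?S = "ball y \<delta> \<inter> ball y' \<delta>'"
  have i: "i \<in> I" and j: "j \<in> I" using p p' unfolding prim_def by auto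
  have "(\<lambda>x. f x - f' x) constant_on ?S"
  proof (rule locally_constant_imp_constant)
    show "connected ?S" by (intro convex_connected convex_Int convex_ball)
    fix a assume a: "a \<in> ?S"
    have aO: "a \<in> O' i \<inter> O' j - Q" using a p p' unfolding prim_def by auto
    let ?z = "H i a"
    define U where "U = H i ` ?S"
    have SO: "?S \<subseteq> O' i \<inter> O' j - Q" using p p' unfolding prim_def by auto
    have Uo: "open U" unfolding U_def using Hc[OF i] Hi[OF i] SO
      by (intro invariance_of_domain open_Int open_ball) (auto elim!: continuous_on_subset inj_on_subset)
    have zU: "?z \<in> U" using a by (auto simp: U_def)
    obtain \<epsilon> where \<epsilon>: "\<epsilon> > 0" "ball ?z \<epsilon> \<subseteq> U" using Uo zU open_contains_ball by blast
    have Uh: "U \<subseteq> H i ` (O' i \<inter> O' j)" using SO by (auto simp: U_def)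
    have oo: "open (H i ` (O' i \<inter> O' j))" using Hc[OF i] Hi[OF i] op i j
      by (intro invariance_of_domain) (auto elim: continuous_on_subset inj_on_subset)
    define D where "D \<zeta> = k \<zeta> - k' (T i j \<zeta>)" for \<zeta>
    have "(D has_field_derivative 0) (at \<zeta>)" if \<zeta>: "\<zeta> \<in> ball ?z \<epsilon>" for \<zeta>
    proof -
      obtain b where b: "b \<in> ?S" "\<zeta> = H i b"
      proof -
        assume b1: "\<And>b. b \<in> ?S \<Longrightarrow> \<zeta> = H i b \<Longrightarrow> thesis"
        have "\<zeta> \<in> H i ` ?S" using \<zeta> \<epsilon>(2) unfolding U_def by (rule subsetD[rotated])
        then show thesis by (elim imageE) (rule b1)
      qed
      have bO: "b \<in> O' i \<inter> O' j - Q" using b SO by auto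
      have "(k has_field_derivative \<eta> i \<zeta>) (at \<zeta>)" using p b unfolding prim_def by (auto simp: image_subset_iff)
      moreover have "(k' has_field_derivative \<eta> j (T i j \<zeta>)) (at (T i j \<zeta>))"
        using p' b TH[OF i j] bO unfolding prim_def by (auto simp: image_subset_iff)
      moreover have "(T i j has_field_derivative deriv (T i j) \<zeta>) (at \<zeta>)"
        using holomorphic_derivI[OF Th[OF i j] oo] b bO by auto
      moreover have "\<eta> i \<zeta> = \<eta> j (T i j \<zeta>) * deriv (T i j) \<zeta>"
        using trans[OF i j bO] TH[OF i j, of b] bO b by auto
      ultimately show ?thesis unfolding D_def
        by (auto intro!: derivative_eq_intros DERIV_chain2[where f = k'])
    qed
    then obtain C where C: "\<And>\<zeta>. \<zeta> \<in> ball ?z \<epsilon> \<Longrightarrow> D \<zeta> = C"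
      using has_field_derivative_0_imp_constant_on[of "ball ?z \<epsilon>" D] unfolding constant_on_def by auto
    have "open (?S \<inter> H i -` ball ?z \<epsilon>)"
      using Hc[OF i] SO by (intro continuous_open_preimage open_Int open_ball) (auto elim!: continuous_on_subset)
    moreover have "f x - f' x = C" if "x \<in> ?S \<inter> H i -` ball ?z \<epsilon>" for x
    proof -
      have "f x = k (H i x)" "f' x = k' (H j x)" using that p p' unfolding prim_def by auto
      moreover have "T i j (H i x) = H j x" using TH[OF i j] that SO by blast
      ultimately show ?thesis using C[of "H i x"] that unfolding D_def by simp
    qed
    ultimately show "\<exists>T. openin (top_of_set ?S) T \<and> a \<in> T \<and> (\<forall>x\<in>T. f x - f' x = f a - f' a)"
      using a \<epsilon>(1) by (intro exI[of _ "?S \<inter> H i -` ball ?z \<epsilon>"]) (auto intro!: open_subset)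
  qed
  then have "f x - f' x = f x' - f' x'" using x unfolding constant_on_def by metis
  then show ?thesis by (simp add: algebra_simps)
qed

text \<open>Compactness of \<open>Z\<close> gives one bound \<open>\<epsilon>\<close> for translations; the
  primitive \<open>f\<close> may come from any chart, as all primitives have the same increments.\<close>

lemma prim_increment:
  assumes i: "i \<in> I" and Z: "compact Z" "Z \<subseteq> O' i - Q"
  obtains \<epsilon> where "\<epsilon> > 0" "\<And>x e y \<delta> f j \<rho> k. x \<in> Z \<Longrightarrow> norm e < \<epsilon> \<Longrightarrow> e \<noteq> 0 \<Longrightarrow> prim y \<delta> f j \<rho> k \<Longrightarrow> x \<in> ball y \<delta> \<Longrightarrow> x + e \<in> ball y \<delta> \<Longrightarrow>
     x + e \<in> O' i \<and> norm ((f (x + e) - f x) / (\<eta> i (H i x) * (H i (x + e) - H i x)) - 1) < 1"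
proof -
  have "\<forall>z\<in>Z. \<exists>\<delta> \<rho> k. prim z \<delta> (\<lambda>x. k (H i x)) i \<rho> k \<and> (\<forall>\<zeta>\<in>ball (H i z) \<rho>. norm (\<eta> i \<zeta> - \<eta> i (H i z)) < norm (\<eta> i (H i z)) / 4)"
    using prim_exists[OF i] Z(2) by blast
  then obtain \<delta> \<rho> k where p: "\<And>z. z \<in> Z \<Longrightarrow> prim z (\<delta> z) (\<lambda>x. k z (H i x)) i (\<rho> z) (k z)"
    and b: "\<And>z \<zeta>. z \<in> Z \<Longrightarrow> \<zeta> \<in> ball (H i z) (\<rho> z) \<Longrightarrow> norm (\<eta> i \<zeta> - \<eta> i (H i z)) < norm (\<eta> i (H i z)) / 4"
    by metis
  have "z \<in> ball z (\<delta> z)" if "z \<in> Z" for z using p[OF that] unfolding prim_def by simp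
  then have cov: "Z \<subseteq> \<Union>((\<lambda>z. ball z (\<delta> z)) ` Z)" by blast
  obtain \<epsilon> where \<epsilon>: "\<epsilon> > 0" "\<And>x. x \<in> Z \<Longrightarrow> \<exists>G\<in>(\<lambda>z. ball z (\<delta> z)) ` Z. ball x \<epsilon> \<subseteq> G"
    using Heine_Borel_lemma[OF Z(1) cov] by (metis (no_types, lifting) imageE open_ball)
  show ?thesis
  proof (rule that[OF \<epsilon>(1)])
    fix x e y \<delta>' f j \<rho>' k'
    assume a: "x \<in> Z" "norm e < \<epsilon>" "e \<noteq> 0" "prim y \<delta>' f j \<rho>' k'" "x \<in> ball y \<delta>'" "x + e \<in> ball y \<delta>'"
    obtain z where z: "z \<in> Z" "ball x \<epsilon> \<subseteq> ball z (\<delta> z)" using \<epsilon>(2)[OF a(1)] by blast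
    have xz: "x \<in> ball z (\<delta> z)" "x + e \<in> ball z (\<delta> z)" using z(2) a(2) \<epsilon>(1) by (auto simp: subset_iff dist_norm)
    let ?B = "ball (H i z) (\<rho> z)"
    have HB: "H i x \<in> ?B" "H i (x + e) \<in> ?B" and O: "x \<in> O' i - Q" "x + e \<in> O' i - Q"
      using p[OF z(1)] xz unfolding prim_def by blast+
    have "f (x + e) - f x = k z (H i (x + e)) - k z (H i x)"
      by (rule primitives_agree_up_to_constant[OF a(4) p[OF z(1)] IntI[OF a(6) xz(2)] IntI[OF a(5) xz(1)]])
    define \<zeta> \<zeta>' where "\<zeta> = H i x" and "\<zeta>' = H i (x + e)"
    have ne: "\<zeta>' \<noteq> \<zeta>" using inj_onD[OF Hi[OF i], of "x + e" x] O a(3) unfolding \<zeta>_def \<zeta>'_def by auto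
    define N where "N = norm (\<eta> i (H i z))"
    have "norm ((k z \<zeta>' - \<eta> i \<zeta> * \<zeta>') - (k z \<zeta> - \<eta> i \<zeta> * \<zeta>)) \<le> N / 2 * norm (\<zeta>' - \<zeta>)"
    proof (rule field_differentiable_bound[OF convex_ball[of "H i z" "\<rho> z"]])
      fix w assume w: "w \<in> ?B"
      have "(k z has_field_derivative \<eta> i w) (at w)" using p[OF z(1)] w unfolding prim_def by auto
      then show "((\<lambda>w. k z w - \<eta> i \<zeta> * w) has_field_derivative (\<eta> i w - \<eta> i \<zeta>)) (at w within ?B)"
        by (auto intro!: derivative_eq_intros intro: has_field_derivative_at_within)
      show "norm (\<eta> i w - \<eta> i \<zeta>) \<le> N / 2"
        using b[OF z(1) w] b[OF z(1) HB(1)] norm_triangle_ineq4[of "\<eta> i w - \<eta> i (H i z)" "\<eta> i \<zeta> - \<eta> i (H i z)"]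
        unfolding N_def \<zeta>_def by simp
    qed (use HB in \<open>auto simp: \<zeta>_def \<zeta>'_def\<close>)
    also have "N / 2 \<le> 2/3 * norm (\<eta> i \<zeta>)"
      using b[OF z(1) HB(1)] norm_triangle_ineq3[of "\<eta> i (H i z)" "\<eta> i \<zeta>"] unfolding N_def \<zeta>_def by (simp add: norm_minus_commute)
    finally have "norm ((k z \<zeta>' - k z \<zeta>) - \<eta> i \<zeta> * (\<zeta>' - \<zeta>)) \<le> 2/3 * (norm (\<eta> i \<zeta>) * norm (\<zeta>' - \<zeta>))"
      by (simp add: algebra_simps mult_right_mono)
    moreover have nzz: "\<eta> i \<zeta> * (\<zeta>' - \<zeta>) \<noteq> 0" using ne nz[OF i O(1)] unfolding \<zeta>_def by simp
    moreover have "(k z \<zeta>' - k z \<zeta>) / (\<eta> i \<zeta> * (\<zeta>' - \<zeta>)) - 1 = ((k z \<zeta>' - k z \<zeta>) - \<eta> i \<zeta> * (\<zeta>' - \<zeta>)) / (\<eta> i \<zeta> * (\<zeta>' - \<zeta>))"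
      using nzz by (simp add: diff_divide_distrib)
    ultimately have "norm ((k z \<zeta>' - k z \<zeta>) / (\<eta> i \<zeta> * (\<zeta>' - \<zeta>)) - 1) \<le> 2/3"
      using nzz by (simp add: norm_divide norm_mult divide_le_eq)
    then show "x + e \<in> O' i \<and> norm ((f (x + e) - f x) / (\<eta> i (H i x) * (H i (x + e) - H i x)) - 1) < 1"
      using O \<open>f (x + e) - f x = _\<close> unfolding \<zeta>_def \<zeta>'_def by auto
  qed
qed

lemma winds_increment:
  assumes i: "i \<in> I" and A: "A \<subseteq> O' i - Q" and D: "continuous_on A D" and e: "e \<noteq> 0"
    and near: "\<And>x. x \<in> A \<Longrightarrow> x + e \<in> O' i \<and> norm (D x / (\<eta> i (H i x) * (H i (x + e) - H i x)) - 1) < 1"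
    and \<phi>: "\<And>x. x \<in> A \<Longrightarrow> \<phi> x \<noteq> 0"
    and w: "winds A \<phi> (\<lambda>x. \<eta> i (H i x)) a" "winds A \<phi> (\<lambda>x. H i (x + e) - H i x) b"
  shows "winds A \<phi> D (a + b)"
proof -
  have Hne: "H i (x + e) - H i x \<noteq> 0" if "x \<in> A" for x
    using inj_on_translate_ne[OF Hi[OF i], of x e] A near[OF that] that e by auto
  have den: "\<eta> i (H i x) * (H i (x + e) - H i x) \<noteq> 0" if "x \<in> A" for x
    using Hne[OF that] nz[OF i, of x] A that by auto
  have HA: "continuous_on A (H i)" using Hc[OF i] A by (auto elim: continuous_on_subset)
  have HAe: "continuous_on A (\<lambda>x. H i (x + e))"
    using near by (intro continuous_on_compose2[OF Hc[OF i]] continuous_intros) auto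
  have "continuous_on A (\<lambda>x. \<eta> i (H i x))"
    using A by (intro continuous_on_compose2[OF holomorphic_on_imp_continuous_on[OF hol[OF i]] HA]) auto
  then have "continuous_on A (\<lambda>x. D x / (\<eta> i (H i x) * (H i (x + e) - H i x)))"
    using D HA HAe den by (intro continuous_intros) auto
  then have "winds A \<phi> (\<lambda>x. D x / (\<eta> i (H i x) * (H i (x + e) - H i x))) 0"
    using near by (intro winds_near_1) auto
  from winds_mult[OF winds_mult[OF w \<phi>] this \<phi>]
  have "winds A \<phi> (\<lambda>x. \<eta> i (H i x) * (H i (x + e) - H i x) * (D x / (\<eta> i (H i x) * (H i (x + e) - H i x)))) (a + b)"
    by simp
  then show ?thesis by (rule winds_cong) (use den in auto)
qed

text \<open>For a small translation \<open>e\<close>, let \<open>D x\<close> be the integral of the form from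
  \<open>x\<close> to \<open>x + e\<close>. Away from \<open>Q\<close> this is a nonvanishing
  function of the plane coordinate, and in a chart it is close to \<open>\<eta> (H x) * (H (x + e) -
  H x)\<close>. Around a point \<open>q\<close> of \<open>Q\<close> the second factor does not wind,
  and \<open>D\<close> winds \<open>s * n q\<close> times, where \<open>s\<close> is the local
  degree. Around infinity the first factor winds \<open>- s * n0\<close> times and the second
  \<open>- 2 * s\<close> times, because \<open>1 / (x + e) - 1 / x\<close> is about \<open>- e /
  x\<^sup>2\<close>. Additivity of winding numbers in a large disc gives the claim after division by
  \<open>s\<close>.\<close>

theorem sum_windings: "(\<Sum>q\<in>Q. n q) + n0 = -2"
proof -
  obtain s where s: "s \<noteq> 0" "\<And>i x. i \<in> I \<Longrightarrow> x \<in> O' i \<Longrightarrow> local_degree (H i) x s" using constant_local_degree by blast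
  define good where "good q r \<longleftrightarrow> ball q r \<subseteq> O' (c q) \<and> 
      winds (ball q r - {q}) (\<lambda>x. x - q) (\<lambda>x. H (c q) x - H (c q) q) s \<and>
      winds (ball q r - {q}) (\<lambda>x. H (c q) x - H (c q) q) (\<lambda>x. \<eta> (c q) (H (c q) x)) (n q) \<and>
      (\<forall>q'\<in>Q. q' \<noteq> q \<longrightarrow> r \<le> dist q q')" for q and r :: real
  have "\<exists>r>0. \<forall>q\<in>Q. good q r"
  proof (rule finite_common_radius[OF Q])
    show "good q r'" if "good q r" "0 < r'" "r' \<le> r" for q r r'
    proof -
      have "ball q r' \<subseteq> ball q r" using that by auto
      then show ?thesis using that unfolding good_def by (auto elim!: winds_subset)
    qed
    fix q assume q: "q \<in> Q"
    let ?i = "c q"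
    have i: "?i \<in> I" "q \<in> O' ?i" using cI[OF q] by auto
    obtain r1 where r1: "r1 > 0" "winds (ball 0 r1 - {0}) (\<lambda>v. v) (\<lambda>v. H ?i (q + v) - H ?i q) s"
      using s(2)[OF i] unfolding local_degree_def by auto
    obtain r2 where r2: "r2 > 0" "winds (ball (H ?i q) r2 - {H ?i q}) (\<lambda>\<zeta>. \<zeta> - H ?i q) (\<eta> ?i) (n q)"
      using nq[OF q] by auto
    have "open (O' ?i \<inter> H ?i -` ball (H ?i q) r2)" using op Hc i by (intro continuous_open_preimage) auto
    then obtain r3 where r3: "r3 > 0" "ball q r3 \<subseteq> O' ?i \<inter> H ?i -` ball (H ?i q) r2"
      using i r2(1) by (auto elim!: openE[where x = q])
    obtain r4 where r4: "r4 > 0" "\<forall>q'\<in>Q. q' \<noteq> q \<longrightarrow> r4 \<le> dist q q'" using finite_set_avoid[OF Q] by blast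
    define r where "r = min r1 (min r3 r4)"
    have r: "ball q r \<subseteq> ball q r1" "ball q r \<subseteq> ball q r3" "r > 0" using r1 r3 r4 by (auto simp: r_def)
    have b: "x \<in> O' ?i" "H ?i x \<in> ball (H ?i q) r2" if "x \<in> ball q r" for x
      using that r(2) r3(2) by blast+
    have "winds (ball q r - {q}) (\<lambda>x. H ?i x - H ?i q) (\<lambda>x. \<eta> ?i (H ?i x)) (n q)"
    proof (rule winds_compose[OF r2(2)])
      show "continuous_on (ball q r - {q}) (H ?i)" using b(1) by (intro continuous_on_subset[OF Hc[OF i(1)]]) auto
      show "H ?i ` (ball q r - {q}) \<subseteq> ball (H ?i q) r2 - {H ?i q}"
        using b inj_onD[OF Hi[OF i(1)]] i(2) by fastforce
    qed
    moreover have "winds (ball q r - {q}) (\<lambda>x. x - q) (\<lambda>x. H ?i x - H ?i q) s"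
      using winds_shift[OF r1(2)] by (rule winds_subset) (use r in auto)
    moreover have "r \<le> r4" by (simp add: r_def)
    ultimately have "good q r" using b(1) r4(2) unfolding good_def by (auto intro: order_trans)
    then show "\<exists>r>0. good q r" using r(3) by blast
  qed
  then obtain r where r: "r > 0" "\<And>q. q \<in> Q \<Longrightarrow> good q r" by blast
  define \<rho>2 where "\<rho>2 = r / 3"
  define \<rho>1 where "\<rho>1 = r / 6"
  have \<rho>: "0 < \<rho>1" "\<rho>1 < \<rho>2" "\<rho>2 < r" using r(1) by (auto simp: \<rho>1_def \<rho>2_def)
  \<comment> \<open>A circle of radius \<open>R\<close> so large that on it \<open>1 / x\<close> lies in the small discs in which \<open>K\<close> and \<open>\<eta> i0\<close> are controlled.\<close>
  have zm: "(0::complex) \<in> ball 0 (1 / R0)" using R0 by simp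
  obtain r' s' where r': "r' > 0" "ball (0::complex) (2 * r') \<subseteq> ball 0 (1 / R0)"
    "winds (ball 0 r' \<times> (ball 0 r' - {0})) snd (\<lambda>p. K (fst p + snd p) - K (fst p)) s'"
    by (rule winds_displacement[OF K open_ball zm]) (rule that)
  obtain r0 where r0: "r0 > 0" "winds (ball (K 0) r0 - {K 0}) (\<lambda>\<zeta>. \<zeta> - K 0) (\<eta> i0) n0" using n0 by auto
  have "open (ball 0 (1 / R0) \<inter> K -` ball (K 0) r0)" using K by (intro continuous_open_preimage) auto
  then obtain r1 where r1: "r1 > 0" "ball 0 r1 \<subseteq> ball 0 (1 / R0) \<inter> K -` ball (K 0) r0"
    using R0 r0(1) by (auto elim!: openE[where x = 0])
  obtain B where B: "\<And>q. q \<in> Q \<Longrightarrow> norm q \<le> B" using finite_imp_bounded[OF Q] unfolding bounded_iff by blast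
  define R where "R = max (max (R0 + 1) 2) (max (B + r) (max (1 / r') (1 / r1))) + 1"
  have R: "R > R0 + 1" "R > 2" "R > B + r" "R > 1 / r'" "R > 1 / r1" by (auto simp: R_def)
  have Rr: "1 / R < r'" "1 / R < r1" using R r' r1 by (auto simp: field_simps)
  have far: "1 / x \<in> ball 0 r'" "1 / x \<in> ball 0 r1" "norm x > R0" "x \<noteq> 0" if "norm x = R" for x :: complex
    using that R Rr by (auto simp: norm_divide)
  have far': "norm (x + v) > R0" "1 / (x + v) - 1 / x \<in> ball 0 r'" "x + v \<noteq> 0"
      "1 / (x + v) - 1 / x = v * (- 1 / (x * (x + v)))" if "norm x = R" "norm v < 1" for x v :: complex
  proof -
    have n: "norm (x + v) > R - 1" using norm_triangle_ineq2[of x "- v"] that by simp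
    then show "norm (x + v) > R0" "x + v \<noteq> 0" using R by auto
    then show eq: "1 / (x + v) - 1 / x = v * (- 1 / (x * (x + v)))" using far(4)[OF that(1)] by (simp add: field_simps)
    have "norm v / norm (x + v) \<le> 1" using n that R by (simp add: divide_le_eq)
    then have "1 / R * (norm v / norm (x + v)) \<le> 1 / R * 1" using R by (intro mult_left_mono) auto
    moreover have "norm (1 / (x + v) - 1 / x) = 1 / R * (norm v / norm (x + v))"
      unfolding eq using that(1) by (simp add: norm_divide norm_mult)
    ultimately have "norm (1 / (x + v) - 1 / x) \<le> 1 / R" by linarith
    then show "1 / (x + v) - 1 / x \<in> ball 0 r'" using Rr by simp
  qed
  have farne: "1 / (x + v) - 1 / x \<noteq> 0" if "norm x = R" "norm v < 1" "v \<noteq> 0" for x v :: complex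
    unfolding far'(4)[OF that(1,2)] using far'(3)[OF that(1,2)] far(4)[OF that(1)] that(3) by simp
  have HK: "H i0 (x + v) = K (1 / x + (1 / (x + v) - 1 / x))" "H i0 x = K (1 / x)" if "norm x = R" "norm v < 1" for x v
    using inf far'(1)[OF that] far(3)[OF that(1)] by auto
  \<comment> \<open>\<open>K\<close> has the same local degree as the other charts, because \<open>v \<mapsto> 1 / (x + v) - 1 / x\<close> winds once.\<close>
  have ss: "s' = s"
  proof -
    define x where "x = complex_of_real R"
    have x: "norm x = R" using R by (simp add: x_def)
    have "winds (ball 0 1 - {0}) (\<lambda>v. snd (1 / x, 1 / (x + v) - 1 / x)) 
        (\<lambda>v. K (fst (1 / x, 1 / (x + v) - 1 / x) + snd (1 / x, 1 / (x + v) - 1 / x)) - K (fst (1 / x, 1 / (x + v) - 1 / x))) s'"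
    proof (rule winds_compose[OF r'(3)])
      show "continuous_on (ball 0 1 - {0}) (\<lambda>v. (1 / x, 1 / (x + v) - 1 / x))"
        using far'(3)[OF x] by (intro continuous_intros) auto
      show "(\<lambda>v. (1 / x, 1 / (x + v) - 1 / x)) ` (ball 0 1 - {0}) \<subseteq> ball 0 r' \<times> (ball 0 r' - {0})"
      proof (rule image_subsetI)
        fix v :: complex assume "v \<in> ball 0 1 - {0}"
        then have v: "norm v < 1" "v \<noteq> 0" by auto
        show "(1 / x, 1 / (x + v) - 1 / x) \<in> ball 0 r' \<times> (ball 0 r' - {0})"
          using far(1)[OF x] far'(2)[OF x v(1)] farne[OF x v] by blast
      qed
    qed
    then have 1: "winds (ball 0 1 - {0}) (\<lambda>v. 1 / (x + v) - 1 / x) (\<lambda>v. H i0 (x + v) - H i0 x) s'"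
      by (rule winds_cong) (use HK[OF x] in auto)
    have "winds (ball 0 1) (\<lambda>v. v) (\<lambda>v. - 1 / (x * (x + v))) 0"
      using far(4)[OF x] far'(3)[OF x] by (intro winds_contractible continuous_intros) auto
    then have "winds (ball 0 1 - {0}) (\<lambda>v. v) (\<lambda>v. - 1 / (x * (x + v))) 0" by (rule winds_subset) auto
    from winds_mult[OF winds_self this]
    have "winds (ball 0 1 - {0}) (\<lambda>v. v) (\<lambda>v. v * (- 1 / (x * (x + v)))) 1" by auto
    then have 2: "winds (ball 0 1 - {0}) (\<lambda>v. v) (\<lambda>v. 1 / (x + v) - 1 / x) 1"
      by (rule winds_cong) (use far'(4)[OF x] in auto)
    have "winds (ball 0 1 - {0}) (\<lambda>v. v) (\<lambda>v. H i0 (x + v) - H i0 x) (1 * s')" by (rule winds_trans[OF 1 2]) auto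
    then have "local_degree (H i0) x s'" by (intro local_degree_mono[of 1]) auto
    then show ?thesis using local_degree_unique[OF Hi[OF i0] op[OF i0]] s(2)[OF i0] inf far(3)[OF x] by blast
  qed
  \<comment> \<open>On the compact set \<open>Z\<close>, a disc with small discs around \<open>Q\<close> removed, one translation \<open>e\<close> works everywhere.\<close>
  define Z where "Z = cball 0 R - (\<Union>q\<in>Q. ball q \<rho>1)"
  have Zc: "compact Z" unfolding Z_def by (intro compact_diff) auto
  have ZQ: "x \<notin> Q" if "x \<in> Z" for x using that \<rho> unfolding Z_def by auto
  define \<C> where "\<C> = {G. \<exists>y \<delta> f i \<rho> k. G = ball y \<delta> \<and> prim y \<delta> f i \<rho> k}"
  have "Z \<subseteq> \<Union>\<C>"
  proof
    fix x assume x: "x \<in> Z"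
    obtain i where "i \<in> I" "x \<in> O' i" using cover by blast
    then obtain \<delta> f \<rho> k where p: "prim x \<delta> f i \<rho> k" using prim_exists[of i x] ZQ[OF x] by blast
    then have "ball x \<delta> \<in> \<C>" unfolding \<C>_def by blast
    moreover have "x \<in> ball x \<delta>" using p by (simp add: prim_def)
    ultimately show "x \<in> \<Union>\<C>" by blast
  qed
  moreover have "open G" if "G \<in> \<C>" for G using that unfolding \<C>_def by auto
  ultimately obtain \<epsilon>1 where \<epsilon>1: "\<epsilon>1 > 0" "\<And>x. x \<in> Z \<Longrightarrow> \<exists>G\<in>\<C>. ball x \<epsilon>1 \<subseteq> G"
    using Heine_Borel_lemma[OF Zc, of \<C>] by metis
  define near where "near i A \<epsilon> \<longleftrightarrow> (\<forall>x e y \<delta> f j \<rho> k. x \<in> A \<longrightarrow> norm e < \<epsilon> \<longrightarrow> e \<noteq> 0 \<longrightarrow> prim y \<delta> f j \<rho> k \<longrightarrow> x \<in> ball y \<delta> \<longrightarrow> x + e \<in> ball y \<delta> \<longrightarrow>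
     x + e \<in> O' i \<and> norm ((f (x + e) - f x) / (\<eta> i (H i x) * (H i (x + e) - H i x)) - 1) < 1)" for i A \<epsilon>
  have near_ex: "\<exists>\<epsilon>>0. near i A \<epsilon>" if "i \<in> I" "compact A" "A \<subseteq> O' i - Q" for i A
    using prim_increment[OF that] unfolding near_def by metis
  define ann where "ann q = cball q \<rho>2 - ball q \<rho>1" for q :: complex
  have annb: "ann q \<subseteq> ball q r - {q}" for q using \<rho> unfolding ann_def by auto
  have annQ: "ann q \<inter> Q = {}" if "q \<in> Q" for q
  proof -
    have "q' \<notin> ann q" if "q' \<in> Q" for q'
      using r(2)[OF \<open>q \<in> Q\<close>] that \<rho> unfolding good_def ann_def by (cases "q' = q") force+
    then show ?thesis by blast
  qed
  have annO: "ann q \<subseteq> O' (c q) - Q" if "q \<in> Q" for q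
    using r(2)[OF that] annb[of q] annQ[OF that] unfolding good_def by blast
  have "\<exists>\<epsilon>>0. \<forall>q\<in>Q. near (c q) (ann q) \<epsilon>"
  proof (rule finite_common_radius[OF Q])
    fix q assume q: "q \<in> Q"
    show "\<exists>\<epsilon>>0. near (c q) (ann q) \<epsilon>"
      using cI[OF q] annO[OF q] by (intro near_ex) (auto simp: ann_def intro!: compact_diff)
  next
    show "near (c q) (ann q) r'" if "near (c q) (ann q) r" "0 < r'" "r' \<le> r" for q r r'
      using that unfolding near_def by (meson less_le_trans)
  qed
  then obtain \<epsilon>2 where \<epsilon>2: "\<epsilon>2 > 0" "\<And>q. q \<in> Q \<Longrightarrow> near (c q) (ann q) \<epsilon>2" by blast
  have sphO: "sphere 0 R \<subseteq> O' i0 - Q" using inf far(3) B R(3) r(1) by fastforce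
  obtain \<epsilon>3 where \<epsilon>3: "\<epsilon>3 > 0" "near i0 (sphere 0 R) \<epsilon>3" using near_ex[OF i0 compact_sphere sphO] by blast
  define \<epsilon> where "\<epsilon> = min (min \<epsilon>1 \<epsilon>2) (min \<epsilon>3 (min 1 \<rho>2)) / 2"
  have \<epsilon>: "0 < \<epsilon>" "\<epsilon> < \<epsilon>1" "\<epsilon> < \<epsilon>2" "\<epsilon> < \<epsilon>3" "\<epsilon> < 1" "\<epsilon> < \<rho>2" using \<epsilon>1(1) \<epsilon>2(1) \<epsilon>3(1) \<rho> by (auto simp: \<epsilon>_def)
  define e where "e = complex_of_real \<epsilon>"
  have e: "norm e = \<epsilon>" "e \<noteq> 0" using \<epsilon> by (auto simp: e_def)
  \<comment> \<open>The increment does not depend on the primitive, so an arbitrary choice is continuous.\<close>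
  define D where "D x = (let f = (SOME f. \<exists>y \<delta> i \<rho> k. prim y \<delta> f i \<rho> k \<and> x \<in> ball y \<delta> \<and> x + e \<in> ball y \<delta>) in f (x + e) - f x)" for x
  have D: "D x = f (x + e) - f x" if p: "prim y \<delta> f i \<rho> k" "x \<in> ball y \<delta>" "x + e \<in> ball y \<delta>" for x y \<delta> f i \<rho> k
  proof -
    define f' where "f' = (SOME f. \<exists>y \<delta> i \<rho> k. prim y \<delta> f i \<rho> k \<and> x \<in> ball y \<delta> \<and> x + e \<in> ball y \<delta>)"
    have "\<exists>y \<delta> i \<rho> k. prim y \<delta> f' i \<rho> k \<and> x \<in> ball y \<delta> \<and> x + e \<in> ball y \<delta>"
      unfolding f'_def by (rule someI[of _ f]) (use p in blast)
    then obtain y' \<delta>' i' \<rho>' k' where p': "prim y' \<delta>' f' i' \<rho>' k'" "x \<in> ball y' \<delta>'" "x + e \<in> ball y' \<delta>'" by blast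
    have "D x = f' (x + e) - f' x" unfolding D_def f'_def by (simp add: Let_def)
    also have "\<dots> = f (x + e) - f x"
      by (rule primitives_agree_up_to_constant[OF p'(1) p(1) IntI[OF p'(3) p(3)] IntI[OF p'(2) p(2)]])
    finally show ?thesis .
  qed
  have Zprim: "\<exists>y \<delta> f i \<rho> k. prim y \<delta> f i \<rho> k \<and> x \<in> ball y \<delta> \<and> x + e \<in> ball y \<delta>" if x: "x \<in> Z" for x
  proof -
    obtain y \<delta> f i \<rho> k where p: "prim y \<delta> f i \<rho> k" "ball x \<epsilon>1 \<subseteq> ball y \<delta>" using \<epsilon>1(2)[OF x] unfolding \<C>_def by blast
    have "x \<in> ball x \<epsilon>1" "x + e \<in> ball x \<epsilon>1" using \<epsilon> e \<epsilon>1 by (auto simp: dist_norm)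
    then show ?thesis using p by blast
  qed
  have Dc: "continuous_on Z D"
  proof (rule continuous_at_imp_continuous_on, rule ballI)
    fix x assume x: "x \<in> Z"
    obtain y \<delta> f i \<rho> k where p: "prim y \<delta> f i \<rho> k" "x \<in> ball y \<delta>" "x + e \<in> ball y \<delta>" using Zprim[OF x] by blast
    define S where "S = ball y \<delta> \<inter> (\<lambda>x. x + e) -` ball y \<delta>"
    have So: "open S" unfolding S_def by (intro open_Int open_ball open_vimage continuous_intros)
    have "i \<in> I" and b: "ball y \<delta> \<subseteq> O' i" "H i ` ball y \<delta> \<subseteq> ball (H i y) \<rho>" using p(1) unfolding prim_def by auto
    have kh: "continuous_on (ball (H i y) \<rho>) k"
      using p(1) unfolding prim_def by (meson DERIV_isCont continuous_at_imp_continuous_on)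
    have "continuous_on (ball y \<delta>) (\<lambda>x. k (H i x))"
      using b Hc[OF \<open>i \<in> I\<close>] by (intro continuous_on_compose2[OF kh]) (auto elim: continuous_on_subset)
    then have fc: "continuous_on (ball y \<delta>) f" by (rule continuous_on_eq) (use p(1) in \<open>auto simp: prim_def\<close>)
    have "continuous_on S (\<lambda>x. f (x + e) - f x)"
      unfolding S_def by (intro continuous_intros continuous_on_compose2[OF fc]) auto
    then have "continuous_on S D" by (rule continuous_on_eq) (use D[OF p(1)] in \<open>auto simp: S_def\<close>)
    then show "isCont D x" using So p by (auto simp: continuous_on_eq_continuous_at S_def)
  qed
  have Dnz: "D x \<noteq> 0" if x: "x \<in> Z" for x
  proof -
    obtain y \<delta> f i \<rho> k where p: "prim y \<delta> f i \<rho> k" "x \<in> ball y \<delta>" "x + e \<in> ball y \<delta>" using Zprim[OF x] by blast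
    have i: "i \<in> I" using p(1) unfolding prim_def by auto
    have O: "x \<in> O' i" "x + e \<in> O' i" and HB: "H i x \<in> ball (H i y) \<rho>" "H i (x + e) \<in> ball (H i y) \<rho>"
      and k: "inj_on k (ball (H i y) \<rho>)" and f: "f x = k (H i x)" "f (x + e) = k (H i (x + e))"
      using p unfolding prim_def by blast+
    have "H i (x + e) \<noteq> H i x" using inj_on_translate_ne[OF Hi[OF i] O e(2)] .
    then have "k (H i (x + e)) \<noteq> k (H i x)" using inj_onD[OF k] HB by blast
    then show ?thesis using D[OF p] f by simp
  qed
  have Dnear: "x + e \<in> O' i \<and> norm (D x / (\<eta> i (H i x) * (H i (x + e) - H i x)) - 1) < 1"
    if nr: "near i A \<epsilon>'" "\<epsilon> < \<epsilon>'" "x \<in> A" "x \<in> Z" for i A \<epsilon>' x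
  proof -
    obtain y \<delta> f i' \<rho> k where p: "prim y \<delta> f i' \<rho> k" "x \<in> ball y \<delta>" "x + e \<in> ball y \<delta>" using Zprim[OF nr(4)] by blast
    show ?thesis using nr(1)[unfolded near_def, rule_format, OF nr(3) _ e(2) p] e(1) nr(2) D[OF p] by simp
  qed
  have annZ: "ann q \<subseteq> Z" if q: "q \<in> Q" for q
  proof
    fix x assume x: "x \<in> ann q"
    have "norm x \<le> norm q + dist q x" using norm_triangle_ineq[of q "x - q"] by (simp add: dist_norm norm_minus_commute)
    also have "\<dots> \<le> R" using B[OF q] x R(3) \<rho> unfolding ann_def by auto
    finally have "x \<in> cball 0 R" by simp
    moreover have "x \<notin> ball q' \<rho>1" if q': "q' \<in> Q" for q'
    proof (cases "q' = q")
      case True then show ?thesis using x by (simp add: ann_def)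
    next
      case False
      then have "r \<le> dist q q'" using r(2)[OF q] q' unfolding good_def by auto
      also have "\<dots> \<le> dist q x + dist q' x" by (metis dist_commute dist_triangle)
      finally show ?thesis using x unfolding ann_def \<rho>1_def \<rho>2_def using r(1) by auto
    qed
    ultimately show "x \<in> Z" unfolding Z_def by auto
  qed
  have w1: "winds (ann q) (\<lambda>x. x - q) D (s * n q)" if q: "q \<in> Q" for q
  proof -
    have g: "good q r" using r(2)[OF q] .
    have i: "c q \<in> I" using cI[OF q] by auto
    have nzq: "x - q \<noteq> 0" if "x \<in> ann q" for x using that annb by auto
    have "winds (ann q) (\<lambda>x. x - q) D (s * n q + 0)"
    proof (rule winds_increment[OF i annO[OF q] continuous_on_subset[OF Dc annZ[OF q]] e(2)])
      show "x + e \<in> O' (c q) \<and> norm (D x / (\<eta> (c q) (H (c q) x) * (H (c q) (x + e) - H (c q) x)) - 1) < 1" if "x \<in> ann q" for x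
        using Dnear[OF \<epsilon>2(2)[OF q] \<epsilon>(3) that] annZ[OF q] that by blast
      have 1: "winds (ann q) (\<lambda>x. x - q) (\<lambda>x. H (c q) x - H (c q) q) s"
        using g annb unfolding good_def by (auto elim!: winds_subset)
      have 2: "winds (ann q) (\<lambda>x. H (c q) x - H (c q) q) (\<lambda>x. \<eta> (c q) (H (c q) x)) (n q)"
        using g annb unfolding good_def by (auto elim!: winds_subset)
      show "winds (ann q) (\<lambda>x. x - q) (\<lambda>x. \<eta> (c q) (H (c q) x)) (s * n q)" by (rule winds_trans[OF 2 1 nzq])
      have sub: "x \<in> O' (c q)" "x + e \<in> O' (c q)" if "x \<in> cball q \<rho>2" for x
      proof -
        have "dist q (x + e) \<le> dist q x + \<epsilon>" using norm_triangle_ineq4[of "q - x" e] e by (simp add: dist_norm algebra_simps)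
        then have "x + e \<in> ball q r" "x \<in> ball q r" using that \<epsilon>(6) r(1) by (auto simp: \<rho>2_def)
        then show "x \<in> O' (c q)" "x + e \<in> O' (c q)" using g unfolding good_def by auto
      qed
      have "winds (cball q \<rho>2) (\<lambda>x. x - q) (\<lambda>x. H (c q) (x + e) - H (c q) x) 0"
      proof (rule winds_contractible)
        show "continuous_on (cball q \<rho>2) (\<lambda>x. H (c q) (x + e) - H (c q) x)"
          using sub by (intro continuous_intros continuous_on_compose2[OF Hc[OF i]]) auto
        show "H (c q) (x + e) - H (c q) x \<noteq> 0" if "x \<in> cball q \<rho>2" for x
          using inj_on_translate_ne[OF Hi[OF i] sub(1)[OF that] sub(2)[OF that] e(2)] by simp
      qed auto
      then show "winds (ann q) (\<lambda>x. x - q) (\<lambda>x. H (c q) (x + e) - H (c q) x) 0"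
        by (rule winds_subset) (auto simp: ann_def)
    qed (use nzq in auto)
    then show ?thesis by simp
  qed
  have sphZ: "sphere 0 R \<subseteq> Z"
  proof
    fix x :: complex assume x: "x \<in> sphere 0 R"
    have "x \<notin> ball q \<rho>1" if "q \<in> Q" for q
      using norm_triangle_ineq[of q "x - q"] x B[OF that] R(3) \<rho> by (auto simp: dist_norm norm_minus_commute)
    then show "x \<in> Z" using x unfolding Z_def by auto
  qed
  have w2: "winds (sphere 0 R) (\<lambda>x. x) D (- s * n0 + (-2) * s)"
  proof (rule winds_increment[OF i0 sphO continuous_on_subset[OF Dc sphZ] e(2)])
    have e1: "norm e < 1" using e \<epsilon> by simp
    have inv: "winds (sphere 0 R) (\<lambda>x. x) (\<lambda>x. 1 / x) (-1)"
      using winds_power_int[OF winds_self, of "sphere 0 R" "\<lambda>x. x" "-1"] by (simp add: power_int_minus inverse_eq_divide)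
    have nzs: "x \<noteq> 0" if "x \<in> sphere 0 R" for x :: complex using far(4) that by auto
    show "x + e \<in> O' i0 \<and> norm (D x / (\<eta> i0 (H i0 x) * (H i0 (x + e) - H i0 x)) - 1) < 1" if "x \<in> sphere 0 R" for x
      using Dnear[OF \<epsilon>3(2) \<epsilon>(4) that] sphZ that by blast
    have Kball: "1 / x \<in> ball 0 (1 / R0)" "K (1 / x) \<in> ball (K 0) r0 - {K 0}" if "x \<in> sphere 0 R" for x
    proof -
      have "1 / x \<in> ball 0 r1" using far(2) that by auto
      then have "1 / x \<in> ball 0 (1 / R0)" "K (1 / x) \<in> ball (K 0) r0" using r1(2) by auto
      moreover have "K (1 / x) \<noteq> K 0" using inj_onD[OF K(2), of "1 / x" 0] calculation(1) R0 nzs[OF that] by auto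
      ultimately show "1 / x \<in> ball 0 (1 / R0)" "K (1 / x) \<in> ball (K 0) r0 - {K 0}" by auto
    qed
    have "continuous_on (sphere 0 R) (\<lambda>x. K (1 / x))"
      using Kball nzs by (intro continuous_on_compose2[OF K(1)] continuous_intros) auto
    then have "winds (sphere 0 R) (\<lambda>x. K (1 / x) - K 0) (\<lambda>x. \<eta> i0 (K (1 / x))) n0"
      using Kball by (intro winds_compose[OF r0(2)]) auto
    then have 1: "winds (sphere 0 R) (\<lambda>x. K (1 / x) - K 0) (\<lambda>x. \<eta> i0 (H i0 x)) n0"
      by (rule winds_cong) (use inf far(3) in auto)
    have "winds (sphere 0 R) (\<lambda>x. snd (0::complex, 1 / x)) (\<lambda>x. K (fst (0::complex, 1 / x) + snd (0::complex, 1 / x)) - K (fst (0::complex, 1 / x))) s'"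
      by (rule winds_compose[OF r'(3)]) (use nzs far(1) r'(1) in \<open>auto intro!: continuous_intros\<close>)
    then have "winds (sphere 0 R) (\<lambda>x. 1 / x) (\<lambda>x. K (1 / x) - K 0) s" unfolding ss by simp
    then have "winds (sphere 0 R) (\<lambda>x. x) (\<lambda>x. K (1 / x) - K 0) (-1 * s)" by (rule winds_trans[OF _ inv nzs])
    from winds_trans[OF 1 this nzs]
    show "winds (sphere 0 R) (\<lambda>x. x) (\<lambda>x. \<eta> i0 (H i0 x)) (- s * n0)" by simp
    have "winds (sphere 0 R) (\<lambda>x. snd (1 / x, 1 / (x + e) - 1 / x)) 
        (\<lambda>x. K (fst (1 / x, 1 / (x + e) - 1 / x) + snd (1 / x, 1 / (x + e) - 1 / x)) - K (fst (1 / x, 1 / (x + e) - 1 / x))) s'"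
    proof (rule winds_compose[OF r'(3)])
      show "continuous_on (sphere 0 R) (\<lambda>x. (1 / x, 1 / (x + e) - 1 / x))"
        using far'(3)[OF _ e1] nzs by (intro continuous_intros) auto
      show "(\<lambda>x. (1 / x, 1 / (x + e) - 1 / x)) ` sphere 0 R \<subseteq> ball 0 r' \<times> (ball 0 r' - {0})"
      proof (rule image_subsetI)
        fix x :: complex assume "x \<in> sphere 0 R"
        then have x: "norm x = R" by simp
        show "(1 / x, 1 / (x + e) - 1 / x) \<in> ball 0 r' \<times> (ball 0 r' - {0})"
          using far(1)[OF x] far'(2)[OF x e1] farne[OF x e1 e(2)] by blast
      qed
    qed
    then have 2: "winds (sphere 0 R) (\<lambda>x. 1 / (x + e) - 1 / x) (\<lambda>x. H i0 (x + e) - H i0 x) s'"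
      by (rule winds_cong) (use HK[OF _ e1] in auto)
    have "winds (sphere 0 R) (\<lambda>x. x) (\<lambda>x. 1 + e / x) 0"
      using nzs e1 R by (intro winds_near_1 continuous_intros) (auto simp: norm_divide)
    from winds_mult[OF winds_self this nzs]
    have "winds (sphere 0 R) (\<lambda>x. x) (\<lambda>x. x * (1 + e / x)) 1" by simp
    from winds_mult[OF winds_self this nzs] have "winds (sphere 0 R) (\<lambda>x. x) (\<lambda>x. x * (x * (1 + e / x))) 2" by simp
    moreover have "winds (sphere 0 R) (\<lambda>x. x) (\<lambda>x. - e) 0"
      by (rule winds_exp[of _ "\<lambda>_. Ln (- e)"]) (use e(2) in auto)
    ultimately have "winds (sphere 0 R) (\<lambda>x. x) (\<lambda>x. - e / (x * (x * (1 + e / x)))) (0 - 2)"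
      by (intro winds_divide nzs)
    then have "winds (sphere 0 R) (\<lambda>x. x) (\<lambda>x. 1 / (x + e) - 1 / x) (0 - 2)"
    proof (rule winds_cong)
      fix x :: complex assume "x \<in> sphere 0 R"
      then have x: "norm x = R" by simp
      have "x * (1 + e / x) = x + e" using far(4)[OF x] by (simp add: field_simps)
      then show "- e / (x * (x * (1 + e / x))) = 1 / (x + e) - 1 / x" using far'(4)[OF x e1] by simp
    qed simp
    then have 3: "winds (sphere 0 R) (\<lambda>x. x) (\<lambda>x. 1 / (x + e) - 1 / x) (-2)" by simp
    from winds_trans[OF 2 3 nzs] show "winds (sphere 0 R) (\<lambda>x. x) (\<lambda>x. H i0 (x + e) - H i0 x) (-2 * s)" unfolding ss .
  qed (use far in auto)
  have "- s * n0 + (-2) * s = (\<Sum>q\<in>Q. s * n q)"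
  proof (rule winding_number_additive[OF Q \<rho>(1,2), of R D])
    show "continuous_on (cball 0 R - (\<Union>q\<in>Q. ball q \<rho>1)) D" using Dc unfolding Z_def .
    show "D x \<noteq> 0" if "x \<in> cball 0 R - (\<Union>q\<in>Q. ball q \<rho>1)" for x using Dnz that unfolding Z_def .
    show "winds (cball q \<rho>2 - ball q \<rho>1) (\<lambda>x. x - q) D (s * n q)" if "q \<in> Q" for q using w1[OF that] unfolding ann_def .
    show "cball q \<rho>2 \<subseteq> ball 0 R" if "q \<in> Q" for q
    proof
      fix x assume "x \<in> cball q \<rho>2"
      then show "x \<in> ball 0 R" using norm_triangle_ineq[of q "x - q"] B[OF that] R(3) \<rho> by (simp add: dist_norm norm_minus_commute)
    qed
    show "cball q \<rho>2 \<inter> cball q' \<rho>2 = {}" if "q \<in> Q" "q' \<in> Q" "q \<noteq> q'" for q q'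
    proof -
      have "r \<le> dist q q'" using r(2)[OF that(1)] that unfolding good_def by auto
      then have "\<not> (dist q x \<le> \<rho>2 \<and> dist q' x \<le> \<rho>2)" for x
        using dist_triangle[of q q' x] r(1) unfolding \<rho>2_def by (simp add: dist_commute)
      then show ?thesis by auto
    qed
  qed (use R w2 in auto)
  then have "s * (- n0 - 2 - (\<Sum>q\<in>Q. n q)) = 0" by (simp add: sum_distrib_left algebra_simps)
  then show ?thesis using s(1) by simp
qed

end

section \<open>Forms on a closed Riemann surface of genus zero\<close>

context
  fixes S :: "'a csurface" and c :: "'a set \<times> ('a \<Rightarrow> complex)"
  assumes S: "riemann_surface S" and c: "c \<in> charts S"
begin

lemma chart_open: "openin (surf_top S) (fst c)"
  and chart_image_open: "open (snd c ` fst c)"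
  and chart_homeo: "homeomorphic_map (subtopology (surf_top S) (fst c)) (top_of_set (snd c ` fst c)) (snd c)"
  using S c unfolding riemann_surface_def case_prod_beta by blast+

lemma chart_sub: "fst c \<subseteq> topspace (surf_top S)"
  using chart_open openin_subset by blast

lemma chart_topspace: "topspace (subtopology (surf_top S) (fst c)) = fst c"
  using chart_sub by auto

lemma chart_inj: "inj_on (snd c) (fst c)"
  using homeomorphic_imp_injective_map[OF chart_homeo] unfolding chart_topspace .

lemma chart_inv: "a \<in> fst c \<Longrightarrow> inv_into (fst c) (snd c) (snd c a) = a"
  using chart_inj by (rule inv_into_f_f)

lemma chart_continuous: "continuous_map (subtopology (surf_top S) (fst c)) euclidean (snd c)"
  using homeomorphic_imp_continuous_map[OF chart_homeo] continuous_map_into_fulltopology by blast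

lemma chart_preimage_open:
  assumes "open W" shows "openin (surf_top S) {a \<in> fst c. snd c a \<in> W}"
proof -
  have "openin (subtopology (surf_top S) (fst c)) {a \<in> topspace (subtopology (surf_top S) (fst c)). snd c a \<in> W}"
    using chart_continuous assms by (intro openin_continuous_map_preimage) auto
  then show ?thesis unfolding chart_topspace using openin_trans_full[OF _ chart_open] by blast
qed

lemma chart_open_image:
  assumes "openin (surf_top S) N" "N \<subseteq> fst c" shows "open (snd c ` N)"
proof -
  have "openin (subtopology (surf_top S) (fst c)) N"
    using assms openin_open_subtopology[OF chart_open] by blast
  then have "openin (top_of_set (snd c ` fst c)) (snd c ` N)"
    using homeomorphic_map_openness_eq[OF chart_homeo] by (metis assms(2) chart_topspace homeomorphic_map_openness chart_homeo)
  then show ?thesis using chart_image_open openin_open_eq by blast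
qed

end

lemma charts_cover: "riemann_surface S \<Longrightarrow> a \<in> topspace (surf_top S) \<Longrightarrow> \<exists>c\<in>charts S. a \<in> fst c"
  unfolding riemann_surface_def case_prod_beta by blast

lemma chart_transition:
  assumes "riemann_surface S" "c \<in> charts S" "c' \<in> charts S"
  shows "(\<lambda>\<zeta>. snd c' (inv_into (fst c) (snd c) \<zeta>)) holomorphic_on snd c ` (fst c \<inter> fst c')"
  using assms unfolding riemann_surface_def case_prod_beta by blast

text \<open>A form is the family of its coefficients in the charts of \<open>M\<close>; it is holomorphic and
  without zeros off \<open>Q\<close>.\<close>

definition form_on :: "'a csurface \<Rightarrow> 'a set \<Rightarrow> ('a set \<times> ('a \<Rightarrow> complex) \<Rightarrow> complex \<Rightarrow> complex) \<Rightarrow> bool" where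
  "form_on M Q \<eta> \<longleftrightarrow>
     (\<forall>c\<in>charts M. \<eta> c holomorphic_on snd c ` (fst c - Q) \<and> (\<forall>a\<in>fst c - Q. \<eta> c (snd c a) \<noteq> 0)) \<and>
     (\<forall>c\<in>charts M. \<forall>c'\<in>charts M. \<forall>a\<in>fst c \<inter> fst c' - Q.
        \<eta> c (snd c a) = \<eta> c' (snd c' a) * deriv (\<lambda>\<zeta>. snd c' (inv_into (fst c) (snd c) \<zeta>)) (snd c a))"

text \<open>Stereographic projection from \<open>p\<close>. The last conclusion says that \<open>\<xi>
  x\<close> tends to \<open>p\<close> as \<open>x\<close> tends to infinity.\<close>

lemma punctured_sphere_coordinate:
  fixes T :: "'a topology"
  assumes "T homeomorphic_space top_of_set (sphere (0 :: real^3) 1)" and cp: "compact_space T" and p: "p \<in> topspace T"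
  obtains \<xi> :: "complex \<Rightarrow> 'a" and X where "continuous_map euclidean T \<xi>"
    "\<And>x. \<xi> x \<in> topspace T - {p}" "\<And>x. X (\<xi> x) = x" "\<And>a. a \<in> topspace T - {p} \<Longrightarrow> \<xi> (X a) = a"
    "\<And>U. openin T U \<Longrightarrow> p \<in> U \<Longrightarrow> \<exists>R. \<forall>x. R < norm x \<longrightarrow> \<xi> x \<in> U"
proof -
  obtain h g where hg: "homeomorphic_maps T (top_of_set (sphere (0 :: real^3) 1)) h g"
    using assms(1) unfolding homeomorphic_space_def by blast
  have h: "continuous_map T (top_of_set (sphere 0 1)) h" and g: "continuous_map (top_of_set (sphere 0 1)) T g"
    and gh: "\<And>a. a \<in> topspace T \<Longrightarrow> g (h a) = a" and hgi: "\<And>y. y \<in> sphere 0 1 \<Longrightarrow> h (g y) = y"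
    using hg unfolding homeomorphic_maps_def by auto
  have hs: "h a \<in> sphere 0 1" if "a \<in> topspace T" for a
    using continuous_map_image_subset_topspace[OF h] that by auto
  have gs: "g y \<in> topspace T" if "y \<in> sphere 0 1" for y
    using continuous_map_image_subset_topspace[OF g] that by auto
  have "(sphere (0::real^3) 1 - {h p}) homeomorphic (UNIV :: complex set)"
    by (rule homeomorphic_punctured_sphere_affine) (use hs[OF p] in auto)
  then obtain k k' where kk: "homeomorphism (sphere 0 1 - {h p}) (UNIV :: complex set) k k'"
    unfolding homeomorphic_def by blast
  then have kc: "continuous_on (sphere 0 1 - {h p}) k" and k'c: "continuous_on UNIV k'"
    and kk1: "\<And>y. y \<in> sphere 0 1 - {h p} \<Longrightarrow> k' (k y) = y" and kk2: "\<And>x. k (k' x) = x"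
    and "range k' = sphere 0 1 - {h p}" unfolding homeomorphism_def by auto
  then have k's: "k' x \<in> sphere 0 1 - {h p}" for x by blast
  define \<xi> where "\<xi> x = g (k' x)" for x
  define X where "X a = k (h a)" for a
  have 1: "continuous_map euclidean T \<xi>"
    unfolding \<xi>_def
  proof (rule continuous_map_compose[of _ "top_of_set (sphere 0 1)" k' T g, unfolded o_def])
    show "continuous_map euclidean (top_of_set (sphere 0 1)) k'"
      using k'c k's by (auto simp: continuous_map_in_subtopology continuous_map_iff_continuous2)
    show "continuous_map (top_of_set (sphere 0 1)) T g" by (rule g)
  qed
  have 2: "\<xi> x \<in> topspace T - {p}" for x
    unfolding \<xi>_def using gs[of "k' x"] k's[of x] hgi[of "k' x"] by auto
  have 3: "X (\<xi> x) = x" for x unfolding X_def \<xi>_def using hgi[of "k' x"] k's[of x] kk2 by simp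
  have hne: "h a \<in> sphere 0 1 - {h p}" if "a \<in> topspace T - {p}" for a
    using that hs[of a] gh[of a] gh[OF p] by auto
  have 4: "\<xi> (X a) = a" if "a \<in> topspace T - {p}" for a
    unfolding X_def \<xi>_def using kk1[OF hne[OF that]] gh[of a] that by simp
  have 5: "\<exists>R. \<forall>x. R < norm x \<longrightarrow> \<xi> x \<in> U" if U: "openin T U" "p \<in> U" for U
  proof -
    have "closedin T (topspace T - U)" using U by (simp add: openin_closedin_eq)
    then have "compactin T (topspace T - U)" using cp closedin_compact_space by blast
    then have "compactin (top_of_set (sphere 0 1)) (h ` (topspace T - U))" using h by (rule image_compactin)
    then have "compact (h ` (topspace T - U))" by (simp add: compactin_subtopology)
    moreover have "h ` (topspace T - U) \<subseteq> sphere 0 1 - {h p}"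
    proof (rule image_subsetI)
      fix a assume "a \<in> topspace T - U"
      then have "a \<in> topspace T - {p}" using U(2) by auto
      then show "h a \<in> sphere 0 1 - {h p}" by (rule hne)
    qed
    ultimately have "compact (k ` h ` (topspace T - U))"
      by (intro compact_continuous_image continuous_on_subset[OF kc])
    then have "bounded (k ` h ` (topspace T - U))" by (rule compact_imp_bounded)
    then obtain R where R: "\<And>y. y \<in> k ` h ` (topspace T - U) \<Longrightarrow> norm y \<le> R"
      unfolding bounded_iff by blast
    have "\<xi> x \<in> U" if "R < norm x" for x
    proof (rule ccontr)
      assume "\<xi> x \<notin> U"
      then have "\<xi> x \<in> topspace T - U" using 2[of x] by auto
      then have "k (h (\<xi> x)) \<in> k ` h ` (topspace T - U)" by (intro imageI)
      then have "norm (X (\<xi> x)) \<le> R" unfolding X_def by (rule R)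
      then show False using that 3[of x] by simp
    qed
    then show ?thesis by blast
  qed
  show ?thesis by (rule that[OF 1 2 3 4 5])
qed

text \<open>One of the singular points is moved to infinity; this is why \<open>Q\<close> is nonempty.\<close>

theorem degree_of_form:
  fixes M :: "'a csurface" and n :: "'a \<Rightarrow> int"
  assumes M: "closed_riemann_surface_genus_0 M" and Q: "finite Q" "Q \<noteq> {}" "Q \<subseteq> topspace (surf_top M)"
    and \<eta>: "form_on M Q \<eta>"
    and n: "\<And>q. q \<in> Q \<Longrightarrow> \<exists>c\<in>charts M. q \<in> fst c \<and> (\<exists>r>0. winds (ball (snd c q) r - {snd c q}) (\<lambda>\<zeta>. \<zeta> - snd c q) (\<eta> c) (n q))"
  shows "(\<Sum>q\<in>Q. n q) = -2"
proof -
  have RS: "riemann_surface M" and cp: "compact_space (surf_top M)"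
    and hs: "surf_top M homeomorphic_space top_of_set (sphere (0 :: real^3) 1)"
    using M unfolding closed_riemann_surface_genus_0_def by auto
  have \<eta>h: "\<eta> k holomorphic_on snd k ` (fst k - Q)" if "k \<in> charts M" for k
    using \<eta> that unfolding form_on_def by blast
  have \<eta>n: "\<eta> k (snd k a) \<noteq> 0" if "k \<in> charts M" "a \<in> fst k - Q" for k a
    using \<eta> that unfolding form_on_def by blast
  have \<eta>t: "\<eta> k (snd k a) = \<eta> k' (snd k' a) * deriv (\<lambda>\<zeta>. snd k' (inv_into (fst k) (snd k) \<zeta>)) (snd k a)"
    if "k \<in> charts M" "k' \<in> charts M" "a \<in> fst k \<inter> fst k' - Q" for k k' a
    using \<eta> that unfolding form_on_def by blast
  obtain p where p: "p \<in> Q" using Q by blast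
  have pt: "p \<in> topspace (surf_top M)" using p Q by blast
  obtain \<xi> :: "complex \<Rightarrow> 'a" and X where \<xi>c: "continuous_map euclidean (surf_top M) \<xi>"
    and \<xi>: "\<And>x. \<xi> x \<in> topspace (surf_top M) - {p}" and X\<xi>: "\<And>x. X (\<xi> x) = x" and \<xi>X: "\<And>a. a \<in> topspace (surf_top M) - {p} \<Longrightarrow> \<xi> (X a) = a"
    and lim: "\<And>U. openin (surf_top M) U \<Longrightarrow> p \<in> U \<Longrightarrow> \<exists>R. \<forall>x. R < norm x \<longrightarrow> \<xi> x \<in> U"
    by (rule punctured_sphere_coordinate[OF hs cp pt]) (rule that)
  have "\<forall>q\<in>Q. \<exists>c. c \<in> charts M \<and> q \<in> fst c \<and>
       (\<exists>r>0. winds (ball (snd c q) r - {snd c q}) (\<lambda>\<zeta>. \<zeta> - snd c q) (\<eta> c) (n q))"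
    using n by blast
  from bchoice[OF this] obtain c where c: "\<And>q. q \<in> Q \<Longrightarrow> c q \<in> charts M \<and> q \<in> fst (c q) \<and>
       (\<exists>r>0. winds (ball (snd (c q) q) r - {snd (c q) q}) (\<lambda>\<zeta>. \<zeta> - snd (c q) q) (\<eta> (c q)) (n q))"
    by blast
  have inj\<xi>: "\<xi> x = \<xi> y \<longleftrightarrow> x = y" for x y using X\<xi> by metis
  define Q' where "Q' = X ` (Q - {p})"
  have Q'iff: "x \<in> Q' \<longleftrightarrow> \<xi> x \<in> Q" for x
  proof
    assume "x \<in> Q'"
    then obtain a where "a \<in> Q - {p}" "x = X a" unfolding Q'_def by blast
    then show "\<xi> x \<in> Q" using \<xi>X[of a] Q(3) by auto
  next
    assume "\<xi> x \<in> Q"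
    then have "\<xi> x \<in> Q - {p}" using \<xi>[of x] by blast
    then show "x \<in> Q'" unfolding Q'_def using X\<xi>[of x] by (metis imageI)
  qed
  define Oc where "Oc k = {x. \<xi> x \<in> fst k}" for k :: "'a set \<times> ('a \<Rightarrow> complex)"
  define H where "H k x = snd k (\<xi> x)" for k :: "'a set \<times> ('a \<Rightarrow> complex)" and x
  define T where "T k k' \<zeta> = snd k' (inv_into (fst k) (snd k) \<zeta>)" for k k' :: "'a set \<times> ('a \<Rightarrow> complex)" and \<zeta>
  have preim: "open {x. \<xi> x \<in> U}" if "openin (surf_top M) U" for U
    using openin_continuous_map_preimage[OF \<xi>c that] by simp
  have ct: "H k ` (Oc k - Q') \<subseteq> snd k ` (fst k - Q)" "H k ` (Oc k \<inter> Oc k') \<subseteq> snd k ` (fst k \<inter> fst k')" for k k'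
    unfolding H_def Oc_def using Q'iff by auto
  have Hcont: "continuous_on (Oc k) (H k)" if k: "k \<in> charts M" for k
  proof -
    have "continuous_map (top_of_set (Oc k)) (subtopology (surf_top M) (fst k)) \<xi>"
      unfolding continuous_map_in_subtopology using \<xi>c by (auto simp: Oc_def intro: continuous_map_from_subtopology)
    from continuous_map_compose[OF this chart_continuous[OF RS k]]
    show ?thesis unfolding H_def[abs_def] o_def by simp
  qed
  let ?z = "snd (c p)" and ?U = "fst (c p)"
  have cp1: "c p \<in> charts M" "p \<in> ?U" using c[OF p] by auto
  obtain R where R: "\<And>x. R < norm x \<Longrightarrow> \<xi> x \<in> ?U" using lim[OF chart_open[OF RS cp1(1)] cp1(2)] by blast
  define R0 where "R0 = max R 1"
  define K where "K w = (if w = 0 then ?z p else ?z (\<xi> (1 / w)))" for w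
  have R0: "R0 > 0" by (simp add: R0_def)
  have far: "\<xi> x \<in> ?U" if "R0 < norm x" for x using R that by (simp add: R0_def)
  have inv_far: "R0 < norm (1 / w)" if "w \<in> ball 0 (1 / R0) - {0}" for w :: complex
    using that R0 by (simp add: norm_divide field_simps)
  have Kc: "continuous_on (ball 0 (1 / R0)) K"
  proof (rule continuous_at_imp_continuous_on, rule ballI)
    fix w :: complex assume w: "w \<in> ball 0 (1 / R0)"
    show "isCont K w"
    proof (cases "w = 0")
      case False
      have "continuous_on (ball 0 (1 / R0) - {0}) (\<lambda>w. H (c p) (1 / w))"
        using far[OF inv_far] by (intro continuous_on_compose2[OF Hcont[OF cp1(1)]] continuous_intros) (auto simp: Oc_def)
      then have "continuous_on (ball 0 (1 / R0) - {0}) K" by (rule continuous_on_eq) (simp add: K_def H_def)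
      then show ?thesis using w False by (subst (asm) continuous_on_eq_continuous_at) auto
    next
      case True
      have "\<exists>d>0. \<forall>w'. norm w' < d \<longrightarrow> dist (K w') (K 0) < e" if e: "e > 0" for e
      proof -
        have "openin (surf_top M) {a \<in> ?U. ?z a \<in> ball (?z p) e}" by (rule chart_preimage_open[OF RS cp1(1)]) auto
        moreover have "p \<in> {a \<in> ?U. ?z a \<in> ball (?z p) e}" using cp1 e by auto
        ultimately obtain R' where R': "\<And>x. R' < norm x \<Longrightarrow> \<xi> x \<in> {a \<in> ?U. ?z a \<in> ball (?z p) e}" using lim by blast
        have "dist (K w') (K 0) < e" if w': "norm w' < 1 / max R' 1" for w'
        proof (cases "w' = 0")
          case False
          define m where "m = max R' 1"
          have m: "m > 0" "R' \<le> m" by (auto simp: m_def)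
          have "norm w' * m < 1" using w' m(1) unfolding m_def[symmetric] by (simp add: less_divide_eq)
          then have "m < norm (1 / w')" using False by (simp add: norm_divide less_divide_eq mult.commute)
          then have "R' < norm (1 / w')" using m(2) by linarith
          from R'[OF this] show ?thesis using False by (simp add: K_def dist_commute)
        qed (use e in simp)
        then show ?thesis by (intro exI[of _ "1 / max R' 1"]) auto
      qed
      then show ?thesis unfolding True continuous_at_eps_delta by (simp add: dist_norm)
    qed
  qed
  have Ki: "inj_on K (ball 0 (1 / R0))"
  proof (rule inj_onI)
    fix w w' assume w: "w \<in> ball 0 (1 / R0)" "w' \<in> ball 0 (1 / R0)" "K w = K w'"
    define q where "q w = (if w = 0 then p else \<xi> (1 / w))" for w :: complex
    have q: "q v \<in> ?U" "K v = ?z (q v)" if "v \<in> ball 0 (1 / R0)" for v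
      using far[OF inv_far, of v] that cp1 by (auto simp: q_def K_def)
    then have "q w = q w'" using inj_onD[OF chart_inj[OF RS cp1(1)]] w by metis
    then show "w = w'" unfolding q_def using \<xi>[of "1 / w"] \<xi>[of "1 / w'"] inj\<xi>[of "1 / w" "1 / w'"] by (auto split: if_splits)
  qed
  have "(\<Sum>q\<in>Q'. n (\<xi> q)) = (\<Sum>a\<in>Q - {p}. n a)"
  proof (rule sum.reindex_cong[of \<xi>, symmetric])
    show "inj_on \<xi> Q'" using inj\<xi> by (simp add: inj_on_def)
    have "a \<in> \<xi> ` Q'" if "a \<in> Q - {p}" for a
      using that \<xi>X[of a] Q(3) unfolding Q'_def by (metis DiffD1 DiffD2 DiffI imageI subsetD)
    then show "Q - {p} = \<xi> ` Q'" using Q'iff \<xi> by blast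
  qed simp
  then have total: "(\<Sum>q\<in>Q'. n (\<xi> q)) + n p = (\<Sum>a\<in>Q. n a)" using p Q(1) by (simp add: sum.remove[of Q p])
  interpret plane_form Q' "charts M" Oc H \<eta> T "\<lambda>x. c (\<xi> x)" "\<lambda>x. n (\<xi> x)" "c p" R0 K "n p"
  proof
    show "finite Q'" using Q by (simp add: Q'_def)
    show "open (Oc k)" if "k \<in> charts M" for k unfolding Oc_def by (rule preim[OF chart_open[OF RS that]])
    show "continuous_on (Oc k) (H k)" if "k \<in> charts M" for k by (rule Hcont[OF that])
    show "inj_on (H k) (Oc k)" if "k \<in> charts M" for k
      using chart_inj[OF RS that] inj\<xi> unfolding H_def Oc_def inj_on_def by blast
    show "\<exists>i\<in>charts M. x \<in> Oc i" for x
      using \<xi>[of x] charts_cover[OF RS] unfolding Oc_def by auto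
    show "\<eta> i holomorphic_on H i ` (Oc i - Q')" if "i \<in> charts M" for i
      by (rule holomorphic_on_subset[OF \<eta>h[OF that] ct(1)])
    show "\<eta> i (H i x) \<noteq> 0" if "i \<in> charts M" "x \<in> Oc i - Q'" for i x
      unfolding H_def by (rule \<eta>n[OF that(1)]) (use that(2) Q'iff in \<open>simp add: Oc_def\<close>)
    show "T i j holomorphic_on H i ` (Oc i \<inter> Oc j)" if "i \<in> charts M" "j \<in> charts M" for i j
      using chart_transition[OF RS that] ct(2) unfolding T_def[abs_def] by (rule holomorphic_on_subset)
    show "T i j (H i x) = H j x" if "i \<in> charts M" "j \<in> charts M" "x \<in> Oc i \<inter> Oc j" for i j x
      using that chart_inv[OF RS that(1)] unfolding T_def H_def Oc_def by simp
    show "\<eta> i (H i x) = \<eta> j (H j x) * deriv (T i j) (H i x)" if "i \<in> charts M" "j \<in> charts M" "x \<in> Oc i \<inter> Oc j - Q'" for i j x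
      unfolding H_def T_def[abs_def] by (rule \<eta>t[OF that(1,2)]) (use that(3) Q'iff in \<open>simp add: Oc_def\<close>)
    show "c (\<xi> q) \<in> charts M \<and> q \<in> Oc (c (\<xi> q))" if "q \<in> Q'" for q
      using c[of "\<xi> q"] that Q'iff unfolding Oc_def by auto
    show "\<exists>r>0. winds (ball (H (c (\<xi> q)) q) r - {H (c (\<xi> q)) q}) (\<lambda>\<zeta>. \<zeta> - H (c (\<xi> q)) q) (\<eta> (c (\<xi> q))) (n (\<xi> q))" if "q \<in> Q'" for q
      using c[of "\<xi> q"] that Q'iff unfolding H_def by auto
    show "x \<in> Oc (c p) \<and> H (c p) x = K (1 / x)" if "R0 < norm x" for x
      using far[OF that] R0 that unfolding Oc_def H_def K_def by auto
    show "\<exists>r>0. winds (ball (K 0) r - {K 0}) (\<lambda>\<zeta>. \<zeta> - K 0) (\<eta> (c p)) (n p)"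
      using c[OF p] by (simp add: K_def)
  qed (use R0 cp1 Kc Ki in auto)
  show ?thesis using sum_windings total by simp
qed

section \<open>The holomorphic data of a conformal minimal immersion\<close>

lemma Du_eq: "(f has_derivative f') (at \<zeta>) \<Longrightarrow> Du f \<zeta> = f' 1"
  and Dv_eq: "(f has_derivative f') (at \<zeta>) \<Longrightarrow> Dv f \<zeta> = f' \<i>"
proof -
  assume f: "(f has_derivative f') (at \<zeta>)"
  have "((\<lambda>t. \<zeta> + w * of_real t) has_derivative (\<lambda>t. w * of_real t)) (at 0)" for w
    by (auto intro!: derivative_eq_intros)
  from has_derivative_compose[OF this, of f f'] f
  have "((\<lambda>t. f (\<zeta> + w * of_real t)) has_derivative (\<lambda>t. f' (w * of_real t))) (at 0)" for w by simp
  moreover have "f' (w * of_real t) = t *\<^sub>R f' w" for w t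
    using linear_scale[OF has_derivative_linear[OF f], of t w] by (simp add: scaleR_conv_of_real mult.commute)
  ultimately have "((\<lambda>t. f (\<zeta> + w * of_real t)) has_vector_derivative f' w) (at 0)" for w
    unfolding has_vector_derivative_def by simp
  from vector_derivative_at[OF this[of 1]] vector_derivative_at[OF this[of \<i>]]
  show "Du f \<zeta> = f' 1" "Dv f \<zeta> = f' \<i>" unfolding Du_def Dv_def by simp_all
qed

lemma derivative_Du_Dv:
  assumes "f differentiable at \<zeta>"
  shows "(f has_derivative (\<lambda>v. Re v *\<^sub>R Du f \<zeta> + Im v *\<^sub>R Dv f \<zeta>)) (at \<zeta>)"
proof -
  obtain f' where f: "(f has_derivative f') (at \<zeta>)" using assms unfolding differentiable_def by blast
  interpret l: linear f' by (rule has_derivative_linear[OF f])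
  have "f' = (\<lambda>v. Re v *\<^sub>R Du f \<zeta> + Im v *\<^sub>R Dv f \<zeta>)"
  proof
    fix v
    have "v = Re v *\<^sub>R 1 + Im v *\<^sub>R \<i>" by (simp add: complex_eq_iff)
    then have "f' v = f' (Re v *\<^sub>R 1 + Im v *\<^sub>R \<i>)" by simp
    then show "f' v = Re v *\<^sub>R Du f \<zeta> + Im v *\<^sub>R Dv f \<zeta>"
      using Du_eq[OF f] Dv_eq[OF f] by (simp add: l.add l.scale)
  qed
  then show ?thesis using f by simp
qed

lemma directional_real_derivative:
  fixes f :: "complex \<Rightarrow> real"
  assumes "f differentiable at (\<zeta> + w * of_real s)"
  shows "((\<lambda>t. f (\<zeta> + w * of_real t)) has_real_derivative (Re w * Du f (\<zeta> + w * of_real s) + Im w * Dv f (\<zeta> + w * of_real s))) (at s)"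
proof -
  have "((\<lambda>t. \<zeta> + w * of_real t) has_derivative (\<lambda>t. w * of_real t)) (at s)"
    by (auto intro!: derivative_eq_intros)
  from has_derivative_compose[OF this derivative_Du_Dv[OF assms]]
  show ?thesis unfolding has_field_derivative_def by (rule has_derivative_eq_rhs) (auto simp: algebra_simps)
qed

text \<open>The mean value theorem twice, once in either order of the variables.\<close>

lemma second_difference_mvt:
  fixes f :: "complex \<Rightarrow> real"
  assumes h: "0 < h" "\<And>x. norm (x - \<zeta>) \<le> 2 * h \<Longrightarrow> f differentiable at x"
    "\<And>x. norm (x - \<zeta>) \<le> 2 * h \<Longrightarrow> Du f differentiable at x" "\<And>x. norm (x - \<zeta>) \<le> 2 * h \<Longrightarrow> Dv f differentiable at x"
  shows "\<exists>x. norm (x - \<zeta>) \<le> 2 * h \<and> f (\<zeta> + h + \<i> * h) - f (\<zeta> + h) - f (\<zeta> + \<i> * h) + f \<zeta> = h * h * Dv (Du f) x"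
    and "\<exists>x. norm (x - \<zeta>) \<le> 2 * h \<and> f (\<zeta> + h + \<i> * h) - f (\<zeta> + h) - f (\<zeta> + \<i> * h) + f \<zeta> = h * h * Du (Dv f) x"
proof -
  have nb: "norm (complex_of_real s + \<i> * complex_of_real t) \<le> 2 * h" if "0 \<le> s" "s \<le> h" "0 \<le> t" "t \<le> h" for s t
    using norm_triangle_ineq[of "complex_of_real s" "\<i> * complex_of_real t"] that by (simp add: norm_mult)
  define g where "g t = f (\<zeta> + \<i> * h + 1 * of_real t) - f (\<zeta> + 1 * of_real t)" for t :: real
  have "\<exists>z>0. z < h \<and> g h - g 0 = (h - 0) * (Du f (\<zeta> + \<i> * h + 1 * of_real z) - Du f (\<zeta> + 1 * of_real z))"
  proof (rule MVT2[OF h(1)])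
    fix t assume t: "0 \<le> t" "t \<le> h"
    have d: "f differentiable at (\<zeta> + \<i> * h + 1 * of_real t)" "f differentiable at (\<zeta> + 1 * of_real t)"
      using nb[OF t, of h] nb[OF t, of 0] h(1) by (auto intro!: h(2) simp: algebra_simps)
    show "(g has_real_derivative Du f (\<zeta> + \<i> * h + 1 * of_real t) - Du f (\<zeta> + 1 * of_real t)) (at t)"
      using DERIV_diff[OF directional_real_derivative[OF d(1)] directional_real_derivative[OF d(2)]] unfolding g_def by simp
  qed
  then obtain s where s: "0 < s" "s < h" "g h - g 0 = h * (Du f (\<zeta> + \<i> * h + 1 * of_real s) - Du f (\<zeta> + 1 * of_real s))" by auto
  have "\<exists>z>0. z < h \<and> Du f (\<zeta> + of_real s + \<i> * of_real h) - Du f (\<zeta> + of_real s + \<i> * of_real 0) = (h - 0) * Dv (Du f) (\<zeta> + of_real s + \<i> * of_real z)"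
  proof (rule MVT2[OF h(1)])
    fix t assume t: "0 \<le> t" "t \<le> h"
    have "Du f differentiable at (\<zeta> + of_real s + \<i> * of_real t)"
      using nb[OF _ _ t, of s] s by (auto intro!: h(3) simp: algebra_simps)
    from directional_real_derivative[OF this]
    show "((\<lambda>x. Du f (\<zeta> + of_real s + \<i> * of_real x)) has_real_derivative Dv (Du f) (\<zeta> + of_real s + \<i> * of_real t)) (at t)" by simp
  qed
  then obtain t where t: "0 < t" "t < h" "Du f (\<zeta> + of_real s + \<i> * of_real h) - Du f (\<zeta> + of_real s) = h * Dv (Du f) (\<zeta> + of_real s + \<i> * of_real t)" by auto
  have "g h - g 0 = h * h * Dv (Du f) (\<zeta> + of_real s + \<i> * of_real t)" using s(3) t(3) by (simp add: add_ac)
  then show "\<exists>x. norm (x - \<zeta>) \<le> 2 * h \<and> f (\<zeta> + h + \<i> * h) - f (\<zeta> + h) - f (\<zeta> + \<i> * h) + f \<zeta> = h * h * Dv (Du f) x"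
    using nb[of s t] s t unfolding g_def by (intro exI[of _ "\<zeta> + of_real s + \<i> * of_real t"]) (auto simp: algebra_simps)
  define k where "k t = f (\<zeta> + h + \<i> * of_real t) - f (\<zeta> + \<i> * of_real t)" for t :: real
  have "\<exists>z>0. z < h \<and> k h - k 0 = (h - 0) * (Dv f (\<zeta> + h + \<i> * of_real z) - Dv f (\<zeta> + \<i> * of_real z))"
  proof (rule MVT2[OF h(1)])
    fix t assume t: "0 \<le> t" "t \<le> h"
    have d: "f differentiable at (\<zeta> + h + \<i> * of_real t)" "f differentiable at (\<zeta> + \<i> * of_real t)"
      using nb[OF _ _ t, of h] nb[OF _ _ t, of 0] h(1) by (auto intro!: h(2) simp: algebra_simps)
    show "(k has_real_derivative Dv f (\<zeta> + h + \<i> * of_real t) - Dv f (\<zeta> + \<i> * of_real t)) (at t)"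
      using DERIV_diff[OF directional_real_derivative[OF d(1)] directional_real_derivative[OF d(2)]] unfolding k_def by simp
  qed
  then obtain s where s: "0 < s" "s < h" "k h - k 0 = h * (Dv f (\<zeta> + h + \<i> * of_real s) - Dv f (\<zeta> + \<i> * of_real s))" by auto
  have "\<exists>z>0. z < h \<and> Dv f (\<zeta> + \<i> * of_real s + 1 * of_real h) - Dv f (\<zeta> + \<i> * of_real s + 1 * of_real 0) = (h - 0) * Du (Dv f) (\<zeta> + \<i> * of_real s + 1 * of_real z)"
  proof (rule MVT2[OF h(1)])
    fix t assume t: "0 \<le> t" "t \<le> h"
    have "Dv f differentiable at (\<zeta> + \<i> * of_real s + 1 * of_real t)"
      using nb[OF t, of s] s by (auto intro!: h(4) simp: algebra_simps)
    from directional_real_derivative[OF this]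
    show "((\<lambda>x. Dv f (\<zeta> + \<i> * of_real s + 1 * of_real x)) has_real_derivative Du (Dv f) (\<zeta> + \<i> * of_real s + 1 * of_real t)) (at t)" by simp
  qed
  then obtain t where t: "0 < t" "t < h" "Dv f (\<zeta> + \<i> * of_real s + of_real h) - Dv f (\<zeta> + \<i> * of_real s) = h * Du (Dv f) (\<zeta> + \<i> * of_real s + of_real t)" by auto
  have "k h - k 0 = h * h * Du (Dv f) (\<zeta> + \<i> * of_real s + of_real t)" using s(3) t(3) by (simp add: add_ac)
  then show "\<exists>x. norm (x - \<zeta>) \<le> 2 * h \<and> f (\<zeta> + h + \<i> * h) - f (\<zeta> + h) - f (\<zeta> + \<i> * h) + f \<zeta> = h * h * Du (Dv f) x"
    using nb[of t s] s t unfolding k_def by (intro exI[of _ "\<zeta> + \<i> * of_real s + of_real t"]) (auto simp: algebra_simps)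
qed

text \<open>Both mixed derivatives are limits of the same second difference quotient.\<close>

lemma mixed_partials:
  fixes f :: "complex \<Rightarrow> real"
  assumes W: "open W" "\<zeta> \<in> W" and f: "Ck_on 2 f W"
  shows "Du (Dv f) \<zeta> = Dv (Du f) \<zeta>"
proof (rule ccontr)
  assume ne: "Du (Dv f) \<zeta> \<noteq> Dv (Du f) \<zeta>"
  have d: "f differentiable_on W" "Du f differentiable_on W" "Dv f differentiable_on W"
    and c: "continuous_on W (Dv (Du f))" "continuous_on W (Du (Dv f))"
    using f by (auto simp: numeral_2_eq_2)
  define e where "e = \<bar>Du (Dv f) \<zeta> - Dv (Du f) \<zeta>\<bar> / 2"
  have e: "e > 0" using ne by (simp add: e_def)
  obtain r where r: "r > 0" "ball \<zeta> r \<subseteq> W" using W open_contains_ball by blast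
  obtain d1 where d1: "d1 > 0" "\<And>x. x \<in> W \<Longrightarrow> dist x \<zeta> < d1 \<Longrightarrow> dist (Dv (Du f) x) (Dv (Du f) \<zeta>) < e"
    using c(1) W(2) e unfolding continuous_on_iff by blast
  obtain d2 where d2: "d2 > 0" "\<And>x. x \<in> W \<Longrightarrow> dist x \<zeta> < d2 \<Longrightarrow> dist (Du (Dv f) x) (Du (Dv f) \<zeta>) < e"
    using c(2) W(2) e unfolding continuous_on_iff by blast
  define h where "h = min r (min d1 d2) / 4"
  have h: "h > 0" "2 * h < r" "2 * h < d1" "2 * h < d2" using r d1 d2 by (auto simp: h_def)
  have inW: "x \<in> W" if "norm (x - \<zeta>) \<le> 2 * h" for x
    using that h(2) by (intro subsetD[OF r(2)]) (auto simp: dist_norm norm_minus_commute)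
  have da: "f differentiable at x" "Du f differentiable at x" "Dv f differentiable at x" if "norm (x - \<zeta>) \<le> 2 * h" for x
    using d W(1) inW[OF that] by (auto simp: differentiable_on_eq_differentiable_at)
  obtain x where x: "norm (x - \<zeta>) \<le> 2 * h" "f (\<zeta> + h + \<i> * h) - f (\<zeta> + h) - f (\<zeta> + \<i> * h) + f \<zeta> = h * h * Dv (Du f) x"
    using second_difference_mvt(1)[OF h(1) da] by blast
  obtain y where y: "norm (y - \<zeta>) \<le> 2 * h" "f (\<zeta> + h + \<i> * h) - f (\<zeta> + h) - f (\<zeta> + \<i> * h) + f \<zeta> = h * h * Du (Dv f) y"
    using second_difference_mvt(2)[OF h(1) da] by blast
  have "Dv (Du f) x = Du (Dv f) y" using x(2) y(2) h(1) by simp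
  moreover have "\<bar>Dv (Du f) x - Dv (Du f) \<zeta>\<bar> < e" using d1(2)[OF inW[OF x(1)]] x(1) h(3) by (simp add: dist_norm)
  moreover have "\<bar>Du (Dv f) y - Du (Dv f) \<zeta>\<bar> < e" using d2(2)[OF inW[OF y(1)]] y(1) h(4) by (simp add: dist_norm)
  ultimately show False
    using abs_triangle_ineq[of "Du (Dv f) \<zeta> - Dv (Du f) x" "Dv (Du f) x - Dv (Du f) \<zeta>"]
      abs_minus_commute[of "Du (Dv f) \<zeta>" "Du (Dv f) y"] unfolding e_def by simp
qed

lemma Du_nth:
  fixes f :: "complex \<Rightarrow> real^'n"
  shows "f differentiable at \<zeta> \<Longrightarrow> Du (\<lambda>\<xi>. f \<xi> $ i) \<zeta> = Du f \<zeta> $ i"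
  and Dv_nth: "f differentiable at \<zeta> \<Longrightarrow> Dv (\<lambda>\<xi>. f \<xi> $ i) \<zeta> = Dv f \<zeta> $ i"
proof -
  assume a: "f differentiable at \<zeta>"
  have "((\<lambda>\<xi>. f \<xi> $ i) has_derivative (\<lambda>v. (Re v *\<^sub>R Du f \<zeta> + Im v *\<^sub>R Dv f \<zeta>) $ i)) (at \<zeta>)"
    using bounded_linear.has_derivative[OF bounded_linear_vec_nth derivative_Du_Dv[OF a]] .
  from Du_eq[OF this] Dv_eq[OF this]
  show "Du (\<lambda>\<xi>. f \<xi> $ i) \<zeta> = Du f \<zeta> $ i" "Dv (\<lambda>\<xi>. f \<xi> $ i) \<zeta> = Dv f \<zeta> $ i" by simp_all
qed

lemma Du_inner: "f differentiable at \<zeta> \<Longrightarrow> g differentiable at \<zeta> \<Longrightarrow> Du (\<lambda>\<xi>. f \<xi> \<bullet> g \<xi>) \<zeta> = f \<zeta> \<bullet> Du g \<zeta> + Du f \<zeta> \<bullet> g \<zeta>"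
  and Dv_inner: "f differentiable at \<zeta> \<Longrightarrow> g differentiable at \<zeta> \<Longrightarrow> Dv (\<lambda>\<xi>. f \<xi> \<bullet> g \<xi>) \<zeta> = f \<zeta> \<bullet> Dv g \<zeta> + Dv f \<zeta> \<bullet> g \<zeta>"
proof -
  assume a: "f differentiable at \<zeta>" "g differentiable at \<zeta>"
  note has_derivative_inner[OF derivative_Du_Dv[OF a(1)] derivative_Du_Dv[OF a(2)]]
  from Du_eq[OF this] Dv_eq[OF this]
  show "Du (\<lambda>\<xi>. f \<xi> \<bullet> g \<xi>) \<zeta> = f \<zeta> \<bullet> Du g \<zeta> + Du f \<zeta> \<bullet> g \<zeta>"
    "Dv (\<lambda>\<xi>. f \<xi> \<bullet> g \<xi>) \<zeta> = f \<zeta> \<bullet> Dv g \<zeta> + Dv f \<zeta> \<bullet> g \<zeta>" by simp_all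
qed

lemma Du_local: 
  assumes "open W" "\<zeta> \<in> W" "\<And>x. x \<in> W \<Longrightarrow> f x = g x"
  shows "Du f \<zeta> = Du g \<zeta>" "Dv f \<zeta> = Dv g \<zeta>"
proof -
  have "\<forall>\<^sub>F x in nhds \<zeta>. f x = g x" using assms eventually_nhds by blast
  moreover have "filterlim (\<lambda>t. \<zeta> + w * of_real t) (nhds \<zeta>) (nhds 0)" for w
  proof -
    have "isCont (\<lambda>t. \<zeta> + w * complex_of_real t) 0" by (intro continuous_intros)
    then show ?thesis by (simp add: isCont_def tendsto_nhds_iff)
  qed
  ultimately have ev: "\<forall>\<^sub>F t in nhds 0. f (\<zeta> + w * of_real t) = g (\<zeta> + w * of_real t)" for w
    unfolding filterlim_iff by blast
  have "vector_derivative (\<lambda>t. f (\<zeta> + w * of_real t)) (at 0) = vector_derivative (\<lambda>t. g (\<zeta> + w * of_real t)) (at 0)" for w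
    by (rule vector_derivative_cong_eq) (use ev[of w] in auto)
  from this[of 1] this[of \<i>] show "Du f \<zeta> = Du g \<zeta>" "Dv f \<zeta> = Dv g \<zeta>" unfolding Du_def Dv_def by simp_all
qed

lemma normal_part_orthogonal_frame:
  assumes "Du Y \<zeta> \<bullet> Dv Y \<zeta> = 0" "Du Y \<zeta> \<noteq> 0" "Dv Y \<zeta> \<noteq> 0"
  shows "normal_part Y \<zeta> x = x - ((x \<bullet> Du Y \<zeta>) / (Du Y \<zeta> \<bullet> Du Y \<zeta>)) *\<^sub>R Du Y \<zeta> - ((x \<bullet> Dv Y \<zeta>) / (Dv Y \<zeta> \<bullet> Dv Y \<zeta>)) *\<^sub>R Dv Y \<zeta>"
    (is "_ = ?n")
  unfolding normal_part_def
proof (rule the_equality)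
  let ?a = "Du Y \<zeta>" and ?b = "Dv Y \<zeta>"
  have ba: "?b \<bullet> ?a = 0" using assms(1) by (simp add: inner_commute)
  have "x - ?n = ((x \<bullet> ?a) / (?a \<bullet> ?a)) *\<^sub>R ?a + ((x \<bullet> ?b) / (?b \<bullet> ?b)) *\<^sub>R ?b" by simp
  also have "\<dots> \<in> span {?a, ?b}" by (intro span_add span_scale span_base) auto
  finally have sp: "x - ?n \<in> span {?a, ?b}" .
  show n: "orthogonal ?n ?a \<and> orthogonal ?n ?b \<and> x - ?n \<in> span {?a, ?b}"
    using sp assms ba by (simp add: orthogonal_def inner_diff_left)
  fix m assume m: "orthogonal m ?a \<and> orthogonal m ?b \<and> x - m \<in> span {?a, ?b}"
  have "m - ?n = (x - ?n) - (x - m)" by simp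
  also have "\<dots> \<in> span {?a, ?b}" by (rule span_diff[OF sp]) (use m in blast)
  finally have "m - ?n \<in> span {?a, ?b}" .
  moreover have "orthogonal (m - ?n) y" if "y \<in> {?a, ?b}" for y
    using m n that by (auto simp: orthogonal_def inner_diff_left)
  ultimately have "orthogonal (m - ?n) (m - ?n)" using orthogonal_to_span by blast
  then show "m = ?n" by (simp only: orthogonal_self right_minus_eq)
qed

lemma Ck_on_nth:
  fixes f :: "complex \<Rightarrow> real^'n"
  assumes "open W" "Ck_on k f W" shows "Ck_on k (\<lambda>\<xi>. f \<xi> $ i) W"
  using assms(2)
proof (induction k arbitrary: f)
  case 0
  then show ?case by (auto intro: continuous_intros)
next
  case (Suc k)
  have cong: "Ck_on k g W \<Longrightarrow> (\<And>x. x \<in> W \<Longrightarrow> g x = g' x) \<Longrightarrow> Ck_on k g' W" for k and g g' :: "complex \<Rightarrow> real"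
  proof (induction k arbitrary: g g')
    case 0
    then show ?case by (auto elim: continuous_on_eq)
  next
    case (Suc k)
    have "g' differentiable_on W" using Suc.prems(1,2) by (auto simp: differentiable_on_def intro: differentiable_transform_within[OF _ zero_less_one])
    moreover have "Du g x = Du g' x" "Dv g x = Dv g' x" if "x \<in> W" for x
      using Du_local[OF assms(1) that Suc.prems(2)] by auto
    ultimately show ?case using Suc.prems(1) Suc.IH[of "Du g" "Du g'"] Suc.IH[of "Dv g" "Dv g'"] by simp
  qed
  have d: "f differentiable_on W" using Suc.prems by simp
  then have da: "f differentiable at x" if "x \<in> W" for x
    using assms(1) that by (auto simp: differentiable_on_eq_differentiable_at)
  have "(\<lambda>\<xi>. f \<xi> $ i) differentiable_on W"
    using d bounded_linear.has_derivative[OF bounded_linear_vec_nth] unfolding differentiable_on_def differentiable_def by blast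
  moreover have "Ck_on k (Du (\<lambda>\<xi>. f \<xi> $ i)) W"
    by (rule cong[OF Suc.IH[of "Du f"]]) (use Suc.prems da in \<open>auto simp: Du_nth\<close>)
  moreover have "Ck_on k (Dv (\<lambda>\<xi>. f \<xi> $ i)) W"
    by (rule cong[OF Suc.IH[of "Dv f"]]) (use Suc.prems da in \<open>auto simp: Dv_nth\<close>)
  ultimately show ?case by simp
qed

text \<open>Differentiating \<open>E = G\<close> and \<open>F = 0\<close> shows that the Laplacian of
  \<open>Y\<close> is orthogonal to both tangent vectors, so it equals its normal part, and in
  conformal coordinates this is a multiple of the mean curvature vector.\<close>

lemma conformal_minimal_harmonic:
  assumes Y: "conformal_minimal_immersion_on Y W" and W: "open W" and z: "\<zeta> \<in> W"
  shows "Du (Du Y) \<zeta> + Dv (Dv Y) \<zeta> = 0" "Du (Dv Y) \<zeta> = Dv (Du Y) \<zeta>"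
    "Du Y \<zeta> \<bullet> Du Y \<zeta> = Dv Y \<zeta> \<bullet> Dv Y \<zeta>" "Du Y \<zeta> \<bullet> Dv Y \<zeta> = 0" "Du Y \<zeta> \<noteq> 0"
    "Y differentiable at \<zeta>" "Du Y differentiable at \<zeta>" "Dv Y differentiable at \<zeta>"
proof -
  have C2: "Ck_on 2 Y W" using Y unfolding conformal_minimal_immersion_on_def smooth_on_def by blast
  then have dW: "Y differentiable_on W" "Du Y differentiable_on W" "Dv Y differentiable_on W" by (auto simp: numeral_2_eq_2)
  have dd: "Y differentiable at x" "Du Y differentiable at x" "Dv Y differentiable at x" if "x \<in> W" for x
    using dW W that by (auto simp: differentiable_on_eq_differentiable_at)
  note d = dd[OF z]
  let ?a = "Du Y" and ?b = "Dv Y"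
  have EG: "?a x \<bullet> ?a x = ?b x \<bullet> ?b x" and F: "?a x \<bullet> ?b x = 0" and det: "fff_det Y x \<noteq> 0" if "x \<in> W" for x
    using Y that unfolding conformal_minimal_immersion_on_def fff_E_def fff_F_def fff_G_def by auto
  show 3: "?a \<zeta> \<bullet> ?a \<zeta> = ?b \<zeta> \<bullet> ?b \<zeta>" "?a \<zeta> \<bullet> ?b \<zeta> = 0" using EG F z by auto
  show a0: "?a \<zeta> \<noteq> 0" using det[OF z] 3 unfolding fff_det_def fff_E_def fff_F_def fff_G_def by auto
  then have b0: "?b \<zeta> \<noteq> 0" using 3 by (metis inner_eq_zero_iff)
  show sym: "Du (Dv Y) \<zeta> = Dv (Du Y) \<zeta>"
  proof (rule vec_eq_iff[THEN iffD2], rule allI)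
    fix i
    have "Du (Dv (\<lambda>\<xi>. Y \<xi> $ i)) \<zeta> = Dv (Du (\<lambda>\<xi>. Y \<xi> $ i)) \<zeta>"
      by (rule mixed_partials[OF W z Ck_on_nth[OF W C2]])
    moreover have "Du (Dv (\<lambda>\<xi>. Y \<xi> $ i)) \<zeta> = Du (\<lambda>\<xi>. Dv Y \<xi> $ i) \<zeta>"
      by (rule Du_local(1)[OF W z]) (simp add: Dv_nth dd)
    moreover have "Dv (Du (\<lambda>\<xi>. Y \<xi> $ i)) \<zeta> = Dv (\<lambda>\<xi>. Du Y \<xi> $ i) \<zeta>"
      by (rule Du_local(2)[OF W z]) (simp add: Du_nth dd)
    ultimately show "Du (Dv Y) \<zeta> $ i = Dv (Du Y) \<zeta> $ i" using d by (simp add: Du_nth Dv_nth)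
  qed
  have eqs: "?a \<zeta> \<bullet> Du ?a \<zeta> = ?b \<zeta> \<bullet> Du ?b \<zeta>" "?a \<zeta> \<bullet> Dv ?a \<zeta> = ?b \<zeta> \<bullet> Dv ?b \<zeta>"
    "?a \<zeta> \<bullet> Du ?b \<zeta> + Du ?a \<zeta> \<bullet> ?b \<zeta> = 0" "?a \<zeta> \<bullet> Dv ?b \<zeta> + Dv ?a \<zeta> \<bullet> ?b \<zeta> = 0"
  proof -
    have "Du (\<lambda>x. ?a x \<bullet> ?a x) \<zeta> = Du (\<lambda>x. ?b x \<bullet> ?b x) \<zeta>" "Dv (\<lambda>x. ?a x \<bullet> ?a x) \<zeta> = Dv (\<lambda>x. ?b x \<bullet> ?b x) \<zeta>"
      by (rule Du_local[OF W z], simp add: EG)+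
    then show "?a \<zeta> \<bullet> Du ?a \<zeta> = ?b \<zeta> \<bullet> Du ?b \<zeta>" "?a \<zeta> \<bullet> Dv ?a \<zeta> = ?b \<zeta> \<bullet> Dv ?b \<zeta>"
      using d by (simp_all add: Du_inner Dv_inner inner_commute)
    have "Du (\<lambda>x. ?a x \<bullet> ?b x) \<zeta> = Du (\<lambda>x. 0) \<zeta>" "Dv (\<lambda>x. ?a x \<bullet> ?b x) \<zeta> = Dv (\<lambda>x. 0::real) \<zeta>"
      by (rule Du_local[OF W z], simp add: F)+
    then show "?a \<zeta> \<bullet> Du ?b \<zeta> + Du ?a \<zeta> \<bullet> ?b \<zeta> = 0" "?a \<zeta> \<bullet> Dv ?b \<zeta> + Dv ?a \<zeta> \<bullet> ?b \<zeta> = 0"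
      using d Du_eq[OF has_derivative_const, of "0::real" \<zeta>] Dv_eq[OF has_derivative_const, of "0::real" \<zeta>] by (simp_all add: Du_inner Dv_inner)
  qed
  let ?L = "Du ?a \<zeta> + Dv ?b \<zeta>"
  have "?a \<zeta> \<bullet> ?L = 0" using eqs sym by (simp add: inner_add_right inner_commute)
  then have La: "?L \<bullet> ?a \<zeta> = 0" by (simp add: inner_commute)
  have "?b \<zeta> \<bullet> ?L = 0" using eqs sym by (simp add: inner_add_right inner_commute)
  then have Lb: "?L \<bullet> ?b \<zeta> = 0" by (simp add: inner_commute)
  have "mean_curvature_vector Y \<zeta> = 0" using Y z unfolding conformal_minimal_immersion_on_def by auto
  then have "fff_G Y \<zeta> *\<^sub>R normal_part Y \<zeta> (Du ?a \<zeta>) + fff_E Y \<zeta> *\<^sub>R normal_part Y \<zeta> (Dv ?b \<zeta>) = 0"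
    using det[OF z] F[OF z] unfolding mean_curvature_vector_def fff_F_def by simp
  then have "fff_E Y \<zeta> *\<^sub>R (normal_part Y \<zeta> (Du ?a \<zeta>) + normal_part Y \<zeta> (Dv ?b \<zeta>)) = 0"
    using 3(1) unfolding fff_E_def fff_G_def by (simp add: scaleR_add_right)
  then have "normal_part Y \<zeta> (Du ?a \<zeta>) + normal_part Y \<zeta> (Dv ?b \<zeta>) = 0" using a0 by (simp add: fff_E_def)
  moreover have "normal_part Y \<zeta> (Du ?a \<zeta>) + normal_part Y \<zeta> (Dv ?b \<zeta>) = ?L - ((?L \<bullet> ?a \<zeta>) / (?a \<zeta> \<bullet> ?a \<zeta>)) *\<^sub>R ?a \<zeta> - ((?L \<bullet> ?b \<zeta>) / (?b \<zeta> \<bullet> ?b \<zeta>)) *\<^sub>R ?b \<zeta>"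
    unfolding normal_part_orthogonal_frame[OF 3(2) a0 b0] by (simp add: inner_add_left add_divide_distrib scaleR_add_left)
  ultimately show "?L = 0" using La Lb by simp
  show "Y differentiable at \<zeta>" "Du Y differentiable at \<zeta>" "Dv Y differentiable at \<zeta>" by (rule dd[OF z])+
qed

text \<open>Harmonicity gives holomorphic \<open>\<phi>\<^sub>i\<close>, conformality gives \<open>\<Sum>
  \<phi>\<^sub>i\<^sup>2 = 0\<close>, and immersion gives that they have no common zero.\<close>

lemma weierstrass_data:
  assumes Y: "conformal_minimal_immersion_on Y W" and W: "open W"
  shows "phi Y i holomorphic_on W"
    and "\<zeta> \<in> W \<Longrightarrow> ((\<lambda>\<xi>. Y \<xi> $ i) has_derivative (\<lambda>v. Re (2 * phi Y i \<zeta> * v))) (at \<zeta>)"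
    and "\<zeta> \<in> W \<Longrightarrow> (\<Sum>i\<in>UNIV. (phi Y i \<zeta>)\<^sup>2) = 0" and "\<zeta> \<in> W \<Longrightarrow> \<exists>i. phi Y i \<zeta> \<noteq> 0"
proof -
  note H = conformal_minimal_harmonic[OF Y W]
  have ph: "phi Y i \<zeta> = (of_real (Du Y \<zeta> $ i) - \<i> * of_real (Dv Y \<zeta> $ i)) / 2" if "\<zeta> \<in> W" for \<zeta> i
    unfolding phi_def using H(6)[OF that] by (simp add: Du_nth Dv_nth)
  show "((\<lambda>\<xi>. Y \<xi> $ i) has_derivative (\<lambda>v. Re (2 * phi Y i \<zeta> * v))) (at \<zeta>)" if "\<zeta> \<in> W"
    using bounded_linear.has_derivative[OF bounded_linear_vec_nth derivative_Du_Dv[OF H(6)[OF that]], of i]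
    by (rule has_derivative_eq_rhs) (simp add: ph[OF that] fun_eq_iff algebra_simps)
  show "(\<Sum>i\<in>UNIV. (phi Y i \<zeta>)\<^sup>2) = 0" if z: "\<zeta> \<in> W"
  proof -
    have "(\<Sum>i\<in>UNIV. (phi Y i \<zeta>)\<^sup>2) = (\<Sum>i\<in>UNIV. of_real ((Du Y \<zeta> $ i * Du Y \<zeta> $ i - Dv Y \<zeta> $ i * Dv Y \<zeta> $ i) / 4) - \<i> * of_real (Du Y \<zeta> $ i * Dv Y \<zeta> $ i / 2))"
      by (intro sum.cong refl) (simp add: ph[OF z] power2_eq_square field_simps)
    also have "\<dots> = of_real ((Du Y \<zeta> \<bullet> Du Y \<zeta> - Dv Y \<zeta> \<bullet> Dv Y \<zeta>) / 4) - \<i> * of_real (Du Y \<zeta> \<bullet> Dv Y \<zeta> / 2)"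
      unfolding inner_vec_def by (simp add: sum_subtractf sum_distrib_left sum_divide_distrib diff_divide_distrib)
    finally show ?thesis using H(3,4)[OF z] by simp
  qed
  show "\<exists>i. phi Y i \<zeta> \<noteq> 0" if z: "\<zeta> \<in> W"
  proof -
    obtain i where "Du Y \<zeta> $ i \<noteq> 0" using H(5)[OF z] by (auto simp: vec_eq_iff)
    then have "Re (2 * phi Y i \<zeta>) \<noteq> 0" by (simp add: ph[OF z])
    then show ?thesis by (intro exI[of _ i]) auto
  qed
  show "phi Y i holomorphic_on W"
  proof -
    define f where "f \<xi> = (complex_of_real (Du Y \<xi> $ i) - \<i> * of_real (Dv Y \<xi> $ i)) / 2" for \<xi>
    have "f field_differentiable at z" if z: "z \<in> W" for z
    proof -
      have a: "((\<lambda>\<xi>. Du Y \<xi> $ i) has_derivative (\<lambda>v. (Re v *\<^sub>R Du (Du Y) z + Im v *\<^sub>R Dv (Du Y) z) $ i)) (at z)"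
        using bounded_linear.has_derivative[OF bounded_linear_vec_nth derivative_Du_Dv[OF H(7)[OF z]]] .
      have b: "((\<lambda>\<xi>. Dv Y \<xi> $ i) has_derivative (\<lambda>v. (Re v *\<^sub>R Du (Dv Y) z + Im v *\<^sub>R Dv (Dv Y) z) $ i)) (at z)"
        using bounded_linear.has_derivative[OF bounded_linear_vec_nth derivative_Du_Dv[OF H(8)[OF z]]] .
      have L: "Dv (Dv Y) z = - Du (Du Y) z" using H(1)[OF z] by (simp add: add_eq_0_iff)
      have "(f has_derivative (\<lambda>v. (of_real (Du (Du Y) z $ i) - \<i> * of_real (Du (Dv Y) z $ i)) / 2 * v)) (at z)"
        unfolding f_def
        by (rule derivative_eq_intros bounded_linear.has_derivative[OF bounded_linear_of_real] a b refl)+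
          (auto simp: fun_eq_iff L H(2)[OF z, symmetric] complex_eq_iff field_simps)
      then show ?thesis unfolding field_differentiable_def has_field_derivative_def by blast
    qed
    then have "f holomorphic_on W" using W by (auto simp: holomorphic_on_def intro: field_differentiable_at_within)
    then show ?thesis by (rule holomorphic_transform) (simp add: f_def ph)
  qed
qed

section \<open>A minimal surface in the charts of its compactification\<close>

text \<open>A biholomorphic change of coordinates maps punctured neighbourhoods to punctured neighbourhoods.\<close>

lemma filterlim_holomorphic_change:
  assumes T: "\<tau> holomorphic_on W" "open W" "inj_on \<tau> W" "z \<in> W"
  shows "filterlim (\<lambda>\<zeta>. q (\<tau> \<zeta>)) F (at z) \<longleftrightarrow> filterlim q F (at (\<tau> z))"
proof -
  obtain g where g: "g holomorphic_on (\<tau> ` W)" "\<And>z. z \<in> W \<Longrightarrow> g (\<tau> z) = z"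
    using holomorphic_has_inverse[OF T(1-3)] by metis
  have o: "open (\<tau> ` W)" by (rule open_mapping_thm3[OF T(1-3)])
  have tz: "\<tau> z \<in> \<tau> ` W" using T(4) by blast
  have ct: "isCont \<tau> z" using T by (meson continuous_on_eq_continuous_at holomorphic_on_imp_continuous_on)
  have cg: "isCont g (\<tau> z)" using g(1) o tz by (meson continuous_on_eq_continuous_at holomorphic_on_imp_continuous_on)
  have ev: "\<forall>\<^sub>F \<zeta> in at z. \<zeta> \<in> W" using T(2,4) by (simp add: eventually_at_in_open')
  have ev': "\<forall>\<^sub>F \<zeta> in at (\<tau> z). \<zeta> \<in> \<tau> ` W" using o tz by (simp add: eventually_at_in_open')
  have f1: "filterlim \<tau> (at (\<tau> z)) (at z)"
  proof (rule filterlim_atI)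
    show "(\<tau> \<longlongrightarrow> \<tau> z) (at z)" using ct by (simp add: isCont_def)
    show "\<forall>\<^sub>F \<zeta> in at z. \<tau> \<zeta> \<noteq> \<tau> z"
      using eventually_conj[OF ev eventually_neq_at_within[of z z UNIV]] by (rule eventually_mono) (use inj_onD[OF T(3)] T(4) in blast)
  qed
  have f2: "filterlim g (at z) (at (\<tau> z))"
  proof (rule filterlim_atI)
    show "(g \<longlongrightarrow> z) (at (\<tau> z))" using cg g(2)[OF T(4)] by (simp add: isCont_def)
    show "\<forall>\<^sub>F \<zeta> in at (\<tau> z). g \<zeta> \<noteq> z"
      using eventually_conj[OF ev' eventually_neq_at_within[of "\<tau> z" "\<tau> z" UNIV]] by (rule eventually_mono) (use g(2) in force)
  qed
  show ?thesis
  proof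
    assume "filterlim q F (at (\<tau> z))"
    from filterlim_compose[OF this f1] show "filterlim (\<lambda>\<zeta>. q (\<tau> \<zeta>)) F (at z)" .
  next
    assume "filterlim (\<lambda>\<zeta>. q (\<tau> \<zeta>)) F (at z)"
    from filterlim_compose[OF this f2] have "filterlim (\<lambda>x. q (\<tau> (g x))) F (at (\<tau> z))" .
    moreover have "\<forall>\<^sub>F x in at (\<tau> z). q (\<tau> (g x)) = q x" using ev' by (rule eventually_mono) (use g(2) in force)
    ultimately show "filterlim q F (at (\<tau> z))" by (simp cong: filterlim_cong)
  qed
qed

text \<open>The factor \<open>deriv \<tau>\<close> cancels in the quotient of the coefficients of two forms.\<close>

lemma quotient_value_change:
  assumes T: "\<tau> holomorphic_on W" "open W" "inj_on \<tau> W" "z \<in> W"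
    and ab: "\<And>\<zeta>. \<zeta> \<in> W \<Longrightarrow> a \<zeta> = a' (\<tau> \<zeta>) * deriv \<tau> \<zeta>" "\<And>\<zeta>. \<zeta> \<in> W \<Longrightarrow> b \<zeta> = b' (\<tau> \<zeta>) * deriv \<tau> \<zeta>"
  shows "quotient_value a b z = quotient_value a' b' (\<tau> z)"
proof -
  have "\<forall>\<^sub>F \<zeta> in at z. \<zeta> \<in> W" using T(2,4) by (simp add: eventually_at_in_open')
  then have "\<forall>\<^sub>F \<zeta> in at z. a \<zeta> / b \<zeta> = a' (\<tau> \<zeta>) / b' (\<tau> \<zeta>)"
    by (rule eventually_mono) (simp add: ab holomorphic_injective_imp_regular[OF T(1-3)])
  then have "filterlim (\<lambda>\<zeta>. a \<zeta> / b \<zeta>) F (at z) \<longleftrightarrow> filterlim (\<lambda>\<zeta>. a' (\<tau> \<zeta>) / b' (\<tau> \<zeta>)) F (at z)" for F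
    by (intro filterlim_cong refl)
  then have "filterlim (\<lambda>\<zeta>. a \<zeta> / b \<zeta>) F (at z) \<longleftrightarrow> filterlim (\<lambda>\<zeta>. a' \<zeta> / b' \<zeta>) F (at (\<tau> z))" for F
    using filterlim_holomorphic_change[OF T, of "\<lambda>\<zeta>. a' \<zeta> / b' \<zeta>"] by simp
  then have eq: "filterlim (\<lambda>\<zeta>. a \<zeta> / b \<zeta>) F (at z) = filterlim (\<lambda>\<zeta>. a' \<zeta> / b' \<zeta>) F (at (\<tau> z))" for F
    by blast
  have "Lim (at z) (\<lambda>\<zeta>. a \<zeta> / b \<zeta>) = Lim (at (\<tau> z)) (\<lambda>\<zeta>. a' \<zeta> / b' \<zeta>)"
    unfolding Lim_def t2_space_class.Lim_def by (simp only: eq)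
  then show ?thesis unfolding quotient_value_def is_pole_def Let_def by (simp add: eq)
qed

lemma phi_eq_derivative:
  fixes Y :: "complex \<Rightarrow> real^4"
  assumes "((\<lambda>\<xi>. Y \<xi> $ i) has_derivative (\<lambda>v. Re (2 * d * v))) (at \<zeta>)"
  shows "phi Y i \<zeta> = d"
  unfolding phi_def using Du_eq[OF assms] Dv_eq[OF assms] by (simp add: complex_eq_iff)

lemma has_derivative_coordinate_change:
  assumes "(y has_derivative (\<lambda>v. Re (2 * d * v))) (at (\<tau> \<zeta>))" "(\<tau> has_field_derivative \<tau>') (at \<zeta>)"
    "open W" "\<zeta> \<in> W" "\<And>\<xi>. \<xi> \<in> W \<Longrightarrow> y' \<xi> = y (\<tau> \<xi>)"
  shows "(y' has_derivative (\<lambda>v. Re (2 * (d * \<tau>') * v))) (at \<zeta>)"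
proof -
  have "((\<lambda>\<xi>. y (\<tau> \<xi>)) has_derivative (\<lambda>v. Re (2 * d * (\<tau>' * v)))) (at \<zeta>)"
    using has_derivative_compose[OF assms(2)[unfolded has_field_derivative_def] assms(1)] .
  then have "(y' has_derivative (\<lambda>v. Re (2 * d * (\<tau>' * v)))) (at \<zeta>)"
    by (rule has_derivative_transform_within_open[OF _ assms(3,4)]) (simp add: assms(5))
  then show ?thesis by (simp add: mult.assoc)
qed

text \<open>The surface \<open>S\<close> is identified by the biholomorphic map \<open>f\<close> with the
  complement of \<open>P\<close> in \<open>M\<close>, and from here on everything is computed in the
  charts of \<open>M\<close>.\<close>

locale punctured_model =
  fixes S :: "'a csurface" and X :: "'a \<Rightarrow> real^4" and M :: "'b csurface" and P :: "'b set" and f :: "'a \<Rightarrow> 'b"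
  assumes S: "minimal_surface S X" and M: "closed_riemann_surface_genus_0 M"
    and P: "finite P" "P \<subseteq> topspace (surf_top M)"
    and fh: "homeomorphic_map (surf_top S) (subtopology (surf_top M) (topspace (surf_top M) - P)) f"
    and fholo: "\<And>k c. k \<in> charts S \<Longrightarrow> c \<in> charts M \<Longrightarrow>
       (\<lambda>\<zeta>. snd c (f (inv_into (fst k) (snd k) \<zeta>))) holomorphic_on snd k ` (fst k \<inter> f -` (fst c - P))"
begin

definition e where "e = inv_into (topspace (surf_top S)) f"
definition D where "D c = snd c ` (fst c - P)" for c :: "'b set \<times> ('b \<Rightarrow> complex)"
definition Y where "Y c \<zeta> = X (e (inv_into (fst c) (snd c) \<zeta>))" for c :: "'b set \<times> ('b \<Rightarrow> complex)"

lemma RS: "riemann_surface S" and RM: "riemann_surface M"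
  using S M unfolding minimal_surface_def closed_riemann_surface_genus_0_def by auto

lemma Hausdorff: "Hausdorff_space (surf_top M)"
  using RM unfolding riemann_surface_def by blast

lemma top_sub: "topspace (subtopology (surf_top M) (topspace (surf_top M) - P)) = topspace (surf_top M) - P"
  by auto

lemma f_inj: "inj_on f (topspace (surf_top S))" and f_img: "f ` topspace (surf_top S) = topspace (surf_top M) - P"
  using homeomorphic_imp_injective_map[OF fh] homeomorphic_imp_surjective_map[OF fh] unfolding top_sub by simp_all

lemma ef: "s \<in> topspace (surf_top S) \<Longrightarrow> e (f s) = s"
  unfolding e_def using f_inj by (rule inv_into_f_f)

lemma fe: "a \<in> topspace (surf_top M) - P \<Longrightarrow> f (e a) = a" "a \<in> topspace (surf_top M) - P \<Longrightarrow> e a \<in> topspace (surf_top S)"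
  unfolding e_def using f_img by (auto intro: f_inv_into_f inv_into_into)

lemma f_cont: "continuous_map (surf_top S) (surf_top M) f"
  using homeomorphic_imp_continuous_map[OF fh] continuous_map_into_fulltopology by blast

lemma e_cont: "continuous_map (subtopology (surf_top M) (topspace (surf_top M) - P)) (surf_top S) e"
proof -
  obtain g where g: "homeomorphic_maps (surf_top S) (subtopology (surf_top M) (topspace (surf_top M) - P)) f g"
    using fh unfolding homeomorphic_map_maps by blast
  then have "continuous_map (subtopology (surf_top M) (topspace (surf_top M) - P)) (surf_top S) g"
    by (simp add: homeomorphic_maps_def)
  moreover have "g a = e a" if "a \<in> topspace (surf_top M) - P" for a
    using g that fe[OF that] ef unfolding homeomorphic_maps_def by (metis top_sub)
  ultimately show ?thesis by (rule continuous_map_eq) (simp add: top_sub)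
qed

lemma P_closed: "openin (surf_top M) U \<Longrightarrow> openin (surf_top M) (U - P)"
  using P Hausdorff closedin_Hausdorff_finite[of "surf_top M" P] openin_diff by blast

lemma D_open: "c \<in> charts M \<Longrightarrow> open (D c)"
  unfolding D_def using chart_open_image[OF RM] P_closed chart_open[OF RM] by (metis Diff_subset)

lemma chart_mem: "c \<in> charts M \<Longrightarrow> a \<in> fst c \<Longrightarrow> a \<in> topspace (surf_top M)"
  using chart_sub[OF RM] by blast

text \<open>The transition from a chart of \<open>M\<close> to a chart of \<open>S\<close> is the inverse of
  the injective holomorphic expression of \<open>f\<close>.\<close>

lemma pullback_chart:
  assumes c: "c \<in> charts M" and a: "a \<in> fst c - P" and k: "k \<in> charts S" "e a \<in> fst k"
  obtains W \<tau> where "open W" "snd c a \<in> W" "W \<subseteq> D c" "\<tau> holomorphic_on W" "inj_on \<tau> W" "\<tau> ` W \<subseteq> snd k ` fst k"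
    "\<tau> (snd c a) = snd k (e a)" "\<And>\<zeta>. \<zeta> \<in> W \<Longrightarrow> Y c \<zeta> = local_rep X k (\<tau> \<zeta>)"
proof -
  define A where "A = fst k \<inter> f -` (fst c - P)"
  have kt: "fst k \<subseteq> topspace (surf_top S)" by (rule chart_sub[OF RS k(1)])
  have at: "a \<in> topspace (surf_top M) - P" using chart_mem[OF c] a by blast
  have Ao: "openin (surf_top S) A"
  proof -
    have "openin (surf_top S) {s \<in> topspace (surf_top S). f s \<in> fst c - P}"
      by (rule openin_continuous_map_preimage[OF f_cont P_closed[OF chart_open[OF RM c]]])
    then have "openin (surf_top S) (fst k \<inter> {s \<in> topspace (surf_top S). f s \<in> fst c - P})"
      using chart_open[OF RS k(1)] by blast
    moreover have "fst k \<inter> {s \<in> topspace (surf_top S). f s \<in> fst c - P} = A" unfolding A_def using kt by auto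
    ultimately show ?thesis by simp
  qed
  define \<theta> where "\<theta> \<zeta> = snd c (f (inv_into (fst k) (snd k) \<zeta>))" for \<zeta>
  have \<theta>s: "\<theta> (snd k s) = snd c (f s)" if "s \<in> A" for s
    using that chart_inv[OF RS k(1)] unfolding \<theta>_def A_def by simp
  have \<theta>h: "\<theta> holomorphic_on snd k ` A" unfolding \<theta>_def[abs_def] A_def by (rule fholo[OF k(1) c])
  have Ao': "open (snd k ` A)" by (rule chart_open_image[OF RS k(1) Ao]) (simp add: A_def)
  have \<theta>i: "inj_on \<theta> (snd k ` A)"
  proof (rule inj_onI)
    fix x y assume "x \<in> snd k ` A" "y \<in> snd k ` A" "\<theta> x = \<theta> y"
    then obtain s t where st: "s \<in> A" "t \<in> A" "x = snd k s" "y = snd k t" "snd c (f s) = snd c (f t)" using \<theta>s by auto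
    then have "f s = f t" using inj_onD[OF chart_inj[OF RM c]] unfolding A_def by blast
    then have "s = t" using inj_onD[OF f_inj] st kt unfolding A_def by blast
    then show "x = y" using st by simp
  qed
  obtain g where g: "g holomorphic_on \<theta> ` snd k ` A" "\<And>z. z \<in> snd k ` A \<Longrightarrow> g (\<theta> z) = z"
    using holomorphic_has_inverse[OF \<theta>h Ao' \<theta>i] by metis
  have ea: "e a \<in> A" using k(2) fe(1)[OF at] a unfolding A_def by simp
  have gs: "g (snd c (f s)) = snd k s" if "s \<in> A" for s using g(2)[of "snd k s"] \<theta>s[OF that] that by auto
  have W: "\<theta> ` snd k ` A = (\<lambda>s. snd c (f s)) ` A" using \<theta>s by (force simp: image_image)
  show ?thesis
  proof (rule that[of "\<theta> ` snd k ` A" g])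
    show "open (\<theta> ` snd k ` A)" by (rule open_mapping_thm3[OF \<theta>h Ao' \<theta>i])
    show "snd c a \<in> \<theta> ` snd k ` A" unfolding W using ea fe(1)[OF at] by (metis imageI)
    show "\<theta> ` snd k ` A \<subseteq> D c" unfolding W unfolding D_def A_def by auto
    show "inj_on g (\<theta> ` snd k ` A)" using g(2) by (intro inj_on_inverseI[of _ \<theta>]) auto
    show "g ` \<theta> ` snd k ` A \<subseteq> snd k ` fst k" using g(2) unfolding A_def by auto
    show "g (snd c a) = snd k (e a)" using gs[OF ea] fe(1)[OF at] by simp
    fix \<zeta> assume "\<zeta> \<in> \<theta> ` snd k ` A"
    then obtain s where s: "s \<in> A" "\<zeta> = snd c (f s)" unfolding W by blast
    have "inv_into (fst c) (snd c) \<zeta> = f s" using s chart_inv[OF RM c] unfolding A_def by simp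
    moreover have "e (f s) = s" using s kt ef unfolding A_def by blast
    ultimately show "Y c \<zeta> = local_rep X k (g \<zeta>)"
      unfolding Y_def local_rep_def using s gs[OF s(1)] chart_inv[OF RS k(1), of s] unfolding A_def by simp
  qed (use g in auto)
qed

lemma chart_at_S: "s \<in> topspace (surf_top S) \<Longrightarrow> chart_at S s \<in> charts S \<and> s \<in> fst (chart_at S s)"
  unfolding chart_at_def using charts_cover[OF RS, of s] by (intro someI_ex[of "\<lambda>c. c \<in> charts S \<and> s \<in> fst c"]) blast

lemma local_minimal: "k \<in> charts S \<Longrightarrow> conformal_minimal_immersion_on (local_rep X k) (snd k ` fst k)"
  using S unfolding minimal_surface_def case_prod_beta by simp

lemma pullback_phi:
  assumes c: "c \<in> charts M" and a: "a \<in> fst c - P" and k: "k \<in> charts S" "e a \<in> fst k"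
  obtains W \<tau> where "open W" "snd c a \<in> W" "W \<subseteq> D c" "\<tau> holomorphic_on W" "inj_on \<tau> W" "\<tau> ` W \<subseteq> snd k ` fst k"
    "\<tau> (snd c a) = snd k (e a)"
    "\<And>\<zeta> i. \<zeta> \<in> W \<Longrightarrow> phi (Y c) i \<zeta> = phi (local_rep X k) i (\<tau> \<zeta>) * deriv \<tau> \<zeta>"
    "\<And>\<zeta> i. \<zeta> \<in> W \<Longrightarrow> ((\<lambda>\<xi>. Y c \<xi> $ i) has_derivative (\<lambda>v. Re (2 * phi (Y c) i \<zeta> * v))) (at \<zeta>)"
proof -
  obtain W \<tau> where W: "open W" "snd c a \<in> W" "W \<subseteq> D c" "\<tau> holomorphic_on W" "inj_on \<tau> W" "\<tau> ` W \<subseteq> snd k ` fst k"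
    "\<tau> (snd c a) = snd k (e a)" and YW: "\<And>\<zeta>. \<zeta> \<in> W \<Longrightarrow> Y c \<zeta> = local_rep X k (\<tau> \<zeta>)"
    by (rule pullback_chart[OF assms]) (rule that)
  have d: "((\<lambda>\<xi>. Y c \<xi> $ i) has_derivative (\<lambda>v. Re (2 * (phi (local_rep X k) i (\<tau> \<zeta>) * deriv \<tau> \<zeta>) * v))) (at \<zeta>)" if "\<zeta> \<in> W" for \<zeta> i
  proof (rule has_derivative_coordinate_change[OF _ _ W(1) that])
    show "((\<lambda>\<xi>. local_rep X k \<xi> $ i) has_derivative (\<lambda>v. Re (2 * phi (local_rep X k) i (\<tau> \<zeta>) * v))) (at (\<tau> \<zeta>))"
      using weierstrass_data(2)[OF local_minimal[OF k(1)] chart_image_open[OF RS k(1)]] W(6) that by blast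
    show "(\<tau> has_field_derivative deriv \<tau> \<zeta>) (at \<zeta>)" by (rule holomorphic_derivI[OF W(4,1) that])
  qed (simp add: YW)
  have p: "phi (Y c) i \<zeta> = phi (local_rep X k) i (\<tau> \<zeta>) * deriv \<tau> \<zeta>" if "\<zeta> \<in> W" for \<zeta> i
    by (rule phi_eq_derivative[OF d[OF that]])
  show ?thesis by (rule that[OF W p]) (use d p in auto)
qed

lemma D_cases:
  assumes c: "c \<in> charts M" and z: "\<zeta> \<in> D c"
  obtains a where "a \<in> fst c - P" "\<zeta> = snd c a" "chart_at S (e a) \<in> charts S" "e a \<in> fst (chart_at S (e a))"
proof -
  obtain a where a: "a \<in> fst c - P" "\<zeta> = snd c a" using z unfolding D_def by blast
  then have "e a \<in> topspace (surf_top S)" using fe(2)[of a] chart_mem[OF c] by blast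
  from chart_at_S[OF this] show ?thesis using that a by blast
qed

lemma Phi_holomorphic: assumes c: "c \<in> charts M" shows "phi (Y c) i holomorphic_on D c"
proof -
  have "phi (Y c) i field_differentiable at \<zeta>" if z: "\<zeta> \<in> D c" for \<zeta>
  proof -
    obtain a where a: "a \<in> fst c - P" "\<zeta> = snd c a" and k: "chart_at S (e a) \<in> charts S" "e a \<in> fst (chart_at S (e a))"
      by (rule D_cases[OF c z])
    let ?k = "chart_at S (e a)"
    obtain W \<tau> where W: "open W" "snd c a \<in> W" "\<tau> holomorphic_on W" "\<tau> ` W \<subseteq> snd ?k ` fst ?k"
      "\<And>\<zeta>. \<zeta> \<in> W \<Longrightarrow> phi (Y c) i \<zeta> = phi (local_rep X ?k) i (\<tau> \<zeta>) * deriv \<tau> \<zeta>"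
      using pullback_phi[OF c a(1) k] by metis
    have "phi (local_rep X ?k) i holomorphic_on snd ?k ` fst ?k"
      by (rule weierstrass_data(1)[OF local_minimal[OF k(1)] chart_image_open[OF RS k(1)]])
    from holomorphic_on_compose_gen[OF W(3) this W(4)] holomorphic_deriv[OF W(3,1)]
    have "(\<lambda>\<zeta>. phi (local_rep X ?k) i (\<tau> \<zeta>) * deriv \<tau> \<zeta>) holomorphic_on W" unfolding o_def by (rule holomorphic_on_mult)
    then have "phi (Y c) i holomorphic_on W" by (rule holomorphic_transform) (simp add: W(5))
    then show ?thesis using W(1,2) a(2) holomorphic_on_imp_differentiable_at by blast
  qed
  then show ?thesis by (auto simp: holomorphic_on_def intro: field_differentiable_at_within)
qed

lemma Y_derivative:
  assumes c: "c \<in> charts M" and z: "\<zeta> \<in> D c"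
  shows "((\<lambda>\<xi>. Y c \<xi> $ i) has_derivative (\<lambda>v. Re (2 * phi (Y c) i \<zeta> * v))) (at \<zeta>)"
proof -
  obtain a where a: "a \<in> fst c - P" "\<zeta> = snd c a" and k: "chart_at S (e a) \<in> charts S" "e a \<in> fst (chart_at S (e a))"
    by (rule D_cases[OF c z])
  show ?thesis using pullback_phi[OF c a(1) k] a(2) by metis
qed

lemma Phi_isotropic:
  assumes c: "c \<in> charts M" and z: "\<zeta> \<in> D c"
  shows "(\<Sum>i\<in>UNIV. (phi (Y c) i \<zeta>)\<^sup>2) = 0" "\<exists>i. phi (Y c) i \<zeta> \<noteq> 0"
proof -
  obtain a where a: "a \<in> fst c - P" "\<zeta> = snd c a" and k: "chart_at S (e a) \<in> charts S" "e a \<in> fst (chart_at S (e a))"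
    by (rule D_cases[OF c z])
  let ?k = "chart_at S (e a)"
  obtain W \<tau> where W: "open W" "snd c a \<in> W" "\<tau> holomorphic_on W" "inj_on \<tau> W" "\<tau> ` W \<subseteq> snd ?k ` fst ?k"
    "\<And>\<zeta> i. \<zeta> \<in> W \<Longrightarrow> phi (Y c) i \<zeta> = phi (local_rep X ?k) i (\<tau> \<zeta>) * deriv \<tau> \<zeta>"
    using pullback_phi[OF c a(1) k] by metis
  have t: "\<tau> \<zeta> \<in> snd ?k ` fst ?k" "\<zeta> \<in> W" using W(2,5) a(2) by auto
  note w = weierstrass_data(3,4)[OF local_minimal[OF k(1)] chart_image_open[OF RS k(1)] t(1)]
  have "(\<Sum>i\<in>UNIV. (phi (Y c) i \<zeta>)\<^sup>2) = (\<Sum>i\<in>UNIV. (phi (local_rep X ?k) i (\<tau> \<zeta>))\<^sup>2) * (deriv \<tau> \<zeta>)\<^sup>2"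
    by (simp add: W(6)[OF t(2)] power_mult_distrib sum_distrib_right)
  then show "(\<Sum>i\<in>UNIV. (phi (Y c) i \<zeta>)\<^sup>2) = 0" using w(1) by simp
  show "\<exists>i. phi (Y c) i \<zeta> \<noteq> 0" using w(2) W(6)[OF t(2)] holomorphic_injective_imp_regular[OF W(3,1,4) t(2)] by auto
qed

text \<open>In these terms \<open>g\<^sub>1 = A1 / B\<close> and \<open>g\<^sub>2 = A2 / B\<close>. The
  function \<open>C\<close> completes them to a basis, in which isotropy becomes \<open>B C = A1
  A2\<close>.\<close>

definition A1 where "A1 c \<zeta> = phi (Y c) 3 \<zeta> + \<i> * phi (Y c) 4 \<zeta>" for c \<zeta>
definition A2 where "A2 c \<zeta> = - phi (Y c) 3 \<zeta> + \<i> * phi (Y c) 4 \<zeta>" for c \<zeta>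
definition B where "B c \<zeta> = phi (Y c) 1 \<zeta> - \<i> * phi (Y c) 2 \<zeta>" for c \<zeta>
definition C where "C c \<zeta> = phi (Y c) 1 \<zeta> + \<i> * phi (Y c) 2 \<zeta>" for c \<zeta>

lemma ABC_holomorphic: "c \<in> charts M \<Longrightarrow> A1 c holomorphic_on D c" "c \<in> charts M \<Longrightarrow> A2 c holomorphic_on D c"
  "c \<in> charts M \<Longrightarrow> B c holomorphic_on D c" "c \<in> charts M \<Longrightarrow> C c holomorphic_on D c"
  unfolding A1_def[abs_def] A2_def[abs_def] B_def[abs_def] C_def[abs_def] by (intro holomorphic_intros Phi_holomorphic; assumption)+

lemma BC_eq:
  assumes "c \<in> charts M" "\<zeta> \<in> D c"
  shows "B c \<zeta> * C c \<zeta> = A1 c \<zeta> * A2 c \<zeta>" "A1 c \<zeta> \<noteq> 0 \<or> A2 c \<zeta> \<noteq> 0 \<or> B c \<zeta> \<noteq> 0 \<or> C c \<zeta> \<noteq> 0"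
proof -
  have "(phi (Y c) 1 \<zeta>)\<^sup>2 + (phi (Y c) 2 \<zeta>)\<^sup>2 + (phi (Y c) 3 \<zeta>)\<^sup>2 + (phi (Y c) 4 \<zeta>)\<^sup>2 = 0"
    using Phi_isotropic(1)[OF assms] by (simp add: sum_4)
  moreover have "B c \<zeta> * C c \<zeta> - A1 c \<zeta> * A2 c \<zeta> = (phi (Y c) 1 \<zeta>)\<^sup>2 + (phi (Y c) 2 \<zeta>)\<^sup>2 + (phi (Y c) 3 \<zeta>)\<^sup>2 + (phi (Y c) 4 \<zeta>)\<^sup>2"
    unfolding A1_def A2_def B_def C_def by (simp add: algebra_simps power2_eq_square)
  ultimately show "B c \<zeta> * C c \<zeta> = A1 c \<zeta> * A2 c \<zeta>" by simp
  show "A1 c \<zeta> \<noteq> 0 \<or> A2 c \<zeta> \<noteq> 0 \<or> B c \<zeta> \<noteq> 0 \<or> C c \<zeta> \<noteq> 0"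
  proof (rule ccontr)
    assume z: "\<not> ?thesis"
    have "2 * phi (Y c) 1 \<zeta> = B c \<zeta> + C c \<zeta>" "2 * \<i> * phi (Y c) 2 \<zeta> = C c \<zeta> - B c \<zeta>"
      "2 * phi (Y c) 3 \<zeta> = A1 c \<zeta> - A2 c \<zeta>" "2 * \<i> * phi (Y c) 4 \<zeta> = A1 c \<zeta> + A2 c \<zeta>"
      unfolding A1_def A2_def B_def C_def by auto
    then have "phi (Y c) i \<zeta> = 0" for i using z exhaust_4[of i] by auto
    then show False using Phi_isotropic(2)[OF assms] by blast
  qed
qed

lemma gauss_pullback:
  assumes c: "c \<in> charts M" and a: "a \<in> fst c - P"
  shows "gauss_map_1 S X (e a) = quotient_value (A1 c) (B c) (snd c a)"
    "gauss_map_2 S X (e a) = quotient_value (A2 c) (B c) (snd c a)"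
proof -
  let ?k = "chart_at S (e a)"
  have "e a \<in> topspace (surf_top S)" using fe(2)[of a] chart_mem[OF c] a by blast
  from chart_at_S[OF this] have k: "?k \<in> charts S" "e a \<in> fst ?k" by auto
  obtain W \<tau> where W: "\<tau> holomorphic_on W" "open W" "inj_on \<tau> W" "snd c a \<in> W" and t: "\<tau> (snd c a) = snd ?k (e a)" 
    and p: "\<And>\<zeta> i. \<zeta> \<in> W \<Longrightarrow> phi (Y c) i \<zeta> = phi (local_rep X ?k) i (\<tau> \<zeta>) * deriv \<tau> \<zeta>"
    using pullback_phi[OF c a(1) k] by metis
  show "gauss_map_1 S X (e a) = quotient_value (A1 c) (B c) (snd c a)"
    unfolding gauss_map_1_def Let_def t[symmetric]
    by (rule quotient_value_change[OF W, symmetric]) (simp_all add: A1_def B_def p algebra_simps)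
  show "gauss_map_2 S X (e a) = quotient_value (A2 c) (B c) (snd c a)"
    unfolding gauss_map_2_def Let_def t[symmetric]
    by (rule quotient_value_change[OF W, symmetric]) (simp_all add: A2_def B_def p algebra_simps)
qed

text \<open>Both coefficients are determined by the derivative of the same function on the surface, so they
  transform like a form.\<close>

lemma Phi_transition:
  assumes c: "c \<in> charts M" "c' \<in> charts M" and a: "a \<in> fst c \<inter> fst c' - P"
  shows "phi (Y c) i (snd c a) = phi (Y c') i (snd c' a) * deriv (\<lambda>\<zeta>. snd c' (inv_into (fst c) (snd c) \<zeta>)) (snd c a)"
proof -
  let ?T = "\<lambda>\<zeta>. snd c' (inv_into (fst c) (snd c) \<zeta>)"
  have T: "?T (snd c x) = snd c' x" if "x \<in> fst c" for x using chart_inv[OF RM c(1) that] by simp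
  have "openin (surf_top M) (fst c \<inter> fst c')" using chart_open[OF RM] c by blast
  then have o: "open (snd c ` (fst c \<inter> fst c' - P))" "open (snd c ` (fst c \<inter> fst c'))"
    by (auto intro!: chart_open_image[OF RM c(1)] P_closed)
  have d: "(?T has_field_derivative deriv ?T (snd c a)) (at (snd c a))"
    by (rule holomorphic_derivI[OF chart_transition[OF RM c] o(2)]) (use a in auto)
  have "((\<lambda>\<xi>. Y c \<xi> $ i) has_derivative (\<lambda>v. Re (2 * (phi (Y c') i (snd c' a) * deriv ?T (snd c a)) * v))) (at (snd c a))"
  proof (rule has_derivative_coordinate_change[OF _ d o(1)])
    show "((\<lambda>\<xi>. Y c' \<xi> $ i) has_derivative (\<lambda>v. Re (2 * phi (Y c') i (snd c' a) * v))) (at (?T (snd c a)))"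
    proof -
      have "snd c' a \<in> D c'" using a unfolding D_def by blast
      moreover have "?T (snd c a) = snd c' a" using T[of a] a by simp
      ultimately show ?thesis using Y_derivative[OF c(2), of "snd c' a" i] by simp
    qed
    fix \<xi> assume "\<xi> \<in> snd c ` (fst c \<inter> fst c' - P)"
    then show "Y c \<xi> $ i = Y c' (?T \<xi>) $ i" using T chart_inv[OF RM c(1)] chart_inv[OF RM c(2)] unfolding Y_def by auto
  qed (use a in auto)
  then show ?thesis by (rule phi_eq_derivative)
qed

end

section \<open>Homogeneous coordinates and the form of three values\<close>

text \<open>For a meromorphic function this is its order at \<open>z\<close>; it also makes sense at an
  essential singularity of a nonvanishing function.\<close>

definition winds_at :: "(complex \<Rightarrow> complex) \<Rightarrow> complex \<Rightarrow> int \<Rightarrow> bool" where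
  "winds_at k z n \<longleftrightarrow> (\<exists>r>0. winds (ball z r - {z}) (\<lambda>\<zeta>. \<zeta> - z) k n)"

lemma winds_at_mult: "winds_at k z m \<Longrightarrow> winds_at l z n \<Longrightarrow> winds_at (\<lambda>\<zeta>. k \<zeta> * l \<zeta>) z (m + n)"
  and winds_at_divide: "winds_at k z m \<Longrightarrow> winds_at l z n \<Longrightarrow> winds_at (\<lambda>\<zeta>. k \<zeta> / l \<zeta>) z (m - n)"
proof -
  assume "winds_at k z m" "winds_at l z n"
  then obtain r s where rs: "r > 0" "winds (ball z r - {z}) (\<lambda>\<zeta>. \<zeta> - z) k m" "s > 0" "winds (ball z s - {z}) (\<lambda>\<zeta>. \<zeta> - z) l n"
    unfolding winds_at_def by blast
  define t where "t = min r s"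
  have t: "t > 0" "winds (ball z t - {z}) (\<lambda>\<zeta>. \<zeta> - z) k m" "winds (ball z t - {z}) (\<lambda>\<zeta>. \<zeta> - z) l n"
    using rs by (auto simp: t_def elim!: winds_subset)
  from winds_mult[OF t(2,3)] winds_divide[OF t(2,3)] t(1)
  show "winds_at (\<lambda>\<zeta>. k \<zeta> * l \<zeta>) z (m + n)" "winds_at (\<lambda>\<zeta>. k \<zeta> / l \<zeta>) z (m - n)"
    unfolding winds_at_def by auto
qed

lemma winds_at_cong: "winds_at k z n \<Longrightarrow> r > 0 \<Longrightarrow> (\<And>\<zeta>. \<zeta> \<in> ball z r - {z} \<Longrightarrow> k \<zeta> = l \<zeta>) \<Longrightarrow> winds_at l z n"
  unfolding winds_at_def
proof (elim exE conjE)
  fix s assume a: "r > 0" "\<And>\<zeta>. \<zeta> \<in> ball z r - {z} \<Longrightarrow> k \<zeta> = l \<zeta>" "s > 0" "winds (ball z s - {z}) (\<lambda>\<zeta>. \<zeta> - z) k n"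
  have "winds (ball z (min r s) - {z}) (\<lambda>\<zeta>. \<zeta> - z) k n" using a(4) by (rule winds_subset) auto
  then have "winds (ball z (min r s) - {z}) (\<lambda>\<zeta>. \<zeta> - z) l n" by (rule winds_cong) (use a in auto)
  then show "\<exists>r>0. winds (ball z r - {z}) (\<lambda>\<zeta>. \<zeta> - z) l n" using a by (intro exI[of _ "min r s"]) auto
qed

lemma winds_at_zero_order:
  assumes "r > 0" "u holomorphic_on ball z r" "u z \<noteq> 0" "\<And>\<zeta>. \<zeta> \<in> ball z r - {z} \<Longrightarrow> k \<zeta> = (\<zeta> - z) ^ n * u \<zeta>"
  shows "winds_at k z (int n)"
proof -
  have "continuous_on (ball z r) u" using assms(2) by (rule holomorphic_on_imp_continuous_on)
  then have "open (ball z r \<inter> u -` (- {0}))" by (intro continuous_open_preimage) auto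
  then obtain s where s: "s > 0" "ball z s \<subseteq> ball z r \<inter> u -` (- {0})"
    using assms(1,3) by (auto elim!: openE[where x = z])
  have "winds (ball z s) (\<lambda>\<zeta>. \<zeta> - z) u 0"
    using s(2) by (intro winds_contractible continuous_on_subset[OF \<open>continuous_on (ball z r) u\<close>]) auto
  then have "winds (ball z s - {z}) (\<lambda>\<zeta>. \<zeta> - z) u 0" by (rule winds_subset) auto
  from winds_mult[OF winds_power_int[OF winds_self, of _ _ "int n"] this]
  have "winds (ball z s - {z}) (\<lambda>\<zeta>. \<zeta> - z) (\<lambda>\<zeta>. (\<zeta> - z) ^ n * u \<zeta>) (int n)" by auto
  then have "winds (ball z s - {z}) (\<lambda>\<zeta>. \<zeta> - z) k (int n)"
  proof (rule winds_cong)
    show "(\<zeta> - z) ^ n * u \<zeta> = k \<zeta>" if "\<zeta> \<in> ball z s - {z}" for \<zeta>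
    proof -
      have "\<zeta> \<in> ball z r - {z}" using that s(2) by blast
      from assms(4)[OF this] show ?thesis by simp
    qed
  qed simp
  then show ?thesis using s(1) unfolding winds_at_def by blast
qed

lemma holomorphic_order:
  assumes "r > 0" "k holomorphic_on ball z r" "\<exists>w\<in>ball z r. k w \<noteq> 0"
  obtains n :: nat and u s where "0 < s" "s \<le> r" "u holomorphic_on ball z s" "\<And>\<zeta>. \<zeta> \<in> ball z s \<Longrightarrow> u \<zeta> \<noteq> 0"
    "\<And>\<zeta>. \<zeta> \<in> ball z s \<Longrightarrow> k \<zeta> = (\<zeta> - z) ^ n * u \<zeta>" "n = 0 \<longleftrightarrow> k z \<noteq> 0"
proof -
  define N where "N = zorder k z"
  define g where "g = zor_poly k z"
  obtain t where N: "if k z = 0 then N > 0 else N = 0" and t: "t > 0" "cball z t \<subseteq> ball z r" "g holomorphic_on cball z t"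
      "\<And>w. w \<in> cball z t \<Longrightarrow> k w = g w * (w - z) ^ nat N \<and> g w \<noteq> 0"
    using zorder_exist_zero[OF assms(2) open_ball connected_ball _ assms(3)] assms(1)
    unfolding N_def g_def by (metis centre_in_ball)
  have "z + of_real t \<in> cball z t" using t(1) by (simp add: dist_norm)
  then have "z + of_real t \<in> ball z r" using t(2) by blast
  then have "t < r" using t(1) by (simp add: dist_norm)
  show ?thesis
  proof (rule that[of t g "nat N"])
    show "g holomorphic_on ball z t" using t(3) ball_subset_cball holomorphic_on_subset by blast
    show "nat N = 0 \<longleftrightarrow> k z \<noteq> 0" using N by (auto split: if_splits)
  qed (use t \<open>t < r\<close> in \<open>auto simp: mult.commute\<close>)
qed

lemma holomorphic_winds_at:
  assumes "r > 0" "k holomorphic_on ball z r" "\<exists>w\<in>ball z r. k w \<noteq> 0"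
  obtains n :: nat where "winds_at k z (int n)" "n = 0 \<longleftrightarrow> k z \<noteq> 0"
proof -
  obtain n :: nat and u s where u: "0 < s" "s \<le> r" "u holomorphic_on ball z s" "\<And>\<zeta>. \<zeta> \<in> ball z s \<Longrightarrow> u \<zeta> \<noteq> 0"
    "\<And>\<zeta>. \<zeta> \<in> ball z s \<Longrightarrow> k \<zeta> = (\<zeta> - z) ^ n * u \<zeta>" "n = 0 \<longleftrightarrow> k z \<noteq> 0"
    by (rule holomorphic_order[OF assms]) (rule that)
  have "winds_at k z (int n)" by (rule winds_at_zero_order[OF u(1,3)]) (use u in auto)
  then show ?thesis using that u(6) by blast
qed

text \<open>The point \<open>[a : b]\<close> of the Riemann sphere.\<close>

definition sph :: "complex \<Rightarrow> complex \<Rightarrow> csphere" where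
  "sph a b = (if b = 0 then None else Some (a / b))"

text \<open>The linear form in \<open>(a, b)\<close> whose zero is the point \<open>v\<close> of the sphere.\<close>

definition ell :: "csphere \<Rightarrow> complex \<Rightarrow> complex \<Rightarrow> complex" where
  "ell v a b = (case v of None \<Rightarrow> b | Some s \<Rightarrow> a - s * b)"

lemma ell_zero_iff: "a \<noteq> 0 \<or> b \<noteq> 0 \<Longrightarrow> ell v a b = 0 \<longleftrightarrow> sph a b = v"
  by (auto simp: ell_def sph_def field_simps split: option.splits)

lemma ell_scale: "ell v (l * a) (l * b) = l * ell v a b"
  by (auto simp: ell_def algebra_simps split: option.splits)

definition wronskian :: "(complex \<Rightarrow> complex) \<Rightarrow> (complex \<Rightarrow> complex) \<Rightarrow> complex \<Rightarrow> complex" where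
  "wronskian a b z = deriv a z * b z - a z * deriv b z"

text \<open>The form \<open>dg / ((g - v\<^sub>1) (g - v\<^sub>2) (g - v\<^sub>3))\<close> for \<open>g = a /
  b\<close>, with a factor \<open>b\<close> left over from homogenizing numerator and denominator to
  degree \<open>3\<close>; unlike that form it can also be used when one of the values is infinity.\<close>

definition omega :: "csphere \<Rightarrow> csphere \<Rightarrow> csphere \<Rightarrow> (complex \<Rightarrow> complex) \<Rightarrow> (complex \<Rightarrow> complex) \<Rightarrow> complex \<Rightarrow> complex" where
  "omega v1 v2 v3 a b z = wronskian a b z * b z / (ell v1 (a z) (b z) * ell v2 (a z) (b z) * ell v3 (a z) (b z))"

lemma wronskian_holomorphic: "a holomorphic_on U \<Longrightarrow> b holomorphic_on U \<Longrightarrow> open U \<Longrightarrow> wronskian a b holomorphic_on U"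
  unfolding wronskian_def[abs_def] by (intro holomorphic_intros)

lemma ell_holomorphic: "a holomorphic_on U \<Longrightarrow> b holomorphic_on U \<Longrightarrow> (\<lambda>z. ell v (a z) (b z)) holomorphic_on U"
  unfolding ell_def by (cases v) (auto intro!: holomorphic_intros)

lemma deriv_local: 
  assumes "open U" "z \<in> U" "\<And>\<zeta>. \<zeta> \<in> U \<Longrightarrow> f \<zeta> = g \<zeta>" shows "deriv f z = deriv g z"
proof (rule deriv_cong_ev)
  show "\<forall>\<^sub>F x in nhds z. f x = g x" unfolding eventually_nhds using assms by blast
qed simp

text \<open>The terms with the derivative of \<open>l\<close> cancel.\<close>

lemma wronskian_scale:
  assumes U: "open U" "z \<in> U" and h: "a holomorphic_on U" "b holomorphic_on U" "l holomorphic_on U"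
    and eq: "\<And>\<zeta>. \<zeta> \<in> U \<Longrightarrow> A \<zeta> = l \<zeta> * a \<zeta>" "\<And>\<zeta>. \<zeta> \<in> U \<Longrightarrow> B \<zeta> = l \<zeta> * b \<zeta>"
  shows "wronskian A B z = (l z)\<^sup>2 * wronskian a b z"
proof -
  have d: "a field_differentiable at z" "b field_differentiable at z" "l field_differentiable at z"
    using U h holomorphic_on_imp_differentiable_at by blast+
  have "deriv A z = deriv (\<lambda>\<zeta>. l \<zeta> * a \<zeta>) z" by (rule deriv_local[OF U]) (rule eq(1))
  moreover have "deriv B z = deriv (\<lambda>\<zeta>. l \<zeta> * b \<zeta>) z" by (rule deriv_local[OF U]) (rule eq(2))
  ultimately show ?thesis
    unfolding wronskian_def using eq[OF U(2)] d by (simp add: deriv_mult algebra_simps power2_eq_square)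
qed

lemma omega_scale:
  assumes U: "open U" "z \<in> U" and h: "a holomorphic_on U" "b holomorphic_on U" "l holomorphic_on U"
    and eq: "\<And>\<zeta>. \<zeta> \<in> U \<Longrightarrow> A \<zeta> = l \<zeta> * a \<zeta>" "\<And>\<zeta>. \<zeta> \<in> U \<Longrightarrow> B \<zeta> = l \<zeta> * b \<zeta>" and nz: "l z \<noteq> 0"
  shows "omega v1 v2 v3 A B z = omega v1 v2 v3 a b z"
proof -
  have w: "wronskian A B z = (l z)\<^sup>2 * wronskian a b z" by (rule wronskian_scale[OF assms(1-7)])
  show ?thesis unfolding omega_def w eq[OF U(2)] ell_scale using nz by (simp add: power2_eq_square)
qed

lemma wronskian_compose:
  assumes T: "T field_differentiable at z" and a: "a field_differentiable at (T z)" and b: "b field_differentiable at (T z)"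
  shows "wronskian (\<lambda>\<zeta>. a (T \<zeta>)) (\<lambda>\<zeta>. b (T \<zeta>)) z = wronskian a b (T z) * deriv T z"
  using deriv_chain[OF T a] deriv_chain[OF T b] unfolding wronskian_def o_def by (simp add: algebra_simps)

text \<open>The value is the limit of \<open>a / b\<close>, which is finite unless \<open>b z = 0\<close>; in
  that case \<open>a z \<noteq> 0\<close> makes it a pole.\<close>

lemma quotient_value_coprime:
  assumes U: "open U" "z \<in> U" and h: "continuous_on U a" "continuous_on U b" and cop: "a z \<noteq> 0 \<or> b z \<noteq> 0"
    and eq: "\<And>\<zeta>. \<zeta> \<in> U - {z} \<Longrightarrow> A \<zeta> * b \<zeta> = B \<zeta> * a \<zeta>" and nz: "\<And>\<zeta>. \<zeta> \<in> U - {z} \<Longrightarrow> B \<zeta> \<noteq> 0 \<and> b \<zeta> \<noteq> 0"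
  shows "quotient_value A B z = sph (a z) (b z)"
proof -
  have ev: "\<forall>\<^sub>F \<zeta> in at z. \<zeta> \<in> U - {z}" using eventually_at_in_open[OF U] .
  then have evq: "\<forall>\<^sub>F \<zeta> in at z. a \<zeta> / b \<zeta> = A \<zeta> / B \<zeta>" by (rule eventually_mono) (use eq nz in \<open>auto simp: field_simps\<close>)
  have la: "(a \<longlongrightarrow> a z) (at z)" and lb: "(b \<longlongrightarrow> b z) (at z)"
    using h U by (auto simp: continuous_on_eq_continuous_at isCont_def)
  show ?thesis
  proof (cases "b z = 0")
    case False
    have "((\<lambda>\<zeta>. a \<zeta> / b \<zeta>) \<longlongrightarrow> a z / b z) (at z)" by (rule tendsto_divide[OF la lb False])
    then have l: "((\<lambda>\<zeta>. A \<zeta> / B \<zeta>) \<longlongrightarrow> a z / b z) (at z)" by (rule Lim_transform_eventually[OF _ evq])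
    then have "\<not> is_pole (\<lambda>\<zeta>. A \<zeta> / B \<zeta>) z"
      unfolding is_pole_def using not_tendsto_and_filterlim_at_infinity[OF _ l] by auto
    moreover have "Lim (at z) (\<lambda>\<zeta>. A \<zeta> / B \<zeta>) = a z / b z" by (rule tendsto_Lim[OF _ l]) simp
    ultimately show ?thesis using False unfolding quotient_value_def sph_def Let_def by simp
  next
    case True
    have "filterlim b (at 0) (at z)"
      using lb True ev nz by (intro filterlim_atI) (auto elim: eventually_mono)
    then have "filterlim (\<lambda>\<zeta>. a \<zeta> / b \<zeta>) at_infinity (at z)"
      using cop True by (intro filterlim_divide_at_infinity[OF la]) auto
    then have "is_pole (\<lambda>\<zeta>. A \<zeta> / B \<zeta>) z" unfolding is_pole_def using filterlim_cong[OF refl refl evq] by blast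
    then show ?thesis using True unfolding quotient_value_def sph_def Let_def by simp
  qed
qed

definition coprime_rep :: "complex \<Rightarrow> real \<Rightarrow> (complex \<Rightarrow> complex) \<Rightarrow> (complex \<Rightarrow> complex) \<Rightarrow> bool" where
  "coprime_rep z r a b \<longleftrightarrow> 0 < r \<and> a holomorphic_on ball z r \<and> b holomorphic_on ball z r \<and> (\<forall>\<zeta>\<in>ball z r. a \<zeta> \<noteq> 0 \<or> b \<zeta> \<noteq> 0)"

lemma coprime_rep_mono: "coprime_rep z r a b \<Longrightarrow> 0 < s \<Longrightarrow> s \<le> r \<Longrightarrow> coprime_rep z s a b"
  unfolding coprime_rep_def by (auto elim: holomorphic_on_subset)

text \<open>Cancel the smaller of the orders of \<open>A\<close> and \<open>B\<close> at \<open>z\<close>.\<close>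

lemma quotient_coprime_rep:
  assumes r: "r > 0" and A: "A holomorphic_on ball z r" and B: "B holomorphic_on ball z r" and nz: "\<exists>w\<in>ball z r. B w \<noteq> 0"
  obtains s a b where "coprime_rep z s a b" "s \<le> r" "\<And>\<zeta>. \<zeta> \<in> ball z s \<Longrightarrow> quotient_value A B \<zeta> = sph (a \<zeta>) (b \<zeta>)"
    "\<And>\<zeta>. \<zeta> \<in> ball z s \<Longrightarrow> A \<zeta> * b \<zeta> = B \<zeta> * a \<zeta>"
proof -
  obtain j :: nat and \<beta> s1 where b: "0 < s1" "s1 \<le> r" "\<beta> holomorphic_on ball z s1" "\<And>\<zeta>. \<zeta> \<in> ball z s1 \<Longrightarrow> \<beta> \<zeta> \<noteq> 0"
    "\<And>\<zeta>. \<zeta> \<in> ball z s1 \<Longrightarrow> B \<zeta> = (\<zeta> - z) ^ j * \<beta> \<zeta>"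
    by (rule holomorphic_order[OF r B nz]) (rule that)
  note witness = that
  have main: ?thesis if rep: "coprime_rep z s a b" "s \<le> s1" "\<And>\<zeta>. \<zeta> \<in> ball z s \<Longrightarrow> A \<zeta> * b \<zeta> = B \<zeta> * a \<zeta>" "\<And>\<zeta>. \<zeta> \<in> ball z s - {z} \<Longrightarrow> b \<zeta> \<noteq> 0" for s a b
  proof (rule witness[OF rep(1)])
    show "s \<le> r" using rep(2) b(2) by simp
    fix \<zeta> assume \<zeta>: "\<zeta> \<in> ball z s"
    show "A \<zeta> * b \<zeta> = B \<zeta> * a \<zeta>" by (rule rep(3)[OF \<zeta>])
    have B0: "B \<xi> \<noteq> 0" if "\<xi> \<in> ball z s - {z}" for \<xi> using b(4,5)[of \<xi>] that rep(2) by auto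
    obtain t where t: "t > 0" "ball \<zeta> t \<subseteq> ball z s" using \<zeta> open_contains_ball open_ball by meson
    define U where "U = (if \<zeta> = z then ball z s else ball \<zeta> t - {z})"
    have U: "open U" "\<zeta> \<in> U" "U \<subseteq> ball z s" "z \<notin> U - {\<zeta>}" using t \<zeta> unfolding U_def by auto
    show "quotient_value A B \<zeta> = sph (a \<zeta>) (b \<zeta>)"
    proof (rule quotient_value_coprime[OF U(1,2)])
      show "continuous_on U a" "continuous_on U b"
        using rep(1) U(3) unfolding coprime_rep_def by (meson continuous_on_subset holomorphic_on_imp_continuous_on)+
      show "a \<zeta> \<noteq> 0 \<or> b \<zeta> \<noteq> 0" using rep(1) \<zeta> unfolding coprime_rep_def by blast
      show "A \<xi> * b \<xi> = B \<xi> * a \<xi>" if "\<xi> \<in> U - {\<zeta>}" for \<xi> using rep(3) that U(3) by blast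
      show "B \<xi> \<noteq> 0 \<and> b \<xi> \<noteq> 0" if "\<xi> \<in> U - {\<zeta>}" for \<xi> using B0[of \<xi>] rep(4)[of \<xi>] that U(3,4) by blast
    qed
  qed
  show ?thesis
  proof (cases "\<exists>w\<in>ball z r. A w \<noteq> 0")
    case False
    show ?thesis by (rule main[of s1 "\<lambda>_. 0" "\<lambda>_. 1"]) (use False b in \<open>auto simp: coprime_rep_def\<close>)
  next
    case True
    obtain i :: nat and \<alpha> s2 where a: "0 < s2" "s2 \<le> r" "\<alpha> holomorphic_on ball z s2" "\<And>\<zeta>. \<zeta> \<in> ball z s2 \<Longrightarrow> \<alpha> \<zeta> \<noteq> 0"
      "\<And>\<zeta>. \<zeta> \<in> ball z s2 \<Longrightarrow> A \<zeta> = (\<zeta> - z) ^ i * \<alpha> \<zeta>"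
      by (rule holomorphic_order[OF r A True]) (rule that)
    define s where "s = min s1 s2"
    have s: "s > 0" "s \<le> s1" "ball z s \<subseteq> ball z s1" "ball z s \<subseteq> ball z s2" using a(1) b(1) by (auto simp: s_def)
    have ab: "\<alpha> holomorphic_on ball z s" "\<beta> holomorphic_on ball z s" using a(3) b(3) s holomorphic_on_subset by blast+
    have v: "\<alpha> \<zeta> \<noteq> 0" "\<beta> \<zeta> \<noteq> 0" "A \<zeta> = (\<zeta> - z) ^ i * \<alpha> \<zeta>" "B \<zeta> = (\<zeta> - z) ^ j * \<beta> \<zeta>" if "\<zeta> \<in> ball z s" for \<zeta>
      using a b s that by blast+
    show ?thesis
    proof (cases "j \<le> i")
      case True
      then have "(\<zeta> - z) ^ i = (\<zeta> - z) ^ j * (\<zeta> - z) ^ (i - j)" for \<zeta> by (simp flip: power_add)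
      then show ?thesis
        using v s ab by (intro main[of s "\<lambda>\<zeta>. (\<zeta> - z) ^ (i - j) * \<alpha> \<zeta>" \<beta>]) (auto simp: coprime_rep_def intro!: holomorphic_intros)
    next
      case False
      then have "(\<zeta> - z) ^ j = (\<zeta> - z) ^ i * (\<zeta> - z) ^ (j - i)" for \<zeta> by (simp flip: power_add)
      then show ?thesis
        using v s ab by (intro main[of s \<alpha> "\<lambda>\<zeta>. (\<zeta> - z) ^ (j - i) * \<beta> \<zeta>"]) (auto simp: coprime_rep_def intro!: holomorphic_intros)
    qed
  qed
qed

text \<open>The Moebius transformation \<open>1 / (g - \<alpha>)\<close> turns \<open>G\<close> into a
  holomorphic function \<open>F\<close> that omits two finite values, so by Picard's great theorem
  \<open>F\<close> or \<open>1 / F\<close> has a finite limit. If \<open>1 / F\<close> tends to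
  \<open>0\<close> and \<open>F\<close> has no zeros near \<open>z\<close>, the coordinates are
  \<open>[\<alpha> + 1 / F : 1]\<close>. Since \<open>1 / 0 = 0\<close>, the limit \<open>0\<close>
  also occurs when \<open>F\<close> vanishes identically near \<open>z\<close>, and a single zero of
  \<open>F\<close> near \<open>z\<close> forces this, because nonzero values of \<open>F\<close> are
  large there.\<close>

lemma picard_coprime_rep:
  assumes r: "r > 0"
    and loc: "\<And>w. w \<in> ball z r - {z} \<Longrightarrow> \<exists>s a b. coprime_rep w s a b \<and> (\<forall>\<zeta>\<in>ball w s. G \<zeta> = sph (a \<zeta>) (b \<zeta>))"
    and omit: "\<And>w. w \<in> ball z r - {z} \<Longrightarrow> G w \<noteq> Some \<alpha> \<and> G w \<noteq> v2 \<and> G w \<noteq> v3"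
    and dist: "Some \<alpha> \<noteq> v2" "Some \<alpha> \<noteq> v3" "v2 \<noteq> v3"
  obtains s a b where "coprime_rep z s a b" "s \<le> r" "\<And>\<zeta>. \<zeta> \<in> ball z s - {z} \<Longrightarrow> G \<zeta> = sph (a \<zeta>) (b \<zeta>)"
proof -
  note witness = that
  \<comment> \<open>The default \<open>val None = 0\<close> is the right value of \<open>1 / (s - \<alpha>)\<close> at infinity.\<close>
  define val where "val v = (case v of None \<Rightarrow> 0 | Some s \<Rightarrow> 1 / (s - \<alpha>))" for v
  define F where "F \<zeta> = val (G \<zeta>)" for \<zeta>
  have val_inj: "v = v'" if "val v = val v'" "v \<noteq> Some \<alpha>" "v' \<noteq> Some \<alpha>" for v v'
    using that unfolding val_def by (cases v; cases v') auto
  let ?D = "ball z r - {z}"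
  have Do: "open ?D" by auto
  have Fh: "F holomorphic_on ?D"
  proof -
    have "F field_differentiable at w" if w: "w \<in> ?D" for w
    proof -
      obtain s a b where sab: "coprime_rep w s a b" "\<forall>\<zeta>\<in>ball w s. G \<zeta> = sph (a \<zeta>) (b \<zeta>)" using loc[OF w] by blast
      define U where "U = ball w s \<inter> ?D"
      have U: "open U" "w \<in> U" using w sab(1) unfolding U_def coprime_rep_def by auto
      have h: "a holomorphic_on U" "b holomorphic_on U" using sab(1) unfolding U_def coprime_rep_def by (auto elim: holomorphic_on_subset)
      have nz: "a \<zeta> - \<alpha> * b \<zeta> \<noteq> 0" "F \<zeta> = b \<zeta> / (a \<zeta> - \<alpha> * b \<zeta>)" if \<zeta>: "\<zeta> \<in> U" for \<zeta>
      proof -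
        have G: "G \<zeta> = sph (a \<zeta>) (b \<zeta>)" "G \<zeta> \<noteq> Some \<alpha>" "a \<zeta> \<noteq> 0 \<or> b \<zeta> \<noteq> 0"
          using sab omit[of \<zeta>] \<zeta> unfolding U_def coprime_rep_def by auto
        then have "ell (Some \<alpha>) (a \<zeta>) (b \<zeta>) \<noteq> 0" using ell_zero_iff by metis
        then show 1: "a \<zeta> - \<alpha> * b \<zeta> \<noteq> 0" by (simp add: ell_def)
        show "F \<zeta> = b \<zeta> / (a \<zeta> - \<alpha> * b \<zeta>)"
          using 1 G(1) unfolding F_def val_def sph_def by (auto simp: field_simps)
      qed
      have "(\<lambda>\<zeta>. b \<zeta> / (a \<zeta> - \<alpha> * b \<zeta>)) holomorphic_on U" using h nz(1) by (intro holomorphic_intros) auto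
      then have "F holomorphic_on U" by (rule holomorphic_transform) (simp add: nz(2))
      then show ?thesis using U holomorphic_on_imp_differentiable_at by blast
    qed
    then show ?thesis by (auto simp: holomorphic_on_def intro: field_differentiable_at_within)
  qed
  have om: "F w \<noteq> val v2 \<and> F w \<noteq> val v3" if "w \<in> ball z r - {z}" for w
    unfolding F_def using val_inj omit[OF that] dist by metis
  have ne: "val v2 \<noteq> val v3" using val_inj dist by metis
  have GF: "G \<zeta> = sph (1 + \<alpha> * F \<zeta>) (F \<zeta>)" if "\<zeta> \<in> ?D" for \<zeta>
    using omit[OF that] unfolding F_def val_def sph_def by (auto simp: field_simps split: option.splits)
  have case1: ?thesis if lim: "(F \<longlongrightarrow> l) (at z)" for l
  proof -
    define F' where "F' = (\<lambda>y. if y = z then l else F y)"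
    have "F' holomorphic_on ball z r" unfolding F'_def by (rule removable_singularity[OF Fh open_ball lim])
    then have "coprime_rep z r (\<lambda>\<zeta>. 1 + \<alpha> * F' \<zeta>) F'" unfolding coprime_rep_def using r by (auto intro!: holomorphic_intros)
    then show ?thesis by (rule witness) (use GF in \<open>auto simp: F'_def\<close>)
  qed
  obtain l where "(F \<longlongrightarrow> l) (at z) \<or> ((inverse \<circ> F) \<longlongrightarrow> l) (at z)"
    by (rule great_Picard[OF open_ball _ ne Fh om]) (use r in auto)
  then show ?thesis
  proof
    assume il: "((inverse \<circ> F) \<longlongrightarrow> l) (at z)"
    show ?thesis
    proof (cases "l = 0")
      case False
      have "((\<lambda>x. inverse ((inverse \<circ> F) x)) \<longlongrightarrow> inverse l) (at z)" by (rule tendsto_inverse[OF il False])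
      then have "(F \<longlongrightarrow> inverse l) (at z)" by (simp add: o_def)
      then show ?thesis by (rule case1)
    next
      case True
      have "\<forall>\<^sub>F x in at z. dist ((inverse \<circ> F) x) 0 < 1" using il True tendstoD[of "inverse \<circ> F" 0 "at z" 1] by simp
      then obtain d where d: "d > 0" "\<And>x. x \<noteq> z \<Longrightarrow> dist x z < d \<Longrightarrow> norm (inverse (F x)) < 1"
        unfolding eventually_at by auto
      define s where "s = min d r"
      have s: "s > 0" "ball z s - {z} \<subseteq> ?D" using d r by (auto simp: s_def)
      have big: "F x = 0 \<or> norm (F x) > 1" if "x \<in> ball z s - {z}" for x
      proof (cases "F x = 0")
        case False
        then have "1 < norm (F x)" using d(2)[of x] that by (simp add: s_def dist_commute norm_inverse inverse_less_1_iff)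
        then show ?thesis ..
      qed simp
      have Fs: "F holomorphic_on ball z s - {z}" using Fh s(2) by (rule holomorphic_on_subset)
      show ?thesis
      proof (cases "\<exists>x\<in>ball z s - {z}. F x = 0")
        case True
        then obtain x where x: "x \<in> ball z s - {z}" "F x = 0" by blast
        define O1 where "O1 = (ball z s - {z}) \<inter> F -` ball 0 1"
        have "open O1" unfolding O1_def using Fs by (intro continuous_open_preimage holomorphic_on_imp_continuous_on) auto
        moreover have "F y = 0" if "y \<in> O1" for y using big[of y] that unfolding O1_def by auto
        moreover have "connected (ball z s - {z})" by (rule connected_punctured_ball) simp
        moreover have "x \<in> O1" "O1 \<subseteq> ball z s - {z}" using x unfolding O1_def by auto
        ultimately have F0: "F y = 0" if "y \<in> ball z s - {z}" for y
          using analytic_continuation_open[of O1 "ball z s - {z}" F "\<lambda>_. 0" y] Fs that by auto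
        have "\<forall>\<^sub>F y in at z. 0 = F y"
          using eventually_at_in_open[OF open_ball centre_in_ball[THEN iffD2, OF s(1)]] by (rule eventually_mono) (simp add: F0)
        then have "(F \<longlongrightarrow> 0) (at z)" by (rule Lim_transform_eventually[OF tendsto_const])
        then show ?thesis by (rule case1)
      next
        case False
        define H where "H = (\<lambda>y. if y = z then 0 else inverse (F y))"
        have "(\<lambda>y. inverse (F y)) holomorphic_on ball z s - {z}" using Fs False by (intro holomorphic_intros) auto
        moreover have "((\<lambda>y. inverse (F y)) \<longlongrightarrow> 0) (at z)" using il True by (simp add: o_def)
        ultimately have "H holomorphic_on ball z s" unfolding H_def by (intro removable_singularity) auto
        then have "coprime_rep z s (\<lambda>\<zeta>. \<alpha> + H \<zeta>) (\<lambda>_. 1)" unfolding coprime_rep_def using s(1) by (auto intro!: holomorphic_intros)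
        then show ?thesis
        proof (rule witness)
          show "s \<le> r" by (simp add: s_def)
          fix \<zeta> assume "\<zeta> \<in> ball z s - {z}"
          then show "G \<zeta> = sph (\<alpha> + H \<zeta>) 1" using GF[of \<zeta>] False s(2) unfolding sph_def H_def by (auto simp: field_simps)
        qed
      qed
    qed
  qed (rule case1)
qed

lemma deriv_affine:
  assumes "a field_differentiable at z" "b field_differentiable at z"
  shows "deriv (\<lambda>z. a z - s * b z) z = deriv a z - s * deriv b z"
  by (intro DERIV_imp_deriv DERIV_diff DERIV_cmult field_differentiable_derivI assms)

text \<open>A linear substitution multiplies the Wronskian by its determinant, which is nonzero for distinct
  points.\<close>

lemma wronskian_ell:
  assumes "v \<noteq> v'"
  shows "\<exists>k. k \<noteq> 0 \<and> (\<forall>a b z. a field_differentiable at z \<longrightarrow> b field_differentiable at z \<longrightarrow>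
     wronskian (\<lambda>z. ell v (a z) (b z)) (\<lambda>z. ell v' (a z) (b z)) z = k * wronskian a b z)"
proof (cases v; cases v')
  fix s assume v: "v = None" "v' = Some s"
  show ?thesis unfolding v wronskian_def ell_def by (intro exI[of _ "-1"]) (simp add: algebra_simps deriv_affine)
next
  fix s assume v: "v = Some s" "v' = None"
  show ?thesis unfolding v wronskian_def ell_def by (intro exI[of _ "1"]) (simp add: algebra_simps deriv_affine)
next
  fix s s' assume v: "v = Some s" "v' = Some s'"
  show ?thesis using v assms unfolding v wronskian_def ell_def by (intro exI[of _ "s - s'"]) (simp add: algebra_simps deriv_affine)
qed (use assms in auto)

text \<open>With \<open>l = ell v\<close> and \<open>m = ell v'\<close> the Wronskian is a multiple of
  \<open>l' m - l m'\<close>, and both terms vanish to order at least \<open>n - 1\<close>.\<close>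

lemma order_wronskian_at_zero:
  assumes r: "r > 0" and h: "a holomorphic_on ball z r" "b holomorphic_on ball z r"
    and W: "\<exists>w\<in>ball z r. wronskian a b w \<noteq> 0" and v: "v \<noteq> v'" and z: "ell v (a z) (b z) = 0"
  obtains n N :: nat where "winds_at (\<lambda>\<zeta>. ell v (a \<zeta>) (b \<zeta>)) z (int n)" "winds_at (wronskian a b) z (int N)" "n \<le> N + 1"
proof -
  let ?l = "\<lambda>\<zeta>. ell v (a \<zeta>) (b \<zeta>)" and ?m = "\<lambda>\<zeta>. ell v' (a \<zeta>) (b \<zeta>)"
  obtain k where k: "k \<noteq> 0" and wk: "\<And>w. a field_differentiable at w \<Longrightarrow> b field_differentiable at w \<Longrightarrow> wronskian ?l ?m w = k * wronskian a b w"
    using wronskian_ell[OF v] by blast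
  have wk': "wronskian ?l ?m w = k * wronskian a b w" if "w \<in> ball z r" for w
    using h that holomorphic_on_imp_differentiable_at by (intro wk) blast+
  have lh: "?l holomorphic_on ball z r" "?m holomorphic_on ball z r" using h ell_holomorphic by blast+
  have lnz: "\<exists>w\<in>ball z r. ?l w \<noteq> 0"
  proof (rule ccontr)
    assume "\<not> ?thesis"
    then have l0: "?l w = 0" if "w \<in> ball z r" for w using that by blast
    obtain w where w: "w \<in> ball z r" "wronskian a b w \<noteq> 0" using W by blast
    have "deriv ?l w = deriv (\<lambda>_. 0) w" by (rule deriv_local[OF open_ball w(1)]) (rule l0)
    then have "wronskian ?l ?m w = 0" using l0[OF w(1)] unfolding wronskian_def by simp
    then show False using wk'[OF w(1)] w(2) k by simp
  qed
  obtain n :: nat and u s where u: "0 < s" "s \<le> r" "u holomorphic_on ball z s" "\<And>\<zeta>. \<zeta> \<in> ball z s \<Longrightarrow> u \<zeta> \<noteq> 0"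
    "\<And>\<zeta>. \<zeta> \<in> ball z s \<Longrightarrow> ?l \<zeta> = (\<zeta> - z) ^ n * u \<zeta>" "n = 0 \<longleftrightarrow> ?l z \<noteq> 0"
    by (rule holomorphic_order[OF r lh(1) lnz]) (rule that)
  have n: "n > 0" using u(6) z by simp
  have 1: "winds_at ?l z (int n)" by (rule winds_at_zero_order[OF u(1,3)]) (use u in auto)
  have sub: "ball z s \<subseteq> ball z r" using u(2) by auto
  define K where "K \<zeta> = ((of_nat n * u \<zeta> + (\<zeta> - z) * deriv u \<zeta>) * ?m \<zeta> - (\<zeta> - z) * u \<zeta> * deriv ?m \<zeta>) / k" for \<zeta>
  have mh: "?m holomorphic_on ball z s" using lh(2) sub by (rule holomorphic_on_subset)
  have Kh: "K holomorphic_on ball z s"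
    unfolding K_def by (intro holomorphic_intros u(3) mh holomorphic_deriv open_ball) (use k in auto)
  have Wl: "wronskian a b \<zeta> = (\<zeta> - z) ^ (n - 1) * K \<zeta>" if \<zeta>: "\<zeta> \<in> ball z s" for \<zeta>
  proof -
    have "deriv ?l \<zeta> = deriv (\<lambda>\<zeta>. (\<zeta> - z) ^ n * u \<zeta>) \<zeta>" by (rule deriv_local[OF open_ball \<zeta>]) (rule u(5))
    also have "\<dots> = of_nat n * (\<zeta> - z) ^ (n - 1) * u \<zeta> + (\<zeta> - z) ^ n * deriv u \<zeta>"
      using holomorphic_derivI[OF u(3) open_ball \<zeta>] by (intro DERIV_imp_deriv) (auto intro!: derivative_eq_intros)
    finally have dl: "deriv ?l \<zeta> = of_nat n * (\<zeta> - z) ^ (n - 1) * u \<zeta> + (\<zeta> - z) ^ n * deriv u \<zeta>" .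
    have p: "(\<zeta> - z) ^ n = (\<zeta> - z) ^ (n - 1) * (\<zeta> - z)" using n by (simp add: power_eq_if mult.commute)
    have "k * wronskian a b \<zeta> = wronskian ?l ?m \<zeta>" using wk' \<zeta> sub by (metis subsetD)
    also have "\<dots> = deriv ?l \<zeta> * ?m \<zeta> - ?l \<zeta> * deriv ?m \<zeta>" by (simp add: wronskian_def)
    also have "\<dots> = (\<zeta> - z) ^ (n - 1) * ((of_nat n * u \<zeta> + (\<zeta> - z) * deriv u \<zeta>) * ?m \<zeta> - (\<zeta> - z) * u \<zeta> * deriv ?m \<zeta>)"
      unfolding dl u(5)[OF \<zeta>] p by (simp add: algebra_simps)
    finally show ?thesis using k unfolding K_def by (simp add: field_simps)
  qed
  have Wh: "wronskian a b holomorphic_on ball z r" by (rule wronskian_holomorphic[OF h open_ball])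
  have Knz: "\<exists>w\<in>ball z s. K w \<noteq> 0"
  proof (rule ccontr)
    assume "\<not> ?thesis"
    then have "wronskian a b w = 0" if "w \<in> ball z s" for w using Wl[OF that] that by simp
    then have "wronskian a b w = 0" if "w \<in> ball z r" for w
      using analytic_continuation_open[of "ball z s" "ball z r" "wronskian a b" "\<lambda>_. 0" w] sub u(1) Wh that by auto
    then show False using W by blast
  qed
  obtain M :: nat and g t where g: "0 < t" "t \<le> s" "g holomorphic_on ball z t" "\<And>\<zeta>. \<zeta> \<in> ball z t \<Longrightarrow> g \<zeta> \<noteq> 0"
      "\<And>\<zeta>. \<zeta> \<in> ball z t \<Longrightarrow> K \<zeta> = (\<zeta> - z) ^ M * g \<zeta>"
    by (rule holomorphic_order[OF u(1) Kh Knz]) (rule that)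
  have "winds_at (wronskian a b) z (int (n - 1 + M))"
    by (rule winds_at_zero_order[OF g(1,3)]) (use g Wl in \<open>auto simp: power_add\<close>)
  then show ?thesis by (rule that[OF 1]) (use n in simp)
qed

text \<open>The three values are distinct, so at most one of the linear forms in the denominator vanishes at
  \<open>z\<close>, and its order exceeds that of the Wronskian by at most one.\<close>

lemma omega_order:
  assumes rep: "coprime_rep z r a b" and W: "\<exists>w\<in>ball z r. wronskian a b w \<noteq> 0"
    and v: "v1 \<noteq> v2" "v1 \<noteq> v3" "v2 \<noteq> v3"
  obtains n :: int and p :: nat where "winds_at (omega v1 v2 v3 a b) z n" "winds_at b z (int p)"
    "int p \<le> n + (if sph (a z) (b z) \<in> {v1, v2, v3} then 1 else 0)"
proof -
  note witness = that
  have r: "r > 0" and h: "a holomorphic_on ball z r" "b holomorphic_on ball z r" and cop: "a z \<noteq> 0 \<or> b z \<noteq> 0"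
    using rep unfolding coprime_rep_def by auto
  have Wh: "wronskian a b holomorphic_on ball z r" by (rule wronskian_holomorphic[OF h open_ball])
  have nz: "\<exists>w\<in>ball z r. ell v (a w) (b w) \<noteq> 0" for v
  proof (rule ccontr)
    assume "\<not> ?thesis"
    then have l0: "ell v (a w) (b w) = 0" if "w \<in> ball z r" for w using that by blast
    obtain w where w: "w \<in> ball z r" "wronskian a b w \<noteq> 0" using W by blast
    obtain v' where v': "v \<noteq> v'" using v by metis
    have "deriv (\<lambda>w. ell v (a w) (b w)) w = deriv (\<lambda>_. 0) w" by (rule deriv_local[OF open_ball w(1)]) (rule l0)
    then have "wronskian (\<lambda>w. ell v (a w) (b w)) (\<lambda>w. ell v' (a w) (b w)) w = 0" using l0[OF w(1)] unfolding wronskian_def by simp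
    moreover have "a field_differentiable at w" "b field_differentiable at w"
      using h w(1) holomorphic_on_imp_differentiable_at by blast+
    ultimately show False using wronskian_ell[OF v'] w(2) by (metis mult_eq_0_iff)
  qed
  have ex: "\<exists>n::nat. winds_at (\<lambda>\<zeta>. ell v (a \<zeta>) (b \<zeta>)) z (int n) \<and> (n = 0 \<longleftrightarrow> ell v (a z) (b z) \<noteq> 0)" for v
    using holomorphic_winds_at[OF r ell_holomorphic[OF h] nz] by metis
  obtain p :: nat where p: "winds_at b z (int p)"
    using ex[of None] by (auto simp: ell_def)
  obtain N0 :: nat where N0: "winds_at (wronskian a b) z (int N0)" using holomorphic_winds_at[OF r Wh W] by metis
  have zero_iff: "ell v (a z) (b z) = 0 \<longleftrightarrow> sph (a z) (b z) = v" for v by (rule ell_zero_iff[OF cop])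
  have main: ?thesis if wn: "winds_at (wronskian a b) z (int N)" and 1: "winds_at (\<lambda>\<zeta>. ell v1 (a \<zeta>) (b \<zeta>)) z (int n1)"
    and 2: "winds_at (\<lambda>\<zeta>. ell v2 (a \<zeta>) (b \<zeta>)) z (int n2)" and 3: "winds_at (\<lambda>\<zeta>. ell v3 (a \<zeta>) (b \<zeta>)) z (int n3)"
    and le: "n1 + n2 + n3 \<le> N + (if sph (a z) (b z) \<in> {v1, v2, v3} then 1 else 0)" for N n1 n2 n3 :: nat
  proof (rule witness[OF _ p])
    show "winds_at (omega v1 v2 v3 a b) z (int N + int p - (int n1 + int n2 + int n3))"
      unfolding omega_def[abs_def] by (intro winds_at_divide winds_at_mult wn p 1 2 3)
    show "int p \<le> int N + int p - (int n1 + int n2 + int n3) + (if sph (a z) (b z) \<in> {v1, v2, v3} then 1 else 0)"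
      using le by (auto split: if_splits)
  qed
  have triv: "winds_at (\<lambda>\<zeta>. ell v (a \<zeta>) (b \<zeta>)) z (int 0)" if "sph (a z) (b z) \<noteq> v" for v
    using ex[of v] zero_iff that by auto
  consider "sph (a z) (b z) = v1" | "sph (a z) (b z) = v2" | "sph (a z) (b z) = v3" | "sph (a z) (b z) \<notin> {v1, v2, v3}" by blast
  then show ?thesis
  proof cases
    case 1
    obtain n N :: nat where nN: "winds_at (\<lambda>\<zeta>. ell v1 (a \<zeta>) (b \<zeta>)) z (int n)" "winds_at (wronskian a b) z (int N)" "n \<le> N + 1"
      by (rule order_wronskian_at_zero[OF r h W v(1)]) (use 1 zero_iff that in auto)
    show ?thesis by (rule main[OF nN(2,1) triv triv]) (use nN 1 v in auto)
  next
    case 2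
    obtain n N :: nat where nN: "winds_at (\<lambda>\<zeta>. ell v2 (a \<zeta>) (b \<zeta>)) z (int n)" "winds_at (wronskian a b) z (int N)" "n \<le> N + 1"
      by (rule order_wronskian_at_zero[OF r h W v(3)]) (use 2 zero_iff that in auto)
    show ?thesis by (rule main[OF nN(2) triv nN(1) triv]) (use nN 2 v in auto)
  next
    case 3
    obtain n N :: nat where nN: "winds_at (\<lambda>\<zeta>. ell v3 (a \<zeta>) (b \<zeta>)) z (int n)" "winds_at (wronskian a b) z (int N)" "n \<le> N + 1"
      by (rule order_wronskian_at_zero[OF r h W v(2)[symmetric]]) (use 3 zero_iff that in auto)
    show ?thesis by (rule main[OF nN(2) triv triv nN(1)]) (use nN 3 v in auto)
  next
    case 4
    show ?thesis by (rule main[OF N0 triv triv triv]) (use 4 in auto)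
  qed
qed

text \<open>The quotient of two linear forms has derivative \<open>0\<close> where its denominator does not
  vanish; the rest is analytic continuation.\<close>

lemma wronskian_zero_constant:
  assumes rep: "coprime_rep z r a b" and W: "\<And>w. w \<in> ball z r \<Longrightarrow> wronskian a b w = 0" and w: "w \<in> ball z r"
  shows "sph (a w) (b w) = sph (a z) (b z)"
proof -
  have r: "r > 0" and h: "a holomorphic_on ball z r" "b holomorphic_on ball z r" and cop: "\<And>\<zeta>. \<zeta> \<in> ball z r \<Longrightarrow> a \<zeta> \<noteq> 0 \<or> b \<zeta> \<noteq> 0"
    using rep unfolding coprime_rep_def by auto
  define v where "v = sph (a z) (b z)"
  obtain v' where v': "v \<noteq> v'" by (metis option.distinct(1) option.inject zero_neq_one)
  let ?l = "\<lambda>\<zeta>. ell v (a \<zeta>) (b \<zeta>)" and ?m = "\<lambda>\<zeta>. ell v' (a \<zeta>) (b \<zeta>)"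
  have lh: "?l holomorphic_on ball z r" "?m holomorphic_on ball z r" using h ell_holomorphic by blast+
  have z: "z \<in> ball z r" using r by simp
  have l0: "?l z = 0" and m0: "?m z \<noteq> 0" using ell_zero_iff[OF cop[OF z]] v' v_def by auto
  have "open (ball z r \<inter> ?m -` (- {0}))"
    using lh(2) by (intro continuous_open_preimage holomorphic_on_imp_continuous_on) auto
  then obtain s where s: "s > 0" "ball z s \<subseteq> ball z r \<inter> ?m -` (- {0})"
    using z m0 by (auto elim!: openE[where x = z])
  have sub: "\<zeta> \<in> ball z r" "?m \<zeta> \<noteq> 0" if "\<zeta> \<in> ball z s" for \<zeta> using s(2) that by blast+
  obtain k where k: "\<And>a b z. a field_differentiable at z \<Longrightarrow> b field_differentiable at z \<Longrightarrow>
     wronskian (\<lambda>z. ell v (a z) (b z)) (\<lambda>z. ell v' (a z) (b z)) z = k * wronskian a b z" using wronskian_ell[OF v'] by blast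
  have "((\<lambda>\<zeta>. ?l \<zeta> / ?m \<zeta>) has_field_derivative 0) (at \<zeta>)" if \<zeta>: "\<zeta> \<in> ball z s" for \<zeta>
  proof -
    note d = holomorphic_derivI[OF lh(1) open_ball sub(1)[OF \<zeta>]] holomorphic_derivI[OF lh(2) open_ball sub(1)[OF \<zeta>]]
    have "wronskian ?l ?m \<zeta> = 0"
      using k[of a \<zeta> b] W[OF sub(1)[OF \<zeta>]] h sub(1)[OF \<zeta>] holomorphic_on_imp_differentiable_at[OF _ open_ball] by simp
    then show ?thesis using DERIV_divide[OF d sub(2)[OF \<zeta>]] by (simp add: wronskian_def)
  qed
  then have "(\<lambda>\<zeta>. ?l \<zeta> / ?m \<zeta>) constant_on ball z s"
    by (intro has_field_derivative_0_imp_constant_on) auto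
  then have q0: "?l \<zeta> / ?m \<zeta> = 0" if "\<zeta> \<in> ball z s" for \<zeta>
    using that s(1) l0 unfolding constant_on_def by (metis centre_in_ball div_0)
  have l0s: "?l \<zeta> = 0" if "\<zeta> \<in> ball z s" for \<zeta>
    using q0[OF that] sub(2)[OF that] by simp
  have "ball z s \<subseteq> ball z r" using sub(1) by blast
  then have "?l w = 0"
    using analytic_continuation_open[of "ball z s" "ball z r" ?l "\<lambda>_. 0" w] s(1) lh(1) w l0s by auto
  then show ?thesis using ell_zero_iff[OF cop[OF w]] unfolding v_def by blast
qed

section \<open>One component of the Gauss map\<close>

lemma connected_space_dichotomy:
  assumes T: "connected_space T" and Z: "\<And>a. a \<in> topspace T \<Longrightarrow> \<exists>U. openin T U \<and> a \<in> U \<and> (U \<inter> Z = {} \<or> U \<subseteq> Z)"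
  shows "topspace T \<inter> Z = {} \<or> topspace T \<subseteq> Z"
proof (rule ccontr)
  assume neg: "\<not> ?thesis"
  have "openin T (topspace T \<inter> Z)"
  proof (subst openin_subopen, intro ballI)
    fix a assume a: "a \<in> topspace T \<inter> Z"
    then obtain U where U: "openin T U" "a \<in> U" "U \<inter> Z = {} \<or> U \<subseteq> Z" using Z by blast
    then have "U \<subseteq> topspace T \<inter> Z" using a openin_subset by blast
    then show "\<exists>U. openin T U \<and> a \<in> U \<and> U \<subseteq> topspace T \<inter> Z" using U by blast
  qed
  moreover have "openin T (topspace T - Z)"
  proof (subst openin_subopen, intro ballI)
    fix a assume a: "a \<in> topspace T - Z"
    then obtain U where U: "openin T U" "a \<in> U" "U \<inter> Z = {} \<or> U \<subseteq> Z" using Z by blast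
    then have "U \<subseteq> topspace T - Z" using a openin_subset by blast
    then show "\<exists>U. openin T U \<and> a \<in> U \<and> U \<subseteq> topspace T - Z" using U by blast
  qed
  ultimately have "\<not> connected_space T"
    unfolding connected_space_def using neg by (intro notI) blast
  then show False using T by blast
qed

text \<open>A relation \<open>A b = B a\<close> depends only on the point \<open>[a : b]\<close>.\<close>

lemma sph_cross_multiply:
  assumes 1: "A * b' = B * a'" and 2: "sph a' b' = sph a0 b0" and 3: "a' \<noteq> 0 \<or> b' \<noteq> 0"
  shows "A * b0 = B * a0"
proof (cases "b' = 0")
  case True
  then show ?thesis using 1 2 3 by (auto simp: sph_def split: if_splits)
next
  case False
  then have q: "b0 \<noteq> 0" "a' / b' = a0 / b0" using 2 by (auto simp: sph_def split: if_splits)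
  have "A = B * (a' / b')" using 1 False by (simp add: field_simps)
  then show ?thesis using q by simp
qed

context punctured_model
begin

lemma N_connected: "connected_space (subtopology (surf_top M) (topspace (surf_top M) - P))"
proof -
  have "connected_space (surf_top S)" using RS unfolding riemann_surface_def by blast
  then show ?thesis using homeomorphic_connected_space homeomorphic_map_imp_homeomorphic_space[OF fh] by blast
qed

lemma N_open: "openin (surf_top M) U \<Longrightarrow> U \<inter> P = {} \<Longrightarrow> openin (subtopology (surf_top M) (topspace (surf_top M) - P)) U"
  using openin_subset by (fastforce simp: openin_subtopology)

lemma snd_in_D_iff: "c \<in> charts M \<Longrightarrow> x \<in> fst c \<Longrightarrow> snd c x \<in> D c \<longleftrightarrow> x \<notin> P"
  unfolding D_def using inj_onD[OF chart_inj[OF RM]] by blast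

lemma ball_D:
  assumes "c \<in> charts M" "a \<in> fst c - P"
  obtains r where "r > 0" "ball (snd c a) r \<subseteq> D c"
proof -
  have "snd c a \<in> D c" using assms unfolding D_def by blast
  then show ?thesis using D_open[OF assms(1)] that open_contains_ball by blast
qed

text \<open>The set of points near which all coefficients vanish is open and closed in the connected punctured
  surface.\<close>

lemma vanish_dichotomy:
  assumes h: "\<And>c. c \<in> charts M \<Longrightarrow> h c holomorphic_on D c"
    and inv: "\<And>c c' a. c \<in> charts M \<Longrightarrow> c' \<in> charts M \<Longrightarrow> a \<in> fst c \<inter> fst c' - P \<Longrightarrow> h c (snd c a) = 0 \<Longrightarrow> h c' (snd c' a) = 0"
  shows "(\<forall>c\<in>charts M. \<forall>\<zeta>\<in>D c. h c \<zeta> = 0) \<or> (\<forall>c\<in>charts M. \<forall>z r. 0 < r \<longrightarrow> ball z r \<subseteq> D c \<longrightarrow> (\<exists>\<zeta>\<in>ball z r. h c \<zeta> \<noteq> 0))"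
proof -
  define Z where "Z = {a. \<exists>c\<in>charts M. a \<in> fst c \<and> (\<exists>r>0. ball (snd c a) r \<subseteq> D c \<and> (\<forall>\<zeta>\<in>ball (snd c a) r. h c \<zeta> = 0))}"
  let ?T = "subtopology (surf_top M) (topspace (surf_top M) - P)"
  have "topspace ?T \<inter> Z = {} \<or> topspace ?T \<subseteq> Z"
  proof (rule connected_space_dichotomy[OF N_connected])
    fix a assume "a \<in> topspace ?T"
    then have a: "a \<in> topspace (surf_top M)" "a \<notin> P" by auto
    obtain c where c: "c \<in> charts M" "a \<in> fst c" using charts_cover[OF RM a(1)] by blast
    obtain r where r: "r > 0" "ball (snd c a) r \<subseteq> D c" using ball_D[OF c(1)] c(2) a(2) by blast
    let ?B = "ball (snd c a) r"
    define U where "U = {x \<in> fst c. snd c x \<in> ?B}"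
    have Uo: "openin (surf_top M) U" unfolding U_def by (rule chart_preimage_open[OF RM c(1) open_ball])
    have UP: "U \<inter> P = {}" using snd_in_D_iff[OF c(1)] r(2) unfolding U_def by blast
    have "U \<subseteq> Z" if ne: "U \<inter> Z \<noteq> {}"
    proof -
      obtain x where x: "x \<in> U" "x \<in> Z" using ne by blast
      obtain c' r' where c': "c' \<in> charts M" "x \<in> fst c'" "r' > 0" "ball (snd c' x) r' \<subseteq> D c'"
        "\<And>\<zeta>. \<zeta> \<in> ball (snd c' x) r' \<Longrightarrow> h c' \<zeta> = 0" using x(2) unfolding Z_def by blast
      define V where "V = U \<inter> {y \<in> fst c'. snd c' y \<in> ball (snd c' x) r'}"
      have Vo: "openin (surf_top M) V" unfolding V_def
        using Uo chart_preimage_open[OF RM c'(1) open_ball] by blast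
      have Vs: "open (snd c ` V)" by (rule chart_open_image[OF RM c(1) Vo]) (auto simp: V_def U_def)
      have xV: "x \<in> V" using x c' unfolding V_def by auto
      have hV: "h c \<zeta> = 0" if \<zeta>: "\<zeta> \<in> snd c ` V" for \<zeta>
      proof -
        obtain y where y: "y \<in> V" "\<zeta> = snd c y" using \<zeta> by blast
        have "h c' (snd c' y) = 0" using c'(5) y(1) unfolding V_def by blast
        then show ?thesis using inv[OF c'(1) c(1), of y] y UP unfolding V_def U_def by blast
      qed
      have Vb: "snd c ` V \<subseteq> ?B" unfolding V_def U_def by blast
      have hb: "h c holomorphic_on ?B" by (rule holomorphic_on_subset[OF h[OF c(1)] r(2)])
      have hB: "h c \<zeta> = 0" if "\<zeta> \<in> ?B" for \<zeta>
        by (rule analytic_continuation_open[of "snd c ` V" ?B "h c" "\<lambda>_. 0" \<zeta>]) (use Vs xV Vb hb hV that in auto)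
      show "U \<subseteq> Z"
      proof
        fix y assume y: "y \<in> U"
        obtain t where t: "t > 0" "ball (snd c y) t \<subseteq> ?B" using y open_contains_ball open_ball unfolding U_def by blast
        show "y \<in> Z" unfolding Z_def using c(1) y t hB r(2) unfolding U_def by blast
      qed
    qed
    then show "\<exists>U. openin ?T U \<and> a \<in> U \<and> (U \<inter> Z = {} \<or> U \<subseteq> Z)"
      using N_open[OF Uo UP] c(2) r(1) by (intro exI[of _ U]) (auto simp: U_def)
  qed
  then show ?thesis
  proof
    assume Zall: "topspace ?T \<subseteq> Z"
    have "h c \<zeta> = 0" if c: "c \<in> charts M" and \<zeta>: "\<zeta> \<in> D c" for c \<zeta>
    proof -
      obtain a where a: "a \<in> fst c - P" "\<zeta> = snd c a" using \<zeta> unfolding D_def by blast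
      have "a \<in> Z" using Zall chart_mem[OF c] a(1) by auto
      then obtain c' where c': "c' \<in> charts M" "a \<in> fst c'" "h c' (snd c' a) = 0" unfolding Z_def by force
      show ?thesis using inv[OF c'(1) c] c' a by blast
    qed
    then show ?thesis by blast
  next
    assume Zn: "topspace ?T \<inter> Z = {}"
    have "\<exists>\<zeta>\<in>ball z r. h c \<zeta> \<noteq> 0" if c: "c \<in> charts M" and r: "0 < r" "ball z r \<subseteq> D c" for c z r
    proof (rule ccontr)
      assume n: "\<not> ?thesis"
      have "z \<in> D c" using r by auto
      then obtain a where a: "a \<in> fst c - P" "z = snd c a" unfolding D_def by blast
      then have "a \<in> Z" unfolding Z_def using c r n by blast
      then show False using Zn chart_mem[OF c] a(1) by auto
    qed
    then show ?thesis by blast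
  qed
qed

lemma B_transition:
  assumes "c \<in> charts M" "c' \<in> charts M" "a \<in> fst c \<inter> fst c' - P"
  shows "B c (snd c a) = B c' (snd c' a) * deriv (\<lambda>\<zeta>. snd c' (inv_into (fst c) (snd c) \<zeta>)) (snd c a)"
    "A1 c (snd c a) = A1 c' (snd c' a) * deriv (\<lambda>\<zeta>. snd c' (inv_into (fst c) (snd c) \<zeta>)) (snd c a)"
    "A2 c (snd c a) = A2 c' (snd c' a) * deriv (\<lambda>\<zeta>. snd c' (inv_into (fst c) (snd c) \<zeta>)) (snd c a)"
  unfolding B_def A1_def A2_def Phi_transition[OF assms] by (simp_all add: algebra_simps)

end

text \<open>The two components of the Gauss map are treated alike: \<open>A\<close> stands for
  \<open>A1\<close> or \<open>A2\<close>, and \<open>G\<close> for the component \<open>A /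
  B\<close>.\<close>

locale gauss_component = punctured_model S X M P f
  for S :: "'a csurface" and X :: "'a \<Rightarrow> real^4" and M :: "'b csurface" and P :: "'b set" and f :: "'a \<Rightarrow> 'b" +
  fixes A :: "'b set \<times> ('b \<Rightarrow> complex) \<Rightarrow> complex \<Rightarrow> complex" and G :: "'a \<Rightarrow> csphere" and v1 v2 v3 :: csphere
  assumes Ah: "\<And>c. c \<in> charts M \<Longrightarrow> A c holomorphic_on D c"
    and At: "\<And>c c' a. c \<in> charts M \<Longrightarrow> c' \<in> charts M \<Longrightarrow> a \<in> fst c \<inter> fst c' - P \<Longrightarrow>
       A c (snd c a) = A c' (snd c' a) * deriv (\<lambda>\<zeta>. snd c' (inv_into (fst c) (snd c) \<zeta>)) (snd c a)"
    and G: "\<And>c a. c \<in> charts M \<Longrightarrow> a \<in> fst c - P \<Longrightarrow> G (e a) = quotient_value (A c) (B c) (snd c a)"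
    and nonconst: "\<not> G constant_on topspace (surf_top S)"
    and omit: "\<And>s. s \<in> topspace (surf_top S) \<Longrightarrow> G s \<noteq> v1 \<and> G s \<noteq> v2 \<and> G s \<noteq> v3"
    and vdist: "v1 \<noteq> v2" "v1 \<noteq> v3" "v2 \<noteq> v3"
begin

lemma transition_map:
  assumes c: "c \<in> charts M" "c' \<in> charts M" and a: "a \<in> fst c \<inter> fst c' - P"
  obtains U T where "open U" "snd c a \<in> U" "U \<subseteq> D c" "T holomorphic_on U" "T ` U \<subseteq> D c'" "T (snd c a) = snd c' a"
    "deriv T (snd c a) = deriv (\<lambda>\<zeta>. snd c' (inv_into (fst c) (snd c) \<zeta>)) (snd c a)" "\<And>\<zeta>. \<zeta> \<in> U \<Longrightarrow> deriv T \<zeta> \<noteq> 0"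
    "\<And>\<zeta>. \<zeta> \<in> U \<Longrightarrow> A c \<zeta> = deriv T \<zeta> * A c' (T \<zeta>)" "\<And>\<zeta>. \<zeta> \<in> U \<Longrightarrow> B c \<zeta> = deriv T \<zeta> * B c' (T \<zeta>)"
proof -
  define T where "T = (\<lambda>\<zeta>. snd c' (inv_into (fst c) (snd c) \<zeta>))"
  define U where "U = snd c ` (fst c \<inter> fst c' - P)"
  have Tx: "T (snd c x) = snd c' x" if "x \<in> fst c" for x using chart_inv[OF RM c(1) that] unfolding T_def by simp
  have "openin (surf_top M) (fst c \<inter> fst c')" using chart_open[OF RM] c by blast
  then have Uo: "open U" unfolding U_def by (auto intro!: chart_open_image[OF RM c(1)] P_closed)
  have Th: "T holomorphic_on U" using chart_transition[OF RM c] unfolding T_def U_def by (rule holomorphic_on_subset) auto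
  have Ti: "inj_on T U"
  proof (rule inj_onI)
    fix x y assume "x \<in> U" "y \<in> U" "T x = T y"
    then obtain p q where pq: "p \<in> fst c \<inter> fst c'" "q \<in> fst c \<inter> fst c'" "x = snd c p" "y = snd c q" "snd c' p = snd c' q"
      using Tx unfolding U_def by auto
    then show "x = y" using inj_onD[OF chart_inj[OF RM c(2)], of p q] by auto
  qed
  show ?thesis
  proof (rule that[of U T])
    show "U \<subseteq> D c" unfolding U_def D_def by auto
    show "T ` U \<subseteq> D c'" using Tx unfolding U_def D_def by auto
    show "T (snd c a) = snd c' a" using Tx a by blast
    show "deriv T \<zeta> \<noteq> 0" if "\<zeta> \<in> U" for \<zeta> by (rule holomorphic_injective_imp_regular[OF Th Uo Ti that])
    fix \<zeta> assume "\<zeta> \<in> U"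
    then obtain x where x: "x \<in> fst c \<inter> fst c' - P" "\<zeta> = snd c x" unfolding U_def by blast
    show "A c \<zeta> = deriv T \<zeta> * A c' (T \<zeta>)" "B c \<zeta> = deriv T \<zeta> * B c' (T \<zeta>)"
      using At[OF c x(1)] B_transition(1)[OF c x(1)] Tx[of x] x unfolding T_def[symmetric] by auto
  qed (use a Uo Th in \<open>auto simp: U_def T_def\<close>)
qed

lemma A_differentiable: "c \<in> charts M \<Longrightarrow> \<zeta> \<in> D c \<Longrightarrow> A c field_differentiable at \<zeta>"
  and B_differentiable: "c \<in> charts M \<Longrightarrow> \<zeta> \<in> D c \<Longrightarrow> B c field_differentiable at \<zeta>"
  using Ah ABC_holomorphic(3) D_open holomorphic_on_imp_differentiable_at by blast+

text \<open>A change of charts \<open>T\<close> multiplies \<open>(A, B)\<close> by \<open>T'\<close>, to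
  which \<open>omega\<close> is insensitive by homogeneity, and the derivatives in the Wronskian
  contribute one more factor \<open>T'\<close>.\<close>

lemma wronskian_omega_transition:
  assumes c: "c \<in> charts M" "c' \<in> charts M" and a: "a \<in> fst c \<inter> fst c' - P"
  shows "wronskian (A c) (B c) (snd c a) = 0 \<Longrightarrow> wronskian (A c') (B c') (snd c' a) = 0"
    "omega v1 v2 v3 (A c) (B c) (snd c a) = omega v1 v2 v3 (A c') (B c') (snd c' a) * deriv (\<lambda>\<zeta>. snd c' (inv_into (fst c) (snd c) \<zeta>)) (snd c a)"
proof -
  obtain U T where U: "open U" "snd c a \<in> U" "U \<subseteq> D c" and T: "T holomorphic_on U" "T ` U \<subseteq> D c'" "T (snd c a) = snd c' a"
    "deriv T (snd c a) = deriv (\<lambda>\<zeta>. snd c' (inv_into (fst c) (snd c) \<zeta>)) (snd c a)" "\<And>\<zeta>. \<zeta> \<in> U \<Longrightarrow> deriv T \<zeta> \<noteq> 0"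
    "\<And>\<zeta>. \<zeta> \<in> U \<Longrightarrow> A c \<zeta> = deriv T \<zeta> * A c' (T \<zeta>)" "\<And>\<zeta>. \<zeta> \<in> U \<Longrightarrow> B c \<zeta> = deriv T \<zeta> * B c' (T \<zeta>)"
    by (rule transition_map[OF assms]) (rule that)
  let ?a = "\<lambda>\<zeta>. A c' (T \<zeta>)" and ?b = "\<lambda>\<zeta>. B c' (T \<zeta>)"
  have h: "?a holomorphic_on U" "?b holomorphic_on U" "deriv T holomorphic_on U"
    using holomorphic_on_compose_gen[OF T(1) Ah[OF c(2)] T(2)] holomorphic_on_compose_gen[OF T(1) ABC_holomorphic(3)[OF c(2)] T(2)]
      holomorphic_deriv[OF T(1) U(1)] by (simp_all add: o_def)
  have Tz: "T (snd c a) \<in> D c'" using T(2) U(2) by blast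
  have w: "wronskian ?a ?b (snd c a) = wronskian (A c') (B c') (T (snd c a)) * deriv T (snd c a)"
    by (rule wronskian_compose[OF holomorphic_on_imp_differentiable_at[OF T(1) U(1,2)] A_differentiable[OF c(2) Tz] B_differentiable[OF c(2) Tz]])
  have s: "wronskian (A c) (B c) (snd c a) = (deriv T (snd c a))\<^sup>2 * wronskian ?a ?b (snd c a)"
    by (rule wronskian_scale[OF U(1,2) h T(6,7)])
  show "wronskian (A c') (B c') (snd c' a) = 0" if "wronskian (A c) (B c) (snd c a) = 0"
    using that T(5)[OF U(2)] T(3) unfolding s w by simp
  have "omega v1 v2 v3 (A c) (B c) (snd c a) = omega v1 v2 v3 ?a ?b (snd c a)"
    by (rule omega_scale[OF U(1,2) h T(6,7) T(5)[OF U(2)]])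
  also have "\<dots> = omega v1 v2 v3 (A c') (B c') (T (snd c a)) * deriv T (snd c a)"
    unfolding omega_def w by simp
  finally show "omega v1 v2 v3 (A c) (B c) (snd c a) = omega v1 v2 v3 (A c') (B c') (snd c' a) * deriv (\<lambda>\<zeta>. snd c' (inv_into (fst c) (snd c) \<zeta>)) (snd c a)"
    unfolding T(3,4) .
qed

lemma constant_in_model_False: assumes "\<And>a. a \<in> topspace (surf_top M) - P \<Longrightarrow> G (e a) = v" shows False
proof -
  have "G s = v" if "s \<in> topspace (surf_top S)" for s
    using assms[of "f s"] ef[OF that] f_img that by auto
  then show False using nonconst unfolding constant_on_def by blast
qed

text \<open>If \<open>B\<close> vanished identically, \<open>G\<close> would have the default value
  \<open>0\<close> everywhere and be constant.\<close>

lemma B_not_vanishing: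
  assumes "c \<in> charts M" "0 < r" "ball z r \<subseteq> D c" shows "\<exists>\<zeta>\<in>ball z r. B c \<zeta> \<noteq> 0"
proof -
  have "\<not> (\<forall>c\<in>charts M. \<forall>\<zeta>\<in>D c. B c \<zeta> = 0)"
  proof
    assume B0: "\<forall>c\<in>charts M. \<forall>\<zeta>\<in>D c. B c \<zeta> = 0"
    have "G (e a) = Some 0" if a: "a \<in> topspace (surf_top M) - P" for a
    proof -
      obtain c where c: "c \<in> charts M" "a \<in> fst c" using charts_cover[OF RM] a by blast
      have z: "snd c a \<in> D c" using c a unfolding D_def by blast
      have "\<forall>\<^sub>F \<zeta> in at (snd c a). \<zeta> \<in> D c - {snd c a}" by (rule eventually_at_in_open[OF D_open[OF c(1)] z])
      then have "\<forall>\<^sub>F \<zeta> in at (snd c a). 0 = A c \<zeta> / B c \<zeta>" by (rule eventually_mono) (use B0 c(1) in auto)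
      then have l: "((\<lambda>\<zeta>. A c \<zeta> / B c \<zeta>) \<longlongrightarrow> 0) (at (snd c a))" by (rule Lim_transform_eventually[OF tendsto_const])
      then have "\<not> is_pole (\<lambda>\<zeta>. A c \<zeta> / B c \<zeta>) (snd c a)"
        unfolding is_pole_def using not_tendsto_and_filterlim_at_infinity[OF _ l] by auto
      moreover have "Lim (at (snd c a)) (\<lambda>\<zeta>. A c \<zeta> / B c \<zeta>) = 0" by (rule tendsto_Lim[OF _ l]) simp
      ultimately show ?thesis using G[OF c(1), of a] c a by (simp add: quotient_value_def Let_def)
    qed
    then show False by (rule constant_in_model_False)
  qed
  moreover have "B c' (snd c' a) = 0" if "c \<in> charts M" "c' \<in> charts M" "a \<in> fst c \<inter> fst c' - P" "B c (snd c a) = 0" for c c' a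
    using B_transition(1)[OF that(2,1), of a] that by auto
  ultimately show ?thesis using vanish_dichotomy[of B] ABC_holomorphic(3) assms by blast
qed

lemma regular_rep:
  assumes c: "c \<in> charts M" and a: "a \<in> fst c - P" and r0: "r0 > 0"
  obtains s a0 b0 where "coprime_rep (snd c a) s a0 b0" "s \<le> r0" "ball (snd c a) s \<subseteq> D c"
    "\<And>\<zeta>. \<zeta> \<in> ball (snd c a) s \<Longrightarrow> A c \<zeta> * b0 \<zeta> = B c \<zeta> * a0 \<zeta>"
    "\<And>\<zeta>. \<zeta> \<in> ball (snd c a) s \<Longrightarrow> G (e (inv_into (fst c) (snd c) \<zeta>)) = sph (a0 \<zeta>) (b0 \<zeta>)"
proof -
  obtain r1 where r1: "r1 > 0" "ball (snd c a) r1 \<subseteq> D c" by (rule ball_D[OF c a])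
  define r where "r = min r0 r1"
  have r: "r > 0" "ball (snd c a) r \<subseteq> D c" "r \<le> r0" using r0 r1 by (auto simp: r_def)
  have h: "A c holomorphic_on ball (snd c a) r" "B c holomorphic_on ball (snd c a) r"
    using holomorphic_on_subset[OF Ah[OF c] r(2)] holomorphic_on_subset[OF ABC_holomorphic(3)[OF c] r(2)] by auto
  obtain s a0 b0 where s: "coprime_rep (snd c a) s a0 b0" "s \<le> r" "\<And>\<zeta>. \<zeta> \<in> ball (snd c a) s \<Longrightarrow> quotient_value (A c) (B c) \<zeta> = sph (a0 \<zeta>) (b0 \<zeta>)"
    "\<And>\<zeta>. \<zeta> \<in> ball (snd c a) s \<Longrightarrow> A c \<zeta> * b0 \<zeta> = B c \<zeta> * a0 \<zeta>"
    by (rule quotient_coprime_rep[OF r(1) h B_not_vanishing[OF c r(1,2)]]) (rule that)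
  have sub: "ball (snd c a) s \<subseteq> ball (snd c a) r" using s(2) by auto
  show ?thesis
  proof (rule that[OF s(1)])
    show "s \<le> r0" using s(2) r(3) by simp
    show "ball (snd c a) s \<subseteq> D c" using sub r(2) by blast
    fix \<zeta> assume \<zeta>: "\<zeta> \<in> ball (snd c a) s"
    then have "\<zeta> \<in> D c" using sub r(2) by blast
    then obtain x where x: "x \<in> fst c - P" "\<zeta> = snd c x" unfolding D_def by blast
    have "inv_into (fst c) (snd c) \<zeta> = x" using chart_inv[OF RM c] x by blast
    then show "G (e (inv_into (fst c) (snd c) \<zeta>)) = sph (a0 \<zeta>) (b0 \<zeta>)" using G[OF c x(1)] s(3)[OF \<zeta>] x(2) by simp
  qed (rule s(4))
qed

text \<open>If the Wronskian vanished identically, \<open>G\<close> would be locally constant, hence constant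
  on the connected surface.\<close>

lemma wronskian_not_vanishing:
  assumes "c \<in> charts M" "0 < r" "ball z r \<subseteq> D c" shows "\<exists>\<zeta>\<in>ball z r. wronskian (A c) (B c) \<zeta> \<noteq> 0"
proof -
  have "\<not> (\<forall>c\<in>charts M. \<forall>\<zeta>\<in>D c. wronskian (A c) (B c) \<zeta> = 0)"
  proof
    assume W0: "\<forall>c\<in>charts M. \<forall>\<zeta>\<in>D c. wronskian (A c) (B c) \<zeta> = 0"
    let ?T = "subtopology (surf_top M) (topspace (surf_top M) - P)"
    have loc: "\<exists>U. openin ?T U \<and> a \<in> U \<and> (\<forall>x\<in>U. G (e x) = G (e a))" if a: "a \<in> topspace ?T" for a
    proof -
      have at: "a \<in> topspace (surf_top M)" using a by auto
      obtain c where c: "c \<in> charts M" "a \<in> fst c" using charts_cover[OF RM at] by blast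
      have aP: "a \<in> fst c - P" using a c by auto
      let ?z = "snd c a"
      obtain s a0 b0 where s: "coprime_rep ?z s a0 b0" "s \<le> 1" "ball ?z s \<subseteq> D c"
        "\<And>\<zeta>. \<zeta> \<in> ball ?z s \<Longrightarrow> A c \<zeta> * b0 \<zeta> = B c \<zeta> * a0 \<zeta>"
        "\<And>\<zeta>. \<zeta> \<in> ball ?z s \<Longrightarrow> G (e (inv_into (fst c) (snd c) \<zeta>)) = sph (a0 \<zeta>) (b0 \<zeta>)"
        by (rule regular_rep[OF c(1) aP zero_less_one]) (rule that)
      have s0: "s > 0" and h0: "a0 holomorphic_on ball ?z s" "b0 holomorphic_on ball ?z s" using s(1) unfolding coprime_rep_def by auto
      have hB: "A c holomorphic_on ball ?z s" "B c holomorphic_on ball ?z s"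
        using holomorphic_on_subset[OF Ah[OF c(1)] s(3)] holomorphic_on_subset[OF ABC_holomorphic(3)[OF c(1)] s(3)] by auto
      define U where "U = ball ?z s \<inter> B c -` (- {0})"
      have Uo: "open U" unfolding U_def using hB(2) by (intro continuous_open_preimage holomorphic_on_imp_continuous_on) auto
      have Une: "U \<noteq> {}" using B_not_vanishing[OF c(1) s0 s(3)] unfolding U_def by blast
      have Us: "U \<subseteq> ball ?z s" unfolding U_def by blast
      have BU: "B c \<zeta> \<noteq> 0" if "\<zeta> \<in> U" for \<zeta> using that unfolding U_def by blast
      have WU: "wronskian a0 b0 \<zeta> = 0" if \<zeta>: "\<zeta> \<in> U" for \<zeta>
      proof -
        have "wronskian a0 b0 \<zeta> = (b0 \<zeta> / B c \<zeta>)\<^sup>2 * wronskian (A c) (B c) \<zeta>"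
        proof (rule wronskian_scale[OF Uo \<zeta>])
          show "A c holomorphic_on U" "B c holomorphic_on U" using hB Us holomorphic_on_subset by blast+
          then show "(\<lambda>\<zeta>. b0 \<zeta> / B c \<zeta>) holomorphic_on U" using BU h0(2) Us
            by (intro holomorphic_intros) (auto elim: holomorphic_on_subset)
          fix \<xi> assume \<xi>: "\<xi> \<in> U"
          then have "A c \<xi> * b0 \<xi> = B c \<xi> * a0 \<xi>" using s(4) Us by blast
          then show "a0 \<xi> = b0 \<xi> / B c \<xi> * A c \<xi>" "b0 \<xi> = b0 \<xi> / B c \<xi> * B c \<xi>" using BU[OF \<xi>] by (simp_all add: field_simps)
        qed
        moreover have "wronskian (A c) (B c) \<zeta> = 0" using W0 c(1) \<zeta> Us s(3) by blast
        ultimately show ?thesis by simp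
      qed
      have Wb: "wronskian a0 b0 \<zeta> = 0" if "\<zeta> \<in> ball ?z s" for \<zeta>
        by (rule analytic_continuation_open[of U "ball ?z s" "wronskian a0 b0" "\<lambda>_. 0" \<zeta>])
          (use Uo Une Us WU that wronskian_holomorphic[OF h0 open_ball] in auto)
      define V where "V = {x \<in> fst c. snd c x \<in> ball ?z s}"
      have Vo: "openin (surf_top M) V" unfolding V_def by (rule chart_preimage_open[OF RM c(1) open_ball])
      have VP: "V \<inter> P = {}" using snd_in_D_iff[OF c(1)] s(3) unfolding V_def by blast
      have "G (e x) = sph (a0 ?z) (b0 ?z)" if "x \<in> V" for x
        using s(5)[of "snd c x"] wronskian_zero_constant[OF s(1) Wb, of "snd c x"] that chart_inv[OF RM c(1)] unfolding V_def by auto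
      moreover have aV: "a \<in> V" unfolding V_def using c(2) s0 by simp
      ultimately have "\<forall>x\<in>V. G (e x) = G (e a)" by metis
      then show ?thesis using N_open[OF Vo VP] aV by blast
    qed
    obtain s0 where "s0 \<in> topspace (surf_top S)" using RS unfolding riemann_surface_def by blast
    then have "f s0 \<in> topspace (surf_top M) - P" using f_img by blast
    then obtain a0 where a0: "a0 \<in> topspace ?T" by auto
    have "topspace ?T \<inter> {x. G (e x) = G (e a0)} = {} \<or> topspace ?T \<subseteq> {x. G (e x) = G (e a0)}"
    proof (rule connected_space_dichotomy[OF N_connected])
      fix a assume "a \<in> topspace ?T"
      then obtain U where U: "openin ?T U" "a \<in> U" "\<And>x. x \<in> U \<Longrightarrow> G (e x) = G (e a)" using loc by meson
      have "U \<inter> {x. G (e x) = G (e a0)} = {} \<or> U \<subseteq> {x. G (e x) = G (e a0)}"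
      proof (cases "G (e a) = G (e a0)")
        case True
        have "G (e x) = G (e a0)" if "x \<in> U" for x using U(3)[OF that] True by (rule trans)
        then show ?thesis by blast
      next
        case False
        have "G (e x) \<noteq> G (e a0)" if "x \<in> U" for x unfolding U(3)[OF that] by (rule False)
        then show ?thesis by blast
      qed
      then show "\<exists>U. openin ?T U \<and> a \<in> U \<and> (U \<inter> {x. G (e x) = G (e a0)} = {} \<or> U \<subseteq> {x. G (e x) = G (e a0)})"
        using U(1,2) by blast
    qed
    then have "topspace ?T \<subseteq> {x. G (e x) = G (e a0)}" using a0 by blast
    then show False using constant_in_model_False[of "G (e a0)"] by auto
  qed
  moreover have "wronskian (A c) (B c) holomorphic_on D c" if "c \<in> charts M" for c
    by (rule wronskian_holomorphic[OF Ah[OF that] ABC_holomorphic(3)[OF that] D_open[OF that]])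
  ultimately show ?thesis using vanish_dichotomy[of "\<lambda>c. wronskian (A c) (B c)"] wronskian_omega_transition(1) assms by blast
qed

text \<open>At a point of the surface the quotient \<open>A / B\<close> is reduced, and at a puncture the
  three omitted values give an extension by Picard's theorem. The cross relation says that
  \<open>a0\<close> and \<open>b0\<close> represent the same component as \<open>A\<close> and
  \<open>B\<close>; it is stated on \<open>D c\<close>, which contains the centre exactly if that is
  not a puncture.\<close>

lemma extended_coprime_rep:
  assumes c: "c \<in> charts M" and a: "a \<in> fst c"
  obtains s a0 b0 where "coprime_rep (snd c a) s a0 b0" "ball (snd c a) s - {snd c a} \<subseteq> D c"
    "\<And>\<zeta>. \<zeta> \<in> ball (snd c a) s \<inter> D c \<Longrightarrow> A c \<zeta> * b0 \<zeta> = B c \<zeta> * a0 \<zeta> \<and> sph (a0 \<zeta>) (b0 \<zeta>) \<notin> {v1, v2, v3}"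
    "\<exists>w\<in>ball (snd c a) s. wronskian a0 b0 w \<noteq> 0"
proof -
  let ?z = "snd c a"
  have omitG: "G (e (inv_into (fst c) (snd c) \<zeta>)) \<notin> {v1, v2, v3}" if \<zeta>: "\<zeta> \<in> D c" for \<zeta>
  proof -
    obtain x where x: "x \<in> fst c - P" "\<zeta> = snd c x" using \<zeta> unfolding D_def by blast
    have "inv_into (fst c) (snd c) \<zeta> = x" using chart_inv[OF RM c] x by blast
    moreover have "e x \<in> topspace (surf_top S)" using fe(2)[of x] chart_mem[OF c] x(1) by blast
    ultimately show ?thesis using omit by simp
  qed
  have reg: "\<exists>s a b. coprime_rep w s a b \<and> s \<le> r0 \<and> ball w s \<subseteq> D c \<and> (\<forall>\<zeta>\<in>ball w s. A c \<zeta> * b \<zeta> = B c \<zeta> * a \<zeta>) \<and>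
      (\<forall>\<zeta>\<in>ball w s. G (e (inv_into (fst c) (snd c) \<zeta>)) = sph (a \<zeta>) (b \<zeta>))" if w: "w \<in> D c" "r0 > 0" for w r0
  proof -
    obtain x where x: "x \<in> fst c - P" "w = snd c x" using w unfolding D_def by blast
    show ?thesis using regular_rep[OF c x(1) w(2)] x(2) by metis
  qed
  have "\<exists>r>0. ball ?z r - {?z} \<subseteq> D c"
  proof -
    have "openin (surf_top M) (fst c - (P - {a}))"
      using chart_open[OF RM c] P Hausdorff closedin_Hausdorff_finite[of "surf_top M" "P - {a}"] openin_diff by blast
    then have "open (snd c ` (fst c - (P - {a})))" by (rule chart_open_image[OF RM c]) auto
    then obtain r where "r > 0" "ball ?z r \<subseteq> snd c ` (fst c - (P - {a}))" using a by (auto elim!: openE[where x = ?z])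
    then show ?thesis unfolding D_def by blast
  qed
  then obtain r where r: "r > 0" "ball ?z r - {?z} \<subseteq> D c" by blast
  have "\<exists>s a0 b0. coprime_rep ?z s a0 b0 \<and> s \<le> r \<and> (\<forall>\<zeta>\<in>ball ?z s \<inter> D c. G (e (inv_into (fst c) (snd c) \<zeta>)) = sph (a0 \<zeta>) (b0 \<zeta>))"
  proof (cases "?z \<in> D c")
    case True
    from reg[OF this r(1)] show ?thesis by blast
  next
    case False
    obtain \<alpha> u2 u3 where u: "Some \<alpha> \<noteq> u2" "Some \<alpha> \<noteq> u3" "u2 \<noteq> u3" "{Some \<alpha>, u2, u3} = {v1, v2, v3}"
    proof (cases v1)
      case (Some \<alpha>)
      then show ?thesis using that[of \<alpha> v2 v3] vdist by auto
    next
      case None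
      then obtain \<alpha> where "v2 = Some \<alpha>" using vdist(1) by (cases v2) auto
      then show ?thesis using that[of \<alpha> v1 v3] vdist by auto
    qed
    have loc: "\<exists>s a b. coprime_rep w s a b \<and> (\<forall>\<zeta>\<in>ball w s. G (e (inv_into (fst c) (snd c) \<zeta>)) = sph (a \<zeta>) (b \<zeta>))"
      if "w \<in> ball ?z r - {?z}" for w
    proof -
      have "w \<in> D c" using that r(2) by blast
      from reg[OF this zero_less_one] show ?thesis by blast
    qed
    have om: "G (e (inv_into (fst c) (snd c) w)) \<noteq> Some \<alpha> \<and> G (e (inv_into (fst c) (snd c) w)) \<noteq> u2 \<and> G (e (inv_into (fst c) (snd c) w)) \<noteq> u3"
      if "w \<in> ball ?z r - {?z}" for w
    proof -
      have "w \<in> D c" using that r(2) by blast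
      from omitG[OF this] show ?thesis unfolding u(4)[symmetric] by blast
    qed
    obtain s a0 b0 where s: "coprime_rep ?z s a0 b0" "s \<le> r" "\<And>\<zeta>. \<zeta> \<in> ball ?z s - {?z} \<Longrightarrow> G (e (inv_into (fst c) (snd c) \<zeta>)) = sph (a0 \<zeta>) (b0 \<zeta>)"
      by (rule picard_coprime_rep[OF r(1) loc om u(1-3)]) (assumption | rule that)+
    then show ?thesis using False by blast
  qed
  then obtain s a0 b0 where s: "coprime_rep ?z s a0 b0" "s \<le> r"
    and sG: "\<And>\<zeta>. \<zeta> \<in> ball ?z s \<inter> D c \<Longrightarrow> G (e (inv_into (fst c) (snd c) \<zeta>)) = sph (a0 \<zeta>) (b0 \<zeta>)" by blast
  have s0: "s > 0" and h0: "a0 holomorphic_on ball ?z s" "b0 holomorphic_on ball ?z s"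
    and cop: "\<And>\<zeta>. \<zeta> \<in> ball ?z s \<Longrightarrow> a0 \<zeta> \<noteq> 0 \<or> b0 \<zeta> \<noteq> 0" using s(1) unfolding coprime_rep_def by auto
  have sub: "ball ?z s - {?z} \<subseteq> D c" using r(2) s(2) by (meson Diff_mono dual_order.refl dual_order.trans subset_ball)
  have eq: "A c \<zeta> * b0 \<zeta> = B c \<zeta> * a0 \<zeta>" if \<zeta>: "\<zeta> \<in> ball ?z s \<inter> D c" for \<zeta>
  proof -
    obtain t a' b' where t: "coprime_rep \<zeta> t a' b'" "\<And>\<xi>. \<xi> \<in> ball \<zeta> t \<Longrightarrow> A c \<xi> * b' \<xi> = B c \<xi> * a' \<xi>"
      "\<And>\<xi>. \<xi> \<in> ball \<zeta> t \<Longrightarrow> G (e (inv_into (fst c) (snd c) \<xi>)) = sph (a' \<xi>) (b' \<xi>)"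
      using reg[of \<zeta> 1] \<zeta> by auto
    have z: "\<zeta> \<in> ball \<zeta> t" and c': "a' \<zeta> \<noteq> 0 \<or> b' \<zeta> \<noteq> 0" using t(1) unfolding coprime_rep_def by auto
    have "sph (a' \<zeta>) (b' \<zeta>) = sph (a0 \<zeta>) (b0 \<zeta>)" using t(3)[OF z] sG[OF \<zeta>] by simp
    from sph_cross_multiply[OF t(2)[OF z] this c'] show ?thesis .
  qed
  have W: "\<exists>w\<in>ball ?z s. wronskian a0 b0 w \<noteq> 0"
  proof (rule ccontr)
    assume "\<not> ?thesis"
    then have W0: "wronskian a0 b0 w = 0" if "w \<in> ball ?z s" for w using that by blast
    define U where "U = (ball ?z s - {?z}) \<inter> b0 -` (- {0})"
    have Uo: "open U" unfolding U_def using holomorphic_on_subset[OF h0(2)]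
      by (intro continuous_open_preimage holomorphic_on_imp_continuous_on) auto
    have UD: "U \<subseteq> D c" "U \<subseteq> ball ?z s" using sub unfolding U_def by blast+
    obtain w where w: "w \<in> ball ?z s - {?z}" "B c w \<noteq> 0"
    proof -
      define w0 where "w0 = ?z + of_real (s/2)"
      have "ball w0 (s/2) \<subseteq> ball ?z s - {?z}"
      proof
        fix x assume x: "x \<in> ball w0 (s/2)"
        have "dist ?z w0 = s/2" using s0 by (simp add: w0_def dist_norm)
        then show "x \<in> ball ?z s - {?z}" using x dist_triangle[of ?z x w0] by (auto simp: dist_commute)
      qed
      then show thesis using that B_not_vanishing[OF c, of "s/2" w0] s0 sub by (meson half_gt_zero subset_trans subsetD)
    qed
    have "b0 w \<noteq> 0" using eq[of w] cop[of w] w sub by auto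
    then have "w \<in> U" using w unfolding U_def by blast
    then obtain t where t: "t > 0" "ball w t \<subseteq> U" using Uo open_contains_ball by blast
    have "wronskian (A c) (B c) \<zeta> = 0" if \<zeta>: "\<zeta> \<in> U" for \<zeta>
    proof -
      have bn: "b0 \<xi> \<noteq> 0" if "\<xi> \<in> U" for \<xi> using that unfolding U_def by blast
      have hU: "a0 holomorphic_on U" "b0 holomorphic_on U" "B c holomorphic_on U"
        using h0 UD ABC_holomorphic(3)[OF c] holomorphic_on_subset by blast+
      have "wronskian (A c) (B c) \<zeta> = (B c \<zeta> / b0 \<zeta>)\<^sup>2 * wronskian a0 b0 \<zeta>"
      proof (rule wronskian_scale[OF Uo \<zeta> hU(1,2)])
        show "(\<lambda>\<zeta>. B c \<zeta> / b0 \<zeta>) holomorphic_on U" using hU bn by (intro holomorphic_intros)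
        fix \<xi> assume \<xi>: "\<xi> \<in> U"
        then have "A c \<xi> * b0 \<xi> = B c \<xi> * a0 \<xi>" using eq UD by blast
        then show "A c \<xi> = B c \<xi> / b0 \<xi> * a0 \<xi>" "B c \<xi> = B c \<xi> / b0 \<xi> * b0 \<xi>" using bn[OF \<xi>] by (simp_all add: field_simps)
      qed
      then show ?thesis using W0[of \<zeta>] \<zeta> UD by auto
    qed
    then show False using wronskian_not_vanishing[OF c t(1), of w] t(2) UD(1) by blast
  qed
  show ?thesis
  proof (rule that[OF s(1) sub _ W])
    show "A c \<zeta> * b0 \<zeta> = B c \<zeta> * a0 \<zeta> \<and> sph (a0 \<zeta>) (b0 \<zeta>) \<notin> {v1, v2, v3}" if "\<zeta> \<in> ball ?z s \<inter> D c" for \<zeta>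
      using eq[OF that] sG[OF that] omitG[of \<zeta>] that by simp
  qed
qed

end

section \<open>Completeness at a puncture\<close>

lemma winds_at_unique:
  assumes "winds_at k z m" "winds_at k z n" "r > 0" and nz: "\<And>\<zeta>. \<zeta> \<in> ball z r - {z} \<Longrightarrow> k \<zeta> \<noteq> 0"
  shows "m = n"
proof -
  obtain s t where st: "s > 0" "winds (ball z s - {z}) (\<lambda>\<zeta>. \<zeta> - z) k m" "t > 0" "winds (ball z t - {z}) (\<lambda>\<zeta>. \<zeta> - z) k n"
    using assms(1,2) unfolding winds_at_def by blast
  define \<rho> where "\<rho> = min r (min s t) / 2"
  have \<rho>: "0 < \<rho>" "\<rho> < r" "\<rho> < s" "\<rho> < t" using st assms(3) by (auto simp: \<rho>_def)
  show ?thesis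
  proof (rule winds_circle_unique[OF \<rho>(1)])
    show "winds (sphere z \<rho>) (\<lambda>x. x - z) k m" using st(2) by (rule winds_subset) (use \<rho> in auto)
    show "winds (sphere z \<rho>) (\<lambda>x. x - z) k n" using st(4) by (rule winds_subset) (use \<rho> in auto)
    show "k x \<noteq> 0" if "x \<in> sphere z \<rho>" for x using that \<rho> by (intro nz) auto
  qed
qed

lemma holomorphic_isolated:
  assumes "r > 0" "k holomorphic_on ball z r" "\<exists>w\<in>ball z r. k w \<noteq> 0"
  obtains s where "0 < s" "s \<le> r" "\<And>\<zeta>. \<zeta> \<in> ball z s - {z} \<Longrightarrow> k \<zeta> \<noteq> 0"
proof -
  obtain n :: nat and u s where u: "0 < s" "s \<le> r" "u holomorphic_on ball z s" "\<And>\<zeta>. \<zeta> \<in> ball z s \<Longrightarrow> u \<zeta> \<noteq> 0"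
    "\<And>\<zeta>. \<zeta> \<in> ball z s \<Longrightarrow> k \<zeta> = (\<zeta> - z) ^ n * u \<zeta>"
    by (rule holomorphic_order[OF assms]) (rule that)
  show ?thesis by (rule that[OF u(1,2)]) (use u in auto)
qed

lemma eq_at_center:
  fixes h k :: "complex \<Rightarrow> complex"
  assumes "r > 0" "continuous_on (ball z r) h" "continuous_on (ball z r) k" "\<And>\<zeta>. \<zeta> \<in> ball z r - {z} \<Longrightarrow> h \<zeta> = k \<zeta>"
  shows "h z = k z"
proof -
  have z: "z \<in> ball z r" using assms(1) by simp
  have "(h \<longlongrightarrow> h z) (at z)" "(k \<longlongrightarrow> k z) (at z)"
    using assms(2,3) z by (auto simp: continuous_on_eq_continuous_at isCont_def)
  moreover have "\<forall>\<^sub>F \<zeta> in at z. h \<zeta> = k \<zeta>"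
    using eventually_at_in_open[OF open_ball z] by (rule eventually_mono) (rule assms(4))
  ultimately show ?thesis using tendsto_cong tendsto_unique[OF trivial_limit_at] by blast
qed

text \<open>The residues \<open>k i z\<close> are real because the real part of the integral of \<open>\<phi>
  i\<close> over a circle is half the increment of the single-valued function \<open>y i\<close>. By
  isotropy their squares sum to \<open>0\<close>.\<close>

lemma no_simple_pole:
  fixes y :: "'i::finite \<Rightarrow> complex \<Rightarrow> real"
  assumes r: "r > 0" and k: "\<And>i. k i holomorphic_on ball z r"
    and \<phi>: "\<And>i \<zeta>. \<zeta> \<in> ball z r - {z} \<Longrightarrow> \<phi> i \<zeta> = k i \<zeta> / (\<zeta> - z)"
    and y: "\<And>i \<zeta>. \<zeta> \<in> ball z r - {z} \<Longrightarrow> (y i has_derivative (\<lambda>v. Re (2 * \<phi> i \<zeta> * v))) (at \<zeta>)"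
    and iso: "\<And>\<zeta>. \<zeta> \<in> ball z r - {z} \<Longrightarrow> (\<Sum>i\<in>UNIV. (\<phi> i \<zeta>)\<^sup>2) = 0"
  shows "k i z = 0"
proof -
  define \<rho> where "\<rho> = r / 2"
  have \<rho>: "0 < \<rho>" "\<rho> < r" using r by (auto simp: \<rho>_def)
  let ?g = "circlepath z \<rho>"
  have gp: "?g t \<in> ball z r - {z}" for t
  proof -
    have "norm (?g t - z) = \<rho>" using \<rho> by (simp add: circlepath norm_mult)
    then show ?thesis using \<rho> by (auto simp: dist_norm norm_minus_commute)
  qed
  have im: "Im (k i z) = 0" for i
  proof -
    have kc: "k i holomorphic_on cball z \<rho>" using k[of i] by (rule holomorphic_on_subset) (use \<rho> in auto)
    have "((\<lambda>u. k i u / (u - z)) has_contour_integral (2 * of_real pi * \<i> * k i z)) ?g"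
      by (rule Cauchy_integral_circlepath_simple[OF kc]) (use \<rho> in auto)
    then have "((\<lambda>u. \<phi> i u) has_contour_integral (2 * of_real pi * \<i> * k i z)) ?g"
      by (rule has_contour_integral_eq) (use \<phi> \<rho> in auto)
    then have "((\<lambda>t. \<phi> i (?g t) * vector_derivative ?g (at t within {0..1})) has_integral (2 * of_real pi * \<i> * k i z)) {0..1}"
      unfolding has_contour_integral_def .
    from has_integral_linear[OF this bounded_linear_Re]
    have 1: "((\<lambda>t. Re (\<phi> i (?g t) * vector_derivative ?g (at t within {0..1}))) has_integral Re (2 * of_real pi * \<i> * k i z)) {0..1}"
      by (simp add: o_def)
    have "((\<lambda>t. 2 * Re (\<phi> i (?g t) * vector_derivative ?g (at t within {0..1}))) has_integral (y i (?g 1) - y i (?g 0))) {0..1}"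
    proof (rule fundamental_theorem_of_calculus)
      fix t :: real assume t: "t \<in> {0..1}"
      have g: "(?g has_vector_derivative vector_derivative ?g (at t within {0..1})) (at t within {0..1})"
        using has_vector_derivative_circlepath[of z \<rho> t "{0..1}"] vector_derivative_circlepath01 t
        by (simp add: vector_derivative_within_cbox)
      have "((\<lambda>t. y i (?g t)) has_derivative (\<lambda>h. Re (2 * \<phi> i (?g t) * (h *\<^sub>R vector_derivative ?g (at t within {0..1}))))) (at t within {0..1})"
        using has_derivative_compose[OF g[unfolded has_vector_derivative_def] y[OF gp]] .
      then show "((\<lambda>t. y i (?g t)) has_vector_derivative 2 * Re (\<phi> i (?g t) * vector_derivative ?g (at t within {0..1}))) (at t within {0..1})"
        unfolding has_vector_derivative_def by (rule has_derivative_eq_rhs) (auto simp: fun_eq_iff algebra_simps)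
    qed simp
    moreover have "?g 1 = ?g 0" by (simp add: circlepath)
    ultimately have "((\<lambda>t. 2 * Re (\<phi> i (?g t) * vector_derivative ?g (at t within {0..1}))) has_integral 0) {0..1}" by simp
    from has_integral_unique[OF this has_integral_mult_right[OF 1, of 2]] show ?thesis by simp
  qed
  have "(\<Sum>i\<in>UNIV. (k i z)\<^sup>2) = 0"
  proof (rule eq_at_center[OF r, of z "\<lambda>\<zeta>. \<Sum>i\<in>UNIV. (k i \<zeta>)\<^sup>2" "\<lambda>_. 0"])
    show "continuous_on (ball z r) (\<lambda>\<zeta>. \<Sum>i\<in>UNIV. (k i \<zeta>)\<^sup>2)"
      by (intro continuous_intros holomorphic_on_imp_continuous_on k)
    fix \<zeta> assume \<zeta>: "\<zeta> \<in> ball z r - {z}"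
    have "(\<Sum>i\<in>UNIV. (k i \<zeta>)\<^sup>2) = (\<Sum>i\<in>UNIV. (\<phi> i \<zeta>)\<^sup>2) * (\<zeta> - z)\<^sup>2"
      unfolding sum_distrib_right using \<zeta> \<phi>[OF \<zeta>] by (intro sum.cong) (auto simp: power_divide)
    then show "(\<Sum>i\<in>UNIV. (k i \<zeta>)\<^sup>2) = 0" using iso[OF \<zeta>] by simp
  qed auto
  moreover have "(k i z)\<^sup>2 = of_real ((Re (k i z))\<^sup>2)" for i using im[of i] by (simp add: complex_eq_iff power2_eq_square)
  ultimately have "of_real (\<Sum>i\<in>UNIV. (Re (k i z))\<^sup>2) = (0::complex)" by simp
  then have "(\<Sum>i\<in>UNIV. (Re (k i z))\<^sup>2) = 0" using of_real_eq_0_iff by blast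
  then have "(Re (k i z))\<^sup>2 = 0" by (subst (asm) sum_nonneg_eq_0_iff) auto
  then show ?thesis using im by (simp add: complex_eq_iff)
qed

context punctured_model
begin

lemma chart_inverse_continuous:
  assumes c: "c \<in> charts M"
  shows "continuous_map (top_of_set (D c)) (surf_top S) (\<lambda>\<zeta>. e (inv_into (fst c) (snd c) \<zeta>))"
proof -
  let ?w = "inv_into (fst c) (snd c)"
  have wi: "?w \<zeta> \<in> fst c - P" if \<zeta>: "\<zeta> \<in> D c" for \<zeta>
  proof -
    obtain x where "x \<in> fst c - P" "\<zeta> = snd c x" using \<zeta> unfolding D_def by blast
    then show ?thesis using chart_inv[OF RM c, of x] by auto
  qed
  have "continuous_map (top_of_set (D c)) (subtopology (surf_top M) (topspace (surf_top M) - P)) ?w"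
    unfolding continuous_map_def
  proof (intro conjI allI impI)
    show "?w \<in> topspace (top_of_set (D c)) \<rightarrow> topspace (subtopology (surf_top M) (topspace (surf_top M) - P))"
      using wi chart_mem[OF c] by auto
    fix U assume "openin (subtopology (surf_top M) (topspace (surf_top M) - P)) U"
    then obtain V where V: "openin (surf_top M) V" "U = V \<inter> (topspace (surf_top M) - P)" unfolding openin_subtopology by blast
    have "openin (surf_top M) (V \<inter> fst c - P)" using V(1) chart_open[OF RM c] P_closed by blast
    then have o: "open (snd c ` (V \<inter> fst c - P))" by (rule chart_open_image[OF RM c]) auto
    have "{\<zeta> \<in> D c. ?w \<zeta> \<in> U} = snd c ` (V \<inter> fst c - P)"
    proof (intro equalityI subsetI)
      fix \<zeta> assume "\<zeta> \<in> {\<zeta> \<in> D c. ?w \<zeta> \<in> U}"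
      then obtain x where x: "x \<in> fst c - P" "\<zeta> = snd c x" "?w \<zeta> \<in> U" unfolding D_def by blast
      then have "x \<in> V" using chart_inv[OF RM c, of x] V(2) by auto
      then show "\<zeta> \<in> snd c ` (V \<inter> fst c - P)" using x by blast
    next
      fix \<zeta> assume "\<zeta> \<in> snd c ` (V \<inter> fst c - P)"
      then obtain x where x: "x \<in> V \<inter> fst c - P" "\<zeta> = snd c x" by blast
      then show "\<zeta> \<in> {\<zeta> \<in> D c. ?w \<zeta> \<in> U}" using chart_inv[OF RM c, of x] chart_mem[OF c, of x] V(2) unfolding D_def by auto
    qed
    moreover have "snd c ` (V \<inter> fst c - P) \<subseteq> D c" unfolding D_def by auto
    ultimately show "openin (top_of_set (D c)) {\<zeta> \<in> topspace (top_of_set (D c)). ?w \<zeta> \<in> U}"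
      using o by (simp add: open_subset)
  qed
  from continuous_map_compose[OF this e_cont] show ?thesis by (simp add: o_def)
qed

text \<open>The image of the path under \<open>e\<close> diverges in \<open>S\<close>, as it leaves every
  compact set, and it has finite length, as its speed is bounded on \<open>{0..<1}\<close>.\<close>

lemma no_bounded_speed_end:
  assumes comp: "complete_surface S X" and c: "c \<in> charts M" and a: "a \<in> fst c" "a \<in> P"
    and \<gamma>: "\<And>t. t \<in> {0..<1} \<Longrightarrow> (\<gamma> has_vector_derivative \<gamma>' t) (at t) \<and> \<gamma> t \<in> D c \<and> (\<forall>i. norm (phi (Y c) i (\<gamma> t) * \<gamma>' t) \<le> L)"
    and \<gamma>': "continuous_on {0..<1} \<gamma>'" and lim: "(\<gamma> \<longlongrightarrow> snd c a) (at_left (1::real))"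
  shows False
proof -
  define \<Gamma> where "\<Gamma> t = e (inv_into (fst c) (snd c) (\<gamma> t))" for t
  have X\<Gamma>: "X \<circ> \<Gamma> = (\<lambda>t. Y c (\<gamma> t))" by (simp add: \<Gamma>_def Y_def fun_eq_iff)
  have \<gamma>c: "continuous_on {0..<1} \<gamma>"
    by (intro continuous_at_imp_continuous_on ballI) (metis \<gamma> has_vector_derivative_continuous)
  define d where "d t = (\<chi> i. Re (2 * phi (Y c) i (\<gamma> t) * \<gamma>' t))" for t :: real
  have d: "((\<lambda>t. Y c (\<gamma> t)) has_vector_derivative d t) (at t)" if t: "t \<in> {0..<1}" for t
  proof -
    have g: "(\<gamma> has_derivative (\<lambda>h. h *\<^sub>R \<gamma>' t)) (at t)" and gD: "\<gamma> t \<in> D c"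
      using \<gamma>[OF t] by (simp_all add: has_vector_derivative_def)
    have "((\<lambda>t. Y c (\<gamma> t) $ i) has_derivative (\<lambda>h. Re (2 * phi (Y c) i (\<gamma> t) * (h *\<^sub>R \<gamma>' t)))) (at t)" for i
      by (rule has_derivative_compose[OF g Y_derivative[OF c gD]])
    then have "((\<lambda>t. Y c (\<gamma> t) $ i) has_derivative (\<lambda>h. h * d t $ i)) (at t)" for i
      unfolding d_def by (rule has_derivative_eq_rhs) (auto simp: fun_eq_iff algebra_simps)
    then show ?thesis
      unfolding has_vector_derivative_def has_derivative_componentwise_within[of "\<lambda>t. Y c (\<gamma> t)"]
      by (auto simp: Basis_vec_def inner_axis)
  qed
  have dc: "continuous_on {0..<1} d"
    unfolding d_def
  proof (intro continuous_intros \<gamma>')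
    fix i
    show "continuous_on {0..<1} (\<lambda>t. phi (Y c) i (\<gamma> t))"
      using \<gamma> by (intro continuous_on_compose2[OF holomorphic_on_imp_continuous_on[OF Phi_holomorphic[OF c]] \<gamma>c]) auto
  qed
  have dn: "norm (d t) \<le> 8 * L" if t: "t \<in> {0..<1}" for t
  proof -
    have "norm (d t) \<le> (\<Sum>i\<in>UNIV. \<bar>d t $ i\<bar>)" by (rule norm_le_l1_cart)
    also have "\<dots> \<le> (\<Sum>i\<in>(UNIV :: 4 set). 2 * L)"
    proof (rule sum_mono)
      fix i
      have "\<bar>d t $ i\<bar> \<le> norm (2 * (phi (Y c) i (\<gamma> t) * \<gamma>' t))" unfolding d_def by (simp only: vec_lambda_beta mult.assoc abs_Re_le_cmod)
      also have "\<dots> = 2 * norm (phi (Y c) i (\<gamma> t) * \<gamma>' t)" by (simp only: norm_mult) simp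
      also have "\<dots> \<le> 2 * L" using \<gamma>[OF t] by simp
      finally show "\<bar>d t $ i\<bar> \<le> 2 * L" .
    qed
    finally show ?thesis by simp
  qed
  have "divergent_path S X \<Gamma>"
    unfolding divergent_path_def
  proof (intro conjI allI impI)
    have "continuous_map (top_of_set {0..<1}) (top_of_set (D c)) \<gamma>"
      using \<gamma>c \<gamma> by (auto simp: continuous_map_in_subtopology)
    from continuous_map_compose[OF this chart_inverse_continuous[OF c]]
    show "continuous_map (top_of_set {0..<1}) (surf_top S) \<Gamma>" unfolding \<Gamma>_def[abs_def] o_def .
    fix b :: real assume b: "0 < b \<and> b < 1"
    have "(\<lambda>t. Y c (\<gamma> t)) C1_differentiable_on {0..b}"
      unfolding C1_differentiable_on_def using d b
      by (intro exI[of _ d] conjI continuous_on_subset[OF dc]) auto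
    then show "(X \<circ> \<Gamma>) piecewise_C1_differentiable_on {0..b}" unfolding X\<Gamma> by (rule C1_differentiable_imp_piecewise)
  next
    fix Cs assume "compactin (surf_top S) Cs"
    then have "compactin (surf_top M) (f ` Cs)" using f_cont image_compactin by blast
    then have cl: "closedin (surf_top M) (f ` Cs)" using Hausdorff compactin_imp_closedin by blast
    have Cs: "Cs \<subseteq> topspace (surf_top S)" using \<open>compactin (surf_top S) Cs\<close> compactin_subset_topspace by blast
    have "a \<notin> f ` Cs" using f_img Cs a(2) by blast
    have "openin (surf_top M) (fst c - f ` Cs)" using chart_open[OF RM c] cl openin_diff by blast
    then have "open (snd c ` (fst c - f ` Cs))" by (rule chart_open_image[OF RM c]) auto
    moreover have "snd c a \<in> snd c ` (fst c - f ` Cs)" using a \<open>a \<notin> f ` Cs\<close> by blast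
    ultimately have "\<forall>\<^sub>F t in at_left 1. \<gamma> t \<in> snd c ` (fst c - f ` Cs)" using topological_tendstoD[OF lim] by blast
    then obtain b where b: "b < 1" "\<And>t. b < t \<Longrightarrow> t < 1 \<Longrightarrow> \<gamma> t \<in> snd c ` (fst c - f ` Cs)" unfolding eventually_at_left_field by blast
    have "\<Gamma> t \<notin> Cs" if t: "b < t \<and> 0 \<le> t \<and> t < 1" for t
    proof
      assume "\<Gamma> t \<in> Cs"
      obtain x where x: "x \<in> fst c - f ` Cs" "\<gamma> t = snd c x" using b(2) t by blast
      have "snd c x \<in> D c" using \<gamma>[of t] t x(2) by auto
      then have "x \<in> topspace (surf_top M) - P" using snd_in_D_iff[OF c] x(1) chart_mem[OF c] by blast
      moreover have "\<Gamma> t = e x" unfolding \<Gamma>_def x(2) using chart_inv[OF RM c, of x] x(1) by simp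
      ultimately have "f (\<Gamma> t) = x" using fe(1) by simp
      then show False using \<open>\<Gamma> t \<in> Cs\<close> x(1) by blast
    qed
    then show "\<exists>t0<1. \<forall>t. t0 < t \<and> 0 \<le> t \<and> t < 1 \<longrightarrow> \<Gamma> t \<notin> Cs" using b(1) by blast
  qed
  then have "path_length_ds X \<Gamma> = \<infinity>" using comp unfolding complete_surface_def by blast
  moreover have "path_length_ds X \<Gamma> \<le> (\<integral>\<^sup>+t. ennreal (8 * L) * indicator {0..<1::real} t \<partial>lborel)"
    unfolding path_length_ds_def
  proof (rule nn_integral_mono)
    fix t :: real
    show "ennreal (norm (vector_derivative (X \<circ> \<Gamma>) (at t))) * indicator {0..<1} t \<le> ennreal (8 * L) * indicator {0..<1} t"
    proof (cases "t \<in> {0..<1}")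
      case True
      have "vector_derivative (X \<circ> \<Gamma>) (at t) = d t" unfolding X\<Gamma> by (rule vector_derivative_at[OF d[OF True]])
      then show ?thesis using dn[OF True] True by (simp add: ennreal_leI)
    qed simp
  qed
  moreover have "(\<integral>\<^sup>+t. ennreal (8 * L) * indicator {0..<1::real} t \<partial>lborel) = ennreal (8 * L) * 1"
    by (subst nn_integral_cmult_indicator) auto
  ultimately show False by (simp add: top_unique)
qed

end

section \<open>The order of the Weierstrass form\<close>

context punctured_model
begin

context
  fixes c z s a1 b1 a2 b2
  assumes c: "c \<in> charts M" and rep1: "coprime_rep z s a1 b1" and rep2: "coprime_rep z s a2 b2"
    and sub: "ball z s - {z} \<subseteq> D c"
    and nz: "\<And>\<zeta>. \<zeta> \<in> ball z s - {z} \<Longrightarrow> B c \<zeta> \<noteq> 0 \<and> b1 \<zeta> \<noteq> 0 \<and> b2 \<zeta> \<noteq> 0"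
    and eq: "\<And>\<zeta>. \<zeta> \<in> ball z s - {z} \<Longrightarrow> A1 c \<zeta> * b1 \<zeta> = B c \<zeta> * a1 \<zeta> \<and> A2 c \<zeta> * b2 \<zeta> = B c \<zeta> * a2 \<zeta>"
begin

text \<open>Isotropic vectors factor as \<open>(B, A1, A2, C) = h (b\<^sub>1 b\<^sub>2, a\<^sub>1 b\<^sub>2,
  b\<^sub>1 a\<^sub>2, a\<^sub>1 a\<^sub>2)\<close>, the Segre parametrization of the quadric
  \<open>B C = A1 A2\<close>.\<close>

lemma spinor:
  assumes \<zeta>: "\<zeta> \<in> ball z s - {z}" and h: "B c \<zeta> = h * (b1 \<zeta> * b2 \<zeta>)"
  shows "A1 c \<zeta> = h * (a1 \<zeta> * b2 \<zeta>)" "A2 c \<zeta> = h * (b1 \<zeta> * a2 \<zeta>)" "C c \<zeta> = h * (a1 \<zeta> * a2 \<zeta>)"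
proof -
  have n: "B c \<zeta> \<noteq> 0" "b1 \<zeta> \<noteq> 0" "b2 \<zeta> \<noteq> 0" using nz[OF \<zeta>] by auto
  have "A1 c \<zeta> * b1 \<zeta> = (h * (a1 \<zeta> * b2 \<zeta>)) * b1 \<zeta>" using eq[OF \<zeta>] h by (simp add: mult_ac)
  then show A1: "A1 c \<zeta> = h * (a1 \<zeta> * b2 \<zeta>)" using n by simp
  have "A2 c \<zeta> * b2 \<zeta> = (h * (b1 \<zeta> * a2 \<zeta>)) * b2 \<zeta>" using eq[OF \<zeta>] h by (simp add: mult_ac)
  then show A2: "A2 c \<zeta> = h * (b1 \<zeta> * a2 \<zeta>)" using n by simp
  have "B c \<zeta> * C c \<zeta> = A1 c \<zeta> * A2 c \<zeta>" using BC_eq(1)[OF c] sub \<zeta> by blast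
  then have "B c \<zeta> * C c \<zeta> = B c \<zeta> * (h * (a1 \<zeta> * a2 \<zeta>))" unfolding A1 A2 unfolding h by (simp add: mult_ac)
  then show "C c \<zeta> = h * (a1 \<zeta> * a2 \<zeta>)" using n by simp
qed

lemma rep_holomorphic:
  shows "0 < s" "a1 holomorphic_on ball z s" "b1 holomorphic_on ball z s" "a2 holomorphic_on ball z s" "b2 holomorphic_on ball z s"
    "a1 z \<noteq> 0 \<or> b1 z \<noteq> 0" "a2 z \<noteq> 0 \<or> b2 z \<noteq> 0"
  using rep1 rep2 unfolding coprime_rep_def by auto

text \<open>A zero of the common factor \<open>E\<close> would be a common zero of all the
  \<open>\<phi>\<^sub>i\<close>, where \<open>X\<close> is not an immersion.\<close>

lemma no_common_factor:
  assumes z: "z \<in> D c" and t: "0 < t" "t \<le> s" and E: "continuous_on (ball z t) E"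
    and BE: "\<And>\<zeta>. \<zeta> \<in> ball z t - {z} \<Longrightarrow> B c \<zeta> = E \<zeta> * (b1 \<zeta> * b2 \<zeta>)"
  shows "E z \<noteq> 0"
proof
  assume E0: "E z = 0"
  have ts: "ball z t \<subseteq> ball z s" using t by auto
  have tD: "ball z t \<subseteq> D c" using ts sub z by blast
  note cD = continuous_on_subset[OF holomorphic_on_imp_continuous_on tD]
  note cs = continuous_on_subset[OF holomorphic_on_imp_continuous_on ts]
  note r = rep_holomorphic
  have "A1 c z = E z * (a1 z * b2 z)"
    by (rule eq_at_center[OF t(1)]) (intro continuous_intros cs cD E ABC_holomorphic c r spinor(1) BE; use ts in blast)+
  moreover have "A2 c z = E z * (b1 z * a2 z)"
    by (rule eq_at_center[OF t(1)]) (intro continuous_intros cs cD E ABC_holomorphic c r spinor(2) BE; use ts in blast)+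
  moreover have "C c z = E z * (a1 z * a2 z)"
    by (rule eq_at_center[OF t(1)]) (intro continuous_intros cs cD E ABC_holomorphic c r spinor(3) BE; use ts in blast)+
  moreover have "B c z = E z * (b1 z * b2 z)"
    by (rule eq_at_center[OF t(1)]) (intro continuous_intros cs cD E ABC_holomorphic c r BE; assumption)+
  ultimately show False using BC_eq(2)[OF c z] E0 by simp
qed

text \<open>If the order were larger, \<open>B / (b1 * b2)\<close> would have a zero at \<open>z\<close>,
  which \<open>no_common_factor\<close> excludes.\<close>

lemma order_at_regular_point:
  assumes z: "z \<in> D c" and p: "winds_at b1 z p1" "winds_at b2 z p2"
  shows "\<exists>n. winds_at (B c) z n \<and> n \<le> p1 + p2"
proof -
  note r = rep_holomorphic
  have sD: "ball z s \<subseteq> D c" using sub z by blast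
  define w where "w = z + of_real (s / 2)"
  have "dist z w = s / 2" using r(1) by (simp add: w_def dist_norm)
  then have w: "w \<in> ball z s - {z}" using r(1) by auto
  obtain n :: nat and u s0 where u: "0 < s0" "s0 \<le> s" "u holomorphic_on ball z s0" "\<And>\<zeta>. \<zeta> \<in> ball z s0 \<Longrightarrow> u \<zeta> \<noteq> 0"
    "\<And>\<zeta>. \<zeta> \<in> ball z s0 \<Longrightarrow> B c \<zeta> = (\<zeta> - z) ^ n * u \<zeta>"
    by (rule holomorphic_order[OF r(1) holomorphic_on_subset[OF ABC_holomorphic(3)[OF c] sD]]) (use w nz in blast, rule that)
  obtain n1 :: nat and u1 s1 where u1: "0 < s1" "s1 \<le> s" "u1 holomorphic_on ball z s1" "\<And>\<zeta>. \<zeta> \<in> ball z s1 \<Longrightarrow> u1 \<zeta> \<noteq> 0"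
    "\<And>\<zeta>. \<zeta> \<in> ball z s1 \<Longrightarrow> b1 \<zeta> = (\<zeta> - z) ^ n1 * u1 \<zeta>"
    by (rule holomorphic_order[OF r(1,3)]) (use w nz in blast, rule that)
  obtain n2 :: nat and u2 s2 where u2: "0 < s2" "s2 \<le> s" "u2 holomorphic_on ball z s2" "\<And>\<zeta>. \<zeta> \<in> ball z s2 \<Longrightarrow> u2 \<zeta> \<noteq> 0"
    "\<And>\<zeta>. \<zeta> \<in> ball z s2 \<Longrightarrow> b2 \<zeta> = (\<zeta> - z) ^ n2 * u2 \<zeta>"
    by (rule holomorphic_order[OF r(1,5)]) (use w nz in blast, rule that)
  have "winds_at (B c) z (int n)" by (rule winds_at_zero_order[OF u(1,3)]) (use u in auto)
  moreover have "winds_at b1 z (int n1)" by (rule winds_at_zero_order[OF u1(1,3)]) (use u1 in auto)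
  then have p1: "p1 = int n1" using winds_at_unique[OF p(1) _ r(1)] nz by blast
  have "winds_at b2 z (int n2)" by (rule winds_at_zero_order[OF u2(1,3)]) (use u2 in auto)
  then have p2: "p2 = int n2" using winds_at_unique[OF p(2) _ r(1)] nz by blast
  have "n \<le> n1 + n2"
  proof (rule ccontr)
    assume "\<not> n \<le> n1 + n2"
    then obtain d where d: "n = n1 + n2 + Suc d" by (metis add_Suc_right less_imp_Suc_add not_le)
    define t where "t = min s0 (min s1 s2)"
    have t: "0 < t" "t \<le> s" "ball z t \<subseteq> ball z s0" "ball z t \<subseteq> ball z s1" "ball z t \<subseteq> ball z s2"
      using u(1,2) u1(1) u2(1) by (auto simp: t_def)
    define E where "E \<zeta> = (\<zeta> - z) ^ Suc d * (u \<zeta> / (u1 \<zeta> * u2 \<zeta>))" for \<zeta>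
    have "E z \<noteq> 0"
    proof (rule no_common_factor[OF z t(1,2)])
      have "E holomorphic_on ball z t" unfolding E_def using u(3) u1(3,4) u2(3,4) t(3-5)
        by (intro holomorphic_intros) (auto elim: holomorphic_on_subset)
      then show "continuous_on (ball z t) E" by (rule holomorphic_on_imp_continuous_on)
      fix \<zeta> assume "\<zeta> \<in> ball z t - {z}"
      then have \<zeta>: "\<zeta> \<in> ball z s0" "\<zeta> \<in> ball z s1" "\<zeta> \<in> ball z s2" using t by blast+
      show "B c \<zeta> = E \<zeta> * (b1 \<zeta> * b2 \<zeta>)"
        unfolding u(5)[OF \<zeta>(1)] u1(5)[OF \<zeta>(2)] u2(5)[OF \<zeta>(3)] E_def d
        using u1(4)[OF \<zeta>(2)] u2(4)[OF \<zeta>(3)] by (simp add: power_add field_simps)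
    qed
    then show False by (simp add: E_def)
  qed
  ultimately show ?thesis unfolding p1 p2 by (metis of_nat_add of_nat_mono)
qed

text \<open>The common factor \<open>\<eta> = B / (b1 * b2)\<close> has no zeros near the puncture, and the
  \<open>\<phi>\<^sub>i\<close> are \<open>\<eta>\<close> times bounded functions \<open>h i\<close>
  without a common zero. A path of bounded speed for \<open>\<eta>\<close> has bounded speed in the
  metric, so \<open>end_order_le\<close> applies; in its second alternative the
  \<open>\<phi>\<^sub>i\<close> would have simple poles, not all with residue \<open>0\<close>.\<close>

lemma order_at_puncture:
  assumes comp: "complete_surface S X" and a: "a \<in> fst c" "a \<in> P" "z = snd c a"
    and p: "winds_at b1 z p1" "winds_at b2 z p2"
  shows "\<exists>n. winds_at (B c) z n \<and> n \<le> p1 + p2 - 2"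
proof -
  note r = rep_holomorphic
  let ?N = "ball z s - {z}"
  define \<eta> where "\<eta> \<zeta> = B c \<zeta> / (b1 \<zeta> * b2 \<zeta>)" for \<zeta>
  have B\<eta>: "B c \<zeta> = \<eta> \<zeta> * (b1 \<zeta> * b2 \<zeta>)" if "\<zeta> \<in> ?N" for \<zeta> using nz[OF that] by (simp add: \<eta>_def)
  have \<eta>0: "\<eta> \<zeta> \<noteq> 0" if "\<zeta> \<in> ?N" for \<zeta> using nz[OF that] by (simp add: \<eta>_def)
  have hN: "b1 holomorphic_on ?N" "b2 holomorphic_on ?N" "B c holomorphic_on ?N"
    using r(3,5) ABC_holomorphic(3)[OF c] sub by (auto elim: holomorphic_on_subset)
  have \<eta>h: "\<eta> holomorphic_on ?N" unfolding \<eta>_def using hN nz by (intro holomorphic_intros) auto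
  obtain m where m: "winds ?N (\<lambda>x. x - z) \<eta> m"
    by (rule winds_exists[OF r(1) holomorphic_on_imp_continuous_on[OF \<eta>h] \<eta>0]) (assumption | rule that)+
  then obtain l where l: "continuous_on ?N l" "\<And>\<zeta>. \<zeta> \<in> ?N \<Longrightarrow> \<eta> \<zeta> = (\<zeta> - z) powi m * exp (l \<zeta>)" unfolding winds_def by blast
  have q: "(\<lambda>\<zeta>. \<eta> \<zeta> / (\<zeta> - z) powi m) holomorphic_on ?N" using \<eta>h by (intro holomorphic_intros) auto
  obtain g where g: "g holomorphic_on ?N" "\<And>\<zeta>. \<zeta> \<in> ?N \<Longrightarrow> \<eta> \<zeta> / (\<zeta> - z) powi m = exp (g \<zeta>)"
    by (rule g_imp_holomorphic_log[OF q l(1)]) (use l(2) \<eta>0 in auto)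
  define h :: "4 \<Rightarrow> complex \<Rightarrow> complex" where "h i \<zeta> =
     (if i = 1 then (b1 \<zeta> * b2 \<zeta> + a1 \<zeta> * a2 \<zeta>) / 2 else if i = 2 then (a1 \<zeta> * a2 \<zeta> - b1 \<zeta> * b2 \<zeta>) / (2 * \<i>)
      else if i = 3 then (a1 \<zeta> * b2 \<zeta> - b1 \<zeta> * a2 \<zeta>) / 2 else (a1 \<zeta> * b2 \<zeta> + b1 \<zeta> * a2 \<zeta>) / (2 * \<i>))" for i \<zeta>
  have hh: "h i holomorphic_on ball z s" for i
    unfolding h_def[abs_def] using r(2-5) by (cases "i = 1"; cases "i = 2"; cases "i = 3") (auto intro!: holomorphic_intros)
  have ph: "phi (Y c) i \<zeta> = \<eta> \<zeta> * h i \<zeta>" if \<zeta>: "\<zeta> \<in> ?N" for i \<zeta>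
  proof -
    note sp = spinor[OF \<zeta> B\<eta>[OF \<zeta>]] B\<eta>[OF \<zeta>]
    have e: "2 * phi (Y c) 1 \<zeta> = B c \<zeta> + C c \<zeta>" "2 * \<i> * phi (Y c) 2 \<zeta> = C c \<zeta> - B c \<zeta>"
      "2 * phi (Y c) 3 \<zeta> = A1 c \<zeta> - A2 c \<zeta>" "2 * \<i> * phi (Y c) 4 \<zeta> = A1 c \<zeta> + A2 c \<zeta>"
      unfolding A1_def A2_def B_def C_def by auto
    have "phi (Y c) 1 \<zeta> = \<eta> \<zeta> * h 1 \<zeta>" using e(1) unfolding sp h_def by (simp add: field_simps)
    moreover have "phi (Y c) 2 \<zeta> = \<eta> \<zeta> * h 2 \<zeta>" using e(2) unfolding sp h_def by (simp add: field_simps)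
    moreover have "phi (Y c) 3 \<zeta> = \<eta> \<zeta> * h 3 \<zeta>" using e(3) unfolding sp h_def by (simp add: field_simps)
    moreover have "phi (Y c) 4 \<zeta> = \<eta> \<zeta> * h 4 \<zeta>" using e(4) unfolding sp h_def by (simp add: field_simps)
    ultimately show ?thesis using exhaust_4[of i] by auto
  qed
  define R where "R = s / 2"
  have R: "0 < R" "R < s" using r(1) by (auto simp: R_def)
  have Rs: "cball z R \<subseteq> ball z s" using R by auto
  have "\<exists>H. \<forall>\<zeta>\<in>cball z R. norm (h i \<zeta>) \<le> H" for i
  proof -
    have "continuous_on (cball z R) (h i)" using holomorphic_on_imp_continuous_on[OF hh] Rs by (rule continuous_on_subset)
    then have "bounded (h i ` cball z R)" by (intro compact_imp_bounded compact_continuous_image) auto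
    then show ?thesis unfolding bounded_iff by blast
  qed
  then obtain H where H: "\<And>i \<zeta>. \<zeta> \<in> cball z R \<Longrightarrow> norm (h i \<zeta>) \<le> H i" by metis
  define L where "L = (\<Sum>i\<in>UNIV. \<bar>H i\<bar>)"
  have HL: "norm (h i \<zeta>) \<le> L" if "\<zeta> \<in> cball z R" for i \<zeta>
  proof -
    have "norm (h i \<zeta>) \<le> \<bar>H i\<bar>" using H[OF that, of i] by linarith
    also have "\<dots> \<le> L" unfolding L_def by (rule member_le_sum) auto
    finally show ?thesis .
  qed
  have shift: "z + x \<in> ?N" if "x \<in> ball 0 R - {0}" for x using that R by (auto simp: dist_norm)
  have "m \<le> -2 \<or> (m = -1 \<and> (\<exists>k \<rho>. 0 < \<rho> \<and> \<rho> \<le> R \<and> k holomorphic_on ball 0 \<rho> \<and> k 0 \<noteq> 0 \<and> (\<forall>x\<in>ball 0 \<rho> - {0}. \<eta> (z + x) = k x / x)))"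
  proof (rule end_order_le[OF R(1)])
    show "(\<lambda>x. g (z + x)) holomorphic_on ball 0 R - {0}"
      by (rule holomorphic_on_compose_gen[of "\<lambda>x. z + x" _ g ?N, unfolded o_def]) (use g(1) shift in \<open>auto intro!: holomorphic_intros\<close>)
    show "\<eta> (z + x) = x powi m * exp (g (z + x))" if "x \<in> ball 0 R - {0}" for x
      using g(2)[OF shift[OF that]] that by (simp add: field_simps)
    fix \<gamma> \<gamma>' :: "real \<Rightarrow> complex" and K
    assume \<gamma>: "\<And>t. t \<in> {0..<1} \<Longrightarrow> (\<gamma> has_vector_derivative \<gamma>' t) (at t) \<and> \<gamma> t \<in> ball 0 R - {0} \<and> norm (\<eta> (z + \<gamma> t) * \<gamma>' t) \<le> K"
      and \<gamma>': "continuous_on {0..<1} \<gamma>'" and lim: "(\<gamma> \<longlongrightarrow> 0) (at_left 1)"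
    show False
    proof (rule no_bounded_speed_end[OF comp c a(1,2) _ \<gamma>'])
      show "((\<lambda>t. z + \<gamma> t) \<longlongrightarrow> snd c a) (at_left 1)" using tendsto_add[OF tendsto_const lim, of z] a(3) by simp
      fix t :: real assume t: "t \<in> {0..<1}"
      have d: "((\<lambda>t. z + \<gamma> t) has_vector_derivative \<gamma>' t) (at t)"
        using has_vector_derivative_add[OF has_vector_derivative_const conjunct1[OF \<gamma>[OF t]], of z] by simp
      have N: "z + \<gamma> t \<in> ?N" using \<gamma>[OF t] shift by blast
      have cb: "z + \<gamma> t \<in> cball z R" using \<gamma>[OF t] by (auto simp: dist_norm)
      have "norm (phi (Y c) i (z + \<gamma> t) * \<gamma>' t) \<le> K * L" for i
      proof -
        have "norm (phi (Y c) i (z + \<gamma> t) * \<gamma>' t) = norm (\<eta> (z + \<gamma> t) * \<gamma>' t) * norm (h i (z + \<gamma> t))"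
          unfolding ph[OF N] by (simp add: norm_mult)
        also have "\<dots> \<le> K * L" using \<gamma>[OF t] HL[OF cb] norm_ge_zero order_trans by (intro mult_mono) blast+
        finally show ?thesis .
      qed
      then show "((\<lambda>t. z + \<gamma> t) has_vector_derivative \<gamma>' t) (at t) \<and> z + \<gamma> t \<in> D c \<and> (\<forall>i. norm (phi (Y c) i (z + \<gamma> t) * \<gamma>' t) \<le> K * L)"
        using d N sub by blast
    qed
  qed
  moreover have False if "m = -1" and k: "0 < \<rho>" "\<rho> \<le> R" "k holomorphic_on ball 0 \<rho>" "k 0 \<noteq> 0" "\<And>x. x \<in> ball 0 \<rho> - {0} \<Longrightarrow> \<eta> (z + x) = k x / x" for k \<rho>
  proof -
    have \<rho>s: "ball z \<rho> \<subseteq> ball z s" using k(2) R by auto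
    have "k (z - z) * h i z = 0" for i
    proof (rule no_simple_pole[OF k(1), of "\<lambda>i \<zeta>. k (\<zeta> - z) * h i \<zeta>" z "phi (Y c)" "\<lambda>i \<xi>. Y c \<xi> $ i"])
      fix i
      have "(\<lambda>\<zeta>. k (\<zeta> - z)) holomorphic_on ball z \<rho>"
        by (rule holomorphic_on_compose_gen[of "\<lambda>x. x - z" _ k "ball 0 \<rho>", unfolded o_def])
          (use k(3) in \<open>auto intro!: holomorphic_intros simp: dist_norm norm_minus_commute\<close>)
      then show "(\<lambda>\<zeta>. k (\<zeta> - z) * h i \<zeta>) holomorphic_on ball z \<rho>"
        by (intro holomorphic_intros holomorphic_on_subset[OF hh \<rho>s])
    next
      fix i \<zeta> assume "\<zeta> \<in> ball z \<rho> - {z}"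
      then have \<zeta>: "\<zeta> \<in> ?N" and \<zeta>0: "\<zeta> - z \<in> ball 0 \<rho> - {0}"
        using \<rho>s by (blast, simp add: dist_norm norm_minus_commute)
      show "phi (Y c) i \<zeta> = k (\<zeta> - z) * h i \<zeta> / (\<zeta> - z)" using ph[OF \<zeta>, of i] k(5)[OF \<zeta>0] by simp
      have D: "\<zeta> \<in> D c" using \<zeta> sub by blast
      show "((\<lambda>\<xi>. Y c \<xi> $ i) has_derivative (\<lambda>v. Re (2 * phi (Y c) i \<zeta> * v))) (at \<zeta>)" by (rule Y_derivative[OF c D])
      show "(\<Sum>i\<in>UNIV. (phi (Y c) i \<zeta>)\<^sup>2) = 0" by (rule Phi_isotropic(1)[OF c D])
    qed
    then have h0: "h i z = 0" for i using k(4) by simp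
    have "b1 z * b2 z + a1 z * a2 z = 0" "a1 z * a2 z - b1 z * b2 z = 0" "a1 z * b2 z - b1 z * a2 z = 0" "a1 z * b2 z + b1 z * a2 z = 0"
      using h0[of 1] h0[of 2] h0[of 3] h0[of 4] by (auto simp: h_def)
    then have "b1 z * b2 z = 0" "a1 z * a2 z = 0" "a1 z * b2 z = 0" "b1 z * a2 z = 0" by (auto simp: add_eq_0_iff)
    then show False using r(6,7) by auto
  qed
  ultimately have "m \<le> -2" by blast
  moreover have "winds_at \<eta> z m" using m r(1) unfolding winds_at_def by blast
  from winds_at_mult[OF this winds_at_mult[OF p]]
  have "winds_at (\<lambda>\<zeta>. \<eta> \<zeta> * (b1 \<zeta> * b2 \<zeta>)) z (m + (p1 + p2))" .
  then have "winds_at (B c) z (m + (p1 + p2))" by (rule winds_at_cong[OF _ r(1)]) (use B\<eta> in simp)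
  ultimately show ?thesis by (intro exI[of _ "m + (p1 + p2)"]) auto
qed

end

end

section \<open>The order of the form of three omitted values\<close>

context gauss_component
begin

text \<open>Near the point \<open>(A, B)\<close> is a multiple of the reduced pair \<open>(a0, b0)\<close>, so
  both give the same form. A linear form can only vanish at the centre if that is a puncture.\<close>

lemma omega_local_order:
  assumes c: "c \<in> charts M" and a: "a \<in> fst c"
    and rep: "coprime_rep (snd c a) s a0 b0" and sub: "ball (snd c a) s - {snd c a} \<subseteq> D c"
    and eq: "\<And>\<zeta>. \<zeta> \<in> ball (snd c a) s \<inter> D c \<Longrightarrow> A c \<zeta> * b0 \<zeta> = B c \<zeta> * a0 \<zeta> \<and> sph (a0 \<zeta>) (b0 \<zeta>) \<notin> {v1, v2, v3}"
    and W: "\<exists>w\<in>ball (snd c a) s. wronskian a0 b0 w \<noteq> 0"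
    and t: "0 < t" "t \<le> s" and nz: "\<And>\<zeta>. \<zeta> \<in> ball (snd c a) t - {snd c a} \<Longrightarrow> B c \<zeta> \<noteq> 0 \<and> b0 \<zeta> \<noteq> 0"
  obtains n p t' where "winds_at (omega v1 v2 v3 (A c) (B c)) (snd c a) n" "winds_at b0 (snd c a) (int p)"
    "int p \<le> n + (if a \<in> P then 1 else 0)" "0 < t'" "\<And>\<zeta>. \<zeta> \<in> ball (snd c a) t' - {snd c a} \<Longrightarrow> wronskian (A c) (B c) \<zeta> \<noteq> 0"
proof -
  let ?z = "snd c a"
  let ?N = "ball ?z t - {?z}"
  have s0: "0 < s" and h: "a0 holomorphic_on ball ?z s" "b0 holomorphic_on ball ?z s" using rep unfolding coprime_rep_def by auto
  have N: "open ?N" "?N \<subseteq> ball ?z s" by (simp add: open_Diff, use subset_ball[OF t(2), of ?z] in blast)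
  then have N: "open ?N" "?N \<subseteq> ball ?z s" "?N \<subseteq> D c" using sub by blast+
  have hN: "a0 holomorphic_on ?N" "b0 holomorphic_on ?N" "B c holomorphic_on ?N"
    using h N ABC_holomorphic(3)[OF c] by (auto elim: holomorphic_on_subset)
  have lN: "(\<lambda>\<zeta>. B c \<zeta> / b0 \<zeta>) holomorphic_on ?N" using hN nz by (intro holomorphic_intros) auto
  have AN: "A c \<zeta> = B c \<zeta> / b0 \<zeta> * a0 \<zeta>" "B c \<zeta> = B c \<zeta> / b0 \<zeta> * b0 \<zeta>" "B c \<zeta> / b0 \<zeta> \<noteq> 0" if "\<zeta> \<in> ?N" for \<zeta>
  proof -
    have "A c \<zeta> * b0 \<zeta> = B c \<zeta> * a0 \<zeta>" using eq that N by blast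
    then show "A c \<zeta> = B c \<zeta> / b0 \<zeta> * a0 \<zeta>" "B c \<zeta> = B c \<zeta> / b0 \<zeta> * b0 \<zeta>" "B c \<zeta> / b0 \<zeta> \<noteq> 0"
      using nz[OF that] by (simp_all add: field_simps)
  qed
  have om: "omega v1 v2 v3 (A c) (B c) \<zeta> = omega v1 v2 v3 a0 b0 \<zeta>" if "\<zeta> \<in> ?N" for \<zeta>
    by (rule omega_scale[OF N(1) that hN(1,2) lN AN(1,2) AN(3)[OF that]])
  obtain n :: int and p :: nat where n: "winds_at (omega v1 v2 v3 a0 b0) ?z n" "winds_at b0 ?z (int p)"
    "int p \<le> n + (if sph (a0 ?z) (b0 ?z) \<in> {v1, v2, v3} then 1 else 0)"
    by (rule omega_order[OF rep W vdist]) (rule that)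
  have np: "int p \<le> n + (if a \<in> P then 1 else 0)"
  proof (cases "a \<in> P")
    case False
    then have "?z \<in> ball ?z s \<inter> D c" using snd_in_D_iff[OF c a] s0 by auto
    then show ?thesis using n(3) eq[of ?z] by auto
  qed (use n(3) in \<open>auto split: if_splits\<close>)
  obtain t1 where t1: "0 < t1" "t1 \<le> s" "\<And>\<zeta>. \<zeta> \<in> ball ?z t1 - {?z} \<Longrightarrow> wronskian a0 b0 \<zeta> \<noteq> 0"
    by (rule holomorphic_isolated[OF s0 wronskian_holomorphic[OF h open_ball] W]) (rule that)
  show ?thesis
  proof (rule that[OF _ n(2) np])
    show "winds_at (omega v1 v2 v3 (A c) (B c)) ?z n" by (rule winds_at_cong[OF n(1) t(1)]) (use om in simp)
    show "0 < min t t1" using t t1 by simp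
    fix \<zeta> assume "\<zeta> \<in> ball ?z (min t t1) - {?z}"
    then have \<zeta>: "\<zeta> \<in> ?N" "\<zeta> \<in> ball ?z t1 - {?z}" by auto
    have "wronskian (A c) (B c) \<zeta> = (B c \<zeta> / b0 \<zeta>)\<^sup>2 * wronskian a0 b0 \<zeta>"
      by (rule wronskian_scale[OF N(1) \<zeta>(1) hN(1,2) lN AN(1,2)])
    then show "wronskian (A c) (B c) \<zeta> \<noteq> 0" using t1(3)[OF \<zeta>(2)] AN(3)[OF \<zeta>(1)] by simp
  qed
qed

lemma ell_not_zero:
  assumes c: "c \<in> charts M" and a: "a \<in> fst c - P" and B: "B c (snd c a) \<noteq> 0" and v: "v \<in> {v1, v2, v3}"
  shows "ell v (A c (snd c a)) (B c (snd c a)) \<noteq> 0"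
proof
  assume "ell v (A c (snd c a)) (B c (snd c a)) = 0"
  then have 1: "sph (A c (snd c a)) (B c (snd c a)) = v" using ell_zero_iff B by blast
  obtain s a0 b0 where s: "coprime_rep (snd c a) s a0 b0"
    "\<And>\<zeta>. \<zeta> \<in> ball (snd c a) s \<inter> D c \<Longrightarrow> A c \<zeta> * b0 \<zeta> = B c \<zeta> * a0 \<zeta> \<and> sph (a0 \<zeta>) (b0 \<zeta>) \<notin> {v1, v2, v3}"
    by (rule extended_coprime_rep[OF c, of a]) (use a in blast, rule that)
  have z: "snd c a \<in> ball (snd c a) s \<inter> D c" using s(1) a unfolding coprime_rep_def D_def by auto
  have b0: "b0 (snd c a) \<noteq> 0" using s(2)[OF z] s(1) B z unfolding coprime_rep_def by auto
  then have "sph (a0 (snd c a)) (b0 (snd c a)) = sph (A c (snd c a)) (B c (snd c a))"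
    using s(2)[OF z] B by (simp add: sph_def field_simps)
  then show False using 1 s(2)[OF z] v by auto
qed

lemma omega_form_on:
  assumes Q: "P \<subseteq> Q" "\<And>c. c \<in> charts M \<Longrightarrow> open (snd c ` (fst c - Q))"
    and nz: "\<And>c a. c \<in> charts M \<Longrightarrow> a \<in> fst c - Q \<Longrightarrow> B c (snd c a) \<noteq> 0 \<and> wronskian (A c) (B c) (snd c a) \<noteq> 0"
  shows "form_on M Q (\<lambda>c. omega v1 v2 v3 (A c) (B c))"
  unfolding form_on_def
proof (intro conjI ballI)
  fix c assume c: "c \<in> charts M"
  have sub: "snd c ` (fst c - Q) \<subseteq> D c" using Q(1) unfolding D_def by blast
  have e: "ell v (A c \<zeta>) (B c \<zeta>) \<noteq> 0" if "\<zeta> \<in> snd c ` (fst c - Q)" "v \<in> {v1, v2, v3}" for \<zeta> v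
    using ell_not_zero[OF c] nz[OF c] that Q(1) by blast
  have "A c holomorphic_on snd c ` (fst c - Q)" "B c holomorphic_on snd c ` (fst c - Q)"
    using Ah[OF c] ABC_holomorphic(3)[OF c] sub holomorphic_on_subset by blast+
  then show "omega v1 v2 v3 (A c) (B c) holomorphic_on snd c ` (fst c - Q)"
    unfolding omega_def[abs_def] using e
    by (intro holomorphic_intros wronskian_holomorphic Q(2)[OF c] ell_holomorphic) auto
  fix a assume a: "a \<in> fst c - Q"
  show "omega v1 v2 v3 (A c) (B c) (snd c a) \<noteq> 0"
    unfolding omega_def using nz[OF c a] e[of "snd c a"] a by auto
next
  fix c c' a assume "c \<in> charts M" "c' \<in> charts M" "a \<in> fst c \<inter> fst c' - Q"
  then show "omega v1 v2 v3 (A c) (B c) (snd c a) = omega v1 v2 v3 (A c') (B c') (snd c' a) * deriv (\<lambda>\<zeta>. snd c' (inv_into (fst c) (snd c) \<zeta>)) (snd c a)"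
    using wronskian_omega_transition(2) Q(1) by blast
qed

end

section \<open>Counting on the sphere\<close>

lemma wronskian_imp_denominator:
  assumes "w \<in> ball z s" "wronskian a b w \<noteq> 0" shows "\<exists>w\<in>ball z s. b w \<noteq> 0"
proof (rule ccontr)
  assume "\<not> ?thesis"
  then have b: "b \<zeta> = 0" if "\<zeta> \<in> ball z s" for \<zeta> using that by blast
  have "deriv b w = deriv (\<lambda>_. 0) w" by (rule deriv_local[OF open_ball assms(1) b])
  then show False using assms b[OF assms(1)] by (simp add: wronskian_def)
qed

lemma coprime_rep_subball: "coprime_rep z s a b \<Longrightarrow> ball w t \<subseteq> ball z s \<Longrightarrow> 0 < t \<Longrightarrow> coprime_rep w t a b"
  unfolding coprime_rep_def by (blast intro: holomorphic_on_subset)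

text \<open>Finitely many of the neighbourhoods \<open>U\<close> cover the space.\<close>

lemma finite_if_locally_isolated:
  assumes T: "compact_space T" and B: "B \<subseteq> topspace T"
    and iso: "\<And>a. a \<in> topspace T \<Longrightarrow> \<exists>U. openin T U \<and> a \<in> U \<and> B \<inter> U \<subseteq> {a}"
  shows "finite B"
proof -
  obtain U where U: "\<And>a. a \<in> topspace T \<Longrightarrow> openin T (U a) \<and> a \<in> U a \<and> B \<inter> U a \<subseteq> {a}" using iso by metis
  have "compactin T (topspace T)" using T unfolding compact_space_def .
  then obtain F where F: "finite F" "F \<subseteq> U ` topspace T" "topspace T \<subseteq> \<Union>F"
    using compactinD[of T "topspace T" "U ` topspace T"] U by blast
  have "B = (\<Union>V\<in>F. B \<inter> V)" using F(3) B by blast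
  moreover have "finite (B \<inter> V)" if V: "V \<in> F" for V
  proof -
    obtain a where "a \<in> topspace T" "V = U a" using V F(2) by blast
    then have "B \<inter> V \<subseteq> {a}" using U by blast
    then show ?thesis by (rule finite_subset) simp
  qed
  ultimately show ?thesis using F(1) finite_UN[OF F(1)] by metis
qed

context punctured_model
begin

text \<open>At a zero of \<open>B\<close> with \<open>b1\<close> and \<open>b2\<close> nonzero, the common
  factor \<open>B / (b1 * b2)\<close> would vanish. So the zeros of \<open>B\<close> cannot
  accumulate at a puncture.\<close>

lemma B_nonzero_near:
  assumes c: "c \<in> charts M" and Bnv: "\<And>z r. 0 < r \<Longrightarrow> ball z r \<subseteq> D c \<Longrightarrow> \<exists>\<zeta>\<in>ball z r. B c \<zeta> \<noteq> 0"
    and rep: "coprime_rep z s a1 b1" "coprime_rep z s a2 b2" and sub: "ball z s - {z} \<subseteq> D c"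
    and nz: "\<And>\<zeta>. \<zeta> \<in> ball z s - {z} \<Longrightarrow> b1 \<zeta> \<noteq> 0 \<and> b2 \<zeta> \<noteq> 0"
    and eq: "\<And>\<zeta>. \<zeta> \<in> ball z s - {z} \<Longrightarrow> A1 c \<zeta> * b1 \<zeta> = B c \<zeta> * a1 \<zeta> \<and> A2 c \<zeta> * b2 \<zeta> = B c \<zeta> * a2 \<zeta>"
    and \<zeta>: "\<zeta> \<in> ball z s - {z}"
  shows "B c \<zeta> \<noteq> 0"
proof
  assume B0: "B c \<zeta> = 0"
  have "open (ball z s - {z})" by (simp add: open_Diff)
  then obtain e1 where e1: "0 < e1" "ball \<zeta> e1 \<subseteq> ball z s - {z}" using \<zeta> open_contains_ball by blast
  have e1D: "ball \<zeta> e1 \<subseteq> D c" using e1(2) sub by blast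
  obtain e2 where e2: "0 < e2" "e2 \<le> e1" "\<And>x. x \<in> ball \<zeta> e2 - {\<zeta>} \<Longrightarrow> B c x \<noteq> 0"
    by (rule holomorphic_isolated[OF e1(1) holomorphic_on_subset[OF ABC_holomorphic(3)[OF c] e1D] Bnv[OF e1(1) e1D]]) (rule that)
  have e: "ball \<zeta> e2 \<subseteq> ball z s - {z}" using e1(2) subset_ball[OF e2(2), of \<zeta>] by blast
  have es: "ball \<zeta> e2 \<subseteq> ball z s" using e by blast
  have bh: "b1 holomorphic_on ball \<zeta> e2" "b2 holomorphic_on ball \<zeta> e2" "B c holomorphic_on ball \<zeta> e2"
    using coprime_rep_subball[OF rep(1) es e2(1)] coprime_rep_subball[OF rep(2) es e2(1)]
      holomorphic_on_subset[OF ABC_holomorphic(3)[OF c]] e sub unfolding coprime_rep_def by blast+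
  have bn: "b1 x \<noteq> 0" "b2 x \<noteq> 0" if "x \<in> ball \<zeta> e2" for x using nz e that by blast+
  have "B c \<zeta> / (b1 \<zeta> * b2 \<zeta>) \<noteq> 0"
  proof (rule no_common_factor[OF c coprime_rep_subball[OF rep(1) es e2(1)] coprime_rep_subball[OF rep(2) es e2(1)], where E = "\<lambda>x. B c x / (b1 x * b2 x)"])
    show "ball \<zeta> e2 - {\<zeta>} \<subseteq> D c" "\<zeta> \<in> D c" using e sub \<zeta> by blast+
    show "B c x \<noteq> 0 \<and> b1 x \<noteq> 0 \<and> b2 x \<noteq> 0" if "x \<in> ball \<zeta> e2 - {\<zeta>}" for x using that e2(3) nz e by blast
    show "A1 c x * b1 x = B c x * a1 x \<and> A2 c x * b2 x = B c x * a2 x" if "x \<in> ball \<zeta> e2 - {\<zeta>}" for x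
      using that e by (intro eq) blast
    show "continuous_on (ball \<zeta> e2) (\<lambda>x. B c x / (b1 x * b2 x))"
      using bn by (intro continuous_intros holomorphic_on_imp_continuous_on bh) auto
    show "B c x = B c x / (b1 x * b2 x) * (b1 x * b2 x)" if "x \<in> ball \<zeta> e2 - {\<zeta>}" for x
    proof -
      have "x \<in> ball z s - {z}" using that e by blast
      from nz[OF this] show ?thesis by simp
    qed
  qed (use e2(1) in auto)
  then show False using B0 by simp
qed

text \<open>At a puncture the two losses of \<open>1\<close> in the orders of the \<open>omega\<close> forms
  are compensated by the \<open>2\<close> in the order of \<open>B\<close>.\<close>

lemma order_inequality:
  assumes comp: "complete_surface S X"
    and i1: "gauss_component S X M P f A1 g1 v1 v2 v3" and i2: "gauss_component S X M P f A2 g2 w1 w2 w3"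
    and c: "c \<in> charts M" and a: "a \<in> fst c"
  shows "\<exists>n n1 n2 t. winds_at (B c) (snd c a) n \<and> winds_at (omega v1 v2 v3 (A1 c) (B c)) (snd c a) n1 \<and>
    winds_at (omega w1 w2 w3 (A2 c) (B c)) (snd c a) n2 \<and> n \<le> n1 + n2 \<and> 0 < t \<and> ball (snd c a) t - {snd c a} \<subseteq> D c \<and>
    (\<forall>\<zeta>\<in>ball (snd c a) t - {snd c a}. B c \<zeta> \<noteq> 0 \<and> wronskian (A1 c) (B c) \<zeta> \<noteq> 0 \<and> wronskian (A2 c) (B c) \<zeta> \<noteq> 0)"
proof -
  interpret G1: gauss_component S X M P f A1 g1 v1 v2 v3 by (rule i1)
  interpret G2: gauss_component S X M P f A2 g2 w1 w2 w3 by (rule i2)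
  let ?z = "snd c a"
  obtain s1 a1 b1 where 1: "coprime_rep ?z s1 a1 b1" "ball ?z s1 - {?z} \<subseteq> D c"
    "\<And>\<zeta>. \<zeta> \<in> ball ?z s1 \<inter> D c \<Longrightarrow> A1 c \<zeta> * b1 \<zeta> = B c \<zeta> * a1 \<zeta> \<and> sph (a1 \<zeta>) (b1 \<zeta>) \<notin> {v1, v2, v3}"
    "\<exists>w\<in>ball ?z s1. wronskian a1 b1 w \<noteq> 0" by (rule G1.extended_coprime_rep[OF c a]) (rule that)
  obtain s2 a2 b2 where 2: "coprime_rep ?z s2 a2 b2" "ball ?z s2 - {?z} \<subseteq> D c"
    "\<And>\<zeta>. \<zeta> \<in> ball ?z s2 \<inter> D c \<Longrightarrow> A2 c \<zeta> * b2 \<zeta> = B c \<zeta> * a2 \<zeta> \<and> sph (a2 \<zeta>) (b2 \<zeta>) \<notin> {w1, w2, w3}"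
    "\<exists>w\<in>ball ?z s2. wronskian a2 b2 w \<noteq> 0" by (rule G2.extended_coprime_rep[OF c a]) (rule that)
  have pos: "0 < s1" "0 < s2" and h: "b1 holomorphic_on ball ?z s1" "b2 holomorphic_on ball ?z s2"
    using 1(1) 2(1) unfolding coprime_rep_def by auto
  have ex: "\<exists>w\<in>ball ?z s1. b1 w \<noteq> 0" "\<exists>w\<in>ball ?z s2. b2 w \<noteq> 0"
    using wronskian_imp_denominator 1(4) 2(4) by blast+
  obtain t1 where t1: "0 < t1" "t1 \<le> s1" "\<And>\<zeta>. \<zeta> \<in> ball ?z t1 - {?z} \<Longrightarrow> b1 \<zeta> \<noteq> 0"
    by (rule holomorphic_isolated[OF pos(1) h(1) ex(1)]) (rule that)
  obtain t2 where t2: "0 < t2" "t2 \<le> s2" "\<And>\<zeta>. \<zeta> \<in> ball ?z t2 - {?z} \<Longrightarrow> b2 \<zeta> \<noteq> 0"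
    by (rule holomorphic_isolated[OF pos(2) h(2) ex(2)]) (rule that)
  define t where "t = min t1 t2"
  have t: "0 < t" "t \<le> t1" "t \<le> t2" "t \<le> s1" "t \<le> s2" using t1 t2 by (auto simp: t_def)
  note ts = subset_ball[OF t(2), of ?z] subset_ball[OF t(3), of ?z] subset_ball[OF t(4), of ?z] subset_ball[OF t(5), of ?z]
  have rep: "coprime_rep ?z t a1 b1" "coprime_rep ?z t a2 b2"
    using coprime_rep_mono[OF 1(1) t(1,4)] coprime_rep_mono[OF 2(1) t(1,5)] by auto
  have sub: "ball ?z t - {?z} \<subseteq> D c" using 1(2) ts(3) by blast
  have b: "b1 \<zeta> \<noteq> 0 \<and> b2 \<zeta> \<noteq> 0" if "\<zeta> \<in> ball ?z t - {?z}" for \<zeta> using that t1(3) t2(3) ts(1,2) by blast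
  have eq: "A1 c \<zeta> * b1 \<zeta> = B c \<zeta> * a1 \<zeta> \<and> A2 c \<zeta> * b2 \<zeta> = B c \<zeta> * a2 \<zeta>" if "\<zeta> \<in> ball ?z t - {?z}" for \<zeta>
  proof -
    have "\<zeta> \<in> ball ?z s1 \<inter> D c" "\<zeta> \<in> ball ?z s2 \<inter> D c" using that sub ts(3,4) by blast+
    then show ?thesis using 1(3) 2(3) by blast
  qed
  have Bn: "B c \<zeta> \<noteq> 0" if "\<zeta> \<in> ball ?z t - {?z}" for \<zeta>
    by (rule B_nonzero_near[OF c G1.B_not_vanishing[OF c] rep sub b eq that])
  have Bb: "B c \<zeta> \<noteq> 0 \<and> b1 \<zeta> \<noteq> 0 \<and> b2 \<zeta> \<noteq> 0" if "\<zeta> \<in> ball ?z t - {?z}" for \<zeta> using that Bn b by blast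
  obtain n1 p1 r1 where o1: "winds_at (omega v1 v2 v3 (A1 c) (B c)) ?z n1" "winds_at b1 ?z (int p1)"
    "int p1 \<le> n1 + (if a \<in> P then 1 else 0)" "0 < r1" "\<And>\<zeta>. \<zeta> \<in> ball ?z r1 - {?z} \<Longrightarrow> wronskian (A1 c) (B c) \<zeta> \<noteq> 0"
    by (rule G1.omega_local_order[OF c a 1 t(1,4)]) (assumption, use Bb in blast, rule that)
  obtain n2 p2 r2 where o2: "winds_at (omega w1 w2 w3 (A2 c) (B c)) ?z n2" "winds_at b2 ?z (int p2)"
    "int p2 \<le> n2 + (if a \<in> P then 1 else 0)" "0 < r2" "\<And>\<zeta>. \<zeta> \<in> ball ?z r2 - {?z} \<Longrightarrow> wronskian (A2 c) (B c) \<zeta> \<noteq> 0"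
    by (rule G2.omega_local_order[OF c a 2 t(1,5)]) (assumption, use Bb in blast, rule that)
  have "\<exists>n. winds_at (B c) ?z n \<and> n \<le> n1 + n2"
  proof (cases "a \<in> P")
    case True
    obtain n where "winds_at (B c) ?z n" "n \<le> int p1 + int p2 - 2"
      using order_at_puncture[OF c rep sub Bb eq comp a True refl o1(2) o2(2)] by blast
    then show ?thesis using o1(3) o2(3) True by (intro exI[of _ n]) auto
  next
    case False
    then have z: "?z \<in> D c" using snd_in_D_iff[OF c a] by simp
    obtain n where "winds_at (B c) ?z n" "n \<le> int p1 + int p2"
      using order_at_regular_point[OF c rep sub Bb eq z o1(2) o2(2)] by blast
    then show ?thesis using o1(3) o2(3) False by (intro exI[of _ n]) auto
  qed
  then obtain n where n: "winds_at (B c) ?z n" "n \<le> n1 + n2" by blast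
  define u where "u = min t (min r1 r2)"
  have u: "0 < u" "ball ?z u \<subseteq> ball ?z t" "ball ?z u \<subseteq> ball ?z r1" "ball ?z u \<subseteq> ball ?z r2"
    using t(1) o1(4) o2(4) by (auto simp: u_def)
  have "ball ?z u - {?z} \<subseteq> D c" using u(2) sub by blast
  moreover have "\<forall>\<zeta>\<in>ball ?z u - {?z}. B c \<zeta> \<noteq> 0 \<and> wronskian (A1 c) (B c) \<zeta> \<noteq> 0 \<and> wronskian (A2 c) (B c) \<zeta> \<noteq> 0"
    using Bn o1(5) o2(5) u(2-4) by blast
  ultimately show ?thesis using n o1(1) o2(1) u(1) by blast
qed

lemma B_form_on:
  assumes Q: "P \<subseteq> Q" and nz: "\<And>c a. c \<in> charts M \<Longrightarrow> a \<in> fst c - Q \<Longrightarrow> B c (snd c a) \<noteq> 0"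
  shows "form_on M Q B"
  unfolding form_on_def
proof (intro conjI ballI)
  fix c assume c: "c \<in> charts M"
  have "snd c ` (fst c - Q) \<subseteq> D c" using Q unfolding D_def by blast
  then show "B c holomorphic_on snd c ` (fst c - Q)" using ABC_holomorphic(3)[OF c] holomorphic_on_subset by blast
  show "B c (snd c a) \<noteq> 0" if "a \<in> fst c - Q" for a by (rule nz[OF c that])
next
  fix c c' a assume "c \<in> charts M" "c' \<in> charts M" "a \<in> fst c \<inter> fst c' - Q"
  then show "B c (snd c a) = B c' (snd c' a) * deriv (\<lambda>\<zeta>. snd c' (inv_into (fst c) (snd c) \<zeta>)) (snd c a)"
    using B_transition(1) Q by blast
qed

text \<open>The three forms are singular in the finite set \<open>Q\<close> of the punctures and the zeros of
  \<open>B\<close> and the two Wronskians. An arbitrary point \<open>q\<close> is added to make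
  \<open>Q\<close> nonempty. Summing the order inequality over \<open>Q\<close> gives \<open>-2
  \<le> -2 + -2\<close>.\<close>

lemma no_two_components_omit_three:
  assumes comp: "complete_surface S X"
    and i1: "gauss_component S X M P f A1 g1 v1 v2 v3" and i2: "gauss_component S X M P f A2 g2 w1 w2 w3"
  shows False
proof -
  interpret G1: gauss_component S X M P f A1 g1 v1 v2 v3 by (rule i1)
  interpret G2: gauss_component S X M P f A2 g2 w1 w2 w3 by (rule i2)
  let ?T = "topspace (surf_top M)"
  define zero where "zero c a \<longleftrightarrow> B c (snd c a) = 0 \<or> wronskian (A1 c) (B c) (snd c a) = 0 \<or> wronskian (A2 c) (B c) (snd c a) = 0" for c a
  have zero_inv: "zero c' a" if "c \<in> charts M" "c' \<in> charts M" "a \<in> fst c \<inter> fst c' - P" "zero c a" for c c' a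
    using that(4) G1.wronskian_omega_transition(1)[OF that(1-3)] G2.wronskian_omega_transition(1)[OF that(1-3)]
      B_transition(1)[OF that(2,1), of a] that(3) unfolding zero_def by auto
  define Z where "Z = {a \<in> ?T - P. \<exists>c\<in>charts M. a \<in> fst c \<and> zero c a}"
  obtain q where q: "q \<in> ?T" using RM unfolding riemann_surface_def by blast
  define Q where "Q = insert q (P \<union> Z)"
  have QT: "Q \<subseteq> ?T" "Q \<noteq> {}" "P \<subseteq> Q" using q P(2) unfolding Q_def Z_def by auto
  define Ok where "Ok c a n n1 n2 \<longleftrightarrow> c \<in> charts M \<and> a \<in> fst c \<and> winds_at (B c) (snd c a) n \<and>
    winds_at (omega v1 v2 v3 (A1 c) (B c)) (snd c a) n1 \<and> winds_at (omega w1 w2 w3 (A2 c) (B c)) (snd c a) n2 \<and> n \<le> n1 + n2" for c a n n1 n2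
  have loc: "\<exists>U. openin (surf_top M) U \<and> a \<in> U \<and> (P \<union> Z) \<inter> U \<subseteq> {a} \<and> (\<exists>c n n1 n2. Ok c a n n1 n2)" if a: "a \<in> ?T" for a
  proof -
    obtain c where c: "c \<in> charts M" "a \<in> fst c" using charts_cover[OF RM a] by blast
    obtain n n1 n2 t where t: "winds_at (B c) (snd c a) n" "winds_at (omega v1 v2 v3 (A1 c) (B c)) (snd c a) n1"
      "winds_at (omega w1 w2 w3 (A2 c) (B c)) (snd c a) n2" "n \<le> n1 + n2" "0 < t" "ball (snd c a) t - {snd c a} \<subseteq> D c"
      and nz: "\<And>\<zeta>. \<zeta> \<in> ball (snd c a) t - {snd c a} \<Longrightarrow> B c \<zeta> \<noteq> 0 \<and> wronskian (A1 c) (B c) \<zeta> \<noteq> 0 \<and> wronskian (A2 c) (B c) \<zeta> \<noteq> 0"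
      using order_inequality[OF comp i1 i2 c] by blast
    define U where "U = {x \<in> fst c. snd c x \<in> ball (snd c a) t}"
    have "openin (surf_top M) U" unfolding U_def by (rule chart_preimage_open[OF RM c(1) open_ball])
    moreover have "a \<in> U" using c(2) t(5) by (simp add: U_def)
    moreover have "x = a" if x: "x \<in> (P \<union> Z) \<inter> U" for x
    proof (rule ccontr)
      assume "x \<noteq> a"
      have xc: "x \<in> fst c" "snd c x \<in> ball (snd c a) t" using x unfolding U_def by auto
      have "snd c x \<noteq> snd c a" using inj_onD[OF chart_inj[OF RM c(1)]] xc(1) c(2) \<open>x \<noteq> a\<close> by blast
      then have b: "snd c x \<in> ball (snd c a) t - {snd c a}" using xc(2) by blast
      then have "x \<notin> P" using t(6) snd_in_D_iff[OF c(1) xc(1)] by blast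
      then have "x \<in> Z" using x by blast
      then obtain c' where c': "c' \<in> charts M" "x \<in> fst c'" "zero c' x" unfolding Z_def by blast
      have "zero c x" by (rule zero_inv[OF c'(1) c(1) _ c'(3)]) (use c'(2) xc(1) \<open>x \<notin> P\<close> in blast)
      then show False using nz[OF b] unfolding zero_def by blast
    qed
    moreover have "Ok c a n n1 n2" unfolding Ok_def using c t(1-4) by blast
    ultimately show ?thesis by blast
  qed
  have "finite (P \<union> Z)"
  proof (rule finite_if_locally_isolated)
    show "compact_space (surf_top M)" using M unfolding closed_riemann_surface_genus_0_def by blast
    show "P \<union> Z \<subseteq> ?T" using P(2) unfolding Z_def by blast
    show "\<exists>U. openin (surf_top M) U \<and> a \<in> U \<and> (P \<union> Z) \<inter> U \<subseteq> {a}" if "a \<in> ?T" for a using loc[OF that] by blast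
  qed
  then have Qf: "finite Q" unfolding Q_def by simp
  have Qo: "open (snd c ` (fst c - Q))" if c: "c \<in> charts M" for c
  proof -
    have "closedin (surf_top M) Q" using Hausdorff closedin_Hausdorff_finite QT(1) Qf by blast
    then have "openin (surf_top M) (fst c - Q)" using chart_open[OF RM c] openin_diff by blast
    then show ?thesis by (rule chart_open_image[OF RM c]) auto
  qed
  have Qnz: "\<not> zero c a" if "c \<in> charts M" "a \<in> fst c - Q" for c a
    using that chart_mem[OF that(1)] unfolding Q_def Z_def by blast
  have "\<forall>a\<in>Q. \<exists>x. Ok (fst x) a (fst (snd x)) (fst (snd (snd x))) (snd (snd (snd x)))"
    using loc QT(1) by (metis fst_conv snd_conv subsetD)
  then obtain x where x: "\<And>a. a \<in> Q \<Longrightarrow> Ok (fst (x a)) a (fst (snd (x a))) (fst (snd (snd (x a)))) (snd (snd (snd (x a))))"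
    by metis
  define k where "k a = fst (x a)" for a
  define n where "n a = fst (snd (x a))" for a
  define n1 where "n1 a = fst (snd (snd (x a)))" for a
  define n2 where "n2 a = snd (snd (snd (x a)))" for a
  have ok: "Ok (k a) a (n a) (n1 a) (n2 a)" if "a \<in> Q" for a using x[OF that] unfolding k_def n_def n1_def n2_def .
  have "(\<Sum>a\<in>Q. n a) = -2"
  proof (rule degree_of_form[OF M Qf QT(2,1)])
    show "form_on M Q B" by (rule B_form_on[OF QT(3)]) (use Qnz in \<open>unfold zero_def, blast\<close>)
  qed (use ok in \<open>unfold Ok_def winds_at_def, blast\<close>)
  moreover have "(\<Sum>a\<in>Q. n1 a) = -2"
  proof (rule degree_of_form[OF M Qf QT(2,1)])
    show "form_on M Q (\<lambda>c. omega v1 v2 v3 (A1 c) (B c))"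
      by (rule G1.omega_form_on[OF QT(3) Qo]) (use Qnz in \<open>unfold zero_def, blast+\<close>)
  qed (use ok in \<open>unfold Ok_def winds_at_def, blast\<close>)
  moreover have "(\<Sum>a\<in>Q. n2 a) = -2"
  proof (rule degree_of_form[OF M Qf QT(2,1)])
    show "form_on M Q (\<lambda>c. omega w1 w2 w3 (A2 c) (B c))"
      by (rule G2.omega_form_on[OF QT(3) Qo]) (use Qnz in \<open>unfold zero_def, blast+\<close>)
  qed (use ok in \<open>unfold Ok_def winds_at_def, blast\<close>)
  moreover have "(\<Sum>a\<in>Q. n a) \<le> (\<Sum>a\<in>Q. n1 a + n2 a)"
    by (rule sum_mono) (use ok in \<open>unfold Ok_def, blast\<close>)
  ultimately show False by (simp add: sum.distrib)
qed

end

lemma three_elements: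
  assumes "\<not> (finite V \<and> card V \<le> 2)"
  obtains v1 v2 v3 where "v1 \<in> V" "v2 \<in> V" "v3 \<in> V" "v1 \<noteq> v2" "v1 \<noteq> v3" "v2 \<noteq> v3"
proof -
  have "\<exists>W\<subseteq>V. finite W \<and> card W = 3"
  proof (cases "finite V")
    case True
    then have "3 \<le> card V" using assms by simp
    then show ?thesis by (meson obtain_subset_with_card_n)
  next
    case False
    then show ?thesis using infinite_arbitrarily_large by metis
  qed
  then obtain W where "W \<subseteq> V" "card W = 3" by blast
  then show ?thesis using that unfolding card_3_iff by blast
qed

lemma genus_0_punctured_model:
  assumes S: "minimal_surface S X" and g: "genus_0 S"
  obtains M :: "(real^3) csurface" and P f where "punctured_model S X M P f"
proof -
  obtain M :: "(real^3) csurface" and P where M: "closed_riemann_surface_genus_0 M"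
    "P \<subseteq> topspace (surf_top M)" "finite P" "conformally_equivalent S (remove_points M P)"
    using g unfolding genus_0_def by blast
  obtain f where f: "homeomorphic_map (surf_top S) (surf_top (remove_points M P)) f"
    and h: "\<forall>(U, z)\<in>charts S. \<forall>(V, w)\<in>charts (remove_points M P). (\<lambda>\<zeta>. w (f (inv_into U z \<zeta>))) holomorphic_on z ` (U \<inter> f -` V)"
    using M(4) unfolding conformally_equivalent_def by blast
  have "punctured_model S X M P f"
  proof
    show "homeomorphic_map (surf_top S) (subtopology (surf_top M) (topspace (surf_top M) - P)) f"
      using f unfolding remove_points_def by simp
    fix k c assume "k \<in> charts S" "c \<in> charts M"
    moreover then have "(fst c - P, snd c) \<in> charts (remove_points M P)"
      unfolding remove_points_def by (force simp: case_prod_beta)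
    ultimately show "(\<lambda>\<zeta>. snd c (f (inv_into (fst k) (snd k) \<zeta>))) holomorphic_on snd k ` (fst k \<inter> f -` (fst c - P))"
      using h[unfolded case_prod_beta, rule_format, of k "(fst c - P, snd c)"] by simp
  qed (use S M in auto)
  then show ?thesis by (rule that)
qed

theorem corollary4p10:
  fixes S :: "'a csurface" and X :: "'a \<Rightarrow> real^4"
  assumes "minimal_surface S X"
    and "nonflat S X"
    and "complete_surface S X"
    and "genus_0 S"
    and "finite_total_curvature S X"
    and "\<not> gauss_map_1 S X constant_on topspace (surf_top S)"
    and "\<not> gauss_map_2 S X constant_on topspace (surf_top S)"
  shows "(finite (omitted_values S (gauss_map_1 S X)) \<and> card (omitted_values S (gauss_map_1 S X)) \<le> 2) \<or>
         (finite (omitted_values S (gauss_map_2 S X)) \<and> card (omitted_values S (gauss_map_2 S X)) \<le> 2)"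
proof (rule ccontr)
  assume "\<not> ?thesis"
  then have neg: "\<not> (finite (omitted_values S (gauss_map_1 S X)) \<and> card (omitted_values S (gauss_map_1 S X)) \<le> 2)"
    "\<not> (finite (omitted_values S (gauss_map_2 S X)) \<and> card (omitted_values S (gauss_map_2 S X)) \<le> 2)" by blast+
  obtain v1 v2 v3 where v: "v1 \<in> omitted_values S (gauss_map_1 S X)" "v2 \<in> omitted_values S (gauss_map_1 S X)"
    "v3 \<in> omitted_values S (gauss_map_1 S X)" "v1 \<noteq> v2" "v1 \<noteq> v3" "v2 \<noteq> v3" by (rule three_elements[OF neg(1)]) (rule that)
  obtain w1 w2 w3 where w: "w1 \<in> omitted_values S (gauss_map_2 S X)" "w2 \<in> omitted_values S (gauss_map_2 S X)"
    "w3 \<in> omitted_values S (gauss_map_2 S X)" "w1 \<noteq> w2" "w1 \<noteq> w3" "w2 \<noteq> w3" by (rule three_elements[OF neg(2)]) (rule that)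
  obtain M :: "(real^3) csurface" and P f where "punctured_model S X M P f"
    by (rule genus_0_punctured_model[OF assms(1,4)]) (rule that)
  then interpret punctured_model S X M P f .
  have ov: "gauss_map_1 S X s \<noteq> v1 \<and> gauss_map_1 S X s \<noteq> v2 \<and> gauss_map_1 S X s \<noteq> v3"
    "gauss_map_2 S X s \<noteq> w1 \<and> gauss_map_2 S X s \<noteq> w2 \<and> gauss_map_2 S X s \<noteq> w3" if "s \<in> topspace (surf_top S)" for s
    using v(1-3) w(1-3) that unfolding omitted_values_def by blast+
  have "gauss_component S X M P f A1 (gauss_map_1 S X) v1 v2 v3"
    by (rule gauss_component.intro[OF punctured_model_axioms gauss_component_axioms.intro
          [OF ABC_holomorphic(1) B_transition(2) gauss_pullback(1) assms(6) ov(1) v(4-6)]])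
  moreover have "gauss_component S X M P f A2 (gauss_map_2 S X) w1 w2 w3"
    by (rule gauss_component.intro[OF punctured_model_axioms gauss_component_axioms.intro
          [OF ABC_holomorphic(2) B_transition(3) gauss_pullback(2) assms(7) ov(2) w(4-6)]])
  ultimately show False by (rule no_two_components_omit_three[OF assms(3)])
qed

end
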